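(* Let $N,m\ge1$, $n\ge2$ be integers and let $\Omega\subset\mathbb{R}^n$ be a bounded Sobolev domain for $(2,m,n)$. Let $F$ satisfy Hypothesis $\mathfrak{F}_{p,N,m,n}$ of the context with $p=2$, and let $$\mathfrak{F}(\vec u)=\int_\Omega F(x,\vec u,\dots,D^m\vec u)\,dx,\qquad \vec u\in W^{m,2}(\Omega,\mathbb{R}^N).$$ Then the restriction of $\mathfrak{F}$ to any closed subspace $H$ of $W^{m,2}(\Omega,\mathbb{R}^N)$ satisfies Hypothesis (A) of the context with $X=H$.
   Context: A bounded domain $\Omega\subset\mathbb{R}^n$ is a Sobolev domain for $(p,m,n)$ if the Sobolev embedding theorems hold for the spaces $W^{m,p}(\Omega)$. Hypothesis (A). Let $H$ be a Hilbert space with inner product $(\cdot,\cdot)_H$ and induced norm $\|\cdot\|$, and let $X$ be a dense linear subspace of $H$. Let $V$ be an open neighborhood of the origin $\theta\in H$, and let $\mathcal{L}\in C^1(V,\mathbb{R})$ satisfy $\mathcal{L}'(\theta)=0$. Assume that the gradient $\nabla\mathcal{L}$ has a Gâteaux derivative $B(u)\in\mathscr{L}_s(H)$ (bounded self-adjoint operators on $H$) at every point $u\in V\cap X$, and that the map $B:V\cap X\to\mathscr{L}_s(H)$ has a decomposition $B=P+Q$, where for each $x\in V\cap X$, $P(x)\in\mathscr{L}_s(H)$ is positive definite and $Q(x)\in\mathscr{L}_s(H)$ is compact, and: (D1) all eigenvectors of $B(\theta)$ corresponding to non-positive eigenvalues belong to $X$; (D2) for any sequence $(x_k)\subset V\cap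 X$ with $\|x_k\|\to0$, $\|P(x_k)u-P(\theta)u\|\to0$ for every $u\in H$; (D3) $Q:V\cap X\to\mathscr{L}(H)$ is continuous at $\theta$ with respect to the topology of $H$; (D4) for any sequence $(x_k)\subset V\cap X$ with $\|x_k\|\to0$ there exist $C_0>0$, $k_0\in\mathbb{N}$ with $(P(x_k)u,u)_H\ge C_0\|u\|^2$ for all $u\in H$, $k\ge k_0$. Hypothesis $\mathfrak{F}_{p,N,m,n}$ ($p\in[2,\infty)$). For multi-indices $\gamma\in\mathbb{N}_0^n$, $|\gamma|\le m$, let $p_\gamma\in(2,\infty)$ if $|\gamma|=m-n/p$; $p_\gamma=\frac{np}{n-(m-|\gamma|)p}$ if $m-n/p<|\gamma|\le m$; $q_\gamma=1$ if $|\gamma|<m-n/p$; $q_\gamma=\frac{p_\gamma}{p_\gamma-1}$ if $m-n/p\le|\gamma|\le m$. Let $p_{\alpha\beta}=p_{\beta\alpha}$ satisfy: $p_{\alpha\beta}=1-\frac1{p_\alpha}-\frac1{p_\beta}$ if $|\alpha|=|\beta|=m$; $p_{\alpha\beta}=1-\frac1{p_\alpha}$ if $m-n/p\le|\alpha|\le m$, $|\beta|<m-n/p$; $p_{\alpha\beta}=1$ if $|\alpha|,|\beta|<m-n/p$; $0<p_{\alpha\beta}<1-\frac1{p_\alpha}-\frac1{p_\beta}$ if $|\alpha|,|\beta|\ge m-n/p$, $|\alpha|+|\beta|<2m$. Let $M_0(k)$ be the number of multi-indices of length $k$. Write $\xi\in\prod_{k=0}^m\mathbb{R}^{N\times M_0(k)}$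 as $\xi=(\xi^i_\alpha)$, $1\le i\le N$, $|\alpha|\le m$, and $\xi^k_\circ=\{\xi^k_\alpha:|\alpha|<m-n/p\}$. In $F(x,\vec u,\dots,D^m\vec u)$, $D^\alpha u^i(x)$ takes the place of $\xi^i_\alpha$. The function $F:\overline\Omega\times\prod_{k=0}^m\mathbb{R}^{N\times M_0(k)}\to\mathbb{R}$, $(x,\xi)\mapsto F(x,\xi)$, is twice continuously differentiable in $\xi$ for almost all $x$, measurable in $x$ for all $\xi$, $F(\cdot,0)\in L^1(\Omega)$, and with $F^i_\alpha=F_{\xi^i_\alpha}$, $F^{ij}_{\alpha\beta}=F_{\xi^i_\alpha\xi^j_\beta}$: (i) $F^i_\alpha(\cdot,0)\in L^1(\Omega)$ if $|\alpha|<m-n/p$, and $F^i_\alpha(\cdot,0)\in L^{q_\alpha}(\Omega)$ if $m-n/p\le|\alpha|\le m$; (ii) there is a continuous positive nondecreasing function $\mathfrak{g}_1$ with $|F^{ij}_{\alpha\beta}(x,\xi)|\le\mathfrak{g}_1\big(\sum_{k=1}^N|\xi^k_\circ|\big)\Big(1+\sum_{k=1}^N\sum_{m-n/p\le|\gamma|\le m}|\xi^k_\gamma|^{p_\gamma}\Big)^{p_{\alpha\beta}}$ for all $i,j$, $|\alpha|,|\beta|\le m$; (iii) there is a continuous positive nondecreasing function $\mathfrak{g}_2$ with $\sum_{i,j=1}^N\sum_{|\alpha|=|\beta|=m}F^{ij}_{\alpha\beta}(x,\xi)\eta^i_\alpha\eta^j_\beta\ge\mathfrak{g}_2\big(\sum_{k=1}^N|\xi^k_\circ|\big)\Big(1+\sum_{k=1}^N\sum_{|\gamma|=m}|\xi^k_\gamma|\Big)^{p-2}\sum_{i=1}^N\sum_{|\alpha|=m}(\eta^i_\alpha)^2$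 for all $\eta\in\mathbb{R}^{N\times M_0(m)}$. If $m\le n/p$, $\mathfrak{g}_1,\mathfrak{g}_2$ are understood as positive constants.
   Formalization: The hypothesis on F does not force L'(θ)=0 (linear terms in F are allowed), so everything in Hypothesis (A) except L'(θ)=0 is proved unconditionally, and full Hypothesis (A) is proved when θ is a critical point of the restriction to H. *)

theory Defs
  imports "HOL-Analysis.Analysis"
begin

section \<open>Multi-indices and weak derivatives\<close>

type_synonym 'n mindex = "'n \<Rightarrow> nat"

definition mi_order :: "'n::finite mindex \<Rightarrow> nat" where
  "mi_order \<gamma> = (\<Sum>i\<in>UNIV. \<gamma> i)"

definition mi_le :: "nat \<Rightarrow> 'n::finite mindex set" where
  "mi_le m = {\<gamma>. mi_order \<gamma> \<le> m}"

lemma finite_mi_le: "finite (mi_le m :: 'n::finite mindex set)"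
proof (rule finite_subset)
  show "(mi_le m :: 'n mindex set) \<subseteq> UNIV \<rightarrow>\<^sub>E {..m}"
  proof
    fix \<gamma> :: "'n mindex" assume "\<gamma> \<in> mi_le m"
    moreover have "\<gamma> i \<le> mi_order \<gamma>" for i
      unfolding mi_order_def by (rule member_le_sum) auto
    ultimately show "\<gamma> \<in> UNIV \<rightarrow>\<^sub>E {..m}"
      by (auto simp: mi_le_def PiE_def intro: order_trans)
  qed
  show "finite ((UNIV :: 'n set) \<rightarrow>\<^sub>E {..m})"
    by (intro finite_PiE) auto
qed

definition partial :: "'n::finite \<Rightarrow> (real^'n \<Rightarrow> real) \<Rightarrow> real^'n \<Rightarrow> real" where
  "partial i \<phi> x = deriv (\<lambda>t. \<phi> (x + t *\<^sub>R axis i 1)) 0"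

definition iter_partial :: "'n::finite list \<Rightarrow> (real^'n \<Rightarrow> real) \<Rightarrow> real^'n \<Rightarrow> real" where
  "iter_partial is \<phi> = foldr partial is \<phi>"

definition smooth :: "(real^'n::finite \<Rightarrow> real) \<Rightarrow> bool" where
  "smooth \<phi> \<longleftrightarrow> (\<forall>is x. iter_partial is \<phi> differentiable (at x))"

text \<open>The classical derivative of multi-index \<open>\<gamma>\<close> is only applied to smooth functions, for which the
  order in which the single partial derivatives are taken does not matter.\<close>

definition mi_partial :: "'n::finite mindex \<Rightarrow> (real^'n \<Rightarrow> real) \<Rightarrow> real^'n \<Rightarrow> real" where
  "mi_partial \<gamma> \<phi> = iter_partial (SOME is. \<forall>i. count_list is i = \<gamma> i) \<phi>"

definition test_function :: "(real^'n::finite) set \<Rightarrow> (real^'n \<Rightarrow> real) \<Rightarrow> bool" where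
  "test_function \<Omega> \<phi> \<longleftrightarrow>
     smooth \<phi> \<and> (\<exists>K. compact K \<and> K \<subseteq> \<Omega> \<and> (\<forall>x. x \<notin> K \<longrightarrow> \<phi> x = 0))"

definition locally_integrable :: "(real^'n::finite) set \<Rightarrow> (real^'n \<Rightarrow> real) \<Rightarrow> bool" where
  "locally_integrable \<Omega> u \<longleftrightarrow> (\<forall>K. compact K \<and> K \<subseteq> \<Omega> \<longrightarrow> integrable (lebesgue_on K) u)"

definition is_weak_deriv ::
    "(real^'n::finite) set \<Rightarrow> 'n mindex \<Rightarrow> (real^'n \<Rightarrow> real) \<Rightarrow> (real^'n \<Rightarrow> real) \<Rightarrow> bool" where
  "is_weak_deriv \<Omega> \<gamma> u v \<longleftrightarrow>
     locally_integrable \<Omega> u \<and> locally_integrable \<Omega> v \<and>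
     (\<forall>\<phi>. test_function \<Omega> \<phi> \<longrightarrow>
        (\<integral>x. u x * mi_partial \<gamma> \<phi> x \<partial>lebesgue_on \<Omega>) =
        (-1) ^ mi_order \<gamma> * (\<integral>x. v x * \<phi> x \<partial>lebesgue_on \<Omega>))"

text \<open>Weak derivatives are unique up to null sets; this picks a representative.\<close>

definition weak_deriv ::
    "(real^'n::finite) set \<Rightarrow> 'n mindex \<Rightarrow> (real^'n \<Rightarrow> real) \<Rightarrow> real^'n \<Rightarrow> real" where
  "weak_deriv \<Omega> \<gamma> u = (SOME v. is_weak_deriv \<Omega> \<gamma> u v)"


section \<open>Scalar Lebesgue and Sobolev spaces, Sobolev domains\<close>

definition Lp :: "real \<Rightarrow> (real^'n::finite) set \<Rightarrow> (real^'n \<Rightarrow> real) set" where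
  "Lp q \<Omega> = {f. f \<in> borel_measurable (lebesgue_on \<Omega>) \<and>
                integrable (lebesgue_on \<Omega>) (\<lambda>x. \<bar>f x\<bar> powr q)}"

definition sobolev :: "nat \<Rightarrow> real \<Rightarrow> (real^'n::finite) set \<Rightarrow> (real^'n \<Rightarrow> real) set" where
  "sobolev m p \<Omega> =
     {u \<in> Lp p \<Omega>. \<forall>\<gamma>\<in>mi_le m. \<exists>v\<in>Lp p \<Omega>. is_weak_deriv \<Omega> \<gamma> u v}"

definition sobolev_norm ::
    "nat \<Rightarrow> real \<Rightarrow> (real^'n::finite) set \<Rightarrow> (real^'n \<Rightarrow> real) \<Rightarrow> real" where
  "sobolev_norm m p \<Omega> u =
     (\<Sum>\<gamma>\<in>mi_le m. \<integral>x. \<bar>weak_deriv \<Omega> \<gamma> u x\<bar> powr p \<partial>lebesgue_on \<Omega>) powr (1 / p)"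

definition bounded_sobolev_seq ::
    "nat \<Rightarrow> real \<Rightarrow> (real^'n::finite) set \<Rightarrow> (nat \<Rightarrow> real^'n \<Rightarrow> real) \<Rightarrow> bool" where
  "bounded_sobolev_seq m p \<Omega> u \<longleftrightarrow>
     (\<forall>k. u k \<in> sobolev m p \<Omega>) \<and> (\<exists>C. \<forall>k. sobolev_norm m p \<Omega> (u k) \<le> C)"

definition sobolev_embeds ::
    "nat \<Rightarrow> real \<Rightarrow> nat \<Rightarrow> real \<Rightarrow> (real^'n::finite) set \<Rightarrow> bool" where
  "sobolev_embeds m p j q \<Omega> \<longleftrightarrow>
     sobolev m p \<Omega> \<subseteq> sobolev j q \<Omega> \<and>
     (\<exists>C. \<forall>u\<in>sobolev m p \<Omega>. sobolev_norm j q \<Omega> u \<le> C * sobolev_norm m p \<Omega> u)"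

definition sobolev_embeds_compactly ::
    "nat \<Rightarrow> real \<Rightarrow> nat \<Rightarrow> real \<Rightarrow> (real^'n::finite) set \<Rightarrow> bool" where
  "sobolev_embeds_compactly m p j q \<Omega> \<longleftrightarrow>
     sobolev_embeds m p j q \<Omega> \<and>
     (\<forall>u. bounded_sobolev_seq m p \<Omega> u \<longrightarrow>
        (\<exists>r w. strict_mono (r :: nat \<Rightarrow> nat) \<and> w \<in> sobolev j q \<Omega> \<and>
           (\<lambda>k. sobolev_norm j q \<Omega> (\<lambda>x. u (r k) x - w x)) \<longlonglongrightarrow> 0))"

text \<open>\<open>v \<gamma>\<close>, for multi-indices of order at most \<open>j\<close>, are continuous versions of the weak derivatives
  of \<open>u\<close>; then \<open>v 0\<close> is \<open>j\<close> times continuously differentiable and the other \<open>v \<gamma>\<close> are its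
  classical derivatives.\<close>

definition cont_version ::
    "nat \<Rightarrow> (real^'n::finite) set \<Rightarrow> (real^'n \<Rightarrow> real) \<Rightarrow> ('n mindex \<Rightarrow> real^'n \<Rightarrow> real) \<Rightarrow> bool" where
  "cont_version j \<Omega> u v \<longleftrightarrow>
     (\<forall>\<gamma>\<in>mi_le j. continuous_on \<Omega> (v \<gamma>) \<and> is_weak_deriv \<Omega> \<gamma> u (v \<gamma>))"

text \<open>Compact embedding into the functions with bounded continuous derivatives of order at most \<open>j\<close>,
  normed by the suprema of these derivatives.\<close>

definition sobolev_embeds_compactly_CB ::
    "nat \<Rightarrow> real \<Rightarrow> nat \<Rightarrow> (real^'n::finite) set \<Rightarrow> bool" where
  "sobolev_embeds_compactly_CB m p j \<Omega> \<longleftrightarrow>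
     (\<exists>C. \<forall>u\<in>sobolev m p \<Omega>. \<exists>v. cont_version j \<Omega> u v \<and>
        (\<forall>\<gamma>\<in>mi_le j. \<forall>x\<in>\<Omega>. \<bar>v \<gamma> x\<bar> \<le> C * sobolev_norm m p \<Omega> u)) \<and>
     (\<forall>u. bounded_sobolev_seq m p \<Omega> u \<longrightarrow>
        (\<exists>r v w. strict_mono (r :: nat \<Rightarrow> nat) \<and> (\<forall>k. cont_version j \<Omega> (u (r k)) (v k)) \<and>
           (\<forall>\<gamma>\<in>mi_le j. uniform_limit \<Omega> (\<lambda>k. v k \<gamma>) (w \<gamma>) sequentially)))"

text \<open>The embedding theorems meant are those of Sobolev and Rellich--Kondrachov on a bounded domain,
  for every \<open>j \<le> m\<close>, according to the sign of \<open>(m - j) p - n\<close>. For \<open>j = m\<close> there is no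
  compactness.\<close>

definition sobolev_domain :: "real \<Rightarrow> nat \<Rightarrow> (real^'n::finite) set \<Rightarrow> bool" where
  "sobolev_domain p m \<Omega> \<longleftrightarrow>
     open \<Omega> \<and> connected \<Omega> \<and> \<Omega> \<noteq> {} \<and> bounded \<Omega> \<and>
     (\<forall>j\<le>m. let n = real CARD('n); s = (real m - real j) * p in
        (s < n \<longrightarrow>
           (\<forall>q. 1 \<le> q \<and> q \<le> n * p / (n - s) \<longrightarrow> sobolev_embeds m p j q \<Omega>) \<and>
           (\<forall>q. j < m \<and> 1 \<le> q \<and> q < n * p / (n - s) \<longrightarrow> sobolev_embeds_compactly m p j q \<Omega>)) \<and>
        (s = n \<longrightarrow> (\<forall>q\<ge>1. sobolev_embeds_compactly m p j q \<Omega>)) \<and>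
        (s > n \<longrightarrow> sobolev_embeds_compactly_CB m p j \<Omega>))"


section \<open>The hypothesis on the integrand\<close>

text \<open>A point \<open>\<xi>\<close> of the product of the spaces \<open>\<real>\<^bsup>N\<times>M\<^sub>0(k)\<^esup>\<close>, \<open>k \<le> m\<close>, is a function of \<open>i\<close> and
  \<open>\<alpha>\<close> that vanishes for \<open>\<alpha>\<close> of order greater than \<open>m\<close>. The product topology of the function space
  induces the Euclidean topology on this finite-dimensional set.\<close>

type_synonym ('N,'n) jet = "'N \<Rightarrow> 'n mindex \<Rightarrow> real"

definition jets :: "nat \<Rightarrow> ('N,'n::finite) jet set" where
  "jets m = {\<xi>. \<forall>i \<alpha>. \<alpha> \<notin> mi_le m \<longrightarrow> \<xi> i \<alpha> = 0}"

definition jet_upd :: "('N,'n) jet \<Rightarrow> 'N \<Rightarrow> 'n mindex \<Rightarrow> real \<Rightarrow> ('N,'n) jet" where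
  "jet_upd \<xi> i \<alpha> t = \<xi>(i := (\<xi> i)(\<alpha> := t))"

definition jet_partial ::
    "'N \<Rightarrow> 'n mindex \<Rightarrow> (('N,'n) jet \<Rightarrow> real) \<Rightarrow> ('N,'n) jet \<Rightarrow> real" where
  "jet_partial i \<alpha> f \<xi> = deriv (\<lambda>t. f (jet_upd \<xi> i \<alpha> t)) (\<xi> i \<alpha>)"

definition jet_C1 :: "nat \<Rightarrow> (('N,'n::finite) jet \<Rightarrow> real) \<Rightarrow> bool" where
  "jet_C1 m f \<longleftrightarrow> continuous_on (jets m) f \<and>
     (\<forall>i. \<forall>\<alpha>\<in>mi_le m.
        (\<forall>\<xi>\<in>jets m. (\<lambda>t. f (jet_upd \<xi> i \<alpha> t)) differentiable (at (\<xi> i \<alpha>))) \<and>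
        continuous_on (jets m) (jet_partial i \<alpha> f))"

definition jet_C2 :: "nat \<Rightarrow> (('N,'n::finite) jet \<Rightarrow> real) \<Rightarrow> bool" where
  "jet_C2 m f \<longleftrightarrow> jet_C1 m f \<and> (\<forall>i. \<forall>\<alpha>\<in>mi_le m. jet_C1 m (jet_partial i \<alpha> f))"

definition pos_nondecreasing :: "(real \<Rightarrow> real) \<Rightarrow> bool" where
  "pos_nondecreasing g \<longleftrightarrow> continuous_on {0..} g \<and> (\<forall>t\<ge>0. g t > 0) \<and> mono_on {0..} g"

text \<open>In \<open>jet_low_norm\<close> and \<open>jet_high_sum\<close> the parameter \<open>c\<close> is the critical order \<open>m - n/p\<close>, and
  \<open>P\<close> is the family of exponents \<open>p\<^sub>\<gamma>\<close>. If \<open>c \<le> 0\<close>, then \<open>jet_low_norm\<close> is \<open>0\<close>, so that a function of it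
  is a constant.\<close>

definition crit_order :: "nat \<Rightarrow> real \<Rightarrow> 'n::finite itself \<Rightarrow> real" where
  "crit_order m p _ = real m - real CARD('n) / p"

definition jet_low_norm :: "nat \<Rightarrow> real \<Rightarrow> ('N::finite,'n::finite) jet \<Rightarrow> real" where
  "jet_low_norm m c \<xi> =
     (\<Sum>k\<in>UNIV. sqrt (\<Sum>\<alpha> | \<alpha> \<in> mi_le m \<and> real (mi_order \<alpha>) < c. (\<xi> k \<alpha>)\<^sup>2))"

definition jet_high_sum ::
    "nat \<Rightarrow> real \<Rightarrow> ('n mindex \<Rightarrow> real) \<Rightarrow> ('N::finite,'n::finite) jet \<Rightarrow> real" where
  "jet_high_sum m c P \<xi> =
     (\<Sum>k\<in>UNIV. \<Sum>\<gamma> | \<gamma> \<in> mi_le m \<and> c \<le> real (mi_order \<gamma>). \<bar>\<xi> k \<gamma>\<bar> powr P \<gamma>)"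

text \<open>\<open>P \<gamma>\<close> is an admissible choice of \<open>p\<^sub>\<gamma>\<close>.\<close>

definition admissible_exponents :: "nat \<Rightarrow> real \<Rightarrow> ('n::finite mindex \<Rightarrow> real) \<Rightarrow> bool" where
  "admissible_exponents m p P \<longleftrightarrow>
     (let n = real CARD('n); c = crit_order m p TYPE('n) in
      \<forall>\<gamma>\<in>mi_le m.
        (real (mi_order \<gamma>) = c \<longrightarrow> P \<gamma> > 2) \<and>
        (c < real (mi_order \<gamma>) \<longrightarrow> P \<gamma> = n * p / (n - (real m - real (mi_order \<gamma>)) * p)))"

definition dual_exponent :: "nat \<Rightarrow> real \<Rightarrow> ('n::finite mindex \<Rightarrow> real) \<Rightarrow> 'n mindex \<Rightarrow> real" where
  "dual_exponent m p P \<gamma> =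
     (if real (mi_order \<gamma>) < crit_order m p TYPE('n) then 1 else P \<gamma> / (P \<gamma> - 1))"

text \<open>\<open>R \<alpha> \<beta>\<close> is an admissible choice of \<open>p\<^sub>\<alpha>\<^sub>\<beta>\<close>.\<close>

definition admissible_pair_exponents ::
    "nat \<Rightarrow> real \<Rightarrow> ('n::finite mindex \<Rightarrow> real) \<Rightarrow> ('n mindex \<Rightarrow> 'n mindex \<Rightarrow> real) \<Rightarrow> bool" where
  "admissible_pair_exponents m p P R \<longleftrightarrow>
     (let c = crit_order m p TYPE('n) in
      \<forall>\<alpha>\<in>mi_le m. \<forall>\<beta>\<in>mi_le m.
        R \<alpha> \<beta> = R \<beta> \<alpha> \<and>
        (mi_order \<alpha> = m \<and> mi_order \<beta> = m \<longrightarrow> R \<alpha> \<beta> = 1 - 1 / P \<alpha> - 1 / P \<beta>) \<and>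
        (c \<le> real (mi_order \<alpha>) \<and> real (mi_order \<beta>) < c \<longrightarrow> R \<alpha> \<beta> = 1 - 1 / P \<alpha>) \<and>
        (real (mi_order \<alpha>) < c \<and> real (mi_order \<beta>) < c \<longrightarrow> R \<alpha> \<beta> = 1) \<and>
        (c \<le> real (mi_order \<alpha>) \<and> c \<le> real (mi_order \<beta>) \<and> mi_order \<alpha> + mi_order \<beta> < 2 * m \<longrightarrow>
           0 < R \<alpha> \<beta> \<and> R \<alpha> \<beta> < 1 - 1 / P \<alpha> - 1 / P \<beta>))"

text \<open>Only points of \<open>\<Omega>\<close> matter, so the values of \<open>F\<close> on the boundary are left unconstrained.\<close>

definition hypothesis_F ::
    "real \<Rightarrow> nat \<Rightarrow> (real^'n::finite) set \<Rightarrow> (real^'n \<Rightarrow> ('N::finite,'n) jet \<Rightarrow> real) \<Rightarrow> bool" where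
  "hypothesis_F p m \<Omega> F \<longleftrightarrow> 2 \<le> p \<and>
     (\<exists>P R. admissible_exponents m p P \<and> admissible_pair_exponents m p P R \<and>
       (AE x in lebesgue_on \<Omega>. jet_C2 m (F x)) \<and>
       (\<forall>\<xi>\<in>jets m. (\<lambda>x. F x \<xi>) \<in> borel_measurable (lebesgue_on \<Omega>)) \<and>
       (\<lambda>x. F x (\<lambda>_ _. 0)) \<in> Lp 1 \<Omega> \<and>
       (\<forall>i. \<forall>\<alpha>\<in>mi_le m.
          (\<lambda>x. jet_partial i \<alpha> (F x) (\<lambda>_ _. 0)) \<in> Lp (dual_exponent m p P \<alpha>) \<Omega>) \<and>
       (\<exists>g1. pos_nondecreasing g1 \<and>
         (AE x in lebesgue_on \<Omega>. \<forall>\<xi>\<in>jets m. \<forall>i j. \<forall>\<alpha>\<in>mi_le m. \<forall>\<beta>\<in>mi_le m.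
            \<bar>jet_partial j \<beta> (jet_partial i \<alpha> (F x)) \<xi>\<bar>
              \<le> g1 (jet_low_norm m (crit_order m p TYPE('n)) \<xi>) *
                 (1 + jet_high_sum m (crit_order m p TYPE('n)) P \<xi>) powr R \<alpha> \<beta>)) \<and>
       (\<exists>g2. pos_nondecreasing g2 \<and>
         (AE x in lebesgue_on \<Omega>. \<forall>\<xi>\<in>jets m. \<forall>\<eta> :: ('N,'n) jet.
            (\<Sum>i\<in>UNIV. \<Sum>j\<in>UNIV. \<Sum>\<alpha> | mi_order \<alpha> = m. \<Sum>\<beta> | mi_order \<beta> = m.
               jet_partial j \<beta> (jet_partial i \<alpha> (F x)) \<xi> * \<eta> i \<alpha> * \<eta> j \<beta>)
              \<ge> g2 (jet_low_norm m (crit_order m p TYPE('n)) \<xi>) *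
                 (1 + (\<Sum>k\<in>UNIV. \<Sum>\<gamma> | mi_order \<gamma> = m. \<bar>\<xi> k \<gamma>\<bar>)) powr (p - 2) *
                 (\<Sum>i\<in>UNIV. \<Sum>\<alpha> | mi_order \<alpha> = m. (\<eta> i \<alpha>)\<^sup>2))))"


section \<open>Hypothesis (A)\<close>

text \<open>The Hilbert spaces of interest depend on parameters (a domain, an order, a closed subspace), so a
  Hilbert space is a linear subspace \<open>H\<close> of a real vector space with an inner product \<open>ip\<close> on it,
  rather than a type of class \<^class>\<open>real_inner\<close>. Operators and functionals on \<open>H\<close> are functions
  on the ambient type of which only the values on \<open>H\<close> matter.\<close>

type_synonym 'a inner_prod = "'a \<Rightarrow> 'a \<Rightarrow> real"

definition ip_norm :: "'a inner_prod \<Rightarrow> 'a \<Rightarrow> real" where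
  "ip_norm ip u = sqrt (ip u u)"

definition hilbert_space :: "'a::real_vector set \<Rightarrow> 'a inner_prod \<Rightarrow> bool" where
  "hilbert_space H ip \<longleftrightarrow> subspace H \<and>
     (\<forall>u\<in>H. \<forall>v\<in>H. ip u v = ip v u) \<and>
     (\<forall>u\<in>H. \<forall>v\<in>H. \<forall>w\<in>H. ip (u + v) w = ip u w + ip v w) \<and>
     (\<forall>c. \<forall>u\<in>H. \<forall>v\<in>H. ip (c *\<^sub>R u) v = c * ip u v) \<and>
     (\<forall>u\<in>H. u \<noteq> 0 \<longrightarrow> ip u u > 0) \<and>
     (\<forall>x :: nat \<Rightarrow> 'a. (\<forall>k. x k \<in> H) \<and>
        (\<forall>e>0. \<exists>K. \<forall>j\<ge>K. \<forall>k\<ge>K. ip_norm ip (x j - x k) < e) \<longrightarrow>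
        (\<exists>u\<in>H. (\<lambda>k. ip_norm ip (x k - u)) \<longlonglongrightarrow> 0))"

definition closed_subspace :: "'a::real_vector set \<Rightarrow> 'a set \<Rightarrow> 'a inner_prod \<Rightarrow> bool" where
  "closed_subspace H W ip \<longleftrightarrow> subspace H \<and> H \<subseteq> W \<and>
     (\<forall>(x :: nat \<Rightarrow> 'a) u. (\<forall>k. x k \<in> H) \<and> u \<in> W \<and> (\<lambda>k. ip_norm ip (x k - u)) \<longlonglongrightarrow> 0 \<longrightarrow> u \<in> H)"

definition dense_subspace :: "'a::real_vector set \<Rightarrow> 'a set \<Rightarrow> 'a inner_prod \<Rightarrow> bool" where
  "dense_subspace X H ip \<longleftrightarrow> subspace X \<and> X \<subseteq> H \<and>
     (\<forall>u\<in>H. \<forall>e>0. \<exists>x\<in>X. ip_norm ip (u - x) < e)"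

definition open_in_hilbert :: "'a::real_vector set \<Rightarrow> 'a set \<Rightarrow> 'a inner_prod \<Rightarrow> bool" where
  "open_in_hilbert V H ip \<longleftrightarrow> V \<subseteq> H \<and>
     (\<forall>u\<in>V. \<exists>e>0. \<forall>v\<in>H. ip_norm ip (v - u) < e \<longrightarrow> v \<in> V)"

definition linear_to_reals :: "'a::real_vector set \<Rightarrow> ('a \<Rightarrow> real) \<Rightarrow> bool" where
  "linear_to_reals H l \<longleftrightarrow> (\<forall>u\<in>H. \<forall>v\<in>H. l (u + v) = l u + l v) \<and> (\<forall>c. \<forall>u\<in>H. l (c *\<^sub>R u) = c * l u)"

definition has_frechet_deriv ::
    "'a::real_vector set \<Rightarrow> 'a inner_prod \<Rightarrow> ('a \<Rightarrow> real) \<Rightarrow> 'a \<Rightarrow> ('a \<Rightarrow> real) \<Rightarrow> bool" where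
  "has_frechet_deriv H ip L u l \<longleftrightarrow>
     linear_to_reals H l \<and> (\<exists>C. \<forall>h\<in>H. \<bar>l h\<bar> \<le> C * ip_norm ip h) \<and>
     (\<forall>e>0. \<exists>d>0. \<forall>h\<in>H. ip_norm ip h < d \<longrightarrow>
        \<bar>L (u + h) - L u - l h\<bar> \<le> e * ip_norm ip h)"

text \<open>\<open>L\<close> is continuously differentiable on the open set \<open>V\<close> with derivative \<open>dL\<close>; continuity of \<open>dL\<close>
  refers to the norm of the dual space.\<close>

definition C1_with_deriv ::
    "'a::real_vector set \<Rightarrow> 'a inner_prod \<Rightarrow> 'a set \<Rightarrow> ('a \<Rightarrow> real) \<Rightarrow> ('a \<Rightarrow> 'a \<Rightarrow> real) \<Rightarrow> bool" where
  "C1_with_deriv H ip V L dL \<longleftrightarrow>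
     (\<forall>u\<in>V. has_frechet_deriv H ip L u (dL u)) \<and>
     (\<forall>u\<in>V. \<forall>e>0. \<exists>d>0. \<forall>v\<in>V. ip_norm ip (v - u) < d \<longrightarrow>
        (\<forall>h\<in>H. \<bar>dL v h - dL u h\<bar> \<le> e * ip_norm ip h))"

definition is_gradient ::
    "'a::real_vector set \<Rightarrow> 'a inner_prod \<Rightarrow> 'a set \<Rightarrow> ('a \<Rightarrow> 'a \<Rightarrow> real) \<Rightarrow> ('a \<Rightarrow> 'a) \<Rightarrow> bool" where
  "is_gradient H ip V dL grad \<longleftrightarrow> (\<forall>u\<in>V. grad u \<in> H \<and> (\<forall>h\<in>H. dL u h = ip (grad u) h))"

definition has_gateaux_deriv ::
    "'a::real_vector set \<Rightarrow> 'a inner_prod \<Rightarrow> ('a \<Rightarrow> 'a) \<Rightarrow> 'a \<Rightarrow> ('a \<Rightarrow> 'a) \<Rightarrow> bool" where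
  "has_gateaux_deriv H ip G u T \<longleftrightarrow>
     (\<forall>h\<in>H. ((\<lambda>t::real. ip_norm ip ((1 / t) *\<^sub>R (G (u + t *\<^sub>R h) - G u) - T h)) \<longlongrightarrow> 0) (at 0))"

definition selfadjoint_op :: "'a::real_vector set \<Rightarrow> 'a inner_prod \<Rightarrow> ('a \<Rightarrow> 'a) \<Rightarrow> bool" where
  "selfadjoint_op H ip T \<longleftrightarrow>
     (\<forall>u\<in>H. T u \<in> H) \<and>
     (\<forall>u\<in>H. \<forall>v\<in>H. T (u + v) = T u + T v) \<and> (\<forall>c. \<forall>u\<in>H. T (c *\<^sub>R u) = c *\<^sub>R T u) \<and>
     (\<exists>C. \<forall>u\<in>H. ip_norm ip (T u) \<le> C * ip_norm ip u) \<and>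
     (\<forall>u\<in>H. \<forall>v\<in>H. ip (T u) v = ip u (T v))"

definition positive_definite_op :: "'a::real_vector set \<Rightarrow> 'a inner_prod \<Rightarrow> ('a \<Rightarrow> 'a) \<Rightarrow> bool" where
  "positive_definite_op H ip T \<longleftrightarrow> (\<forall>u\<in>H. u \<noteq> 0 \<longrightarrow> ip (T u) u > 0)"

definition compact_op :: "'a::real_vector set \<Rightarrow> 'a inner_prod \<Rightarrow> ('a \<Rightarrow> 'a) \<Rightarrow> bool" where
  "compact_op H ip T \<longleftrightarrow>
     (\<forall>x :: nat \<Rightarrow> 'a. (\<forall>k. x k \<in> H) \<and> (\<exists>C. \<forall>k. ip_norm ip (x k) \<le> C) \<longrightarrow>
        (\<exists>r. \<exists>w\<in>H. strict_mono (r :: nat \<Rightarrow> nat) \<and>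
           (\<lambda>k. ip_norm ip (T (x (r k)) - w)) \<longlonglongrightarrow> 0))"

definition null_seq_in :: "'a set \<Rightarrow> 'a inner_prod \<Rightarrow> (nat \<Rightarrow> 'a) \<Rightarrow> bool" where
  "null_seq_in S ip x \<longleftrightarrow> (\<forall>k. x k \<in> S) \<and> (\<lambda>k. ip_norm ip (x k)) \<longlonglongrightarrow> 0"

text \<open>Hypothesis (A) for a functional \<open>L\<close> on \<open>V\<close> with derivative \<open>dL\<close>, apart from the requirement
  that the origin is a critical point: the hypothesis on the integrand does not force this, as
  linear terms are allowed in it.\<close>

definition hypothesis_A_regular ::
    "'a::real_vector set \<Rightarrow> 'a inner_prod \<Rightarrow> 'a set \<Rightarrow> 'a set \<Rightarrow> ('a \<Rightarrow> real) \<Rightarrow> ('a \<Rightarrow> 'a \<Rightarrow> real) \<Rightarrow> bool"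
  where
  "hypothesis_A_regular H ip X V L dL \<longleftrightarrow>
     hilbert_space H ip \<and> dense_subspace X H ip \<and> open_in_hilbert V H ip \<and> 0 \<in> V \<and>
     C1_with_deriv H ip V L dL \<and>
     (\<exists>grad B P Q. is_gradient H ip V dL grad \<and>
       (\<forall>x\<in>V \<inter> X.
          selfadjoint_op H ip (B x) \<and> has_gateaux_deriv H ip grad x (B x) \<and>
          (\<forall>u\<in>H. B x u = P x u + Q x u) \<and>
          selfadjoint_op H ip (P x) \<and> positive_definite_op H ip (P x) \<and>
          selfadjoint_op H ip (Q x) \<and> compact_op H ip (Q x)) \<and>
       (\<forall>\<mu>\<le>0. \<forall>e\<in>H. e \<noteq> 0 \<and> B 0 e = \<mu> *\<^sub>R e \<longrightarrow> e \<in> X) \<and>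
       (\<forall>x. null_seq_in (V \<inter> X) ip x \<longrightarrow>
          (\<forall>u\<in>H. (\<lambda>k. ip_norm ip (P (x k) u - P 0 u)) \<longlonglongrightarrow> 0)) \<and>
       (\<forall>e>0. \<exists>d>0. \<forall>x\<in>V \<inter> X. ip_norm ip x < d \<longrightarrow>
          (\<forall>u\<in>H. ip_norm ip (Q x u - Q 0 u) \<le> e * ip_norm ip u)) \<and>
       (\<forall>x. null_seq_in (V \<inter> X) ip x \<longrightarrow>
          (\<exists>C0>0. \<exists>k0. \<forall>k\<ge>k0. \<forall>u\<in>H. ip (P (x k) u) u \<ge> C0 * (ip_norm ip u)\<^sup>2)))"

definition hypothesis_A ::
    "'a::real_vector set \<Rightarrow> 'a inner_prod \<Rightarrow> 'a set \<Rightarrow> 'a set \<Rightarrow> ('a \<Rightarrow> real) \<Rightarrow> bool" where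
  "hypothesis_A H ip X V L \<longleftrightarrow>
     (\<exists>dL. hypothesis_A_regular H ip X V L dL \<and> (\<forall>h\<in>H. dL 0 h = 0))"


section \<open>The Hilbert space \<open>W\<^sup>m\<^sup>,\<^sup>2(\<Omega>, \<real>\<^sup>N)\<close> and the functional\<close>

definition ae_eq :: "('a::euclidean_space \<Rightarrow> 'b) \<Rightarrow> ('a \<Rightarrow> 'b) \<Rightarrow> bool" where
  "ae_eq f g \<longleftrightarrow> (AE x in lebesgue. f x = g x)"

text \<open>Functions modulo almost everywhere equality form a vector space. A class of functions on \<open>\<Omega>\<close> is
  identified with the class of the extensions by zero.\<close>

quotient_type (overloaded) ('a, 'b) aefun = "'a::euclidean_space \<Rightarrow> 'b::real_vector" / ae_eq
proof (rule equivpI)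
  show "reflp (ae_eq :: ('a \<Rightarrow> 'b) \<Rightarrow> _)" by (auto simp: reflp_def ae_eq_def)
  show "symp (ae_eq :: ('a \<Rightarrow> 'b) \<Rightarrow> _)" by (auto simp: symp_def ae_eq_def eq_commute)
  show "transp (ae_eq :: ('a \<Rightarrow> 'b) \<Rightarrow> _)"
  proof (rule transpI)
    fix f g h :: "'a \<Rightarrow> 'b"
    assume "ae_eq f g" "ae_eq g h"
    then show "ae_eq f h" unfolding ae_eq_def by eventually_elim simp
  qed
qed

instantiation aefun :: (euclidean_space, real_vector) real_vector
begin

lift_definition zero_aefun :: "('a, 'b) aefun" is "\<lambda>_. 0" .

lift_definition plus_aefun :: "('a, 'b) aefun \<Rightarrow> ('a, 'b) aefun \<Rightarrow> ('a, 'b) aefun"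
  is "\<lambda>f g x. f x + g x"
  unfolding ae_eq_def by (erule (1) eventually_elim2) simp

lift_definition minus_aefun :: "('a, 'b) aefun \<Rightarrow> ('a, 'b) aefun \<Rightarrow> ('a, 'b) aefun"
  is "\<lambda>f g x. f x - g x"
  unfolding ae_eq_def by (erule (1) eventually_elim2) simp

lift_definition uminus_aefun :: "('a, 'b) aefun \<Rightarrow> ('a, 'b) aefun"
  is "\<lambda>f x. - f x"
  unfolding ae_eq_def by (erule eventually_mono) simp

lift_definition scaleR_aefun :: "real \<Rightarrow> ('a, 'b) aefun \<Rightarrow> ('a, 'b) aefun"
  is "\<lambda>c f x. c *\<^sub>R f x"
  unfolding ae_eq_def by (erule eventually_mono) simp

instance
  by (standard; transfer) (auto simp: ae_eq_def algebra_simps)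

end

definition sobolev_vec ::
    "nat \<Rightarrow> real \<Rightarrow> (real^'n::finite) set \<Rightarrow> (real^'n, real^'N::finite) aefun set" where
  "sobolev_vec m p \<Omega> =
     {abs_aefun f | f. (\<forall>x. x \<notin> \<Omega> \<longrightarrow> f x = 0) \<and> (\<forall>i. (\<lambda>x. f x $ i) \<in> sobolev m p \<Omega>)}"

definition comp_deriv ::
    "(real^'n::finite) set \<Rightarrow> 'n mindex \<Rightarrow> 'N::finite \<Rightarrow> (real^'n, real^'N) aefun \<Rightarrow> real^'n \<Rightarrow> real" where
  "comp_deriv \<Omega> \<alpha> i u = weak_deriv \<Omega> \<alpha> (\<lambda>x. rep_aefun u x $ i)"

definition sobolev_ip ::
    "nat \<Rightarrow> (real^'n::finite) set \<Rightarrow> (real^'n, real^'N::finite) aefun inner_prod" where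
  "sobolev_ip m \<Omega> u v =
     (\<Sum>i\<in>UNIV. \<Sum>\<alpha>\<in>mi_le m.
        \<integral>x. comp_deriv \<Omega> \<alpha> i u x * comp_deriv \<Omega> \<alpha> i v x \<partial>lebesgue_on \<Omega>)"

definition jet_of ::
    "nat \<Rightarrow> (real^'n::finite) set \<Rightarrow> (real^'n, real^'N::finite) aefun \<Rightarrow> real^'n \<Rightarrow> ('N,'n) jet" where
  "jet_of m \<Omega> u x = (\<lambda>i \<alpha>. if \<alpha> \<in> mi_le m then comp_deriv \<Omega> \<alpha> i u x else 0)"

definition sobolev_functional ::
    "nat \<Rightarrow> (real^'n::finite) set \<Rightarrow> (real^'n \<Rightarrow> ('N::finite,'n) jet \<Rightarrow> real) \<Rightarrow>
       (real^'n, real^'N) aefun \<Rightarrow> real" where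
  "sobolev_functional m \<Omega> F u = (\<integral>x. F x (jet_of m \<Omega> u x) \<partial>lebesgue_on \<Omega>)"

end

theory Submission
  imports Defs
begin

text \<open>The second derivative of the functional at \<open>u\<close> is the form
  \<open>\<Sum>\<^sub>a\<^sub>,\<^sub>b \<integral> F\<^sub>a\<^sub>b(x, Du) D\<^sub>a v D\<^sub>b w\<close>. The exponents are arranged so that, by the Sobolev embeddings
  and Hoelder's inequality, each summand is bounded by \<open>\<parallel>v\<parallel> \<parallel>w\<parallel>\<close>, and it is represented by a
  bounded self-adjoint operator. Let \<open>P u\<close> collect the summands with both derivatives of the top order \<open>m\<close>,
  completed by the lower order terms of the inner product itself, and let \<open>Q u\<close> be the rest. For \<open>p = 2\<close> the
  ellipticity condition bounds \<open>P u\<close> below by a positive constant. Each summand of \<open>Q u\<close>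
  involves a derivative of order below \<open>m\<close>, for which the embedding is compact; near the limiting exponent
  this is where the strict inequality on \<open>p\<^sub>\<alpha>\<^sub>\<beta>\<close> is needed. Compactness of \<open>Q u\<close> and norm continuity of
  \<open>Q\<close> at \<open>0\<close> follow.
  The coefficients of \<open>P u\<close> are only bounded, so that \<open>P\<close> is strongly continuous at \<open>0\<close> by dominated
  convergence along almost everywhere convergent subsequences.

  All integral estimates are carried out with pointwise domination by powers of an integrable weight.\<close>

section \<open>Set-based Hilbert spaces\<close>

locale hilbert_on =
  fixes H :: "'a::real_vector set" and ip :: "'a inner_prod"
  assumes hilbert: "hilbert_space H ip"
begin

abbreviation nm :: "'a \<Rightarrow> real" where "nm \<equiv> ip_norm ip"

lemma sub: "subspace H"
  using hilbert by (simp add: hilbert_space_def)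

lemmas H_zero [simp] = subspace_0[OF sub]
lemmas H_add [simp] = subspace_add[OF sub]
lemmas H_scale [simp] = subspace_scale[OF sub]
lemmas H_diff [simp] = subspace_diff[OF sub]

lemma ip_sym: "u \<in> H \<Longrightarrow> v \<in> H \<Longrightarrow> ip u v = ip v u"
  and ip_add_left: "u \<in> H \<Longrightarrow> v \<in> H \<Longrightarrow> w \<in> H \<Longrightarrow> ip (u + v) w = ip u w + ip v w"
  and ip_scale_left: "u \<in> H \<Longrightarrow> v \<in> H \<Longrightarrow> ip (c *\<^sub>R u) v = c * ip u v"
  and ip_pos: "u \<in> H \<Longrightarrow> u \<noteq> 0 \<Longrightarrow> ip u u > 0"
  using hilbert by (auto simp: hilbert_space_def)

lemma complete:
  assumes "\<And>k. x k \<in> H" "\<And>e. e > 0 \<Longrightarrow> \<exists>K. \<forall>j\<ge>K. \<forall>k\<ge>K. nm (x j - x k) < e"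
  obtains u where "u \<in> H" "(\<lambda>k. nm (x k - u)) \<longlonglongrightarrow> 0"
  using hilbert assms unfolding hilbert_space_def by blast

lemma ip_add_right: "u \<in> H \<Longrightarrow> v \<in> H \<Longrightarrow> w \<in> H \<Longrightarrow> ip w (u + v) = ip w u + ip w v"
  using ip_add_left[of u v w] ip_sym[of w "u + v"] ip_sym[of w u] ip_sym[of w v] by simp

lemma ip_scale_right: "u \<in> H \<Longrightarrow> v \<in> H \<Longrightarrow> ip u (c *\<^sub>R v) = c * ip u v"
  using ip_scale_left[of v u c] ip_sym[of u "c *\<^sub>R v"] ip_sym[of u v] by simp

lemma ip_diff_left: "u \<in> H \<Longrightarrow> v \<in> H \<Longrightarrow> w \<in> H \<Longrightarrow> ip (u - v) w = ip u w - ip v w"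
  using ip_add_left[of "u - v" v w] by simp

lemma ip_diff_right: "u \<in> H \<Longrightarrow> v \<in> H \<Longrightarrow> w \<in> H \<Longrightarrow> ip w (u - v) = ip w u - ip w v"
  using ip_add_right[of "u - v" v w] by simp

lemma ip_zero_left [simp]: "u \<in> H \<Longrightarrow> ip 0 u = 0"
  using ip_scale_left[of 0 u 0] by simp

lemma ip_zero_right [simp]: "u \<in> H \<Longrightarrow> ip u 0 = 0"
  using ip_scale_right[of u 0 0] by simp

lemmas ip_simps = ip_add_left ip_add_right ip_diff_left ip_diff_right ip_scale_left ip_scale_right

lemma ip_nonneg: "u \<in> H \<Longrightarrow> ip u u \<ge> 0"
  using ip_pos[of u] by (cases "u = 0") auto

lemma nm_sq: "u \<in> H \<Longrightarrow> (nm u)\<^sup>2 = ip u u"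
  by (simp add: ip_norm_def ip_nonneg)

lemma nm_nonneg [simp]: "u \<in> H \<Longrightarrow> nm u \<ge> 0"
  by (simp add: ip_norm_def ip_nonneg)

lemma nm_zero [simp]: "nm 0 = 0"
  by (simp add: ip_norm_def)

lemma nm_eq_zero_iff: "u \<in> H \<Longrightarrow> nm u = 0 \<longleftrightarrow> u = 0"
  using ip_pos[of u] by (cases "u = 0") (auto simp: ip_norm_def)

lemma nm_scale: "u \<in> H \<Longrightarrow> nm (c *\<^sub>R u) = \<bar>c\<bar> * nm u"
  by (simp add: ip_norm_def ip_simps real_sqrt_mult mult.assoc[symmetric])

lemma cauchy_schwarz:
  assumes u: "u \<in> H" and v: "v \<in> H"
  shows "\<bar>ip u v\<bar> \<le> nm u * nm v"
proof (cases "v = 0")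
  case True
  then show ?thesis using u by simp
next
  case False
  then have pos: "ip v v > 0" using v ip_pos by simp
  let ?c = "ip u v / ip v v"
  have "0 \<le> ip (u - ?c *\<^sub>R v) (u - ?c *\<^sub>R v)"
    using u v by (intro ip_nonneg) auto
  also have "\<dots> = ip u u - (ip u v)\<^sup>2 / ip v v"
    using u v pos ip_sym[OF u v] by (simp add: ip_simps power2_eq_square field_simps)
  finally have "(ip u v)\<^sup>2 \<le> ip u u * ip v v"
    using pos by (simp add: field_simps)
  then have "sqrt ((ip u v)\<^sup>2) \<le> sqrt (ip u u * ip v v)" by (rule real_sqrt_le_mono)
  then show ?thesis by (simp only: real_sqrt_abs ip_norm_def real_sqrt_mult)
qed

lemma nm_triangle: 
  assumes u: "u \<in> H" and v: "v \<in> H"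
  shows "nm (u + v) \<le> nm u + nm v"
proof -
  have "(nm (u + v))\<^sup>2 = (nm u)\<^sup>2 + 2 * ip u v + (nm v)\<^sup>2"
    using u v ip_sym[OF u v] by (simp add: nm_sq ip_simps)
  also have "\<dots> \<le> (nm u + nm v)\<^sup>2"
    using cauchy_schwarz[OF u v] by (simp add: power2_sum)
  finally show ?thesis using u v by (meson add_nonneg_nonneg nm_nonneg power2_le_imp_le)
qed

lemma nm_triangle_diff:
  assumes "u \<in> H" "v \<in> H" shows "nm (u - v) \<le> nm u + nm v"
  using nm_triangle[OF assms(1) H_scale[OF assms(2), of "-1"]] nm_scale[of v "-1"] assms by simp

lemma nm_le_of_dual_bound:
  assumes u: "u \<in> H" and c: "\<And>w. w \<in> H \<Longrightarrow> \<bar>ip u w\<bar> \<le> c * nm w" "c \<ge> 0"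
  shows "nm u \<le> c"
proof (cases "u = 0")
  case False
  then have "nm u > 0" using u nm_eq_zero_iff nm_nonneg by (metis less_eq_real_def)
  moreover have "nm u * nm u \<le> c * nm u"
    using c(1)[OF u] nm_sq[OF u] by (simp add: power2_eq_square)
  ultimately show ?thesis by simp
qed (use c in simp)

text \<open>The representative of \<open>l\<close> minimises \<open>\<parallel>u\<parallel>\<^sup>2 - 2 l u\<close>; minimising sequences are Cauchy by the
  parallelogram law.\<close>

lemma riesz:
  assumes l: "linear_to_reals H l" and C: "\<And>h. h \<in> H \<Longrightarrow> \<bar>l h\<bar> \<le> C * nm h"
  shows "\<exists>u. u \<in> H \<and> (\<forall>h\<in>H. l h = ip u h)"
proof -
  have l_add: "l (u + v) = l u + l v" if "u \<in> H" "v \<in> H" for u v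
    using l that by (simp add: linear_to_reals_def)
  have l_scale: "l (c *\<^sub>R u) = c * l u" if "u \<in> H" for u c
    using l that by (simp add: linear_to_reals_def)
  define J where "J u = ip u u - 2 * l u" for u
  have lower: "- C\<^sup>2 \<le> J u" if "u \<in> H" for u
  proof -
    have "l u \<le> C * nm u" using C[OF that] by linarith
    moreover have "0 \<le> (nm u - C)\<^sup>2" by simp
    ultimately show ?thesis
      using nm_sq[OF that] by (simp add: J_def power2_diff algebra_simps)
  qed
  define m where "m = Inf (J ` H)"
  have bdd: "bdd_below (J ` H)" using lower by (intro bdd_belowI2)
  have m_le: "m \<le> J u" if "u \<in> H" for u
    unfolding m_def using that bdd by (intro cInf_lower) auto
  have "\<exists>u\<in>H. J u < m + 1 / real (Suc k)" for k
  proof -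
    have "Inf (J ` H) < m + 1 / real (Suc k)" unfolding m_def by (simp del: of_nat_Suc)
    moreover have "J ` H \<noteq> {}" using H_zero by blast
    ultimately show ?thesis using cInf_lessD[of "J ` H"] by auto
  qed
  then obtain x where xH: "\<And>k. x k \<in> H" and xJ: "\<And>k. J (x k) < m + 1 / real (Suc k)" by metis
  have dist: "(nm (x j - x k))\<^sup>2 \<le> 2 / real (Suc j) + 2 / real (Suc k)" for j k
  proof -
    have "(nm (x j - x k))\<^sup>2 = 2 * J (x j) + 2 * J (x k) - 4 * J ((1/2) *\<^sub>R (x j + x k))"
      using xH[of j] xH[of k] ip_sym[OF xH[of j] xH[of k]]
      by (simp add: nm_sq J_def ip_simps l_add l_scale algebra_simps)
    also have "\<dots> \<le> 2 * (m + 1 / real (Suc j)) + 2 * (m + 1 / real (Suc k)) - 4 * m"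
      using xJ[of j] xJ[of k] m_le[of "(1/2) *\<^sub>R (x j + x k)"] xH[of j] xH[of k]
      by (intro diff_mono add_mono mult_left_mono) auto
    finally show ?thesis by simp
  qed
  have "\<exists>K. \<forall>j\<ge>K. \<forall>k\<ge>K. nm (x j - x k) < e" if "e > 0" for e
  proof -
    obtain K where K: "4 / e\<^sup>2 < real (Suc K)"
      using reals_Archimedean2[of "4 / e\<^sup>2"] by (meson less_SucI less_imp_of_nat_less lessI order_less_trans)
    have "nm (x j - x k) < e" if "j \<ge> K" "k \<ge> K" for j k
    proof -
      have 1: "2 / real (Suc i) \<le> 2 / real (Suc K)" if "i \<ge> K" for i
        using that by (intro divide_left_mono) auto
      have "(nm (x j - x k))\<^sup>2 \<le> 4 / real (Suc K)"
        using dist[of j k] 1[OF \<open>j \<ge> K\<close>] 1[OF \<open>k \<ge> K\<close>] by simp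
      also have "\<dots> < e\<^sup>2" using K \<open>e > 0\<close> by (simp add: field_simps del: of_nat_Suc)
      finally show ?thesis using \<open>e > 0\<close> by (meson less_imp_le power_less_imp_less_base)
    qed
    then show ?thesis by blast
  qed
  then obtain u where u: "u \<in> H" and lim: "(\<lambda>k. nm (x k - u)) \<longlonglongrightarrow> 0"
    using complete[of x] xH by blast
  have Jdiff: "J (x k) = J u + (nm (x k - u))\<^sup>2 + 2 * (ip u (x k - u) - l (x k - u))" for k
  proof -
    have "l (x k - u) = l (x k) - l u"
      using l_add[of "x k - u" u] xH[of k] u by simp
    then show ?thesis using xH[of k] u ip_sym[OF u xH[of k]]
      by (simp add: nm_sq J_def ip_simps algebra_simps)
  qed
  have "(\<lambda>k. ip u (x k - u) - l (x k - u)) \<longlonglongrightarrow> 0"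
  proof (rule Lim_null_comparison)
    show "\<forall>\<^sub>F k in sequentially. norm (ip u (x k - u) - l (x k - u)) \<le> (nm u + C) * nm (x k - u)"
    proof (rule always_eventually, rule allI)
      fix k
      show "norm (ip u (x k - u) - l (x k - u)) \<le> (nm u + C) * nm (x k - u)"
        using cauchy_schwarz[of u "x k - u"] C[of "x k - u"] u xH[of k] H_diff[OF xH[of k] u]
        by (simp add: distrib_right del: H_diff)
    qed
    show "(\<lambda>k. (nm u + C) * nm (x k - u)) \<longlonglongrightarrow> 0"
      using tendsto_mult_right_zero[OF lim] by simp
  qed
  then have "(\<lambda>k. J u + (nm (x k - u))\<^sup>2 + 2 * (ip u (x k - u) - l (x k - u))) \<longlonglongrightarrow> J u + 0\<^sup>2 + 2 * 0"
    by (intro tendsto_intros lim)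
  then have "(\<lambda>k. J (x k)) \<longlonglongrightarrow> J u" unfolding Jdiff[symmetric] by simp
  moreover have "(\<lambda>k. m + 1 / real (Suc k)) \<longlonglongrightarrow> m + 0"
    by (intro tendsto_add tendsto_const LIMSEQ_Suc[OF lim_1_over_n])
  ultimately have "J u \<le> m"
    using xJ by (intro LIMSEQ_le[of "\<lambda>k. J (x k)" _ "\<lambda>k. m + 1 / real (Suc k)"]) (auto intro: less_imp_le)
  have "l h = ip u h" if h: "h \<in> H" for h
  proof (rule ccontr)
    assume neq: "l h \<noteq> ip u h"
    define d where "d = ip u h - l h"
    have quad: "0 \<le> t\<^sup>2 * ip h h + 2 * t * d" for t
    proof -
      have "J (u + t *\<^sub>R h) = J u + t\<^sup>2 * ip h h + 2 * t * d"
        using u h ip_sym[OF u h]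
        by (simp add: J_def d_def ip_simps l_add l_scale algebra_simps power2_eq_square)
      then show ?thesis using m_le[of "u + t *\<^sub>R h"] \<open>J u \<le> m\<close> u h by auto
    qed
    have "d \<noteq> 0" using neq by (simp add: d_def)
    define s where "s = ip h h + 1"
    have "s > 0" using ip_nonneg[OF h] by (simp add: s_def)
    have "0 \<le> (- d / s)\<^sup>2 * (s - 1) + 2 * (- d / s) * d"
      using quad[of "- d / s"] by (simp add: s_def)
    also have "\<dots> = d\<^sup>2 * (- s - 1) / s\<^sup>2"
      using \<open>s > 0\<close> by (simp add: field_simps power2_eq_square)
    also have "\<dots> < 0" using \<open>s > 0\<close> \<open>d \<noteq> 0\<close> by (intro divide_neg_pos mult_pos_neg) auto
    finally show False by simp
  qed
  with u show ?thesis by (intro exI[of _ u] conjI ballI)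
qed

definition bounded_form :: "('a \<Rightarrow> 'a \<Rightarrow> real) \<Rightarrow> bool" where
  "bounded_form b \<longleftrightarrow>
     (\<forall>v\<in>H. linear_to_reals H (b v)) \<and> (\<forall>w\<in>H. linear_to_reals H (\<lambda>v. b v w)) \<and>
     (\<exists>C. \<forall>v\<in>H. \<forall>w\<in>H. \<bar>b v w\<bar> \<le> C * nm v * nm w)"

definition op_of_form :: "('a \<Rightarrow> 'a \<Rightarrow> real) \<Rightarrow> 'a \<Rightarrow> 'a" where
  "op_of_form b v = (SOME z. z \<in> H \<and> (\<forall>w\<in>H. b v w = ip z w))"

lemma ip_eqI:
  assumes "u \<in> H" "v \<in> H" "\<And>w. w \<in> H \<Longrightarrow> ip u w = ip v w"
  shows "u = v"
proof -
  have "nm (u - v) \<le> 0"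
    by (rule nm_le_of_dual_bound) (simp_all add: ip_simps assms)
  then have "nm (u - v) = 0" using nm_nonneg[of "u - v"] assms by (simp add: order_antisym)
  then show ?thesis using nm_eq_zero_iff[of "u - v"] assms by simp
qed

context
  fixes b assumes b: "bounded_form b"
begin

lemma op_of_form_aux:
  assumes v: "v \<in> H"
  shows "op_of_form b v \<in> H \<and> (\<forall>w\<in>H. b v w = ip (op_of_form b v) w)"
proof -
  obtain C where C: "\<And>v w. v \<in> H \<Longrightarrow> w \<in> H \<Longrightarrow> \<bar>b v w\<bar> \<le> C * nm v * nm w"
    using b unfolding bounded_form_def by blast
  have lin: "linear_to_reals H (b v)" using b v unfolding bounded_form_def by blast
  from someI_ex[OF riesz[OF lin C[OF v]], folded op_of_form_def] show ?thesis .
qed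

lemma op_of_form_in: "v \<in> H \<Longrightarrow> op_of_form b v \<in> H"
  by (rule conjunct1[OF op_of_form_aux])

lemma ip_op_of_form: "v \<in> H \<Longrightarrow> w \<in> H \<Longrightarrow> ip (op_of_form b v) w = b v w"
  by (rule bspec[OF conjunct2[OF op_of_form_aux], symmetric])

lemma selfadjoint_op_of_form:
  assumes "\<And>v w. v \<in> H \<Longrightarrow> w \<in> H \<Longrightarrow> b v w = b w v"
  shows "selfadjoint_op H ip (op_of_form b)"
proof -
  have lin: "b (u + v) w = b u w + b v w" "b (c *\<^sub>R u) w = c * b u w"
    if "u \<in> H" "v \<in> H" "w \<in> H" for u v w c
    using b that by (simp_all add: bounded_form_def linear_to_reals_def)
  obtain C where C: "\<forall>v\<in>H. \<forall>w\<in>H. \<bar>b v w\<bar> \<le> C * nm v * nm w"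
    using b unfolding bounded_form_def by (elim conjE exE) blast
  have "nm (op_of_form b v) \<le> \<bar>C\<bar> * nm v" if v: "v \<in> H" for v
  proof (rule nm_le_of_dual_bound)
    show "op_of_form b v \<in> H" using v by (rule op_of_form_in)
    show "\<bar>ip (op_of_form b v) w\<bar> \<le> \<bar>C\<bar> * nm v * nm w" if w: "w \<in> H" for w
    proof -
      have "\<bar>b v w\<bar> \<le> C * nm v * nm w" using C v w by blast
      also have "\<dots> \<le> \<bar>C\<bar> * nm v * nm w" using v w by (intro mult_right_mono) auto
      finally show ?thesis using ip_op_of_form[OF v w] by simp
    qed
  qed (use v in auto)
  moreover have "op_of_form b (u + v) = op_of_form b u + op_of_form b v" if "u \<in> H" "v \<in> H" for u v
    by (rule ip_eqI) (use that in \<open>auto simp: op_of_form_in ip_op_of_form ip_simps lin\<close>)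
  moreover have "op_of_form b (c *\<^sub>R u) = c *\<^sub>R op_of_form b u" if "u \<in> H" for u c
    by (rule ip_eqI) (use that in \<open>auto simp: op_of_form_in ip_op_of_form ip_simps lin\<close>)
  moreover have "ip (op_of_form b u) v = ip u (op_of_form b v)" if "u \<in> H" "v \<in> H" for u v
    using ip_op_of_form[OF that] ip_op_of_form[OF that(2,1)] ip_sym[OF that(1) op_of_form_in[OF that(2)]]
      assms[OF that] by simp
  ultimately show ?thesis
    unfolding selfadjoint_op_def by (intro conjI exI[of _ "\<bar>C\<bar>"] ballI allI op_of_form_in)
qed

end

end

section \<open>Domination by powers of an integrable weight\<close>

text \<open>\<open>dom_pow M \<theta> f a L\<close> says, up to constants, that the norm of \<open>f\<close> in \<open>L\<^bsup>1/\<theta>\<^esup>\<close> is at most \<open>a\<close>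
  (with \<open>1/0 = \<infinity>\<close>). Since the weight is at least \<open>1\<close>, the inclusions between these spaces and Hoelder's
  inequality reduce to monotonicity of powers, at the price of letting the bound \<open>L\<close> on the integral
  of the weight grow.\<close>

definition dom_pow :: "'x measure \<Rightarrow> real \<Rightarrow> ('x \<Rightarrow> real) \<Rightarrow> real \<Rightarrow> real \<Rightarrow> bool" where
  "dom_pow M \<theta> f a L \<longleftrightarrow> f \<in> borel_measurable M \<and> 0 \<le> a \<and>
     (\<exists>A. integrable M A \<and> (\<forall>x. 1 \<le> A x) \<and> (\<integral>x. A x \<partial>M) \<le> L \<and>
        (AE x in M. \<bar>f x\<bar> \<le> a * A x powr \<theta>))"

lemma dom_powI:
  assumes "f \<in> borel_measurable M" "0 \<le> a" "integrable M A" "\<forall>x. 1 \<le> A x" "(\<integral>x. A x \<partial>M) \<le> L"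
    "AE x in M. \<bar>f x\<bar> \<le> a * A x powr \<theta>"
  shows "dom_pow M \<theta> f a L"
  using assms unfolding dom_pow_def by blast

lemma dom_powE:
  assumes "dom_pow M \<theta> f a L"
  obtains A where "f \<in> borel_measurable M" "0 \<le> a" "integrable M A" "\<forall>x. 1 \<le> A x"
    "(\<integral>x. A x \<partial>M) \<le> L" "AE x in M. \<bar>f x\<bar> \<le> a * A x powr \<theta>"
  using assms unfolding dom_pow_def by blast

lemma dom_pow_measurable: "dom_pow M \<theta> f a L \<Longrightarrow> f \<in> borel_measurable M"
  by (simp add: dom_pow_def)

lemma dom_pow_exponent_mono:
  assumes "dom_pow M \<theta> f a L" "\<theta> \<le> \<theta>'"
  shows "dom_pow M \<theta>' f a L"
proof -
  obtain A where A: "f \<in> borel_measurable M" "0 \<le> a" "integrable M A" "\<forall>x. 1 \<le> A x"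
    "(\<integral>x. A x \<partial>M) \<le> L" and le: "AE x in M. \<bar>f x\<bar> \<le> a * A x powr \<theta>"
    using assms(1) by (rule dom_powE)
  have "a * A x powr \<theta> \<le> a * A x powr \<theta>'" for x
    using A(2,4) assms(2) by (intro mult_left_mono powr_mono) auto
  then have "AE x in M. \<bar>f x\<bar> \<le> a * A x powr \<theta>'"
    using le by (auto elim!: eventually_mono intro: order_trans)
  then show ?thesis using A by (intro dom_powI)
qed

lemma dom_pow_mono:
  assumes "dom_pow M \<theta> f a L" "a \<le> a'" "L \<le> L'"
  shows "dom_pow M \<theta> f a' L'"
proof -
  obtain A where A: "f \<in> borel_measurable M" "0 \<le> a" "integrable M A" "\<forall>x. 1 \<le> A x"
    "(\<integral>x. A x \<partial>M) \<le> L" and le: "AE x in M. \<bar>f x\<bar> \<le> a * A x powr \<theta>"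
    using assms(1) by (rule dom_powE)
  have "a * A x powr \<theta> \<le> a' * A x powr \<theta>" for x
    using assms(2) by (intro mult_right_mono) auto
  then have "AE x in M. \<bar>f x\<bar> \<le> a' * A x powr \<theta>"
    using le by (auto elim!: eventually_mono intro: order_trans)
  then show ?thesis using A assms(2,3) by (intro dom_powI[of _ _ _ A]) auto
qed

lemma dom_pow_bound:
  assumes "dom_pow M \<theta> f a L" "g \<in> borel_measurable M" "AE x in M. \<bar>g x\<bar> \<le> \<bar>f x\<bar>"
  shows "dom_pow M \<theta> g a L"
proof -
  obtain A where A: "f \<in> borel_measurable M" "0 \<le> a" "integrable M A" "\<forall>x. 1 \<le> A x"
    "(\<integral>x. A x \<partial>M) \<le> L" and le: "AE x in M. \<bar>f x\<bar> \<le> a * A x powr \<theta>"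
    using assms(1) by (rule dom_powE)
  have "AE x in M. \<bar>g x\<bar> \<le> a * A x powr \<theta>"
    using le assms(3) by eventually_elim auto
  then show ?thesis using A assms(2) by (intro dom_powI[of _ _ _ A])
qed

lemma dom_pow_mult:
  assumes f: "dom_pow M \<theta> f a L" and g: "dom_pow M \<phi> g b L'" and "0 \<le> \<theta>" "0 \<le> \<phi>"
  shows "dom_pow M (\<theta> + \<phi>) (\<lambda>x. f x * g x) (a * b) (L + L')"
proof -
  obtain A where A: "f \<in> borel_measurable M" "0 \<le> a" "integrable M A" "\<forall>x. 1 \<le> A x"
    "(\<integral>x. A x \<partial>M) \<le> L" and leA: "AE x in M. \<bar>f x\<bar> \<le> a * A x powr \<theta>"
    using f by (rule dom_powE)
  obtain B where B: "g \<in> borel_measurable M" "0 \<le> b" "integrable M B" "\<forall>x. 1 \<le> B x"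
    "(\<integral>x. B x \<partial>M) \<le> L'" and leB: "AE x in M. \<bar>g x\<bar> \<le> b * B x powr \<phi>"
    using g by (rule dom_powE)
  have pos: "0 \<le> A x" "0 \<le> B x" and ge: "1 \<le> A x + B x" for x
    using A(4)[rule_format, of x] B(4)[rule_format, of x] by auto
  have "AE x in M. \<bar>f x * g x\<bar> \<le> a * b * (A x + B x) powr (\<theta> + \<phi>)"
    using leA leB
  proof eventually_elim
    case (elim x)
    have "\<bar>f x * g x\<bar> \<le> (a * A x powr \<theta>) * (b * B x powr \<phi>)"
      unfolding abs_mult using elim A(2) by (intro mult_mono) auto
    also have "\<dots> \<le> (a * (A x + B x) powr \<theta>) * (b * (A x + B x) powr \<phi>)"
      using A(2) B(2) pos[of x] assms(3,4) by (intro mult_mono powr_mono2) auto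
    finally show ?case by (simp add: powr_add algebra_simps)
  qed
  then show ?thesis
    using A B by (intro dom_powI[where A = "\<lambda>x. A x + B x"]) (auto simp: ge intro!: add_mono)
qed

lemma dom_pow_abs: "dom_pow M \<theta> f a L \<Longrightarrow> dom_pow M \<theta> (\<lambda>x. \<bar>f x\<bar>) a L"
  by (rule dom_pow_bound) (auto dest: dom_pow_measurable)

lemma dom_pow_cmult:
  assumes "dom_pow M \<theta> f a L"
  shows "dom_pow M \<theta> (\<lambda>x. c * f x) (\<bar>c\<bar> * a) L"
proof -
  obtain A where A: "f \<in> borel_measurable M" "0 \<le> a" "integrable M A" "\<forall>x. 1 \<le> A x"
    "(\<integral>x. A x \<partial>M) \<le> L" and le: "AE x in M. \<bar>f x\<bar> \<le> a * A x powr \<theta>"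
    using assms(1) by (rule dom_powE)
  have "AE x in M. \<bar>c * f x\<bar> \<le> \<bar>c\<bar> * a * A x powr \<theta>"
    using le by eventually_elim (simp add: abs_mult mult_left_mono mult.assoc)
  then show ?thesis using A by (intro dom_powI[of _ _ _ A]) auto
qed

context finite_measure
begin

abbreviation \<mu> :: real where "\<mu> \<equiv> measure M (space M)"

lemma dom_pow_const: "0 \<le> \<theta> \<Longrightarrow> dom_pow M \<theta> (\<lambda>_. c) \<bar>c\<bar> \<mu>"
  by (rule dom_powI[where A = "\<lambda>_. 1"]) auto

lemma dom_pow_sum:
  assumes "finite I" and dom: "\<And>i. i \<in> I \<Longrightarrow> dom_pow M \<theta> (f i) a L" and "0 \<le> \<theta>" "0 \<le> a"
  shows "dom_pow M \<theta> (\<lambda>x. \<Sum>i\<in>I. f i x) (real (card I) * a) (\<mu> + real (card I) * L)"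
proof -
  have "\<forall>i\<in>I. \<exists>A. f i \<in> borel_measurable M \<and> integrable M A \<and> (\<forall>x. 1 \<le> A x) \<and> (\<integral>x. A x \<partial>M) \<le> L \<and>
      (AE x in M. \<bar>f i x\<bar> \<le> a * A x powr \<theta>)"
    using dom unfolding dom_pow_def by blast
  then obtain A where A: "\<And>i. i \<in> I \<Longrightarrow> f i \<in> borel_measurable M \<and> integrable M (A i) \<and>
      (\<forall>x. 1 \<le> A i x) \<and> (\<integral>x. A i x \<partial>M) \<le> L \<and> (AE x in M. \<bar>f i x\<bar> \<le> a * A i x powr \<theta>)"
    unfolding bchoice_iff by blast
  have pos: "0 \<le> (\<Sum>i\<in>I. A i x)" for x
    using A by (intro sum_nonneg) (auto intro: order_trans[OF zero_le_one])
  have "AE x in M. \<forall>i\<in>I. \<bar>f i x\<bar> \<le> a * A i x powr \<theta>"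
    using A assms(1) by (intro AE_finite_allI) auto
  then have "AE x in M. \<bar>\<Sum>i\<in>I. f i x\<bar> \<le> real (card I) * a * (1 + (\<Sum>i\<in>I. A i x)) powr \<theta>"
  proof eventually_elim
    case (elim x)
    have "\<bar>\<Sum>i\<in>I. f i x\<bar> \<le> (\<Sum>i\<in>I. \<bar>f i x\<bar>)" by (rule sum_abs)
    also have "\<dots> \<le> (\<Sum>i\<in>I. a * (1 + (\<Sum>i\<in>I. A i x)) powr \<theta>)"
    proof (rule sum_mono)
      fix i assume i: "i \<in> I"
      have pos': "0 \<le> A j x" if "j \<in> I" for j using A[OF that] by (meson order_trans zero_le_one)
      then have "A i x \<le> (\<Sum>i\<in>I. A i x)" using i assms(1) by (intro member_le_sum) auto
      then have "a * A i x powr \<theta> \<le> a * (1 + (\<Sum>i\<in>I. A i x)) powr \<theta>"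
        using pos'[OF i] assms by (intro mult_left_mono powr_mono2) auto
      then show "\<bar>f i x\<bar> \<le> a * (1 + (\<Sum>i\<in>I. A i x)) powr \<theta>" using elim i by fastforce
    qed
    finally show ?case by simp
  qed
  moreover have "(\<integral>x. 1 + (\<Sum>i\<in>I. A i x) \<partial>M) = \<mu> + (\<Sum>i\<in>I. \<integral>x. A i x \<partial>M)"
    using A by (subst Bochner_Integration.integral_add) (auto intro!: Bochner_Integration.integral_sum)
  moreover have "(\<Sum>i\<in>I. \<integral>x. A i x \<partial>M) \<le> real (card I) * L"
    using A sum_mono[of I "\<lambda>i. \<integral>x. A i x \<partial>M" "\<lambda>_. L"] by simp
  ultimately show ?thesis
    using A assms pos by (intro dom_powI[where A = "\<lambda>x. 1 + (\<Sum>i\<in>I. A i x)"] borel_measurable_sum) auto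
qed

lemma dom_pow_add:
  assumes f: "dom_pow M \<theta> f a L" and g: "dom_pow M \<theta> g b L'" and "0 \<le> \<theta>"
  shows "dom_pow M \<theta> (\<lambda>x. f x + g x) (a + b) (L + L')"
proof -
  obtain A where A: "f \<in> borel_measurable M" "0 \<le> a" "integrable M A" "\<forall>x. 1 \<le> A x"
    "(\<integral>x. A x \<partial>M) \<le> L" and leA: "AE x in M. \<bar>f x\<bar> \<le> a * A x powr \<theta>"
    using f by (rule dom_powE)
  obtain B where B: "g \<in> borel_measurable M" "0 \<le> b" "integrable M B" "\<forall>x. 1 \<le> B x"
    "(\<integral>x. B x \<partial>M) \<le> L'" and leB: "AE x in M. \<bar>g x\<bar> \<le> b * B x powr \<theta>"
    using g by (rule dom_powE)
  have pos: "0 \<le> A x" "0 \<le> B x" and ge: "1 \<le> A x + B x" for x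
    using A(4)[rule_format, of x] B(4)[rule_format, of x] by auto
  have "AE x in M. \<bar>f x + g x\<bar> \<le> (a + b) * (A x + B x) powr \<theta>"
    using leA leB
  proof eventually_elim
    case (elim x)
    have "\<bar>f x + g x\<bar> \<le> a * A x powr \<theta> + b * B x powr \<theta>"
      using elim by linarith
    also have "\<dots> \<le> a * (A x + B x) powr \<theta> + b * (A x + B x) powr \<theta>"
      using A(2) B(2) pos[of x] assms(3) by (intro add_mono mult_mono powr_mono2) auto
    finally show ?case by (simp add: algebra_simps)
  qed
  then show ?thesis
    using A B by (intro dom_powI[where A = "\<lambda>x. A x + B x"]) (auto simp: ge intro!: add_mono)
qed

lemma dom_pow_integrable:
  assumes "dom_pow M 1 f a L"
  shows "integrable M f" and "(\<integral>x. \<bar>f x\<bar> \<partial>M) \<le> a * L" and "\<bar>\<integral>x. f x \<partial>M\<bar> \<le> a * L"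
proof -
  obtain A where A: "f \<in> borel_measurable M" "0 \<le> a" "integrable M A" "\<forall>x. 1 \<le> A x"
    "(\<integral>x. A x \<partial>M) \<le> L" and le: "AE x in M. \<bar>f x\<bar> \<le> a * A x powr 1"
    using assms by (rule dom_powE)
  have pos: "0 \<le> A x" for x using A(4)[rule_format, of x] by auto
  have le': "AE x in M. \<bar>f x\<bar> \<le> a * A x"
    using le by eventually_elim (simp add: pos)
  show int: "integrable M f"
    by (rule Bochner_Integration.integrable_bound[of M "\<lambda>x. a * A x"])
      (use A le' pos in \<open>auto simp: abs_mult\<close>)
  have "(\<integral>x. \<bar>f x\<bar> \<partial>M) \<le> (\<integral>x. a * A x \<partial>M)"
    using int A le' by (intro integral_mono_AE) auto
  also have "\<dots> \<le> a * L" using A by (auto intro: mult_left_mono)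
  finally show *: "(\<integral>x. \<bar>f x\<bar> \<partial>M) \<le> a * L" .
  then show "\<bar>\<integral>x. f x \<partial>M\<bar> \<le> a * L" using integral_abs_bound[of M f] by linarith
qed

lemma dom_pow_of_integrable:
  assumes f: "f \<in> borel_measurable M" and \<theta>: "0 < \<theta>" and b: "0 \<le> b"
    and int: "integrable M (\<lambda>x. \<bar>f x\<bar> powr (1 / \<theta>))"
    and le: "(\<integral>x. \<bar>f x\<bar> powr (1 / \<theta>) \<partial>M) \<le> b powr (1 / \<theta>)"
  shows "dom_pow M \<theta> f b (\<mu> + 1)"
proof (cases "b = 0")
  case True
  then have "(\<integral>x. \<bar>f x\<bar> powr (1 / \<theta>) \<partial>M) \<le> 0" using le by simp
  then have "(\<integral>x. \<bar>f x\<bar> powr (1 / \<theta>) \<partial>M) = 0" by (simp add: order_antisym)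
  then have "AE x in M. \<bar>f x\<bar> powr (1 / \<theta>) = 0"
    using integral_nonneg_eq_0_iff_AE[OF int] by simp
  then have "AE x in M. \<bar>f x\<bar> \<le> 0 * 1 powr \<theta>" by eventually_elim simp
  then show ?thesis using f True by (intro dom_powI[where A = "\<lambda>_. 1"]) auto
next
  case False
  then have b: "b > 0" using b by simp
  define X where "X x = \<bar>f x\<bar> powr (1 / \<theta>) / b powr (1 / \<theta>)" for x
  have X: "integrable M X" "(\<integral>x. X x \<partial>M) \<le> 1" "\<And>x. X x \<ge> 0"
    unfolding X_def[abs_def] using int le b by (auto simp: divide_le_eq_1)
  have "\<bar>f x\<bar> \<le> b * (1 + X x) powr \<theta>" for x
  proof -
    have "\<bar>f x\<bar> = b * X x powr \<theta>"
      using \<theta> b by (cases "f x = 0") (auto simp: X_def powr_divide powr_powr)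
    also have "\<dots> \<le> b * (1 + X x) powr \<theta>"
      using b \<theta> X(3)[of x] by (intro mult_left_mono powr_mono2) auto
    finally show ?thesis .
  qed
  then show ?thesis using f b X by (intro dom_powI[where A = "\<lambda>x. 1 + X x"]) auto
qed

lemma dom_pow_powr_integrable:
  assumes dom: "dom_pow M \<theta> f a L" and \<theta>: "0 < \<theta>" and p: "0 < p" "p \<le> 1 / \<theta>"
  shows "integrable M (\<lambda>x. \<bar>f x\<bar> powr p)" and "(\<integral>x. \<bar>f x\<bar> powr p \<partial>M) \<le> a powr p * L"
proof -
  obtain A where A: "f \<in> borel_measurable M" "0 \<le> a" "integrable M A" "\<forall>x. 1 \<le> A x"
    "(\<integral>x. A x \<partial>M) \<le> L" and le: "AE x in M. \<bar>f x\<bar> \<le> a * A x powr \<theta>"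
    using dom by (rule dom_powE)
  have le': "AE x in M. \<bar>f x\<bar> powr p \<le> a powr p * A x"
    using le
  proof eventually_elim
    case (elim x)
    have "\<bar>f x\<bar> powr p \<le> (a * A x powr \<theta>) powr p" using elim p by (intro powr_mono2) auto
    also have "\<dots> = a powr p * A x powr (\<theta> * p)" using A(2) by (simp add: powr_mult powr_powr)
    also have "\<dots> \<le> a powr p * A x powr 1"
      using A(4)[rule_format, of x] p \<theta> by (intro mult_left_mono powr_mono) (auto simp: field_simps)
    finally show ?case using A(4)[rule_format, of x] by simp
  qed
  show int: "integrable M (\<lambda>x. \<bar>f x\<bar> powr p)"
    by (rule Bochner_Integration.integrable_bound[of M "\<lambda>x. a powr p * A x"])
      (use A le' in \<open>auto elim!: eventually_mono\<close>)
  have "(\<integral>x. \<bar>f x\<bar> powr p \<partial>M) \<le> (\<integral>x. a powr p * A x \<partial>M)"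
    using int A le' by (intro integral_mono_AE) auto
  also have "\<dots> \<le> a powr p * L" using A by (auto intro: mult_left_mono)
  finally show "(\<integral>x. \<bar>f x\<bar> powr p \<partial>M) \<le> a powr p * L" .
qed

lemma dom_pow_eventually_small:
  assumes f: "\<And>k::nat. f k \<in> borel_measurable M" and \<theta>: "0 < \<theta>"
    and int: "\<And>k. integrable M (\<lambda>x. \<bar>f k x\<bar> powr (1 / \<theta>))"
    and lim: "(\<lambda>k. \<integral>x. \<bar>f k x\<bar> powr (1 / \<theta>) \<partial>M) \<longlonglongrightarrow> 0" and e: "0 < e"
  shows "\<forall>\<^sub>F k in sequentially. dom_pow M \<theta> (f k) e (\<mu> + 1)"
proof -
  have "\<forall>\<^sub>F k in sequentially. (\<integral>x. \<bar>f k x\<bar> powr (1 / \<theta>) \<partial>M) < e powr (1 / \<theta>)"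
    using lim e by (intro order_tendstoD) auto
  then show ?thesis
    by eventually_elim (use f \<theta> int e in \<open>auto intro!: dom_pow_of_integrable\<close>)
qed

text \<open>Splitting off \<open>min (\<bar>f k\<bar> ^ (1/\<theta>)) C\<close>, which is dominated by a constant, leaves at most \<open>C * Y k\<close>.\<close>

lemma dom_pow_eventually_small_growth:
  assumes f: "\<And>k::nat. f k \<in> borel_measurable M" and \<theta>: "0 < \<theta>"
    and Y: "\<And>k. integrable M (Y k)" "\<And>k x. 0 \<le> Y k x" "(\<lambda>k. \<integral>x. Y k x \<partial>M) \<longlonglongrightarrow> 0"
    and le: "\<And>k. AE x in M. \<bar>f k x\<bar> powr (1 / \<theta>) \<le> C * (1 + Y k x)" and C: "0 \<le> C"
    and lim: "AE x in M. (\<lambda>k. f k x) \<longlonglongrightarrow> 0" and e: "0 < e"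
  shows "\<forall>\<^sub>F k in sequentially. dom_pow M \<theta> (f k) e (\<mu> + 1)"
proof (rule dom_pow_eventually_small[OF f \<theta> _ _ e])
  define z where "z k x = \<bar>f k x\<bar> powr (1 / \<theta>)" for k x
  have zm [measurable]: "z k \<in> borel_measurable M" for k
    using f[of k] unfolding z_def by measurable
  have z0: "0 \<le> z k x" for k x by (simp add: z_def)
  show int: "integrable M (\<lambda>x. \<bar>f k x\<bar> powr (1 / \<theta>))" for k
    by (rule Bochner_Integration.integrable_bound[of M "\<lambda>x. C * (1 + Y k x)"])
      (use Y le[of k] C f zm[of k, unfolded z_def] in \<open>auto elim!: eventually_mono\<close>)
  have "(\<lambda>k. \<integral>x. min (z k x) C \<partial>M) \<longlonglongrightarrow> (\<integral>x. 0 \<partial>M)"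
  proof (rule integral_dominated_convergence[where w = "\<lambda>_. C"])
    show "AE x in M. (\<lambda>k. min (z k x) C) \<longlonglongrightarrow> 0"
      using lim
    proof eventually_elim
      case (elim x)
      have "(\<lambda>k. \<bar>f k x\<bar>) \<longlonglongrightarrow> 0" using elim by (rule tendsto_rabs_zero)
      then have "(\<lambda>k. \<bar>f k x\<bar> powr (1 / \<theta>)) \<longlonglongrightarrow> 0 powr (1 / \<theta>)"
        using \<theta> by (intro tendsto_powr') auto
      then have "(\<lambda>k. z k x) \<longlonglongrightarrow> 0" by (simp add: z_def)
      then have "(\<lambda>k. min (z k x) C) \<longlonglongrightarrow> min 0 C" by (intro tendsto_min tendsto_const)
      then show ?case using C by simp
    qed
    show "AE x in M. norm (min (z k x) C) \<le> C" for k
      using C z0[of k] by (auto simp: abs_le_iff min_le_iff_disj intro: order_trans)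
  qed auto
  then have lim1: "(\<lambda>k. (\<integral>x. min (z k x) C \<partial>M) + C * (\<integral>x. Y k x \<partial>M)) \<longlonglongrightarrow> 0 + C * 0"
    using Y(3) by (intro tendsto_intros) auto
  have "(\<integral>x. z k x \<partial>M) \<le> (\<integral>x. min (z k x) C \<partial>M) + C * (\<integral>x. Y k x \<partial>M)" for k
  proof -
    have imin: "integrable M (\<lambda>x. min (z k x) C)"
      by (rule Bochner_Integration.integrable_bound[of M "\<lambda>_. C"])
        (use C z0[of k] in \<open>auto simp: abs_le_iff min_le_iff_disj intro: order_trans\<close>)
    have "(\<integral>x. z k x \<partial>M) \<le> (\<integral>x. min (z k x) C + C * Y k x \<partial>M)"
    proof (rule integral_mono_AE)
      show "AE x in M. z k x \<le> min (z k x) C + C * Y k x"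
        using le[of k]
      proof eventually_elim
        case (elim x)
        have "0 \<le> C * Y k x" using C Y(2) by simp
        then show ?case using elim by (auto simp: z_def min_def algebra_simps)
      qed
    qed (use int imin Y in \<open>auto simp: z_def\<close>)
    then show ?thesis using imin Y by simp
  qed
  then have "(\<lambda>k. \<integral>x. z k x \<partial>M) \<longlonglongrightarrow> 0"
    using lim1 z0 by (intro tendsto_sandwich[of "\<lambda>_. 0" "\<lambda>k. \<integral>x. z k x \<partial>M" _ "\<lambda>k. (\<integral>x. min (z k x) C \<partial>M) + C * (\<integral>x. Y k x \<partial>M)"])
      simp_all
  then show "(\<lambda>k. \<integral>x. \<bar>f k x\<bar> powr (1 / \<theta>) \<partial>M) \<longlonglongrightarrow> 0" unfolding z_def .
qed

lemma dom_pow_eventually_small_dominated: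
  assumes f: "\<And>k::nat. f k \<in> borel_measurable M" and \<theta>: "0 < \<theta>"
    and G: "dom_pow M \<theta> G a L"
    and le: "\<And>k. AE x in M. \<bar>f k x\<bar> \<le> \<bar>G x\<bar>"
    and lim: "AE x in M. (\<lambda>k. f k x) \<longlonglongrightarrow> 0" and e: "0 < e"
  shows "\<forall>\<^sub>F k in sequentially. dom_pow M \<theta> (f k) e (\<mu> + 1)"
proof (rule dom_pow_eventually_small[OF f \<theta> _ _ e])
  have intG: "integrable M (\<lambda>x. \<bar>G x\<bar> powr (1 / \<theta>))"
    using dom_pow_powr_integrable[OF G \<theta>] \<theta> by simp
  have m: "(\<lambda>x. \<bar>f k x\<bar> powr (1 / \<theta>)) \<in> borel_measurable M" for k
    using f[of k] by measurable
  have le': "AE x in M. \<bar>f k x\<bar> powr (1 / \<theta>) \<le> \<bar>G x\<bar> powr (1 / \<theta>)" for k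
    using le[of k] by eventually_elim (use \<theta> in \<open>auto intro!: powr_mono2\<close>)
  show "integrable M (\<lambda>x. \<bar>f k x\<bar> powr (1 / \<theta>))" for k
    by (rule Bochner_Integration.integrable_bound[OF intG m]) (use le' in auto)
  have "(\<lambda>k. \<integral>x. \<bar>f k x\<bar> powr (1 / \<theta>) \<partial>M) \<longlonglongrightarrow> (\<integral>x. 0 \<partial>M)"
  proof (rule integral_dominated_convergence[OF _ m intG])
    show "AE x in M. (\<lambda>k. \<bar>f k x\<bar> powr (1 / \<theta>)) \<longlonglongrightarrow> 0"
      using lim
    proof eventually_elim
      case (elim x)
      have "(\<lambda>k. \<bar>f k x\<bar>) \<longlonglongrightarrow> 0" using elim by (rule tendsto_rabs_zero)
      then have "(\<lambda>k. \<bar>f k x\<bar> powr (1 / \<theta>)) \<longlonglongrightarrow> 0 powr (1 / \<theta>)"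
        using \<theta> by (intro tendsto_powr') auto
      then show ?case by simp
    qed
  qed (use le' in auto)
  then show "(\<lambda>k. \<integral>x. \<bar>f k x\<bar> powr (1 / \<theta>) \<partial>M) \<longlonglongrightarrow> 0" by simp
qed

end

section \<open>Integral functionals on a Hilbert space of functions\<close>

lemma null_seq_by_subseq:
  fixes f :: "nat \<Rightarrow> real"
  assumes "\<And>r. strict_mono (r::nat \<Rightarrow> nat) \<Longrightarrow> \<exists>s. strict_mono s \<and> (\<lambda>k. f (r (s k))) \<longlonglongrightarrow> 0"
  shows "f \<longlonglongrightarrow> 0"
proof (rule ccontr)
  assume "\<not> f \<longlonglongrightarrow> 0"
  then obtain e where e: "e > 0" "\<not> (\<forall>\<^sub>F k in sequentially. dist (f k) 0 < e)"
    unfolding tendsto_iff by auto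
  then have "infinite {k. \<not> dist (f k) 0 < e}"
    by (simp add: frequently_def[symmetric] frequently_cofinite[symmetric] cofinite_eq_sequentially not_eventually)
  then obtain r :: "nat \<Rightarrow> nat" where r: "strict_mono r" "\<And>k. r k \<in> {k. \<not> dist (f k) 0 < e}"
    using infinite_enumerate by blast
  obtain s where s: "strict_mono s" "(\<lambda>k. f (r (s k))) \<longlonglongrightarrow> 0"
    using assms[OF r(1)] by auto
  then have "\<forall>\<^sub>F k in sequentially. dist (f (r (s k))) 0 < e"
    using e(1) unfolding tendsto_iff by auto
  then obtain k where "dist (f (r (s k))) 0 < e"
    using eventually_happens'[OF sequentially_bot] by blast
  then show False using r(2)[of "s k"] by simp
qed

lemma dom_pow_mult3:
  assumes M: "finite_measure M" and g: "dom_pow M \<rho> g N L" and p: "dom_pow M \<sigma> p a L'" and q: "dom_pow M \<tau> q b L''"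
    and nn: "0 \<le> \<rho>" "0 \<le> \<sigma>" "0 \<le> \<tau>" and le: "\<rho> + \<sigma> + \<tau> \<le> 1"
  shows "integrable M (\<lambda>x. g x * p x * q x)"
    and "(\<integral>x. \<bar>g x * p x * q x\<bar> \<partial>M) \<le> N * a * b * (L + L' + L'')"
    and "\<bar>\<integral>x. g x * p x * q x \<partial>M\<bar> \<le> N * a * b * (L + L' + L'')"
proof -
  interpret finite_measure M by (rule M)
  have "dom_pow M ((\<rho> + \<sigma>) + \<tau>) (\<lambda>x. (g x * p x) * q x) ((N * a) * b) ((L + L') + L'')"
    using nn by (intro dom_pow_mult[OF dom_pow_mult[OF g p] q]) auto
  then have "dom_pow M 1 (\<lambda>x. g x * p x * q x) (N * a * b) (L + L' + L'')"
    using le by (rule dom_pow_exponent_mono)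
  from dom_pow_integrable[OF this]
  show "integrable M (\<lambda>x. g x * p x * q x)"
    and "(\<integral>x. \<bar>g x * p x * q x\<bar> \<partial>M) \<le> N * a * b * (L + L' + L'')"
    and "\<bar>\<integral>x. g x * p x * q x \<partial>M\<bar> \<le> N * a * b * (L + L' + L'')" by auto
qed

lemma dom_pow_mult2:
  assumes M: "finite_measure M" and p: "dom_pow M \<sigma> p a L'" and q: "dom_pow M \<tau> q b L''"
    and nn: "0 \<le> \<sigma>" "0 \<le> \<tau>" and le: "\<sigma> + \<tau> \<le> 1"
  shows "integrable M (\<lambda>x. p x * q x)"
    and "\<bar>\<integral>x. p x * q x \<partial>M\<bar> \<le> a * b * (L' + L'')"
proof -
  interpret finite_measure M by (rule M)
  have "dom_pow M 1 (\<lambda>x. p x * q x) (a * b) (L' + L'')"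
    using dom_pow_mult[OF p q nn] le by (rule dom_pow_exponent_mono)
  from dom_pow_integrable[OF this]
  show "integrable M (\<lambda>x. p x * q x)" and "\<bar>\<integral>x. p x * q x \<partial>M\<bar> \<le> a * b * (L' + L'')" by auto
qed

locale nemytskii = hilbert_on H ip + finite_measure M
  for H :: "'a::real_vector set" and ip :: "'a inner_prod" and M :: "'x measure" +
  fixes I Top :: "'k set" and D :: "'a \<Rightarrow> 'k \<Rightarrow> 'x \<Rightarrow> real" and \<theta> :: "'k \<Rightarrow> real"
    and R :: "'k \<Rightarrow> 'k \<Rightarrow> real"
    and F0 :: "'x \<Rightarrow> ('k \<Rightarrow> real) \<Rightarrow> real" and F1 :: "'k \<Rightarrow> 'x \<Rightarrow> ('k \<Rightarrow> real) \<Rightarrow> real"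
    and F2 :: "'k \<Rightarrow> 'k \<Rightarrow> 'x \<Rightarrow> ('k \<Rightarrow> real) \<Rightarrow> real" and Ce Le :: real
    and S :: "('k \<Rightarrow> real) set" and J :: "'a \<Rightarrow> 'x \<Rightarrow> 'k \<Rightarrow> real"
  defines "S \<equiv> {\<xi>. \<forall>c. c \<notin> I \<longrightarrow> \<xi> c = 0}"
    and "J \<equiv> \<lambda>u x c. if c \<in> I then D u c x else 0"
  assumes fin: "finite I" and Top_sub: "Top \<subseteq> I"
    and th: "\<And>c. c \<in> I \<Longrightarrow> 0 \<le> \<theta> c" "\<And>c. c \<in> I \<Longrightarrow> \<theta> c \<le> 1 / 2" "\<And>c. c \<in> Top \<Longrightarrow> \<theta> c = 1 / 2"
    and R: "\<And>a b. a \<in> I \<Longrightarrow> b \<in> I \<Longrightarrow> 0 \<le> R a b" "\<And>a b. a \<in> I \<Longrightarrow> b \<in> I \<Longrightarrow> R a b \<le> 1 - \<theta> a - \<theta> b"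
      "\<And>a b. a \<in> I \<Longrightarrow> b \<in> I \<Longrightarrow> R a b = R b a"
    and R_strict: "\<And>a b. a \<in> I \<Longrightarrow> b \<in> I \<Longrightarrow> \<not> (a \<in> Top \<and> b \<in> Top) \<Longrightarrow> 0 < \<theta> a \<Longrightarrow> 0 < \<theta> b \<Longrightarrow>
      R a b < 1 - \<theta> a - \<theta> b"
    and D_add: "\<And>u v c. u \<in> H \<Longrightarrow> v \<in> H \<Longrightarrow> c \<in> I \<Longrightarrow> AE x in M. D (u + v) c x = D u c x + D v c x"
    and D_scale: "\<And>u c s. u \<in> H \<Longrightarrow> c \<in> I \<Longrightarrow> AE x in M. D (s *\<^sub>R u) c x = s * D u c x"
    and ip_eq: "\<And>u v. u \<in> H \<Longrightarrow> v \<in> H \<Longrightarrow> ip u v = (\<Sum>c\<in>I. \<integral>x. D u c x * D v c x \<partial>M)"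
    and Ce: "0 \<le> Ce" and Le: "0 \<le> Le"
    and emb: "\<And>u c. u \<in> H \<Longrightarrow> c \<in> I \<Longrightarrow> dom_pow M (\<theta> c) (D u c) (Ce * nm u) Le"
    and cpt: "\<And>c \<kappa> v B. c \<in> I \<Longrightarrow> c \<notin> Top \<Longrightarrow> \<theta> c = 0 \<or> \<theta> c < \<kappa> \<Longrightarrow> 0 \<le> \<kappa> \<Longrightarrow> \<kappa> \<le> 1 \<Longrightarrow>
      (\<And>k::nat. v k \<in> H) \<Longrightarrow> (\<And>k. nm (v k) \<le> B) \<Longrightarrow>
      \<exists>r. strict_mono (r::nat \<Rightarrow> nat) \<and>
        (\<forall>e>0. \<exists>K. \<forall>j\<ge>K. \<forall>k\<ge>K. dom_pow M \<kappa> (D (v (r j) - v (r k)) c) e Le)"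
    and growth: "\<And>K. 0 \<le> K \<Longrightarrow> \<exists>C\<ge>0. AE x in M. \<forall>\<xi>\<in>S. (\<forall>c\<in>I. \<theta> c = 0 \<longrightarrow> \<bar>\<xi> c\<bar> \<le> K) \<longrightarrow>
      (\<forall>a\<in>I. \<forall>b\<in>I. \<bar>F2 a b x \<xi>\<bar> \<le> C * (1 + (\<Sum>c | c \<in> I \<and> 0 < \<theta> c. \<bar>\<xi> c\<bar> powr (1 / \<theta> c))) powr R a b)"
    and deriv0: "AE x in M. \<forall>\<xi>\<in>S. \<forall>\<eta>\<in>S.
      ((\<lambda>t. F0 x (\<lambda>c. \<xi> c + t * \<eta> c)) has_real_derivative (\<Sum>a\<in>I. F1 a x \<xi> * \<eta> a)) (at 0)"
    and deriv1: "AE x in M. \<forall>\<xi>\<in>S. \<forall>\<eta>\<in>S. \<forall>a\<in>I.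
      ((\<lambda>t. F1 a x (\<lambda>c. \<xi> c + t * \<eta> c)) has_real_derivative (\<Sum>b\<in>I. F2 a b x \<xi> * \<eta> b)) (at 0)"
    and F2_sym: "AE x in M. \<forall>\<xi>\<in>S. \<forall>a\<in>I. \<forall>b\<in>I. F2 a b x \<xi> = F2 b a x \<xi>"
    and F2_cont: "AE x in M. \<forall>\<xi>::nat \<Rightarrow> 'k \<Rightarrow> real. (\<forall>k. \<xi> k \<in> S) \<longrightarrow> (\<forall>c. (\<lambda>k. \<xi> k c) \<longlonglongrightarrow> 0) \<longrightarrow>
      (\<forall>a\<in>I. \<forall>b\<in>I. (\<lambda>k. F2 a b x (\<xi> k)) \<longlonglongrightarrow> F2 a b x (\<lambda>_. 0))"
    and F0_meas: "\<And>u. u \<in> H \<Longrightarrow> (\<lambda>x. F0 x (J u x)) \<in> borel_measurable M"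
    and F1_meas: "\<And>u a. u \<in> H \<Longrightarrow> a \<in> I \<Longrightarrow> (\<lambda>x. F1 a x (J u x)) \<in> borel_measurable M"
    and F2_meas: "\<And>u a b. u \<in> H \<Longrightarrow> a \<in> I \<Longrightarrow> b \<in> I \<Longrightarrow> (\<lambda>x. F2 a b x (J u x)) \<in> borel_measurable M"
    and F0_int: "integrable M (\<lambda>x. F0 x (\<lambda>_. 0))"
    and F1_dom: "\<And>a. a \<in> I \<Longrightarrow> \<exists>c L. dom_pow M (1 - \<theta> a) (\<lambda>x. F1 a x (\<lambda>_. 0)) c L"
    and ell: "\<exists>l>0. AE x in M. \<forall>\<xi>\<in>S. \<forall>\<eta> :: 'k \<Rightarrow> real.
      l * (\<Sum>a\<in>Top. (\<eta> a)\<^sup>2) \<le> (\<Sum>a\<in>Top. \<Sum>b\<in>Top. F2 a b x \<xi> * \<eta> a * \<eta> b)"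
begin

lemma finM: "finite_measure M"
  by (rule finite_measure_axioms)

lemma D_meas: "u \<in> H \<Longrightarrow> c \<in> I \<Longrightarrow> D u c \<in> borel_measurable M"
  using emb dom_pow_measurable by blast

lemma J_in_S [simp]: "J u x \<in> S"
  by (simp add: S_def J_def)

lemma line_in_S [simp]: "\<xi> \<in> S \<Longrightarrow> \<eta> \<in> S \<Longrightarrow> (\<lambda>c. \<xi> c + t * \<eta> c) \<in> S"
  by (simp add: S_def)

lemma zero_in_S [simp]: "(\<lambda>_. 0) \<in> S"
  by (simp add: S_def)

lemma J_in [simp]: "c \<in> I \<Longrightarrow> J u x c = D u c x"
  by (simp add: J_def)

lemma J_add: "u \<in> H \<Longrightarrow> v \<in> H \<Longrightarrow> AE x in M. J (u + v) x = (\<lambda>c. J u x c + J v x c)"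
proof -
  assume "u \<in> H" "v \<in> H"
  then have "AE x in M. \<forall>c\<in>I. D (u + v) c x = D u c x + D v c x"
    using fin D_add by (intro AE_finite_allI) auto
  then show ?thesis by eventually_elim (auto simp: J_def)
qed

lemma J_scale: "u \<in> H \<Longrightarrow> AE x in M. J (s *\<^sub>R u) x = (\<lambda>c. s * J u x c)"
proof -
  assume "u \<in> H"
  then have "AE x in M. \<forall>c\<in>I. D (s *\<^sub>R u) c x = s * D u c x"
    using fin D_scale by (intro AE_finite_allI) auto
  then show ?thesis by eventually_elim (auto simp: J_def)
qed

lemma J_zero: "AE x in M. J 0 x = (\<lambda>_. 0)"
  using J_scale[OF H_zero, of 0] by simp

lemma J_line: "u \<in> H \<Longrightarrow> h \<in> H \<Longrightarrow> AE x in M. J (u + t *\<^sub>R h) x = (\<lambda>c. J u x c + t * J h x c)"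
proof -
  assume "u \<in> H" "h \<in> H"
  then have "AE x in M. J (u + t *\<^sub>R h) x = (\<lambda>c. J u x c + J (t *\<^sub>R h) x c)" "AE x in M. J (t *\<^sub>R h) x = (\<lambda>c. t * J h x c)"
    by (auto intro: J_add J_scale)
  then show ?thesis by eventually_elim simp
qed

lemma weight:
  assumes u: "u \<in> H"
  shows "\<exists>W. integrable M W \<and> (\<forall>x. 1 \<le> W x) \<and> (\<integral>x. W x \<partial>M) \<le> \<mu> + real (card I) * Le \<and>
    (AE x in M. \<forall>c\<in>I. \<bar>D u c x\<bar> \<le> Ce * nm u * W x powr \<theta> c)"
proof -
  have "\<forall>c\<in>I. \<exists>A. integrable M A \<and> (\<forall>x. 1 \<le> A x) \<and> (\<integral>x. A x \<partial>M) \<le> Le \<and>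
      (AE x in M. \<bar>D u c x\<bar> \<le> Ce * nm u * A x powr \<theta> c)"
    using emb[OF u] unfolding dom_pow_def by blast
  then obtain A where A: "\<And>c. c \<in> I \<Longrightarrow> integrable M (A c) \<and> (\<forall>x. 1 \<le> A c x) \<and> (\<integral>x. A c x \<partial>M) \<le> Le \<and>
      (AE x in M. \<bar>D u c x\<bar> \<le> Ce * nm u * A c x powr \<theta> c)"
    unfolding bchoice_iff by blast
  define W where "W x = 1 + (\<Sum>c\<in>I. A c x)" for x
  have A1: "0 \<le> A c x" if "c \<in> I" for c x using A[OF that] by (meson order_trans zero_le_one)
  have W1: "1 \<le> W x" for x using A1 by (simp add: W_def sum_nonneg)
  have AW: "A c x \<le> W x" if "c \<in> I" for c x
    using member_le_sum[of c I "\<lambda>c. A c x"] that fin A1 by (simp add: W_def add_increasing)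
  have "AE x in M. \<forall>c\<in>I. \<bar>D u c x\<bar> \<le> Ce * nm u * A c x powr \<theta> c"
    using A fin by (intro AE_finite_allI) auto
  then have "AE x in M. \<forall>c\<in>I. \<bar>D u c x\<bar> \<le> Ce * nm u * W x powr \<theta> c"
  proof eventually_elim
    case (elim x)
    have "Ce * nm u * A c x powr \<theta> c \<le> Ce * nm u * W x powr \<theta> c" if "c \<in> I" for c
      using that A1 AW th Ce u by (intro mult_left_mono powr_mono2) auto
    with elim show ?case by (meson order_trans)
  qed
  moreover have "(\<integral>x. W x \<partial>M) = \<mu> + (\<Sum>c\<in>I. \<integral>x. A c x \<partial>M)"
    unfolding W_def using A by (subst Bochner_Integration.integral_add) (auto intro!: Bochner_Integration.integral_sum)
  moreover have "(\<Sum>c\<in>I. \<integral>x. A c x \<partial>M) \<le> real (card I) * Le"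
    using A sum_mono[of I "\<lambda>c. \<integral>x. A c x \<partial>M" "\<lambda>_. Le"] by simp
  moreover have "integrable M W" unfolding W_def using A by auto
  ultimately show ?thesis using W1 by (intro exI[of _ W]) auto
qed

lemma F2_dominated:
  assumes r: "0 \<le> r"
  shows "\<exists>N L. 0 \<le> N \<and> 0 \<le> L \<and> (\<forall>u\<in>H. \<forall>h\<in>H. nm u \<le> r \<longrightarrow> nm h \<le> r \<longrightarrow>
    (\<exists>G. (\<forall>a\<in>I. \<forall>b\<in>I. dom_pow M (R a b) (G a b) N L) \<and> (\<forall>a b x. 0 \<le> G a b x) \<and>
      (AE x in M. \<forall>t. \<bar>t\<bar> \<le> 1 \<longrightarrow> (\<forall>a\<in>I. \<forall>b\<in>I. \<bar>F2 a b x (\<lambda>c. J u x c + t * J h x c)\<bar> \<le> G a b x))))"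
proof -
  define K where "K = 2 * (Ce * r)"
  have K: "0 \<le> K" using Ce r by (simp add: K_def)
  obtain C where C: "0 \<le> C" and gr: "AE x in M. \<forall>\<xi>\<in>S. (\<forall>c\<in>I. \<theta> c = 0 \<longrightarrow> \<bar>\<xi> c\<bar> \<le> K) \<longrightarrow>
      (\<forall>a\<in>I. \<forall>b\<in>I. \<bar>F2 a b x \<xi>\<bar> \<le> C * (1 + (\<Sum>c | c \<in> I \<and> 0 < \<theta> c. \<bar>\<xi> c\<bar> powr (1 / \<theta> c))) powr R a b)"
    using growth[OF K] by blast
  define K2 where "K2 = 1 + (\<Sum>c | c \<in> I \<and> 0 < \<theta> c. K powr (1 / \<theta> c))"
  have K2: "1 \<le> K2" unfolding K2_def by (simp add: sum_nonneg)
  define N where "N = C * K2"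
  have N: "0 \<le> N" using C K2 by (simp add: N_def)
  define L where "L = 2 * (\<mu> + real (card I) * Le)"
  have "\<exists>G. (\<forall>a\<in>I. \<forall>b\<in>I. dom_pow M (R a b) (G a b) N L) \<and> (\<forall>a b x. 0 \<le> G a b x) \<and>
      (AE x in M. \<forall>t. \<bar>t\<bar> \<le> 1 \<longrightarrow> (\<forall>a\<in>I. \<forall>b\<in>I. \<bar>F2 a b x (\<lambda>c. J u x c + t * J h x c)\<bar> \<le> G a b x))"
    if u: "u \<in> H" "nm u \<le> r" and h: "h \<in> H" "nm h \<le> r" for u h
  proof -
    obtain A where A: "integrable M A" "\<forall>x. 1 \<le> A x" "(\<integral>x. A x \<partial>M) \<le> \<mu> + real (card I) * Le"
      and leA: "AE x in M. \<forall>c\<in>I. \<bar>D u c x\<bar> \<le> Ce * nm u * A x powr \<theta> c" using weight[OF u(1)] by blast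
    obtain B where B: "integrable M B" "\<forall>x. 1 \<le> B x" "(\<integral>x. B x \<partial>M) \<le> \<mu> + real (card I) * Le"
      and leB: "AE x in M. \<forall>c\<in>I. \<bar>D h c x\<bar> \<le> Ce * nm h * B x powr \<theta> c" using weight[OF h(1)] by blast
    define W where "W x = A x + B x" for x
    have W1: "1 \<le> W x" and AW: "0 \<le> A x" "A x \<le> W x" and BW: "0 \<le> B x" "B x \<le> W x" for x
      using A(2)[rule_format, of x] B(2)[rule_format, of x] by (auto simp: W_def)
    have W_int: "integrable M W" "(\<integral>x. W x \<partial>M) \<le> L" unfolding W_def L_def using A B by auto
    define G where "G a b x = N * W x powr R a b" for a b x
    have "dom_pow M (R a b) (G a b) N L" for a b
    proof (rule dom_powI[where A = W])
      show "G a b \<in> borel_measurable M" unfolding G_def using W_int(1) by measurable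
    qed (use N W1 W_int in \<open>auto simp: G_def\<close>)
    moreover have "AE x in M. \<forall>t. \<bar>t\<bar> \<le> 1 \<longrightarrow> (\<forall>a\<in>I. \<forall>b\<in>I. \<bar>F2 a b x (\<lambda>c. J u x c + t * J h x c)\<bar> \<le> G a b x)"
      using gr leA leB
    proof eventually_elim
      case (elim x)
      show ?case
      proof (intro allI impI ballI)
        fix t :: real and a b assume t: "\<bar>t\<bar> \<le> 1" and ab: "a \<in> I" "b \<in> I"
        let ?\<xi> = "\<lambda>c. J u x c + t * J h x c"
        have \<xi>: "\<bar>?\<xi> c\<bar> \<le> K * W x powr \<theta> c" if c: "c \<in> I" for c
        proof -
          have "\<bar>D u c x\<bar> \<le> Ce * nm u * A x powr \<theta> c" using elim(2) c by blast
          also have "\<dots> \<le> (Ce * r) * W x powr \<theta> c"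
            using u Ce r th(1)[OF c] AW by (intro mult_mono powr_mono2) auto
          finally have 1: "\<bar>D u c x\<bar> \<le> (Ce * r) * W x powr \<theta> c" .
          have "\<bar>D h c x\<bar> \<le> Ce * nm h * B x powr \<theta> c" using elim(3) c by blast
          also have "\<dots> \<le> (Ce * r) * W x powr \<theta> c"
            using h Ce r th(1)[OF c] BW by (intro mult_mono powr_mono2) auto
          finally have 2: "\<bar>D h c x\<bar> \<le> (Ce * r) * W x powr \<theta> c" .
          have "\<bar>t * D h c x\<bar> \<le> \<bar>D h c x\<bar>" using t by (simp add: abs_mult mult_left_le_one_le)
          then have "\<bar>D u c x + t * D h c x\<bar> \<le> \<bar>D u c x\<bar> + \<bar>D h c x\<bar>" by linarith
          then show ?thesis using 1 2 c by (simp add: K_def)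
        qed
        have "\<bar>?\<xi> c\<bar> \<le> K" if "c \<in> I" "\<theta> c = 0" for c
          using \<xi>[OF that(1)] that(2) W1[of x] by simp
        then have "\<forall>c\<in>I. \<theta> c = 0 \<longrightarrow> \<bar>?\<xi> c\<bar> \<le> K" by blast
        then have "\<bar>F2 a b x ?\<xi>\<bar> \<le> C * (1 + (\<Sum>c | c \<in> I \<and> 0 < \<theta> c. \<bar>?\<xi> c\<bar> powr (1 / \<theta> c))) powr R a b"
          by (rule elim(1)[THEN bspec, THEN mp, THEN bspec, THEN bspec, OF line_in_S[OF J_in_S J_in_S] _ ab])
        also have "\<dots> \<le> C * (K2 * W x) powr R a b"
        proof (rule mult_left_mono[OF powr_mono2 C])
          show "0 \<le> 1 + (\<Sum>c | c \<in> I \<and> 0 < \<theta> c. \<bar>?\<xi> c\<bar> powr (1 / \<theta> c))"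
            by (intro add_nonneg_nonneg sum_nonneg) auto
          show "0 \<le> R a b" using R ab by blast
        next
          have "\<bar>?\<xi> c\<bar> powr (1 / \<theta> c) \<le> K powr (1 / \<theta> c) * W x" if "c \<in> I" "0 < \<theta> c" for c
          proof -
            have "\<bar>?\<xi> c\<bar> powr (1 / \<theta> c) \<le> (K * W x powr \<theta> c) powr (1 / \<theta> c)"
              using \<xi>[OF that(1)] that by (intro powr_mono2) auto
            also have "\<dots> = K powr (1 / \<theta> c) * W x"
              using K W1[of x] that by (simp add: powr_mult powr_powr)
            finally show ?thesis .
          qed
          then have "(\<Sum>c | c \<in> I \<and> 0 < \<theta> c. \<bar>?\<xi> c\<bar> powr (1 / \<theta> c))
              \<le> (\<Sum>c | c \<in> I \<and> 0 < \<theta> c. K powr (1 / \<theta> c) * W x)"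
            by (intro sum_mono) auto
          then show "1 + (\<Sum>c | c \<in> I \<and> 0 < \<theta> c. \<bar>?\<xi> c\<bar> powr (1 / \<theta> c)) \<le> K2 * W x"
            using W1[of x] by (simp add: K2_def distrib_right sum_distrib_right)
        qed
        also have "\<dots> = C * (K2 powr R a b * W x powr R a b)"
          using K2 W1[of x] by (simp add: powr_mult)
        also have "\<dots> \<le> C * (K2 powr 1 * W x powr R a b)"
          using C K2 R(2)[OF ab] th(1)[OF ab(1)] th(1)[OF ab(2)]
          by (intro mult_left_mono mult_right_mono powr_mono) auto
        finally show "\<bar>F2 a b x ?\<xi>\<bar> \<le> G a b x" using K2 by (simp add: G_def N_def)
      qed
    qed
    moreover have "0 \<le> G a b x" for a b x using N by (simp add: G_def)
    ultimately show ?thesis by (intro exI[of _ G]) auto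
  qed
  moreover have "0 \<le> L"
  proof -
    obtain W where W: "\<forall>x. 1 \<le> W x" "(\<integral>x. W x \<partial>M) \<le> \<mu> + real (card I) * Le"
      using weight[OF H_zero] by blast
    have "0 \<le> W x" for x using W(1)[rule_format, of x] by simp
    then have "0 \<le> (\<integral>x. W x \<partial>M)" by simp
    then show ?thesis using W(2) by (simp add: L_def)
  qed
  ultimately show ?thesis using N by (intro exI[of _ N] exI[of _ L]) auto
qed

lemma deriv_line:
  assumes "\<And>\<xi> \<eta>. \<xi> \<in> S \<Longrightarrow> \<eta> \<in> S \<Longrightarrow> ((\<lambda>t. f (\<lambda>c. \<xi> c + t * \<eta> c)) has_real_derivative g \<xi> \<eta>) (at 0)"
    and S: "\<xi> \<in> S" "\<eta> \<in> S"
  shows "((\<lambda>t. f (\<lambda>c. \<xi> c + t * \<eta> c)) has_real_derivative g (\<lambda>c. \<xi> c + s * \<eta> c) \<eta>) (at s)"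
proof -
  have "((\<lambda>t. f (\<lambda>c. (\<xi> c + s * \<eta> c) + t * \<eta> c)) has_real_derivative g (\<lambda>c. \<xi> c + s * \<eta> c) \<eta>) (at 0)"
    using S by (intro assms(1)) auto
  moreover have "(\<lambda>t. f (\<lambda>c. (\<xi> c + s * \<eta> c) + t * \<eta> c)) = (\<lambda>t. (\<lambda>t. f (\<lambda>c. \<xi> c + t * \<eta> c)) (t + s))"
    by (simp add: algebra_simps)
  ultimately show ?thesis
    using DERIV_shift[of "\<lambda>t. f (\<lambda>c. \<xi> c + t * \<eta> c)" "g (\<lambda>c. \<xi> c + s * \<eta> c) \<eta>" 0 s] by simp
qed

lemma pointwise_bounds:
  assumes u: "u \<in> H" and h: "h \<in> H" and G0: "\<And>a b x. 0 \<le> G a b x"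
    and G: "AE x in M. \<forall>t. \<bar>t\<bar> \<le> 1 \<longrightarrow> (\<forall>a\<in>I. \<forall>b\<in>I. \<bar>F2 a b x (\<lambda>c. J u x c + t * J h x c)\<bar> \<le> G a b x)"
  shows "AE x in M. \<forall>a\<in>I. \<forall>t. \<bar>t\<bar> \<le> 1 \<longrightarrow>
      \<bar>F1 a x (\<lambda>c. J u x c + t * J h x c) - F1 a x (J u x)\<bar> \<le> \<bar>t\<bar> * (\<Sum>b\<in>I. G a b x * \<bar>D h b x\<bar>)"
    and "AE x in M. \<bar>F0 x (\<lambda>c. J u x c + J h x c) - F0 x (J u x) - (\<Sum>a\<in>I. F1 a x (J u x) * D h a x)\<bar>
      \<le> (\<Sum>a\<in>I. \<Sum>b\<in>I. G a b x * \<bar>D h b x\<bar> * \<bar>D h a x\<bar>)"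
    and "AE x in M. \<forall>a\<in>I. ((\<lambda>t. F1 a x (\<lambda>c. J u x c + t * J h x c)) has_real_derivative
      (\<Sum>b\<in>I. F2 a b x (J u x) * D h b x)) (at 0)"
proof -
  show F1_bound: "AE x in M. \<forall>a\<in>I. \<forall>t. \<bar>t\<bar> \<le> 1 \<longrightarrow>
      \<bar>F1 a x (\<lambda>c. J u x c + t * J h x c) - F1 a x (J u x)\<bar> \<le> \<bar>t\<bar> * (\<Sum>b\<in>I. G a b x * \<bar>D h b x\<bar>)"
    using G deriv1
  proof eventually_elim
    case (elim x)
    show ?case
    proof (intro ballI allI impI)
      fix a and t :: real assume a: "a \<in> I" and t: "\<bar>t\<bar> \<le> 1"
      let ?f = "\<lambda>t. F1 a x (\<lambda>c. J u x c + t * J h x c)"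
      let ?B = "\<Sum>b\<in>I. G a b x * \<bar>D h b x\<bar>"
      have "norm (?f t - ?f 0) \<le> ?B * norm (t - 0)"
      proof (rule field_differentiable_bound[of "{-1..1}"])
        fix s :: real assume s: "s \<in> {-1..1}"
        have "(?f has_real_derivative (\<Sum>b\<in>I. F2 a b x (\<lambda>c. J u x c + s * J h x c) * J h x b)) (at s)"
          by (rule deriv_line[where f = "F1 a x" and g = "\<lambda>\<xi> \<eta>. \<Sum>b\<in>I. F2 a b x \<xi> * \<eta> b"])
            (use elim(2) a in simp_all)
        then show "(?f has_field_derivative (\<Sum>b\<in>I. F2 a b x (\<lambda>c. J u x c + s * J h x c) * J h x b)) (at s within {-1..1})"
          by (rule has_field_derivative_at_within)
        have "norm (\<Sum>b\<in>I. F2 a b x (\<lambda>c. J u x c + s * J h x c) * J h x b)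
            \<le> (\<Sum>b\<in>I. \<bar>F2 a b x (\<lambda>c. J u x c + s * J h x c) * J h x b\<bar>)"
          unfolding real_norm_def by (rule sum_abs)
        also have "\<dots> \<le> ?B"
          using elim(1) s a by (intro sum_mono) (auto simp: abs_mult intro!: mult_right_mono)
        finally show "norm (\<Sum>b\<in>I. F2 a b x (\<lambda>c. J u x c + s * J h x c) * J h x b) \<le> ?B" .
      qed (use t in auto)
      then show "\<bar>F1 a x (\<lambda>c. J u x c + t * J h x c) - F1 a x (J u x)\<bar> \<le> \<bar>t\<bar> * ?B"
        by (simp add: mult.commute)
    qed
  qed
  show "AE x in M. \<bar>F0 x (\<lambda>c. J u x c + J h x c) - F0 x (J u x) - (\<Sum>a\<in>I. F1 a x (J u x) * D h a x)\<bar>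
      \<le> (\<Sum>a\<in>I. \<Sum>b\<in>I. G a b x * \<bar>D h b x\<bar> * \<bar>D h a x\<bar>)"
    using F1_bound deriv0
  proof eventually_elim
    case (elim x)
    let ?f = "\<lambda>t. F0 x (\<lambda>c. J u x c + t * J h x c) - t * (\<Sum>a\<in>I. F1 a x (J u x) * D h a x)"
    let ?B = "\<Sum>a\<in>I. \<Sum>b\<in>I. G a b x * \<bar>D h b x\<bar> * \<bar>D h a x\<bar>"
    have "norm (?f 1 - ?f 0) \<le> ?B * norm (1 - 0 :: real)"
    proof (rule field_differentiable_bound[of "{0..1}"])
      fix s :: real assume s: "s \<in> {0..1}"
      let ?d = "(\<Sum>a\<in>I. F1 a x (\<lambda>c. J u x c + s * J h x c) * J h x a) - (\<Sum>a\<in>I. F1 a x (J u x) * D h a x)"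
      have "((\<lambda>t. F0 x (\<lambda>c. J u x c + t * J h x c)) has_real_derivative
          (\<Sum>a\<in>I. F1 a x (\<lambda>c. J u x c + s * J h x c) * J h x a)) (at s)"
        by (rule deriv_line[where f = "F0 x" and g = "\<lambda>\<xi> \<eta>. \<Sum>a\<in>I. F1 a x \<xi> * \<eta> a"])
          (use elim(2) in simp_all)
      then have "(?f has_real_derivative ?d) (at s)"
        by (auto intro!: derivative_eq_intros)
      then show "(?f has_field_derivative ?d) (at s within {0..1})"
        by (rule has_field_derivative_at_within)
      have "?d = (\<Sum>a\<in>I. (F1 a x (\<lambda>c. J u x c + s * J h x c) - F1 a x (J u x)) * D h a x)"
        by (simp add: sum_subtractf left_diff_distrib)
      also have "norm \<dots> \<le> (\<Sum>a\<in>I. \<bar>(F1 a x (\<lambda>c. J u x c + s * J h x c) - F1 a x (J u x)) * D h a x\<bar>)"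
        unfolding real_norm_def by (rule sum_abs)
      also have "\<dots> \<le> ?B"
      proof (rule sum_mono)
        fix a assume a: "a \<in> I"
        have "\<bar>F1 a x (\<lambda>c. J u x c + s * J h x c) - F1 a x (J u x)\<bar> \<le> \<bar>s\<bar> * (\<Sum>b\<in>I. G a b x * \<bar>D h b x\<bar>)"
          using elim(1)[rule_format, OF a, of s] s by simp
        also have "\<dots> \<le> 1 * (\<Sum>b\<in>I. G a b x * \<bar>D h b x\<bar>)"
          using s G0 by (intro mult_right_mono sum_nonneg) auto
        finally have "\<bar>F1 a x (\<lambda>c. J u x c + s * J h x c) - F1 a x (J u x)\<bar> * \<bar>D h a x\<bar>
            \<le> (\<Sum>b\<in>I. G a b x * \<bar>D h b x\<bar>) * \<bar>D h a x\<bar>"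
          by (intro mult_right_mono) auto
        then show "\<bar>(F1 a x (\<lambda>c. J u x c + s * J h x c) - F1 a x (J u x)) * D h a x\<bar>
            \<le> (\<Sum>b\<in>I. G a b x * \<bar>D h b x\<bar> * \<bar>D h a x\<bar>)"
          by (simp add: abs_mult sum_distrib_right)
      qed
      finally show "norm ?d \<le> ?B" .
    qed auto
    then show ?case by simp
  qed
  show "AE x in M. \<forall>a\<in>I. ((\<lambda>t. F1 a x (\<lambda>c. J u x c + t * J h x c)) has_real_derivative
      (\<Sum>b\<in>I. F2 a b x (J u x) * D h b x)) (at 0)"
    using deriv1
  proof eventually_elim
    case (elim x)
    show ?case
    proof
      fix a assume "a \<in> I"
      then have "((\<lambda>t. F1 a x (\<lambda>c. J u x c + t * J h x c)) has_real_derivative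
        (\<Sum>b\<in>I. F2 a b x (J u x) * J h x b)) (at 0)" by (rule elim[rule_format, OF J_in_S J_in_S])
      then show "((\<lambda>t. F1 a x (\<lambda>c. J u x c + t * J h x c)) has_real_derivative
        (\<Sum>b\<in>I. F2 a b x (J u x) * D h b x)) (at 0)" by simp
    qed
  qed
qed


lemma integral_triple_sum:
  assumes G: "\<And>a b. a \<in> I \<Longrightarrow> b \<in> I \<Longrightarrow> dom_pow M (R a b) (G a b) N L" and h: "h \<in> H" and w: "w \<in> H"
  shows "integrable M (\<lambda>x. \<Sum>a\<in>I. \<Sum>b\<in>I. \<bar>G a b x\<bar> * \<bar>D h b x\<bar> * \<bar>D w a x\<bar>)"
    and "(\<integral>x. (\<Sum>a\<in>I. \<Sum>b\<in>I. \<bar>G a b x\<bar> * \<bar>D h b x\<bar> * \<bar>D w a x\<bar>) \<partial>M)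
      \<le> (real (card I))\<^sup>2 * (N * Ce\<^sup>2 * (L + Le + Le)) * nm h * nm w"
proof -
  have *: "integrable M (\<lambda>x. \<bar>G a b x\<bar> * \<bar>D h b x\<bar> * \<bar>D w a x\<bar>)"
    "\<bar>\<integral>x. \<bar>G a b x\<bar> * \<bar>D h b x\<bar> * \<bar>D w a x\<bar> \<partial>M\<bar> \<le> N * (Ce * nm h) * (Ce * nm w) * (L + Le + Le)"
    if a: "a \<in> I" and b: "b \<in> I" for a b
    using dom_pow_mult3[OF finM dom_pow_abs[OF G[OF a b]] dom_pow_abs[OF emb[OF h b]] dom_pow_abs[OF emb[OF w a]]
      R(1)[OF a b] th(1)[OF b] th(1)[OF a]] R(2)[OF a b] by auto
  show "integrable M (\<lambda>x. \<Sum>a\<in>I. \<Sum>b\<in>I. \<bar>G a b x\<bar> * \<bar>D h b x\<bar> * \<bar>D w a x\<bar>)"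
    using * by (intro Bochner_Integration.integrable_sum) auto
  have "(\<integral>x. (\<Sum>a\<in>I. \<Sum>b\<in>I. \<bar>G a b x\<bar> * \<bar>D h b x\<bar> * \<bar>D w a x\<bar>) \<partial>M)
      = (\<Sum>a\<in>I. \<Sum>b\<in>I. \<integral>x. \<bar>G a b x\<bar> * \<bar>D h b x\<bar> * \<bar>D w a x\<bar> \<partial>M)"
    using * by (simp add: Bochner_Integration.integral_sum)
  also have "\<dots> \<le> (\<Sum>a\<in>I. \<Sum>b\<in>I. N * (Ce * nm h) * (Ce * nm w) * (L + Le + Le))"
    using *(2) by (intro sum_mono) (auto simp: abs_le_iff)
  finally show "(\<integral>x. (\<Sum>a\<in>I. \<Sum>b\<in>I. \<bar>G a b x\<bar> * \<bar>D h b x\<bar> * \<bar>D w a x\<bar>) \<partial>M)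
      \<le> (real (card I))\<^sup>2 * (N * Ce\<^sup>2 * (L + Le + Le)) * nm h * nm w"
    by (simp add: power2_eq_square algebra_simps)
qed

lemma F1_remainder_dom:
  assumes G: "\<And>b. b \<in> I \<Longrightarrow> dom_pow M (R a b) (G a b) N L" and a: "a \<in> I" and h: "h \<in> H" and N: "0 \<le> N"
  shows "dom_pow M (1 - \<theta> a) (\<lambda>x. \<Sum>b\<in>I. G a b x * \<bar>D h b x\<bar>)
    (real (card I) * (N * (Ce * nm h))) (\<mu> + real (card I) * (L + Le))"
proof (rule dom_pow_sum[OF fin])
  fix b assume b: "b \<in> I"
  have "dom_pow M (R a b + \<theta> b) (\<lambda>x. G a b x * \<bar>D h b x\<bar>) (N * (Ce * nm h)) (L + Le)"
    using R(1)[OF a b] th(1)[OF b] by (intro dom_pow_mult G dom_pow_abs emb h b)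
  then show "dom_pow M (1 - \<theta> a) (\<lambda>x. G a b x * \<bar>D h b x\<bar>) (N * (Ce * nm h)) (L + Le)"
    by (rule dom_pow_exponent_mono) (use R(2)[OF a b] in simp)
qed (use th(2)[OF a] N Ce h in auto)

lemma F1_dom_at:
  assumes u: "u \<in> H" and a: "a \<in> I"
  shows "\<exists>c L. dom_pow M (1 - \<theta> a) (\<lambda>x. F1 a x (J u x)) c L"
proof -
  obtain N L where N: "0 \<le> N" and L: "\<forall>v\<in>H. \<forall>h\<in>H. nm v \<le> nm u \<longrightarrow> nm h \<le> nm u \<longrightarrow>
    (\<exists>G. (\<forall>a\<in>I. \<forall>b\<in>I. dom_pow M (R a b) (G a b) N L) \<and> (\<forall>a b x. 0 \<le> G a b x) \<and>
      (AE x in M. \<forall>t. \<bar>t\<bar> \<le> 1 \<longrightarrow> (\<forall>a\<in>I. \<forall>b\<in>I. \<bar>F2 a b x (\<lambda>c. J v x c + t * J h x c)\<bar> \<le> G a b x)))"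
    using F2_dominated[OF nm_nonneg[OF u]] by blast
  obtain G where G: "\<And>a b. a \<in> I \<Longrightarrow> b \<in> I \<Longrightarrow> dom_pow M (R a b) (G a b) N L" "\<And>a b x. 0 \<le> G a b x"
    and Gle: "AE x in M. \<forall>t. \<bar>t\<bar> \<le> 1 \<longrightarrow> (\<forall>a\<in>I. \<forall>b\<in>I. \<bar>F2 a b x (\<lambda>c. J 0 x c + t * J u x c)\<bar> \<le> G a b x)"
    using L[rule_format, OF H_zero u] nm_nonneg[OF u] by auto
  obtain c L' where F: "dom_pow M (1 - \<theta> a) (\<lambda>x. F1 a x (\<lambda>_. 0)) c L'" using F1_dom[OF a] by blast
  note pw = pointwise_bounds(1)[OF H_zero u G(2) Gle]
  have "AE x in M. \<bar>F1 a x (J u x)\<bar> \<le> \<bar>\<bar>F1 a x (\<lambda>_. 0)\<bar> + (\<Sum>b\<in>I. G a b x * \<bar>D u b x\<bar>)\<bar>"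
    using pw J_zero
  proof eventually_elim
    case (elim x)
    have "\<bar>F1 a x (J u x) - F1 a x (\<lambda>_. 0)\<bar> \<le> (\<Sum>b\<in>I. G a b x * \<bar>D u b x\<bar>)"
      using elim(1)[rule_format, OF a, of 1] elim(2) by simp
    then show ?case by linarith
  qed
  then have "dom_pow M (1 - \<theta> a) (\<lambda>x. F1 a x (J u x)) (c + real (card I) * (N * (Ce * nm u)))
      (L' + (\<mu> + real (card I) * (L + Le)))"
    using th(2)[OF a]
    by (intro dom_pow_bound[OF dom_pow_add[OF dom_pow_abs[OF F] F1_remainder_dom[where G = G, OF G(1)[OF a] a u N]] F1_meas[OF u a]]) auto
  then show ?thesis by blast
qed

definition dL :: "'a \<Rightarrow> 'a \<Rightarrow> real" where
  "dL u h = (\<Sum>a\<in>I. \<integral>x. F1 a x (J u x) * D h a x \<partial>M)"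

lemma F1_D_integrable:
  assumes u: "u \<in> H" and h: "h \<in> H" and a: "a \<in> I"
  shows "integrable M (\<lambda>x. F1 a x (J u x) * D h a x)"
proof -
  obtain c L where "dom_pow M (1 - \<theta> a) (\<lambda>x. F1 a x (J u x)) c L" using F1_dom_at[OF u a] by blast
  from dom_pow_mult2(1)[OF finM this emb[OF h a]] show ?thesis using th(1)[OF a] th(2)[OF a] by auto
qed

lemma linear_integral:
  assumes "\<And>h. h \<in> H \<Longrightarrow> integrable M (\<lambda>x. g x * D h a x)" and a: "a \<in> I"
  shows "linear_to_reals H (\<lambda>h. \<integral>x. g x * D h a x \<partial>M)"
  unfolding linear_to_reals_def
proof (intro conjI ballI allI)
  fix u v assume u: "u \<in> H" and v: "v \<in> H"
  have "(\<integral>x. g x * D (u + v) a x \<partial>M) = (\<integral>x. g x * D u a x + g x * D v a x \<partial>M)"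
    using D_add[OF u v a] u v
    by (intro integral_cong_AE borel_measurable_integrable Bochner_Integration.integrable_add assms(1))
      (auto simp: distrib_left elim!: eventually_mono)
  then show "(\<integral>x. g x * D (u + v) a x \<partial>M) = (\<integral>x. g x * D u a x \<partial>M) + (\<integral>x. g x * D v a x \<partial>M)"
    using assms(1)[OF u] assms(1)[OF v] by simp
next
  fix c u assume u: "u \<in> H"
  have "(\<integral>x. g x * D (c *\<^sub>R u) a x \<partial>M) = (\<integral>x. c * (g x * D u a x) \<partial>M)"
    using D_scale[OF u a, of c] u
    by (intro integral_cong_AE borel_measurable_integrable Bochner_Integration.integrable_mult_right assms(1))
      (auto elim!: eventually_mono)
  then show "(\<integral>x. g x * D (c *\<^sub>R u) a x \<partial>M) = c * (\<integral>x. g x * D u a x \<partial>M)" by simp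
qed

lemma linear_sum:
  "(\<And>a. a \<in> A \<Longrightarrow> linear_to_reals H (f a)) \<Longrightarrow> linear_to_reals H (\<lambda>h. \<Sum>a\<in>A. f a h)"
  by (simp add: linear_to_reals_def sum.distrib sum_distrib_left)

lemma dL_linear:
  assumes u: "u \<in> H" shows "linear_to_reals H (dL u)"
  unfolding dL_def[abs_def] by (intro linear_sum linear_integral F1_D_integrable u)

lemma dL_bounded:
  assumes u: "u \<in> H" shows "\<exists>C. \<forall>h\<in>H. \<bar>dL u h\<bar> \<le> C * nm h"
proof -
  have "\<forall>a\<in>I. \<exists>C. \<forall>h\<in>H. \<bar>\<integral>x. F1 a x (J u x) * D h a x \<partial>M\<bar> \<le> C * nm h"
  proof
    fix a assume a: "a \<in> I"
    obtain c L where F: "dom_pow M (1 - \<theta> a) (\<lambda>x. F1 a x (J u x)) c L" using F1_dom_at[OF u a] by blast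
    have "\<bar>\<integral>x. F1 a x (J u x) * D h a x \<partial>M\<bar> \<le> (c * Ce * (L + Le)) * nm h" if h: "h \<in> H" for h
      using dom_pow_mult2(2)[OF finM F emb[OF h a]] th(1)[OF a] th(2)[OF a] by (simp add: algebra_simps)
    then show "\<exists>C. \<forall>h\<in>H. \<bar>\<integral>x. F1 a x (J u x) * D h a x \<partial>M\<bar> \<le> C * nm h" by blast
  qed
  then obtain C where C: "\<And>a h. a \<in> I \<Longrightarrow> h \<in> H \<Longrightarrow> \<bar>\<integral>x. F1 a x (J u x) * D h a x \<partial>M\<bar> \<le> C a * nm h"
    unfolding bchoice_iff by blast
  have "\<bar>dL u h\<bar> \<le> (\<Sum>a\<in>I. C a) * nm h" if h: "h \<in> H" for h
    unfolding dL_def sum_distrib_right using C h by (intro order_trans[OF sum_abs] sum_mono) auto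
  then show ?thesis by blast
qed

lemma second_order_bounds:
  assumes r: "0 \<le> r"
  shows "\<exists>K\<ge>0. \<forall>u\<in>H. \<forall>h\<in>H. nm u \<le> r \<longrightarrow> nm h \<le> r \<longrightarrow>
    integrable M (\<lambda>x. F0 x (J (u + h) x) - F0 x (J u x)) \<and>
    \<bar>(\<integral>x. F0 x (J (u + h) x) - F0 x (J u x) \<partial>M) - dL u h\<bar> \<le> K * nm h * nm h \<and>
    (\<forall>w\<in>H. \<bar>dL (u + h) w - dL u w\<bar> \<le> K * nm h * nm w)"
proof -
  obtain N L where N: "0 \<le> N" and L0: "0 \<le> L" and L: "\<forall>u\<in>H. \<forall>h\<in>H. nm u \<le> r \<longrightarrow> nm h \<le> r \<longrightarrow>
    (\<exists>G. (\<forall>a\<in>I. \<forall>b\<in>I. dom_pow M (R a b) (G a b) N L) \<and> (\<forall>a b x. 0 \<le> G a b x) \<and>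
      (AE x in M. \<forall>t. \<bar>t\<bar> \<le> 1 \<longrightarrow> (\<forall>a\<in>I. \<forall>b\<in>I. \<bar>F2 a b x (\<lambda>c. J u x c + t * J h x c)\<bar> \<le> G a b x)))"
    using F2_dominated[OF r] by blast
  define K where "K = (real (card I))\<^sup>2 * (N * Ce\<^sup>2 * (L + Le + Le))"
  have K: "0 \<le> K" using N L0 Le by (simp add: K_def)
  have main: "integrable M (\<lambda>x. F0 x (J (u + h) x) - F0 x (J u x)) \<and>
    \<bar>(\<integral>x. F0 x (J (u + h) x) - F0 x (J u x) \<partial>M) - dL u h\<bar> \<le> K * nm h * nm h \<and>
    (\<forall>w\<in>H. \<bar>dL (u + h) w - dL u w\<bar> \<le> K * nm h * nm w)"
    if u: "u \<in> H" "nm u \<le> r" and h: "h \<in> H" "nm h \<le> r" for u h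
  proof -
    have uh: "u + h \<in> H" using u h by simp
    obtain G where G: "\<And>a b. a \<in> I \<Longrightarrow> b \<in> I \<Longrightarrow> dom_pow M (R a b) (G a b) N L" "\<And>a b x. 0 \<le> G a b x"
      and Gle: "AE x in M. \<forall>t. \<bar>t\<bar> \<le> 1 \<longrightarrow> (\<forall>a\<in>I. \<forall>b\<in>I. \<bar>F2 a b x (\<lambda>c. J u x c + t * J h x c)\<bar> \<le> G a b x)"
      using L[rule_format, OF u(1) h(1) u(2) h(2)] by auto
    note pw = pointwise_bounds[OF u(1) h(1) G(2) Gle]
    note triple = integral_triple_sum[OF G(1) h(1), unfolded abs_of_nonneg[OF G(2)]]
    define lin where "lin x = (\<Sum>a\<in>I. F1 a x (J u x) * D h a x)" for x
    have lin: "integrable M lin" "(\<integral>x. lin x \<partial>M) = dL u h"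
      unfolding lin_def dL_def using F1_D_integrable[OF u(1) h(1)] by (auto simp: Bochner_Integration.integral_sum)
    define rem where "rem x = F0 x (J (u + h) x) - F0 x (J u x) - lin x" for x
    have rem_le: "AE x in M. \<bar>rem x\<bar> \<le> (\<Sum>a\<in>I. \<Sum>b\<in>I. G a b x * \<bar>D h b x\<bar> * \<bar>D h a x\<bar>)"
      using pw(2) J_add[OF u(1) h(1)] unfolding rem_def lin_def by eventually_elim simp
    have "rem \<in> borel_measurable M"
      unfolding rem_def using F0_meas[OF uh] F0_meas[OF u(1)] lin(1) by measurable
    then have rem: "integrable M rem"
      using rem_le by (intro Bochner_Integration.integrable_bound[OF triple(1)[OF _ _ h(1)]])
        (auto elim!: eventually_mono)
    have "\<bar>\<integral>x. rem x \<partial>M\<bar> \<le> (\<integral>x. \<bar>rem x\<bar> \<partial>M)" by (rule integral_abs_bound)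
    also have "\<dots> \<le> (\<integral>x. (\<Sum>a\<in>I. \<Sum>b\<in>I. G a b x * \<bar>D h b x\<bar> * \<bar>D h a x\<bar>) \<partial>M)"
      using rem triple(1)[OF _ _ h(1)] rem_le by (intro integral_mono_AE) auto
    also have "\<dots> \<le> K * nm h * nm h" unfolding K_def by (rule triple(2)[OF _ _ h(1)])
    finally have rem_bound: "\<bar>\<integral>x. rem x \<partial>M\<bar> \<le> K * nm h * nm h" .
    have diff_eq: "F0 x (J (u + h) x) - F0 x (J u x) = rem x + lin x" for x by (simp add: rem_def)
    have "\<bar>dL (u + h) w - dL u w\<bar> \<le> K * nm h * nm w" if w: "w \<in> H" for w
    proof -
      define d where "d x = (\<Sum>a\<in>I. F1 a x (J (u + h) x) * D w a x - F1 a x (J u x) * D w a x)" for x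
      have d: "integrable M d" "(\<integral>x. d x \<partial>M) = dL (u + h) w - dL u w"
        unfolding d_def dL_def using F1_D_integrable[OF u(1) w] F1_D_integrable[OF uh w]
        by (auto simp: Bochner_Integration.integral_sum sum_subtractf)
      have d_le: "AE x in M. \<bar>d x\<bar> \<le> (\<Sum>a\<in>I. \<Sum>b\<in>I. G a b x * \<bar>D h b x\<bar> * \<bar>D w a x\<bar>)"
        using pw(1) J_add[OF u(1) h(1)]
      proof eventually_elim
        case (elim x)
        show ?case unfolding d_def
        proof (intro order_trans[OF sum_abs] sum_mono)
          fix a assume a: "a \<in> I"
          have "\<bar>F1 a x (J (u + h) x) - F1 a x (J u x)\<bar> \<le> (\<Sum>b\<in>I. G a b x * \<bar>D h b x\<bar>)"
            using elim(1)[rule_format, OF a, of 1] elim(2) by simp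
          then have "\<bar>F1 a x (J (u + h) x) - F1 a x (J u x)\<bar> * \<bar>D w a x\<bar> \<le> (\<Sum>b\<in>I. G a b x * \<bar>D h b x\<bar>) * \<bar>D w a x\<bar>"
            by (rule mult_right_mono) simp
          then show "\<bar>F1 a x (J (u + h) x) * D w a x - F1 a x (J u x) * D w a x\<bar>
              \<le> (\<Sum>b\<in>I. G a b x * \<bar>D h b x\<bar> * \<bar>D w a x\<bar>)"
            by (simp add: left_diff_distrib[symmetric] abs_mult sum_distrib_right)
        qed
      qed
      have "\<bar>\<integral>x. d x \<partial>M\<bar> \<le> (\<integral>x. \<bar>d x\<bar> \<partial>M)" by (rule integral_abs_bound)
      also have "\<dots> \<le> (\<integral>x. (\<Sum>a\<in>I. \<Sum>b\<in>I. G a b x * \<bar>D h b x\<bar> * \<bar>D w a x\<bar>) \<partial>M)"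
        using d(1) triple(1)[OF _ _ w] d_le by (intro integral_mono_AE) auto
      also have "\<dots> \<le> K * nm h * nm w" unfolding K_def by (rule triple(2)[OF _ _ w])
      finally show ?thesis by (simp add: d(2))
    qed
    then show ?thesis
      unfolding diff_eq using rem lin rem_bound by simp
  qed
  then show ?thesis using K by blast
qed

definition func :: "'a \<Rightarrow> real" where
  "func u = (\<integral>x. F0 x (J u x) \<partial>M)"

lemma F0_integrable:
  assumes u: "u \<in> H" shows "integrable M (\<lambda>x. F0 x (J u x))"
proof -
  have int: "integrable M (\<lambda>x. F0 x (J (0 + u) x) - F0 x (J 0 x))"
  proof -
    obtain K where bd: "\<forall>v\<in>H. \<forall>h\<in>H. nm v \<le> nm u \<longrightarrow> nm h \<le> nm u \<longrightarrow>
        integrable M (\<lambda>x. F0 x (J (v + h) x) - F0 x (J v x))"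
      using second_order_bounds[OF nm_nonneg[OF u]] by blast
    show ?thesis using bd[rule_format, OF H_zero u] nm_nonneg[OF u] by simp
  qed
  have "integrable M (\<lambda>x. F0 x (J 0 x)) \<longleftrightarrow> integrable M (\<lambda>x. F0 x (\<lambda>_. 0))"
    using J_zero F0_meas[OF H_zero] F0_int by (intro integrable_cong_AE) (auto elim!: eventually_mono)
  then have "integrable M (\<lambda>x. (F0 x (J (0 + u) x) - F0 x (J 0 x)) + F0 x (J 0 x))"
    using int F0_int by (intro Bochner_Integration.integrable_add) auto
  then show ?thesis by simp
qed

lemma func_frechet:
  assumes u: "u \<in> H" shows "has_frechet_deriv H ip func u (dL u)"
proof -
  have "0 \<le> nm u + 1" using u by (simp add: add_nonneg_nonneg)
  from second_order_bounds[OF this] obtain K where K: "0 \<le> K"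
    and bd: "\<forall>v\<in>H. \<forall>h\<in>H. nm v \<le> nm u + 1 \<longrightarrow> nm h \<le> nm u + 1 \<longrightarrow>
      integrable M (\<lambda>x. F0 x (J (v + h) x) - F0 x (J v x)) \<and>
      \<bar>(\<integral>x. F0 x (J (v + h) x) - F0 x (J v x) \<partial>M) - dL v h\<bar> \<le> K * nm h * nm h \<and>
      (\<forall>w\<in>H. \<bar>dL (v + h) w - dL v w\<bar> \<le> K * nm h * nm w)" by blast
  have main: "\<bar>func (u + h) - func u - dL u h\<bar> \<le> K * nm h * nm h" if h: "h \<in> H" "nm h \<le> 1" for h
  proof -
    have "nm h \<le> nm u + 1" using h(2) nm_nonneg[OF u] by linarith
    then have "\<bar>(\<integral>x. F0 x (J (u + h) x) - F0 x (J u x) \<partial>M) - dL u h\<bar> \<le> K * nm h * nm h"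
      using bd[rule_format, OF u h(1)] by simp
    then show ?thesis
      using F0_integrable[OF u] F0_integrable[of "u + h"] u h by (simp add: func_def)
  qed
  have "\<exists>d>0. \<forall>h\<in>H. nm h < d \<longrightarrow> \<bar>func (u + h) - func u - dL u h\<bar> \<le> e * nm h" if e: "e > 0" for e
  proof (intro exI[of _ "min 1 (e / (K + 1))"] conjI ballI impI)
    show "0 < min 1 (e / (K + 1))" using e K by simp
    fix h assume h: "h \<in> H" "nm h < min 1 (e / (K + 1))"
    then have "(K + 1) * nm h \<le> e" using K by (simp add: field_simps)
    then have "K * nm h \<le> e" using nm_nonneg[OF h(1)] by (simp add: distrib_right)
    then have "K * nm h * nm h \<le> e * nm h" by (rule mult_right_mono) (use h in simp)
    then show "\<bar>func (u + h) - func u - dL u h\<bar> \<le> e * nm h" using main[of h] h by simp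
  qed
  then show ?thesis
    unfolding has_frechet_deriv_def using dL_linear[OF u] dL_bounded[OF u] by auto
qed

lemma func_C1: "C1_with_deriv H ip H func dL"
  unfolding C1_with_deriv_def
proof (intro conjI ballI allI impI)
  show "has_frechet_deriv H ip func u (dL u)" if "u \<in> H" for u using func_frechet[OF that] .
  fix u and e :: real assume u: "u \<in> H" and e: "0 < e"
  have "0 \<le> nm u + 1" using u by (simp add: add_nonneg_nonneg)
  from second_order_bounds[OF this] obtain K where K: "0 \<le> K"
    and bd: "\<forall>v\<in>H. \<forall>h\<in>H. nm v \<le> nm u + 1 \<longrightarrow> nm h \<le> nm u + 1 \<longrightarrow>
      (\<forall>w\<in>H. \<bar>dL (v + h) w - dL v w\<bar> \<le> K * nm h * nm w)" by blast
  show "\<exists>d>0. \<forall>v\<in>H. nm (v - u) < d \<longrightarrow> (\<forall>h\<in>H. \<bar>dL v h - dL u h\<bar> \<le> e * nm h)"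
  proof (intro exI[of _ "min 1 (e / (K + 1))"] conjI ballI impI)
    show "0 < min 1 (e / (K + 1))" using e K by simp
    fix v w assume v: "v \<in> H" "nm (v - u) < min 1 (e / (K + 1))" and w: "w \<in> H"
    have vu: "v - u \<in> H" using v u by simp
    have "(K + 1) * nm (v - u) \<le> e" using K v by (simp add: field_simps)
    then have "K * nm (v - u) \<le> e" using nm_nonneg[OF vu] by (simp add: distrib_right)
    then have "K * nm (v - u) * nm w \<le> e * nm w" by (rule mult_right_mono) (use w in simp)
    moreover have "\<bar>dL (u + (v - u)) w - dL u w\<bar> \<le> K * nm (v - u) * nm w"
      using bd[rule_format, OF u vu _ _ w] v(2) nm_nonneg[OF u] by simp
    ultimately show "\<bar>dL v w - dL u w\<bar> \<le> e * nm w" by simp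
  qed
qed

definition grad :: "'a \<Rightarrow> 'a" where
  "grad u = (SOME z. z \<in> H \<and> (\<forall>h\<in>H. dL u h = ip z h))"

lemma grad:
  assumes u: "u \<in> H"
  shows "grad u \<in> H \<and> (\<forall>h\<in>H. dL u h = ip (grad u) h)"
proof -
  obtain C where C: "\<And>h. h \<in> H \<Longrightarrow> \<bar>dL u h\<bar> \<le> C * nm h" using dL_bounded[OF u] by blast
  from someI_ex[OF riesz[OF dL_linear[OF u] C], folded grad_def] show ?thesis .
qed

lemma is_gradient: "is_gradient H ip H dL grad"
  unfolding is_gradient_def using grad by simp

end

lemma null_limit_by_bound:
  fixes f :: "nat \<Rightarrow> real"
  assumes "\<And>k. 0 \<le> f k" "0 \<le> K" "\<And>e. 0 < e \<Longrightarrow> \<forall>\<^sub>F k in sequentially. f k \<le> K * e"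
  shows "f \<longlonglongrightarrow> 0"
proof (rule tendstoI)
  fix e :: real assume e: "0 < e"
  have "0 < e / (K + 1)" using e assms(2) by simp
  from assms(3)[OF this] show "\<forall>\<^sub>F k in sequentially. dist (f k) 0 < e"
  proof eventually_elim
    case (elim k)
    have "K * (e / (K + 1)) < e" using e assms(2) by (simp add: field_simps)
    then show ?case using elim assms(1)[of k] by simp
  qed
qed

context nemytskii
begin

definition bform :: "('k \<Rightarrow> 'k \<Rightarrow> 'x \<Rightarrow> real) \<Rightarrow> 'a \<Rightarrow> 'a \<Rightarrow> real" where
  "bform c v w = (\<Sum>a\<in>I. \<Sum>b\<in>I. \<integral>x. c a b x * D v b x * D w a x \<partial>M)"

definition coef_dom :: "('k \<Rightarrow> 'k \<Rightarrow> 'x \<Rightarrow> real) \<Rightarrow> real \<Rightarrow> real \<Rightarrow> bool" where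
  "coef_dom c N L \<longleftrightarrow> (\<forall>a\<in>I. \<forall>b\<in>I. dom_pow M (1 - \<theta> a - \<theta> b) (c a b) N L)"

lemma exponent_nonneg: "a \<in> I \<Longrightarrow> b \<in> I \<Longrightarrow> 0 \<le> 1 - \<theta> a - \<theta> b"
  using th(2)[of a] th(2)[of b] by simp

lemma bform_term:
  assumes "coef_dom c N L" and v: "v \<in> H" and w: "w \<in> H" and a: "a \<in> I" and b: "b \<in> I"
  shows "integrable M (\<lambda>x. c a b x * D v b x * D w a x)"
    and "\<bar>\<integral>x. c a b x * D v b x * D w a x \<partial>M\<bar> \<le> N * Ce\<^sup>2 * (L + Le + Le) * nm v * nm w"
proof -
  have dom: "dom_pow M (1 - \<theta> a - \<theta> b) (c a b) N L" using assms by (simp add: coef_dom_def)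
  note * = dom_pow_mult3[OF finM dom emb[OF v b] emb[OF w a] exponent_nonneg[OF a b] th(1)[OF b] th(1)[OF a]]
  show "integrable M (\<lambda>x. c a b x * D v b x * D w a x)" using *(1) by simp
  show "\<bar>\<integral>x. c a b x * D v b x * D w a x \<partial>M\<bar> \<le> N * Ce\<^sup>2 * (L + Le + Le) * nm v * nm w"
    using *(3) by (simp add: power2_eq_square algebra_simps)
qed

lemma bform_le:
  assumes "\<And>a b. a \<in> I \<Longrightarrow> b \<in> I \<Longrightarrow> \<bar>\<integral>x. c a b x * D v b x * D w a x \<partial>M\<bar> \<le> E"
  shows "\<bar>bform c v w\<bar> \<le> (real (card I))\<^sup>2 * E"
proof -
  have "\<bar>bform c v w\<bar> \<le> (\<Sum>a\<in>I. \<Sum>b\<in>I. E)"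
    unfolding bform_def using assms
    by (intro order_trans[OF sum_abs] sum_mono) (auto intro!: order_trans[OF sum_abs] sum_mono)
  then show ?thesis by (simp add: power2_eq_square mult.assoc)
qed

lemma bform_bound:
  assumes "coef_dom c N L" "v \<in> H" "w \<in> H"
  shows "\<bar>bform c v w\<bar> \<le> (real (card I))\<^sup>2 * (N * Ce\<^sup>2 * (L + Le + Le)) * nm v * nm w"
  using bform_le[of c v w, OF bform_term(2)[OF assms]] by (simp add: mult.assoc)

lemma bounded_bform:
  assumes c: "coef_dom c N L"
  shows "bounded_form (bform c)"
  unfolding bounded_form_def
proof (intro conjI ballI)
  fix v assume v: "v \<in> H"
  show "linear_to_reals H (bform c v)"
    unfolding bform_def[abs_def] by (intro linear_sum linear_integral bform_term(1)[OF c v])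
next
  fix w assume w: "w \<in> H"
  have eq: "(\<lambda>x. c a b x * D v b x * D w a x) = (\<lambda>x. (c a b x * D w a x) * D v b x)" for a b v
    by (simp add: algebra_simps)
  show "linear_to_reals H (\<lambda>v. bform c v w)"
    unfolding bform_def[abs_def] eq
    by (intro linear_sum linear_integral bform_term(1)[OF c _ w, unfolded eq])
next
  show "\<exists>C. \<forall>v\<in>H. \<forall>w\<in>H. \<bar>bform c v w\<bar> \<le> C * nm v * nm w"
    using bform_bound[OF c] by blast
qed

lemma bform_sym:
  assumes c: "coef_dom c N L" and sym: "AE x in M. \<forall>a\<in>I. \<forall>b\<in>I. c a b x = c b a x"
    and v: "v \<in> H" and w: "w \<in> H"
  shows "bform c v w = bform c w v"
proof -
  have "(\<integral>x. c a b x * D v b x * D w a x \<partial>M) = (\<integral>x. c b a x * D w a x * D v b x \<partial>M)"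
    if "a \<in> I" "b \<in> I" for a b
    using that sym
    by (intro integral_cong_AE borel_measurable_integrable bform_term(1)[OF c] v w) (auto elim!: eventually_mono)
  then have "bform c v w = (\<Sum>a\<in>I. \<Sum>b\<in>I. \<integral>x. c b a x * D w a x * D v b x \<partial>M)"
    unfolding bform_def by simp
  also have "\<dots> = bform c w v" unfolding bform_def by (rule sum.swap)
  finally show ?thesis .
qed

lemma bform_add:
  assumes "coef_dom c N L" "coef_dom d N' L'" "v \<in> H" "w \<in> H"
  shows "bform (\<lambda>a b x. c a b x + d a b x) v w = bform c v w + bform d v w"
  unfolding bform_def sum.distrib[symmetric]
  using bform_term(1)[OF assms(1,3,4)] bform_term(1)[OF assms(2,3,4)]
  by (intro sum.cong refl) (simp add: distrib_right)

lemma bform_diff: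
  assumes "coef_dom c N L" "coef_dom d N' L'" "v \<in> H" "w \<in> H"
  shows "bform (\<lambda>a b x. c a b x - d a b x) v w = bform c v w - bform d v w"
  unfolding bform_def sum_subtractf[symmetric]
  using bform_term(1)[OF assms(1,3,4)] bform_term(1)[OF assms(2,3,4)]
  by (intro sum.cong refl) (simp add: left_diff_distrib)

definition cB :: "'a \<Rightarrow> 'k \<Rightarrow> 'k \<Rightarrow> 'x \<Rightarrow> real" where
  "cB u a b x = F2 a b x (J u x)"

definition cP :: "'a \<Rightarrow> 'k \<Rightarrow> 'k \<Rightarrow> 'x \<Rightarrow> real" where
  "cP u a b x = (if a \<in> Top \<and> b \<in> Top then F2 a b x (J u x) else if a = b then 1 else 0)"

definition cQ :: "'a \<Rightarrow> 'k \<Rightarrow> 'k \<Rightarrow> 'x \<Rightarrow> real" where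
  "cQ u a b x = (if a \<in> Top \<and> b \<in> Top then 0 else F2 a b x (J u x) - (if a = b then 1 else 0))"

lemma cB_eq: "cB u = (\<lambda>a b x. cP u a b x + cQ u a b x)"
  by (auto simp: cB_def cP_def cQ_def fun_eq_iff)

lemma coef_dom_uniform:
  assumes r: "0 \<le> r"
  shows "\<exists>N L. 0 \<le> N \<and> 0 \<le> L \<and> (\<forall>u\<in>H. nm u \<le> r \<longrightarrow> (\<forall>a\<in>I. \<forall>b\<in>I.
    dom_pow M (R a b) (cB u a b) N L \<and> dom_pow M (R a b) (cP u a b) N L \<and> dom_pow M (R a b) (cQ u a b) N L))"
proof -
  obtain N L where N: "0 \<le> N" "0 \<le> L" and L: "\<forall>u\<in>H. \<forall>h\<in>H. nm u \<le> r \<longrightarrow> nm h \<le> r \<longrightarrow>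
    (\<exists>G. (\<forall>a\<in>I. \<forall>b\<in>I. dom_pow M (R a b) (G a b) N L) \<and> (\<forall>a b x. 0 \<le> G a b x) \<and>
      (AE x in M. \<forall>t. \<bar>t\<bar> \<le> 1 \<longrightarrow> (\<forall>a\<in>I. \<forall>b\<in>I. \<bar>F2 a b x (\<lambda>c. J u x c + t * J h x c)\<bar> \<le> G a b x)))"
    using F2_dominated[OF r] by blast
  have "dom_pow M (R a b) (cB u a b) (N + 1) (L + \<mu>) \<and> dom_pow M (R a b) (cP u a b) (N + 1) (L + \<mu>) \<and>
      dom_pow M (R a b) (cQ u a b) (N + 1) (L + \<mu>)"
    if u: "u \<in> H" "nm u \<le> r" and a: "a \<in> I" and b: "b \<in> I" for u a b
  proof -
    obtain G where G: "\<forall>a\<in>I. \<forall>b\<in>I. dom_pow M (R a b) (G a b) N L"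
      and Gle: "AE x in M. \<forall>t. \<bar>t\<bar> \<le> 1 \<longrightarrow> (\<forall>a\<in>I. \<forall>b\<in>I. \<bar>F2 a b x (\<lambda>c. J u x c + t * J 0 x c)\<bar> \<le> G a b x)"
      using L[rule_format, OF u(1) H_zero u(2)] r by auto
    have "AE x in M. \<bar>F2 a b x (J u x)\<bar> \<le> \<bar>G a b x\<bar>"
      using Gle
    proof eventually_elim
      case (elim x)
      have "\<bar>F2 a b x (J u x)\<bar> \<le> G a b x" using elim[rule_format, OF _ a b, of 0] by simp
      then show ?case by linarith
    qed
    then have F2: "dom_pow M (R a b) (\<lambda>x. F2 a b x (J u x)) N L"
      by (rule dom_pow_bound[OF G[rule_format, OF a b] F2_meas[OF u(1) a b]])
    then have 1: "dom_pow M (R a b) (\<lambda>x. F2 a b x (J u x)) (N + 1) (L + \<mu>)"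
      by (rule dom_pow_mono) auto
    have c: "dom_pow M (R a b) (\<lambda>_. s) (N + 1) (L + \<mu>)" if "\<bar>s\<bar> \<le> 1" for s :: real
      by (rule dom_pow_mono[OF dom_pow_const[OF R(1)[OF a b], of s]]) (use that N in auto)
    have 2: "dom_pow M (R a b) (\<lambda>x. F2 a b x (J u x) + s) (N + 1) (L + \<mu>)" if "\<bar>s\<bar> \<le> 1" for s :: real
      by (rule dom_pow_mono[OF dom_pow_add[OF F2 dom_pow_const[OF R(1)[OF a b], of s] R(1)[OF a b]]]) (use that in auto)
    have "cQ u a b = (if a \<in> Top \<and> b \<in> Top then (\<lambda>_. 0) else (\<lambda>x. F2 a b x (J u x) + (if a = b then - 1 else 0)))"
      by (auto simp: cQ_def)
    moreover have "cP u a b = (if a \<in> Top \<and> b \<in> Top then (\<lambda>x. F2 a b x (J u x)) else (\<lambda>_. if a = b then 1 else 0))"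
      by (auto simp: cP_def)
    moreover have "cB u a b = (\<lambda>x. F2 a b x (J u x))" by (auto simp: cB_def)
    ultimately show ?thesis using 1 2 c by simp
  qed
  then show ?thesis using N by (intro exI[of _ "N + 1"] exI[of _ "L + \<mu>"]) auto
qed

lemma coef_dom_at:
  assumes u: "u \<in> H"
  shows "\<exists>N L. 0 \<le> N \<and> 0 \<le> L \<and> coef_dom (cB u) N L \<and> coef_dom (cP u) N L \<and> coef_dom (cQ u) N L"
proof -
  obtain N L where "0 \<le> N" "0 \<le> L" and *: "\<forall>v\<in>H. nm v \<le> nm u \<longrightarrow> (\<forall>a\<in>I. \<forall>b\<in>I.
    dom_pow M (R a b) (cB v a b) N L \<and> dom_pow M (R a b) (cP v a b) N L \<and> dom_pow M (R a b) (cQ v a b) N L)"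
    using coef_dom_uniform[OF nm_nonneg[OF u]] by blast
  have "dom_pow M (1 - \<theta> a - \<theta> b) c N L" if "a \<in> I" "b \<in> I" "dom_pow M (R a b) c N L" for a b c
    using dom_pow_exponent_mono[OF that(3) R(2)[OF that(1,2)]] .
  then have "coef_dom (cB u) N L \<and> coef_dom (cP u) N L \<and> coef_dom (cQ u) N L"
    unfolding coef_dom_def using *[rule_format, OF u order_refl] by simp
  then show ?thesis using \<open>0 \<le> N\<close> \<open>0 \<le> L\<close> by blast
qed

definition opB :: "'a \<Rightarrow> 'a \<Rightarrow> 'a" where "opB u = op_of_form (bform (cB u))"
definition opP :: "'a \<Rightarrow> 'a \<Rightarrow> 'a" where "opP u = op_of_form (bform (cP u))"
definition opQ :: "'a \<Rightarrow> 'a \<Rightarrow> 'a" where "opQ u = op_of_form (bform (cQ u))"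

lemma bounded_forms:
  assumes "u \<in> H"
  shows "bounded_form (bform (cB u))" "bounded_form (bform (cP u))" "bounded_form (bform (cQ u))"
  using coef_dom_at[OF assms] bounded_bform by blast+

lemma op_in:
  assumes "u \<in> H" "v \<in> H"
  shows "opB u v \<in> H" "opP u v \<in> H" "opQ u v \<in> H"
  using bounded_forms[OF assms(1)] op_of_form_in assms(2) by (auto simp: opB_def opP_def opQ_def)

lemma ip_op:
  assumes "u \<in> H" "v \<in> H" "w \<in> H"
  shows "ip (opB u v) w = bform (cB u) v w" "ip (opP u v) w = bform (cP u) v w" "ip (opQ u v) w = bform (cQ u) v w"
  using bounded_forms[OF assms(1)] ip_op_of_form assms(2,3) by (auto simp: opB_def opP_def opQ_def)

lemma selfadjoint_ops:
  assumes u: "u \<in> H"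
  shows "selfadjoint_op H ip (opB u)" "selfadjoint_op H ip (opP u)" "selfadjoint_op H ip (opQ u)"
proof -
  obtain N L where dom: "coef_dom (cB u) N L" "coef_dom (cP u) N L" "coef_dom (cQ u) N L"
    using coef_dom_at[OF u] by blast
  have sym: "AE x in M. \<forall>a\<in>I. \<forall>b\<in>I. F2 a b x (J u x) = F2 b a x (J u x)"
    using F2_sym by eventually_elim simp
  then have "AE x in M. \<forall>a\<in>I. \<forall>b\<in>I. cB u a b x = cB u b a x" "AE x in M. \<forall>a\<in>I. \<forall>b\<in>I. cP u a b x = cP u b a x"
    "AE x in M. \<forall>a\<in>I. \<forall>b\<in>I. cQ u a b x = cQ u b a x"
    by (auto simp: cB_def cP_def cQ_def elim!: eventually_mono)
  with dom show "selfadjoint_op H ip (opB u)" "selfadjoint_op H ip (opP u)" "selfadjoint_op H ip (opQ u)"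
    unfolding opB_def opP_def opQ_def using bform_sym
    by (auto intro!: selfadjoint_op_of_form bounded_forms[OF u])
qed

lemma opB_eq:
  assumes u: "u \<in> H" and v: "v \<in> H"
  shows "opB u v = opP u v + opQ u v"
proof (rule ip_eqI)
  fix w assume w: "w \<in> H"
  obtain N L where dom: "coef_dom (cP u) N L" "coef_dom (cQ u) N L" using coef_dom_at[OF u] by blast
  show "ip (opB u v) w = ip (opP u v + opQ u v) w"
    using bform_add[OF dom v w] by (simp add: ip_add_left op_in ip_op u v w cB_eq)
qed (use op_in u v in auto)

lemma opB_gateaux_seq:
  assumes u: "u \<in> H" and h: "h \<in> H" and X: "\<And>k. X k \<noteq> 0" "\<And>k. \<bar>X k\<bar> \<le> 1" "X \<longlonglongrightarrow> 0"
  shows "(\<lambda>k. nm ((1 / X k) *\<^sub>R (grad (u + X k *\<^sub>R h) - grad u) - opB u h)) \<longlonglongrightarrow> 0"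
proof -
  have uX: "u + X k *\<^sub>R h \<in> H" for k using u h by simp
  obtain N L where N: "0 \<le> N" "0 \<le> L" and L: "\<forall>v\<in>H. \<forall>w\<in>H. nm v \<le> nm u + nm h \<longrightarrow> nm w \<le> nm u + nm h \<longrightarrow>
    (\<exists>G. (\<forall>a\<in>I. \<forall>b\<in>I. dom_pow M (R a b) (G a b) N L) \<and> (\<forall>a b x. 0 \<le> G a b x) \<and>
      (AE x in M. \<forall>t. \<bar>t\<bar> \<le> 1 \<longrightarrow> (\<forall>a\<in>I. \<forall>b\<in>I. \<bar>F2 a b x (\<lambda>c. J v x c + t * J w x c)\<bar> \<le> G a b x)))"
    using F2_dominated[OF add_nonneg_nonneg[OF nm_nonneg[OF u] nm_nonneg[OF h]]] by blast
  obtain G where G: "\<And>a b. a \<in> I \<Longrightarrow> b \<in> I \<Longrightarrow> dom_pow M (R a b) (G a b) N L" "\<And>a b x. 0 \<le> G a b x"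
    and Gle: "AE x in M. \<forall>t. \<bar>t\<bar> \<le> 1 \<longrightarrow> (\<forall>a\<in>I. \<forall>b\<in>I. \<bar>F2 a b x (\<lambda>c. J u x c + t * J h x c)\<bar> \<le> G a b x)"
    using L[rule_format, OF u h] nm_nonneg[OF u] nm_nonneg[OF h] by auto
  obtain N' L' where domB: "coef_dom (cB u) N' L'" using coef_dom_at[OF u] by blast
  note pw = pointwise_bounds[OF u h G(2) Gle]
  have line: "AE x in M. \<forall>k. J (u + X k *\<^sub>R h) x = (\<lambda>c. J u x c + X k * J h x c)"
    using J_line[OF u h] by (simp add: AE_all_countable)
  define e where "e k a x = (F1 a x (J (u + X k *\<^sub>R h) x) - F1 a x (J u x)) / X k - (\<Sum>b\<in>I. F2 a b x (J u x) * D h b x)" for k a x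
  have e_meas: "e k a \<in> borel_measurable M" if a: "a \<in> I" for k a
  proof -
    have [measurable]: "(\<lambda>x. F1 a x (J (u + X k *\<^sub>R h) x)) \<in> borel_measurable M" "(\<lambda>x. F1 a x (J u x)) \<in> borel_measurable M"
      using F1_meas a u uX by auto
    have "(\<lambda>x. F2 a b x (J u x) * D h b x) \<in> borel_measurable M" if "b \<in> I" for b
      using F2_meas[OF u a that] D_meas[OF h that] by measurable
    then have [measurable]: "(\<lambda>x. \<Sum>b\<in>I. F2 a b x (J u x) * D h b x) \<in> borel_measurable M"
      by (intro borel_measurable_sum)
    show ?thesis unfolding e_def by measurable
  qed
  have small: "\<forall>\<^sub>F k in sequentially. dom_pow M (1 - \<theta> a) (e k a) \<epsilon> (\<mu> + 1)" if a: "a \<in> I" and \<epsilon>: "0 < \<epsilon>" for a \<epsilon>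
  proof (rule dom_pow_eventually_small_dominated[OF e_meas[OF a] _ _ _ _ \<epsilon>])
    show "dom_pow M (1 - \<theta> a) (\<lambda>x. 2 * (\<Sum>b\<in>I. G a b x * \<bar>D h b x\<bar>))
        (\<bar>2\<bar> * (real (card I) * (N * (Ce * nm h)))) (\<mu> + real (card I) * (L + Le))"
      by (intro dom_pow_cmult F1_remainder_dom[where G = G] G a h N)
    show "0 < 1 - \<theta> a" using th(2)[OF a] by simp
    show "AE x in M. \<bar>e k a x\<bar> \<le> \<bar>2 * (\<Sum>b\<in>I. G a b x * \<bar>D h b x\<bar>)\<bar>" for k
      using pw(1) line Gle
    proof eventually_elim
      case (elim x)
      let ?S = "\<Sum>b\<in>I. G a b x * \<bar>D h b x\<bar>"
      have "\<bar>F1 a x (J (u + X k *\<^sub>R h) x) - F1 a x (J u x)\<bar> \<le> \<bar>X k\<bar> * ?S"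
        using elim(1)[rule_format, OF a X(2)[of k]] elim(2) by simp
      then have 1: "\<bar>(F1 a x (J (u + X k *\<^sub>R h) x) - F1 a x (J u x)) / X k\<bar> \<le> ?S"
        using X(1)[of k] by (simp add: abs_divide field_simps)
      have "\<bar>\<Sum>b\<in>I. F2 a b x (J u x) * D h b x\<bar> \<le> ?S"
      proof (intro order_trans[OF sum_abs] sum_mono)
        fix b assume b: "b \<in> I"
        have "\<bar>F2 a b x (J u x)\<bar> \<le> G a b x" using elim(3)[rule_format, OF _ a b, of 0] by simp
        then show "\<bar>F2 a b x (J u x) * D h b x\<bar> \<le> G a b x * \<bar>D h b x\<bar>"
          by (simp add: abs_mult mult_right_mono)
      qed
      with 1 show ?case unfolding e_def by linarith
    qed
    show "AE x in M. (\<lambda>k. e k a x) \<longlonglongrightarrow> 0"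
      using pw(3) line
    proof eventually_elim
      case (elim x)
      let ?d = "\<Sum>b\<in>I. F2 a b x (J u x) * D h b x"
      have "((\<lambda>t. F1 a x (\<lambda>c. J u x c + t * J h x c)) has_real_derivative ?d) (at 0)"
        using elim(1) a by blast
      then have "((\<lambda>t. (F1 a x (\<lambda>c. J u x c + t * J h x c) - F1 a x (J u x)) / t) \<longlongrightarrow> ?d) (at 0)"
        by (simp add: DERIV_def)
      then have "((\<lambda>t. (F1 a x (\<lambda>c. J u x c + t * J h x c) - F1 a x (J u x)) / t) \<circ> X) \<longlonglongrightarrow> ?d"
        using X unfolding tendsto_at_iff_sequentially by simp
      then have "(\<lambda>k. (F1 a x (J (u + X k *\<^sub>R h) x) - F1 a x (J u x)) / X k) \<longlonglongrightarrow> ?d"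
        using elim(2) by (simp add: o_def)
      then have "(\<lambda>k. (F1 a x (J (u + X k *\<^sub>R h) x) - F1 a x (J u x)) / X k - ?d) \<longlonglongrightarrow> ?d - ?d"
        by (intro tendsto_intros)
      then show ?case by (simp add: e_def)
    qed
  qed
  let ?z = "\<lambda>k. (1 / X k) *\<^sub>R (grad (u + X k *\<^sub>R h) - grad u) - opB u h"
  have zH: "?z k \<in> H" for k using grad[OF u] grad[OF uX] op_in[OF u h] by simp
  have ip_z: "ip (?z k) w = (\<Sum>a\<in>I. \<integral>x. e k a x * D w a x \<partial>M)" if w: "w \<in> H" for k w
  proof -
    have "ip (?z k) w = (1 / X k) * (dL (u + X k *\<^sub>R h) w - dL u w) - bform (cB u) h w"
      using grad[OF u] grad[OF uX] op_in[OF u h] w by (simp add: ip_diff_left ip_scale_left ip_op u h)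
    also have "\<dots> = (\<Sum>a\<in>I. (1 / X k) * ((\<integral>x. F1 a x (J (u + X k *\<^sub>R h) x) * D w a x \<partial>M) - (\<integral>x. F1 a x (J u x) * D w a x \<partial>M))
        - (\<Sum>b\<in>I. \<integral>x. cB u a b x * D h b x * D w a x \<partial>M))"
      by (simp add: dL_def bform_def sum_subtractf sum_divide_distrib diff_divide_distrib)
    also have "\<dots> = (\<Sum>a\<in>I. \<integral>x. e k a x * D w a x \<partial>M)"
    proof (rule sum.cong[OF refl])
      fix a assume a: "a \<in> I"
      have eq: "e k a x * D w a x = (1 / X k) * (F1 a x (J (u + X k *\<^sub>R h) x) * D w a x - F1 a x (J u x) * D w a x)
          - (\<Sum>b\<in>I. cB u a b x * D h b x * D w a x)" for x
        by (simp add: e_def cB_def left_diff_distrib sum_distrib_right diff_divide_distrib)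
      show "(1 / X k) * ((\<integral>x. F1 a x (J (u + X k *\<^sub>R h) x) * D w a x \<partial>M) - (\<integral>x. F1 a x (J u x) * D w a x \<partial>M))
        - (\<Sum>b\<in>I. \<integral>x. cB u a b x * D h b x * D w a x \<partial>M) = (\<integral>x. e k a x * D w a x \<partial>M)"
        unfolding eq
        using F1_D_integrable[OF u w a] F1_D_integrable[OF uX w a] bform_term(1)[OF domB h w a]
        by (simp add: Bochner_Integration.integral_sum)
    qed
    finally show ?thesis .
  qed
  show ?thesis
  proof (rule null_limit_by_bound)
    show "0 \<le> nm (?z k)" for k using zH by simp
    show "0 \<le> real (card I) * (Ce * (\<mu> + 1 + Le))" using Ce Le by simp
    fix \<epsilon> :: real assume \<epsilon>: "0 < \<epsilon>"
    have "\<forall>\<^sub>F k in sequentially. \<forall>a\<in>I. dom_pow M (1 - \<theta> a) (e k a) \<epsilon> (\<mu> + 1)"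
      using small[OF _ \<epsilon>] fin by (intro eventually_ball_finite) auto
    then show "\<forall>\<^sub>F k in sequentially. nm (?z k) \<le> real (card I) * (Ce * (\<mu> + 1 + Le)) * \<epsilon>"
    proof eventually_elim
      case (elim k)
      show ?case
      proof (rule nm_le_of_dual_bound[OF zH])
        fix w assume w: "w \<in> H"
        have "\<bar>\<integral>x. e k a x * D w a x \<partial>M\<bar> \<le> Ce * (\<mu> + 1 + Le) * \<epsilon> * nm w" if a: "a \<in> I" for a
          using dom_pow_mult2(2)[OF finM elim[rule_format, OF a] emb[OF w a]] th(1)[OF a] th(2)[OF a]
          by (simp add: algebra_simps)
        then have "\<bar>ip (?z k) w\<bar> \<le> (\<Sum>a\<in>I. Ce * (\<mu> + 1 + Le) * \<epsilon> * nm w)"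
          unfolding ip_z[OF w] by (intro order_trans[OF sum_abs] sum_mono) auto
        then show "\<bar>ip (?z k) w\<bar> \<le> real (card I) * (Ce * (\<mu> + 1 + Le)) * \<epsilon> * nm w"
          by (simp add: mult.assoc)
      qed (use Ce Le \<epsilon> in simp)
    qed
  qed
qed

lemma opB_gateaux:
  assumes u: "u \<in> H"
  shows "has_gateaux_deriv H ip grad u (opB u)"
  unfolding has_gateaux_deriv_def
proof
  fix h assume h: "h \<in> H"
  show "((\<lambda>t. nm ((1 / t) *\<^sub>R (grad (u + t *\<^sub>R h) - grad u) - opB u h)) \<longlongrightarrow> 0) (at 0)"
    unfolding tendsto_at_iff_sequentially
  proof (intro allI impI)
    fix X :: "nat \<Rightarrow> real" assume X: "\<forall>i. X i \<in> UNIV - {0}" "X \<longlonglongrightarrow> 0"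
    have "\<forall>\<^sub>F i in sequentially. dist (X i) 0 < 1" using X(2) by (rule tendstoD) simp
    then obtain K where K: "\<And>i. i \<ge> K \<Longrightarrow> \<bar>X i\<bar> < 1" unfolding eventually_sequentially by auto
    have "(\<lambda>i. nm ((1 / X (i + K)) *\<^sub>R (grad (u + X (i + K) *\<^sub>R h) - grad u) - opB u h)) \<longlonglongrightarrow> 0"
      using X K by (intro opB_gateaux_seq u h LIMSEQ_ignore_initial_segment) (auto intro: less_imp_le)
    then show "((\<lambda>t. nm ((1 / t) *\<^sub>R (grad (u + t *\<^sub>R h) - grad u) - opB u h)) \<circ> X) \<longlonglongrightarrow> 0"
      unfolding o_def by (rule LIMSEQ_offset)
  qed
qed

end

lemma dom_pow_zero_exponent:
  assumes "dom_pow M 0 f N L" shows "AE x in M. \<bar>f x\<bar> \<le> N"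
proof -
  obtain A where A: "\<forall>x. 1 \<le> A x" and le: "AE x in M. \<bar>f x\<bar> \<le> N * A x powr 0"
    using assms unfolding dom_pow_def by blast
  have "A x \<noteq> 0" for x using A[rule_format, of x] by simp
  then show ?thesis using le by simp
qed

context nemytskii
begin

lemma opP_coercive:
  "\<exists>C0>0. \<forall>u\<in>H. \<forall>v\<in>H. C0 * (nm v)\<^sup>2 \<le> ip (opP u v) v"
proof -
  obtain l where l: "l > 0" and el: "AE x in M. \<forall>\<xi>\<in>S. \<forall>\<eta> :: 'k \<Rightarrow> real.
      l * (\<Sum>a\<in>Top. (\<eta> a)\<^sup>2) \<le> (\<Sum>a\<in>Top. \<Sum>b\<in>Top. F2 a b x \<xi> * \<eta> a * \<eta> b)"
    using ell by blast
  have "min l 1 * (nm v)\<^sup>2 \<le> ip (opP u v) v" if u: "u \<in> H" and v: "v \<in> H" for u v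
  proof -
    obtain N L where dom: "coef_dom (cP u) N L" using coef_dom_at[OF u] by blast
    have split: "(\<Sum>a\<in>I. \<Sum>b\<in>I. cP u a b x * y b * y a) =
        (\<Sum>a\<in>Top. \<Sum>b\<in>Top. F2 a b x (J u x) * y a * y b) + (\<Sum>a\<in>I - Top. (y a)\<^sup>2)" for x and y :: "'k \<Rightarrow> real"
    proof -
      have 1: "(\<Sum>b\<in>I. cP u a b x * y b * y a) = (\<Sum>b\<in>Top. F2 a b x (J u x) * y a * y b)" if a: "a \<in> Top" for a
      proof -
        have "(\<Sum>b\<in>I. cP u a b x * y b * y a) = (\<Sum>b\<in>Top. cP u a b x * y b * y a)"
          using fin Top_sub a by (intro sum.mono_neutral_right) (auto simp: cP_def)
        also have "\<dots> = (\<Sum>b\<in>Top. F2 a b x (J u x) * y a * y b)"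
          using a by (intro sum.cong) (auto simp: cP_def)
        finally show ?thesis .
      qed
      have 2: "(\<Sum>b\<in>I. cP u a b x * y b * y a) = (y a)\<^sup>2" if a: "a \<in> I - Top" for a
      proof -
        have "(\<Sum>b\<in>I. cP u a b x * y b * y a) = (\<Sum>b\<in>I. if b = a then (y a)\<^sup>2 else 0)"
          using a by (intro sum.cong) (auto simp: cP_def power2_eq_square)
        then show ?thesis using a fin by simp
      qed
      have "(\<Sum>a\<in>I. \<Sum>b\<in>I. cP u a b x * y b * y a) =
          (\<Sum>a\<in>I - Top. \<Sum>b\<in>I. cP u a b x * y b * y a) + (\<Sum>a\<in>Top. \<Sum>b\<in>I. cP u a b x * y b * y a)"
        by (rule sum.subset_diff[OF Top_sub fin])
      then show ?thesis using 1 2 by simp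
    qed
    have int1: "integrable M (\<lambda>x. \<Sum>a\<in>I. \<Sum>b\<in>I. cP u a b x * D v b x * D v a x)"
      using bform_term(1)[OF dom v v] by (intro Bochner_Integration.integrable_sum) auto
    have int_c: "integrable M (\<lambda>x. D v c x * D v c x)" if c: "c \<in> I" for c
      using dom_pow_mult2(1)[OF finM emb[OF v c] emb[OF v c]] th(1)[OF c] th(2)[OF c] by simp
    have "min l 1 * (nm v)\<^sup>2 = (\<integral>x. min l 1 * (\<Sum>c\<in>I. D v c x * D v c x) \<partial>M)"
      using int_c v by (simp add: nm_sq ip_eq Bochner_Integration.integral_sum)
    also have "\<dots> \<le> (\<integral>x. (\<Sum>a\<in>I. \<Sum>b\<in>I. cP u a b x * D v b x * D v a x) \<partial>M)"
    proof (rule integral_mono_AE)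
      show "AE x in M. min l 1 * (\<Sum>c\<in>I. D v c x * D v c x) \<le> (\<Sum>a\<in>I. \<Sum>b\<in>I. cP u a b x * D v b x * D v a x)"
        using el
      proof eventually_elim
        case (elim x)
        have "min l 1 * (\<Sum>c\<in>I. D v c x * D v c x) =
            min l 1 * (\<Sum>c\<in>Top. (D v c x)\<^sup>2) + min l 1 * (\<Sum>c\<in>I - Top. (D v c x)\<^sup>2)"
          using sum.subset_diff[OF Top_sub fin, of "\<lambda>c. (D v c x)\<^sup>2"] by (simp add: power2_eq_square distrib_left)
        also have "\<dots> \<le> l * (\<Sum>c\<in>Top. (D v c x)\<^sup>2) + 1 * (\<Sum>c\<in>I - Top. (D v c x)\<^sup>2)"
          by (intro add_mono mult_right_mono) (auto simp: sum_nonneg)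
        also have "\<dots> \<le> (\<Sum>a\<in>Top. \<Sum>b\<in>Top. F2 a b x (J u x) * D v a x * D v b x) + (\<Sum>c\<in>I - Top. (D v c x)\<^sup>2)"
          using elim[rule_format, OF J_in_S, of "\<lambda>c. D v c x" u] by simp
        finally show ?case unfolding split .
      qed
      show "integrable M (\<lambda>x. min l 1 * (\<Sum>c\<in>I. D v c x * D v c x))"
        using int_c by (intro integrable_mult_right Bochner_Integration.integrable_sum) auto
    qed (rule int1)
    also have "\<dots> = bform (cP u) v v"
      using bform_term(1)[OF dom v v] by (simp add: bform_def Bochner_Integration.integral_sum)
    finally show ?thesis by (simp add: ip_op u v)
  qed
  then show ?thesis using l by (intro exI[of _ "min l 1"]) auto
qed

lemma ae_null_subseq:
  assumes x: "\<And>k::nat. x k \<in> H" and lim: "(\<lambda>k. nm (x k)) \<longlonglongrightarrow> 0"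
  shows "\<exists>r. strict_mono (r :: nat \<Rightarrow> nat) \<and> (AE y in M. \<forall>c\<in>I. (\<lambda>k. D (x (r k)) c y) \<longlonglongrightarrow> 0)"
proof -
  define g where "g k y = (\<Sum>c\<in>I. \<bar>D (x k) c y\<bar>)" for k y
  have dom: "dom_pow M 1 (D (x k) c) (Ce * nm (x k)) Le" if "c \<in> I" for k c
    using dom_pow_exponent_mono[OF emb[OF x that], of 1] th(2)[OF that] by simp
  have int: "integrable M (\<lambda>y. \<bar>D (x k) c y\<bar>)" if "c \<in> I" for k c
    using dom_pow_integrable(1)[OF dom[OF that]] by simp
  have g: "integrable M (g k)" for k unfolding g_def using int by (intro Bochner_Integration.integrable_sum) auto
  have g_le: "(\<integral>y. norm (g k y) \<partial>M) \<le> (real (card I) * Ce * Le) * nm (x k)" for k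
  proof -
    have "(\<integral>y. norm (g k y) \<partial>M) = (\<Sum>c\<in>I. \<integral>y. \<bar>D (x k) c y\<bar> \<partial>M)"
      unfolding g_def using int by (simp add: sum_nonneg Bochner_Integration.integral_sum)
    also have "\<dots> \<le> (\<Sum>c\<in>I. Ce * nm (x k) * Le)"
      by (intro sum_mono dom_pow_integrable(2) dom)
    finally show ?thesis by (simp add: algebra_simps)
  qed
  have "(\<lambda>k. \<integral>y. norm (g k y) \<partial>M) \<longlonglongrightarrow> 0"
  proof (rule tendsto_sandwich[of "\<lambda>_. 0" _ _ "\<lambda>k. (real (card I) * Ce * Le) * nm (x k)"])
    show "(\<lambda>k. (real (card I) * Ce * Le) * nm (x k)) \<longlonglongrightarrow> 0"
      using tendsto_mult_right_zero[OF lim] by simp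
  qed (use g_le in auto)
  from tendsto_L1_AE_subseq[OF g this]
  obtain r where r: "strict_mono r" "AE y in M. (\<lambda>k. g (r k) y) \<longlonglongrightarrow> 0" by blast
  have "AE y in M. \<forall>c\<in>I. (\<lambda>k. D (x (r k)) c y) \<longlonglongrightarrow> 0"
    using r(2)
  proof eventually_elim
    case (elim y)
    show ?case
    proof
      fix c assume c: "c \<in> I"
      have "norm (D (x (r k)) c y) \<le> g (r k) y" for k
        unfolding g_def real_norm_def using c fin by (intro member_le_sum) auto
      then show "(\<lambda>k. D (x (r k)) c y) \<longlonglongrightarrow> 0"
        by (intro Lim_null_comparison[OF _ elim]) auto
    qed
  qed
  with r(1) show ?thesis by blast
qed

lemma F2_lim_subseq:
  assumes x: "\<And>k::nat. x k \<in> H" and lim: "(\<lambda>k. nm (x k)) \<longlonglongrightarrow> 0"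
  shows "\<exists>r. strict_mono (r :: nat \<Rightarrow> nat) \<and>
    (AE y in M. \<forall>a\<in>I. \<forall>b\<in>I. (\<lambda>k. F2 a b y (J (x (r k)) y) - F2 a b y (J 0 y)) \<longlonglongrightarrow> 0)"
proof -
  obtain r where r: "strict_mono r" and ae: "AE y in M. \<forall>c\<in>I. (\<lambda>k. D (x (r k)) c y) \<longlonglongrightarrow> 0"
    using ae_null_subseq[OF x lim] by blast
  have "AE y in M. \<forall>a\<in>I. \<forall>b\<in>I. (\<lambda>k. F2 a b y (J (x (r k)) y) - F2 a b y (J 0 y)) \<longlonglongrightarrow> 0"
    using ae F2_cont J_zero
  proof eventually_elim
    case (elim y)
    have "(\<lambda>k. J (x (r k)) y c) \<longlonglongrightarrow> 0" for c
      using elim(1) by (cases "c \<in> I") (auto simp: J_def)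
    then have "\<forall>a\<in>I. \<forall>b\<in>I. (\<lambda>k. F2 a b y (J (x (r k)) y)) \<longlonglongrightarrow> F2 a b y (\<lambda>_. 0)"
      using elim(2)[rule_format, of "\<lambda>k. J (x (r k)) y"] by simp
    then show ?case by (simp add: elim(3) LIM_zero)
  qed
  with r show ?thesis by blast
qed

lemma null_seq_bounded:
  assumes x: "\<And>k::nat. x k \<in> H" and lim: "(\<lambda>k. nm (x k)) \<longlonglongrightarrow> 0"
  shows "\<exists>B\<ge>0. \<forall>k. nm (x k) \<le> B"
proof -
  have "Bseq (\<lambda>k. nm (x k))" using lim by (intro convergent_imp_Bseq convergentI)
  then obtain B where "0 < B" "\<And>k. norm (nm (x k)) \<le> B" by (rule BseqE) auto
  then show ?thesis by (intro exI[of _ B]) (auto simp: abs_le_iff)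
qed

lemma opP_strongly_continuous:
  assumes x: "\<And>k::nat. x k \<in> H" and lim: "(\<lambda>k. nm (x k)) \<longlonglongrightarrow> 0" and u: "u \<in> H"
  shows "(\<lambda>k. nm (opP (x k) u - opP 0 u)) \<longlonglongrightarrow> 0"
proof (rule null_seq_by_subseq)
  fix r :: "nat \<Rightarrow> nat" assume r: "strict_mono r"
  have lim': "(\<lambda>k. nm (x (r k))) \<longlonglongrightarrow> 0"
    using LIMSEQ_subseq_LIMSEQ[OF lim r] by (simp add: o_def)
  obtain s where s: "strict_mono s"
    and ae: "AE y in M. \<forall>a\<in>I. \<forall>b\<in>I. (\<lambda>k. F2 a b y (J (x (r (s k))) y) - F2 a b y (J 0 y)) \<longlonglongrightarrow> 0"
    using F2_lim_subseq[OF x lim'] by blast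
  obtain B where B: "0 \<le> B" "\<And>k. nm (x k) \<le> B" using null_seq_bounded[OF x lim] by blast
  obtain N L where N: "0 \<le> N" and dom: "\<forall>u\<in>H. nm u \<le> B \<longrightarrow> (\<forall>a\<in>I. \<forall>b\<in>I.
      dom_pow M (R a b) (cB u a b) N L \<and> dom_pow M (R a b) (cP u a b) N L \<and> dom_pow M (R a b) (cQ u a b) N L)"
    using coef_dom_uniform[OF B(1)] by blast
  have cP_meas: "cP v a b \<in> borel_measurable M" if "v \<in> H" "nm v \<le> B" "a \<in> I" "b \<in> I" for v a b
    using dom[rule_format, OF that] dom_pow_measurable by blast
  define y where "y k = x (r (s k))" for k
  have y: "y k \<in> H" "nm (y k) \<le> B" for k using x B by (auto simp: y_def)
  have zero: "nm 0 \<le> B" using B by simp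
  define f where "f k a b z = (cP (y k) a b z - cP 0 a b z) * D u b z" for k a b z
  have f_meas: "f k a b \<in> borel_measurable M" if "a \<in> I" "b \<in> I" for k a b
    unfolding f_def using cP_meas[OF y that] cP_meas[OF H_zero zero that] D_meas[OF u that(2)] by measurable
  have small: "\<forall>\<^sub>F k in sequentially. dom_pow M (1 - \<theta> a) (f k a b) \<epsilon> (\<mu> + 1)"
    if a: "a \<in> I" and b: "b \<in> I" and \<epsilon>: "0 < \<epsilon>" for a b \<epsilon>
  proof (rule dom_pow_eventually_small_dominated[OF f_meas[OF a b] _ _ _ _ \<epsilon>])
    show "0 < 1 - \<theta> a" using th(2)[OF a] by simp
    show "dom_pow M (1 - \<theta> a) (\<lambda>z. (2 * N) * D u b z) (\<bar>2 * N\<bar> * (Ce * nm u)) Le"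
      by (rule dom_pow_exponent_mono[OF dom_pow_cmult[OF emb[OF u b]]]) (use th(2)[OF a] th(2)[OF b] in simp)
    show "AE z in M. \<bar>f k a b z\<bar> \<le> \<bar>2 * N * D u b z\<bar>" for k
    proof (cases "a \<in> Top \<and> b \<in> Top")
      case True
      then have "R a b = 0" using R(1)[OF a b] R(2)[OF a b] th(3)[of a] th(3)[of b] by simp
      then have "AE z in M. \<bar>cP (y k) a b z\<bar> \<le> N" "AE z in M. \<bar>cP 0 a b z\<bar> \<le> N"
        using dom[rule_format, OF y a b, of k] dom[rule_format, OF H_zero zero a b] dom_pow_zero_exponent by auto
      then show ?thesis
      proof eventually_elim
        case (elim z)
        have "\<bar>cP (y k) a b z - cP 0 a b z\<bar> \<le> \<bar>2 * N\<bar>" using elim by linarith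
        then show ?case unfolding f_def abs_mult by (rule mult_right_mono) simp
      qed
    next
      case False
      then show ?thesis by (auto simp: f_def cP_def)
    qed
    show "AE z in M. (\<lambda>k. f k a b z) \<longlonglongrightarrow> 0"
      using ae
    proof eventually_elim
      case (elim z)
      show ?case
      proof (cases "a \<in> Top \<and> b \<in> Top")
        case True
        have "(\<lambda>k. (F2 a b z (J (x (r (s k))) z) - F2 a b z (J 0 z)) * D u b z) \<longlonglongrightarrow> 0"
          using elim a b by (intro tendsto_mult_left_zero) auto
        then show ?thesis using True by (simp add: f_def cP_def y_def)
      next
        case False
        then show ?thesis by (auto simp: f_def cP_def)
      qed
    qed
  qed
  have zH: "opP (y k) u - opP 0 u \<in> H" for k using op_in[OF y(1) u] op_in[OF H_zero u] by simp
  have ip_z: "ip (opP (y k) u - opP 0 u) w = bform (\<lambda>a b z. cP (y k) a b z - cP 0 a b z) u w" if w: "w \<in> H" for k w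
  proof -
    obtain N1 L1 N2 L2 where "coef_dom (cP (y k)) N1 L1" "coef_dom (cP 0) N2 L2"
      using coef_dom_at[OF y(1)] coef_dom_at[OF H_zero] by blast
    from bform_diff[OF this u w] show ?thesis
      using op_in[OF y(1) u] op_in[OF H_zero u] w by (simp add: ip_diff_left ip_op y(1) u)
  qed
  have "(\<lambda>k. nm (opP (y k) u - opP 0 u)) \<longlonglongrightarrow> 0"
  proof (rule null_limit_by_bound)
    show "0 \<le> nm (opP (y k) u - opP 0 u)" for k using zH by simp
    show "0 \<le> (real (card I))\<^sup>2 * (Ce * (\<mu> + 1 + Le))" using Ce Le by simp
    fix \<epsilon> :: real assume \<epsilon>: "0 < \<epsilon>"
    have "\<forall>\<^sub>F k in sequentially. \<forall>a\<in>I. \<forall>b\<in>I. dom_pow M (1 - \<theta> a) (f k a b) \<epsilon> (\<mu> + 1)"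
      using small[OF _ _ \<epsilon>] fin by (intro eventually_ball_finite ballI) auto
    then show "\<forall>\<^sub>F k in sequentially. nm (opP (y k) u - opP 0 u) \<le> (real (card I))\<^sup>2 * (Ce * (\<mu> + 1 + Le)) * \<epsilon>"
    proof eventually_elim
      case (elim k)
      show ?case
      proof (rule nm_le_of_dual_bound[OF zH])
        fix w assume w: "w \<in> H"
        have "\<bar>\<integral>z. (cP (y k) a b z - cP 0 a b z) * D u b z * D w a z \<partial>M\<bar> \<le> Ce * (\<mu> + 1 + Le) * \<epsilon> * nm w"
          if a: "a \<in> I" and b: "b \<in> I" for a b
          using dom_pow_mult2(2)[OF finM elim[rule_format, OF a b] emb[OF w a]] th(1)[OF a] th(2)[OF a]
          by (simp add: f_def algebra_simps)
        from bform_le[of "\<lambda>a b z. cP (y k) a b z - cP 0 a b z", OF this]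
        show "\<bar>ip (opP (y k) u - opP 0 u) w\<bar> \<le> (real (card I))\<^sup>2 * (Ce * (\<mu> + 1 + Le)) * \<epsilon> * nm w"
          unfolding ip_z[OF w] by (simp add: mult.assoc)
      qed (use Ce Le \<epsilon> in simp)
    qed
  qed
  with s show "\<exists>s. strict_mono s \<and> (\<lambda>k. nm (opP (x (r (s k))) u - opP 0 u)) \<longlonglongrightarrow> 0"
    unfolding y_def by blast
qed

lemma opQ_norm_continuous_subseq:
  assumes x: "\<And>k::nat. x k \<in> H" and lim: "(\<lambda>k. nm (x k)) \<longlonglongrightarrow> 0"
  shows "\<exists>s. strict_mono (s :: nat \<Rightarrow> nat) \<and>
    (\<forall>e>0. \<forall>\<^sub>F k in sequentially. \<forall>u\<in>H. nm (opQ (x (s k)) u - opQ 0 u) \<le> e * nm u)"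
proof -
  obtain s where s: "strict_mono s"
    and ae: "AE y in M. \<forall>a\<in>I. \<forall>b\<in>I. (\<lambda>k. F2 a b y (J (x (s k)) y) - F2 a b y (J 0 y)) \<longlonglongrightarrow> 0"
    using F2_lim_subseq[OF x lim] by blast
  obtain B where B: "0 \<le> B" "\<And>k. nm (x k) \<le> B" using null_seq_bounded[OF x lim] by blast
  obtain C where C: "0 \<le> C" and gr: "AE y in M. \<forall>\<xi>\<in>S. (\<forall>c\<in>I. \<theta> c = 0 \<longrightarrow> \<bar>\<xi> c\<bar> \<le> Ce * B) \<longrightarrow>
      (\<forall>a\<in>I. \<forall>b\<in>I. \<bar>F2 a b y \<xi>\<bar> \<le> C * (1 + (\<Sum>c | c \<in> I \<and> 0 < \<theta> c. \<bar>\<xi> c\<bar> powr (1 / \<theta> c))) powr R a b)"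
    using growth[of "Ce * B"] B(1) Ce by auto
  define y where "y k = x (s k)" for k
  have y: "y k \<in> H" "nm (y k) \<le> B" for k using x B by (auto simp: y_def)
  have y_lim: "(\<lambda>k. nm (y k)) \<longlonglongrightarrow> 0"
    using LIMSEQ_subseq_LIMSEQ[OF lim s] by (simp add: o_def y_def)
  define Y where "Y k z = (\<Sum>c | c \<in> I \<and> 0 < \<theta> c. \<bar>D (y k) c z\<bar> powr (1 / \<theta> c))" for k z
  have Y0: "0 \<le> Y k z" for k z by (simp add: Y_def sum_nonneg)
  have powr_int: "integrable M (\<lambda>z. \<bar>D (y k) c z\<bar> powr (1 / \<theta> c))"
    "(\<integral>z. \<bar>D (y k) c z\<bar> powr (1 / \<theta> c) \<partial>M) \<le> (Ce * nm (y k)) powr (1 / \<theta> c) * Le"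
    if "c \<in> I" "0 < \<theta> c" for k c
    using dom_pow_powr_integrable[OF emb[OF y(1) that(1)] that(2), of "1 / \<theta> c"] that by auto
  have Y_int: "integrable M (Y k)" for k
    unfolding Y_def using powr_int by (intro Bochner_Integration.integrable_sum) auto
  have Y_le: "(\<integral>z. Y k z \<partial>M) \<le> (\<Sum>c | c \<in> I \<and> 0 < \<theta> c. (Ce * nm (y k)) powr (1 / \<theta> c) * Le)" for k
    unfolding Y_def using powr_int by (subst Bochner_Integration.integral_sum) (auto intro!: sum_mono)
  have "(\<lambda>k. (Ce * nm (y k)) powr (1 / \<theta> c) * Le) \<longlonglongrightarrow> 0" if "c \<in> I" "0 < \<theta> c" for c
  proof -
    have "(\<lambda>k. Ce * nm (y k)) \<longlonglongrightarrow> 0" by (rule tendsto_mult_right_zero[OF y_lim])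
    then have "(\<lambda>k. (Ce * nm (y k)) powr (1 / \<theta> c)) \<longlonglongrightarrow> 0 powr (1 / \<theta> c)"
      using that Ce y by (intro tendsto_powr') auto
    then show ?thesis using tendsto_mult_left_zero[of "\<lambda>k. (Ce * nm (y k)) powr (1 / \<theta> c)" sequentially Le] by simp
  qed
  then have "(\<lambda>k. \<Sum>c | c \<in> I \<and> 0 < \<theta> c. (Ce * nm (y k)) powr (1 / \<theta> c) * Le) \<longlonglongrightarrow> (\<Sum>c | c \<in> I \<and> 0 < \<theta> c. 0)"
    by (intro tendsto_sum) auto
  then have Y_lim: "(\<lambda>k. \<integral>z. Y k z \<partial>M) \<longlonglongrightarrow> 0"
    using Y_le Y0 by (intro tendsto_sandwich[of "\<lambda>_. 0" "\<lambda>k. \<integral>z. Y k z \<partial>M" _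
      "\<lambda>k. \<Sum>c | c \<in> I \<and> 0 < \<theta> c. (Ce * nm (y k)) powr (1 / \<theta> c) * Le"]) simp_all
  have low: "AE z in M. \<forall>c\<in>I. \<theta> c = 0 \<longrightarrow> \<bar>D (y k) c z\<bar> \<le> Ce * B" for k
  proof (intro AE_finite_allI fin)
    fix c assume c: "c \<in> I"
    show "AE z in M. \<theta> c = 0 \<longrightarrow> \<bar>D (y k) c z\<bar> \<le> Ce * B"
    proof (cases "\<theta> c = 0")
      case True
      then have "AE z in M. \<bar>D (y k) c z\<bar> \<le> Ce * nm (y k)"
        using emb[OF y(1) c, of k] dom_pow_zero_exponent by metis
      moreover have "Ce * nm (y k) \<le> Ce * B" using Ce y by (intro mult_left_mono)
      ultimately show ?thesis by (auto elim!: eventually_mono)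
    qed simp
  qed
  define f where "f k a b z = cQ (y k) a b z - cQ 0 a b z" for k a b z
  have f_eq: "f k a b z = (if a \<in> Top \<and> b \<in> Top then 0 else F2 a b z (J (y k) z) - F2 a b z (J 0 z))" for k a b z
    by (simp add: f_def cQ_def)
  have small: "\<forall>\<^sub>F k in sequentially. dom_pow M (1 - \<theta> a - \<theta> b) (f k a b) \<epsilon> (\<mu> + 1)"
    if a: "a \<in> I" and b: "b \<in> I" and \<epsilon>: "0 < \<epsilon>" for a b \<epsilon>
  proof (cases "a \<in> Top \<and> b \<in> Top")
    case True
    then have "f k a b = (\<lambda>_. 0)" for k by (simp add: f_eq fun_eq_iff)
    moreover have "dom_pow M (1 - \<theta> a - \<theta> b) (\<lambda>_. 0) \<epsilon> (\<mu> + 1)"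
      by (rule dom_pow_mono[OF dom_pow_const[OF exponent_nonneg[OF a b], of 0]]) (use \<epsilon> in auto)
    ultimately show ?thesis by simp
  next
    case False
    have f_F2: "f k a b z = F2 a b z (J (y k) z) - F2 a b z (J 0 z)" for k z using False by (auto simp: f_eq)
    let ?\<sigma> = "1 - \<theta> a - \<theta> b"
    have \<sigma>: "0 < ?\<sigma>"
    proof (cases "0 < \<theta> a \<and> 0 < \<theta> b")
      case True
      then show ?thesis using R_strict[OF a b False] R(1)[OF a b] by linarith
    next
      case False
      then show ?thesis using th(1)[OF a] th(1)[OF b] th(2)[OF a] th(2)[OF b] by linarith
    qed
    show ?thesis
    proof (rule dom_pow_eventually_small_growth[OF _ \<sigma> Y_int Y0 Y_lim _ _ _ \<epsilon>])
      show "f k a b \<in> borel_measurable M" for k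
        using F2_meas[OF y(1) a b, of k] F2_meas[OF H_zero a b] unfolding f_F2[abs_def] by measurable
      show "AE z in M. \<bar>f k a b z\<bar> powr (1 / ?\<sigma>) \<le> (2 * C) powr (1 / ?\<sigma>) * (1 + Y k z)" for k
        using gr low[of k] J_zero
      proof eventually_elim
        case (elim z)
        have "\<forall>c\<in>I. \<theta> c = 0 \<longrightarrow> \<bar>J (y k) z c\<bar> \<le> Ce * B" using elim(2) by simp
        from elim(1)[THEN bspec, THEN mp, THEN bspec, THEN bspec, OF J_in_S this a b]
        have 1: "\<bar>F2 a b z (J (y k) z)\<bar> \<le> C * (1 + Y k z) powr R a b" by (simp add: Y_def)
        have "\<forall>c\<in>I. \<theta> c = 0 \<longrightarrow> \<bar>J 0 z c\<bar> \<le> Ce * B" using elim(3) Ce B by simp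
        from elim(1)[THEN bspec, THEN mp, THEN bspec, THEN bspec, OF J_in_S this a b]
        have "\<bar>F2 a b z (J 0 z)\<bar> \<le> C * 1" by (simp add: elim(3))
        also have "\<dots> \<le> C * (1 + Y k z) powr R a b"
          using C Y0[of k z] R(1)[OF a b] by (intro mult_left_mono ge_one_powr_ge_zero) auto
        finally have "\<bar>f k a b z\<bar> \<le> (2 * C) * (1 + Y k z) powr R a b"
          using 1 unfolding f_F2 by linarith
        then have "\<bar>f k a b z\<bar> powr (1 / ?\<sigma>) \<le> ((2 * C) * (1 + Y k z) powr R a b) powr (1 / ?\<sigma>)"
          using \<sigma> by (intro powr_mono2) auto
        also have "\<dots> = (2 * C) powr (1 / ?\<sigma>) * (1 + Y k z) powr (R a b / ?\<sigma>)"
          using C by (simp add: powr_mult powr_powr)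
        also have "\<dots> \<le> (2 * C) powr (1 / ?\<sigma>) * (1 + Y k z) powr 1"
          using Y0[of k z] R(2)[OF a b] \<sigma> by (intro mult_left_mono powr_mono) auto
        finally show ?case using Y0[of k z] by simp
      qed
      show "AE z in M. (\<lambda>k. f k a b z) \<longlonglongrightarrow> 0"
        using ae unfolding f_F2 y_def by eventually_elim (use a b in simp)
    qed simp
  qed
  define K where "K = (real (card I))\<^sup>2 * (Ce\<^sup>2 * (\<mu> + 1 + Le + Le))"
  have K: "0 \<le> K" using Le by (simp add: K_def)
  have main: "\<forall>\<^sub>F k in sequentially. \<forall>u\<in>H. nm (opQ (y k) u - opQ 0 u) \<le> e * nm u" if e: "e > 0" for e
  proof -
    have e': "0 < e / (K + 1)" using e K by simp
    have "\<forall>\<^sub>F k in sequentially. \<forall>a\<in>I. \<forall>b\<in>I. dom_pow M (1 - \<theta> a - \<theta> b) (f k a b) (e / (K + 1)) (\<mu> + 1)"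
      using small[OF _ _ e'] fin by (intro eventually_ball_finite ballI) auto
    then show ?thesis
    proof eventually_elim
      case (elim k)
      have cd: "coef_dom (f k) (e / (K + 1)) (\<mu> + 1)" using elim by (simp add: coef_dom_def)
      show ?case
      proof
        fix u assume u: "u \<in> H"
        have "nm (opQ (y k) u - opQ 0 u) \<le> K * (e / (K + 1)) * nm u"
        proof (rule nm_le_of_dual_bound)
          show "opQ (y k) u - opQ 0 u \<in> H" using op_in[OF y(1) u] op_in[OF H_zero u] by simp
          fix w assume w: "w \<in> H"
          obtain N1 L1 N2 L2 where "coef_dom (cQ (y k)) N1 L1" "coef_dom (cQ 0) N2 L2"
            using coef_dom_at[OF y(1)] coef_dom_at[OF H_zero] by blast
          from bform_diff[OF this u w]
          have "ip (opQ (y k) u - opQ 0 u) w = bform (f k) u w"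
            using op_in[OF y(1) u] op_in[OF H_zero u] w by (simp add: ip_diff_left ip_op y(1) u f_def[abs_def])
          then show "\<bar>ip (opQ (y k) u - opQ 0 u) w\<bar> \<le> K * (e / (K + 1)) * nm u * nm w"
            using bform_bound[OF cd u w] by (simp add: K_def algebra_simps)
        qed (use K e u in simp)
        also have "\<dots> \<le> e * nm u"
          using K e u by (intro mult_right_mono) (auto simp: field_simps)
        finally show "nm (opQ (y k) u - opQ 0 u) \<le> e * nm u" .
      qed
    qed
  qed
  with s show ?thesis unfolding y_def by blast
qed

lemma opQ_norm_continuous:
  assumes e: "0 < e"
  shows "\<exists>d>0. \<forall>x\<in>H. nm x < d \<longrightarrow> (\<forall>u\<in>H. nm (opQ x u - opQ 0 u) \<le> e * nm u)"
proof (rule ccontr)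
  assume neg: "\<not> ?thesis"
  have "\<exists>x. x \<in> H \<and> nm x < 1 / real (Suc k) \<and> \<not> (\<forall>u\<in>H. nm (opQ x u - opQ 0 u) \<le> e * nm u)" for k
  proof -
    have "0 < 1 / real (Suc k)" by simp
    with neg show ?thesis by blast
  qed
  then obtain x where x: "\<And>k. x k \<in> H" "\<And>k. nm (x k) < 1 / real (Suc k)"
    and bad: "\<And>k. \<not> (\<forall>u\<in>H. nm (opQ (x k) u - opQ 0 u) \<le> e * nm u)" by metis
  have "(\<lambda>k. nm (x k)) \<longlonglongrightarrow> 0"
  proof (rule tendsto_sandwich[of "\<lambda>_. 0" _ _ "\<lambda>k. 1 / real (Suc k)"])
    show "(\<lambda>k. 1 / real (Suc k)) \<longlonglongrightarrow> 0" by (rule LIMSEQ_Suc[OF lim_1_over_n])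
  qed (use x in \<open>auto intro: less_imp_le always_eventually\<close>)
  from opQ_norm_continuous_subseq[where x = x, OF x(1) this]
  obtain s where "\<forall>e>0. \<forall>\<^sub>F k in sequentially. \<forall>u\<in>H. nm (opQ (x (s k)) u - opQ 0 u) \<le> e * nm u"
    by blast
  then have "\<forall>\<^sub>F k in sequentially. \<forall>u\<in>H. nm (opQ (x (s k)) u - opQ 0 u) \<le> e * nm u" using e by blast
  then obtain k where "\<forall>u\<in>H. nm (opQ (x (s k)) u - opQ 0 u) \<le> e * nm u"
    using eventually_happens'[OF sequentially_bot] by blast
  with bad show False by blast
qed

end

context nemytskii
begin

lemma common_compact_subseq:
  assumes "finite T"
    and "\<And>c \<kappa>. (c, \<kappa>) \<in> T \<Longrightarrow> c \<in> I \<and> c \<notin> Top \<and> (\<theta> c = 0 \<or> \<theta> c < \<kappa>) \<and> 0 \<le> \<kappa> \<and> \<kappa> \<le> 1"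
    and v: "\<And>k::nat. v k \<in> H" "\<And>k. nm (v k) \<le> B"
  shows "\<exists>r. strict_mono (r :: nat \<Rightarrow> nat) \<and>
    (\<forall>(c, \<kappa>)\<in>T. \<forall>e>0. \<exists>K. \<forall>j\<ge>K. \<forall>k\<ge>K. dom_pow M \<kappa> (D (v (r j) - v (r k)) c) e Le)"
  using assms(1,2)
proof (induction T rule: finite_induct)
  case empty
  show ?case by (intro exI[of _ id]) (simp add: strict_mono_def)
next
  case (insert p T)
  obtain c \<kappa> where p: "p = (c, \<kappa>)" by (cases p)
  have c: "c \<in> I" "c \<notin> Top" "\<theta> c = 0 \<or> \<theta> c < \<kappa>" "0 \<le> \<kappa>" "\<kappa> \<le> 1"
    using insert.prems[of c \<kappa>] p by auto
  have "c \<in> I \<and> c \<notin> Top \<and> (\<theta> c = 0 \<or> \<theta> c < \<kappa>) \<and> 0 \<le> \<kappa> \<and> \<kappa> \<le> 1" if "(c, \<kappa>) \<in> T" for c \<kappa>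
    using insert.prems[of c \<kappa>] that by simp
  then have "\<exists>r. strict_mono (r :: nat \<Rightarrow> nat) \<and>
    (\<forall>(c, \<kappa>)\<in>T. \<forall>e>0. \<exists>K. \<forall>j\<ge>K. \<forall>k\<ge>K. dom_pow M \<kappa> (D (v (r j) - v (r k)) c) e Le)"
    by (rule insert.IH)
  then obtain r :: "nat \<Rightarrow> nat" where r: "strict_mono r"
    and rT: "\<forall>(c, \<kappa>)\<in>T. \<forall>e>0. \<exists>K. \<forall>j\<ge>K. \<forall>k\<ge>K. dom_pow M \<kappa> (D (v (r j) - v (r k)) c) e Le"
    by blast
  obtain s :: "nat \<Rightarrow> nat" where s: "strict_mono s"
    and sp: "\<forall>e>0. \<exists>K. \<forall>j\<ge>K. \<forall>k\<ge>K. dom_pow M \<kappa> (D (v (r (s j)) - v (r (s k))) c) e Le"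
    using cpt[OF c, of "\<lambda>k. v (r k)" B] v by auto
  have "\<exists>K. \<forall>j\<ge>K. \<forall>k\<ge>K. dom_pow M \<kappa>' (D (v (r (s j)) - v (r (s k))) c') e Le"
    if cT: "(c', \<kappa>') \<in> T" and e: "e > 0" for c' \<kappa>' e
  proof -
    obtain K where K: "\<forall>j\<ge>K. \<forall>k\<ge>K. dom_pow M \<kappa>' (D (v (r j) - v (r k)) c') e Le"
      using rT cT e by blast
    have "s j \<ge> K" if "j \<ge> K" for j using seq_suble[OF s, of j] that by simp
    then show ?thesis using K by (intro exI[of _ K]) auto
  qed
  then show ?case
    using sp p strict_mono_o[OF r s] by (intro exI[of _ "\<lambda>k. r (s k)"]) (auto simp: o_def)
qed

lemma opQ_compact:
  assumes u: "u \<in> H"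
  shows "compact_op H ip (opQ u)"
  unfolding compact_op_def
proof (intro allI impI, elim conjE exE)
  fix x :: "nat \<Rightarrow> 'a" and B assume xH: "\<forall>k. x k \<in> H" and xB: "\<forall>k. nm (x k) \<le> B"
  have x: "x k \<in> H" "nm (x k) \<le> B" for k using xH xB by auto
  obtain C where C: "\<forall>v\<in>H. nm (opQ u v) \<le> C * nm v"
    using selfadjoint_ops(3)[OF u] unfolding selfadjoint_op_def by blast
  define y where "y k = opQ u (x k)" for k
  define B' where "B' = \<bar>C\<bar> * B"
  have y: "y k \<in> H" "nm (y k) \<le> B'" for k
  proof -
    show "y k \<in> H" using op_in(3)[OF u x(1)] by (simp add: y_def)
    have "nm (y k) \<le> C * nm (x k)" using C x by (simp add: y_def)
    also have "\<dots> \<le> \<bar>C\<bar> * B" using x[of k] by (intro mult_mono) auto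
    finally show "nm (y k) \<le> B'" by (simp add: B'_def)
  qed
  have B0: "0 \<le> B" using x[of 0] nm_nonneg[OF x(1), of 0] by linarith
  then have B'0: "0 \<le> B'" by (simp add: B'_def)
  define T where "T = (\<lambda>(a, b). (a, if \<theta> a = 0 then 0 else 1 - R a b - \<theta> b)) `
    {(a, b). a \<in> I \<and> b \<in> I \<and> a \<notin> Top \<and> (\<theta> a = 0 \<or> 0 < \<theta> b)}"
  have T_fin: "finite T"
    unfolding T_def by (intro finite_imageI finite_subset[OF _ finite_cartesian_product[OF fin fin]]) auto
  have T_ok: "c \<in> I \<and> c \<notin> Top \<and> (\<theta> c = 0 \<or> \<theta> c < \<kappa>) \<and> 0 \<le> \<kappa> \<and> \<kappa> \<le> 1" if cT: "(c, \<kappa>) \<in> T" for c \<kappa>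
  proof -
    obtain p where p: "p \<in> {(a, b). a \<in> I \<and> b \<in> I \<and> a \<notin> Top \<and> (\<theta> a = 0 \<or> 0 < \<theta> b)}"
      and eq: "(c, \<kappa>) = (\<lambda>(a, b). (a, if \<theta> a = 0 then 0 else 1 - R a b - \<theta> b)) p"
      using cT unfolding T_def image_iff Bex_def by blast
    define b where "b = snd p"
    have "p = (c, b)" and \<kappa>: "\<kappa> = (if \<theta> c = 0 then 0 else 1 - R c b - \<theta> b)"
      using eq by (cases p, simp add: b_def)+
    then have b: "b \<in> I" "c \<in> I" "c \<notin> Top" "\<theta> c = 0 \<or> 0 < \<theta> b" using p by simp_all
    show ?thesis
    proof (cases "\<theta> c = 0")
      case False
      then have "0 < \<theta> c" "0 < \<theta> b" using b th(1)[OF b(2)] by auto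
      then have "R c b < 1 - \<theta> c - \<theta> b" using b by (intro R_strict) auto
      then show ?thesis using False b \<kappa> R(1)[OF b(2,1)] th(1)[OF b(1)] th(1)[OF b(2)] by auto
    qed (use b \<kappa> in auto)
  qed
  obtain r :: "nat \<Rightarrow> nat" where r: "strict_mono r"
    and rT: "\<forall>(c, \<kappa>)\<in>T. \<forall>e>0. \<exists>K. \<forall>j\<ge>K. \<forall>k\<ge>K. dom_pow M \<kappa> (D (x (r j) - x (r k)) c) e Le"
    using common_compact_subseq[where v = x, OF T_fin T_ok x] by blast
  obtain s :: "nat \<Rightarrow> nat" where s: "strict_mono s"
    and sT: "\<forall>(c, \<kappa>)\<in>T. \<forall>e>0. \<exists>K. \<forall>j\<ge>K. \<forall>k\<ge>K. dom_pow M \<kappa> (D (y (r (s j)) - y (r (s k))) c) e Le"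
    using common_compact_subseq[where v = "\<lambda>k. y (r k)", OF T_fin T_ok y] by blast
  obtain N L where N: "0 \<le> N" "0 \<le> L" and dom: "\<forall>v\<in>H. nm v \<le> nm u \<longrightarrow> (\<forall>a\<in>I. \<forall>b\<in>I.
    dom_pow M (R a b) (cB v a b) N L \<and> dom_pow M (R a b) (cP v a b) N L \<and> dom_pow M (R a b) (cQ v a b) N L)"
    using coef_dom_uniform[OF nm_nonneg[OF u]] by blast
  have domQ: "dom_pow M (R a b) (cQ u a b) N L" if "a \<in> I" "b \<in> I" for a b
    using dom[rule_format, OF u order_refl that] by blast
  define q where "q k = r (s k)" for k
  have q: "strict_mono q" using strict_mono_o[OF r s] by (simp add: o_def q_def[abs_def])
  have ev: "\<exists>K. \<forall>j\<ge>K. \<forall>k\<ge>K. \<forall>(c, \<kappa>)\<in>T. dom_pow M \<kappa> (D (x (q j) - x (q k)) c) e Le \<and>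
      dom_pow M \<kappa> (D (y (q j) - y (q k)) c) e Le" if e: "e > 0" for e
  proof -
    have "\<forall>p\<in>T. \<exists>K. \<forall>j\<ge>K. \<forall>k\<ge>K. dom_pow M (snd p) (D (x (q j) - x (q k)) (fst p)) e Le \<and>
      dom_pow M (snd p) (D (y (q j) - y (q k)) (fst p)) e Le"
    proof
      fix p assume p: "p \<in> T"
      obtain K where K: "\<forall>j\<ge>K. \<forall>k\<ge>K. dom_pow M (snd p) (D (x (r j) - x (r k)) (fst p)) e Le"
        using bspec[OF rT p] e by (auto simp: case_prod_beta)
      obtain K' where K': "\<forall>j\<ge>K'. \<forall>k\<ge>K'. dom_pow M (snd p) (D (y (r (s j)) - y (r (s k))) (fst p)) e Le"
        using bspec[OF sT p] e by (auto simp: case_prod_beta)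
      have "s j \<ge> K" if "j \<ge> K" for j using seq_suble[OF s, of j] that by simp
      then show "\<exists>K. \<forall>j\<ge>K. \<forall>k\<ge>K. dom_pow M (snd p) (D (x (q j) - x (q k)) (fst p)) e Le \<and>
        dom_pow M (snd p) (D (y (q j) - y (q k)) (fst p)) e Le"
        using K K' by (intro exI[of _ "max K K'"]) (auto simp: q_def)
    qed
    then obtain K where K: "\<And>p j k. p \<in> T \<Longrightarrow> j \<ge> K p \<Longrightarrow> k \<ge> K p \<Longrightarrow>
        dom_pow M (snd p) (D (x (q j) - x (q k)) (fst p)) e Le \<and> dom_pow M (snd p) (D (y (q j) - y (q k)) (fst p)) e Le"
      unfolding bchoice_iff by blast
    have "K p \<le> (\<Sum>p\<in>T. K p)" if "p \<in> T" for p using T_fin that by (intro member_le_sum) auto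
    then show ?thesis using K by (intro exI[of _ "\<Sum>p\<in>T. K p"]) (fastforce intro: order_trans)
  qed
  define E where "E = N * (Ce * (2 * B + 2 * B')) * (L + Le + Le)"
  have E: "0 \<le> E" using N Ce Le B0 B'0 by (simp add: E_def)
  have key: "(nm (y (q j) - y (q k)))\<^sup>2 \<le> (real (card I))\<^sup>2 * (E * e)"
    if e: "e > 0" and T: "\<forall>(c, \<kappa>)\<in>T. dom_pow M \<kappa> (D (x (q j) - x (q k)) c) e Le \<and>
      dom_pow M \<kappa> (D (y (q j) - y (q k)) c) e Le" for e j k
  proof -
    let ?v = "x (q j) - x (q k)" and ?w = "y (q j) - y (q k)"
    have v: "?v \<in> H" "nm ?v \<le> 2 * B"
      using H_diff[OF x(1) x(1)] nm_triangle_diff[OF x(1) x(1), of "q j" "q k"] x(2)[of "q j"] x(2)[of "q k"] by (auto simp del: H_diff)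
    have w: "?w \<in> H" "nm ?w \<le> 2 * B'"
      using H_diff[OF y(1) y(1)] nm_triangle_diff[OF y(1) y(1), of "q j" "q k"] y(2)[of "q j"] y(2)[of "q k"] by (auto simp del: H_diff)
    have w_eq: "?w = opQ u ?v"
    proof (rule ip_eqI)
      fix z assume z: "z \<in> H"
      have "linear_to_reals H (\<lambda>v. bform (cQ u) v z)"
        using bounded_forms(3)[OF u] z unfolding bounded_form_def by blast
      then have "bform (cQ u) (?v + x (q k)) z = bform (cQ u) ?v z + bform (cQ u) (x (q k)) z"
        using v(1) x(1) unfolding linear_to_reals_def by blast
      then show "ip ?w z = ip (opQ u ?v) z"
        using op_in(3)[OF u] x z v by (simp add: y_def ip_diff_left ip_op u)
    qed (use w op_in(3)[OF u v(1)] in auto)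
    have emb_v: "dom_pow M (\<theta> c) (D ?v c) (Ce * (2 * B + 2 * B')) Le" if "c \<in> I" for c
      by (rule dom_pow_mono[OF emb[OF v(1) that]]) (use v B'0 Ce in \<open>auto intro!: mult_left_mono\<close>)
    have emb_w: "dom_pow M (\<theta> c) (D ?w c) (Ce * (2 * B + 2 * B')) Le" if "c \<in> I" for c
      by (rule dom_pow_mono[OF emb[OF w(1) that]]) (use w B0 Ce in \<open>auto intro!: mult_left_mono\<close>)
    have pair_le: "\<bar>\<integral>z. cQ u a b z * D ?v b z * D ?w a z \<partial>M\<bar> \<le> E * e" if a: "a \<in> I" and b: "b \<in> I" for a b
    proof -
      consider "a \<in> Top \<and> b \<in> Top" | "a \<notin> Top" "\<theta> a = 0 \<or> 0 < \<theta> b" | "b \<notin> Top" "\<theta> b = 0 \<or> 0 < \<theta> a"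
        using th(1)[OF a] th(1)[OF b] th(3)[of a] th(3)[of b] by force
      then show ?thesis
      proof cases
        case 1
        then show ?thesis using E e by (simp add: cQ_def)
      next
        case 2
        let ?\<kappa> = "if \<theta> a = 0 then 0 else 1 - R a b - \<theta> b"
        have inT: "(a, ?\<kappa>) \<in> T" unfolding T_def using a b 2 by (intro image_eqI[of _ _ "(a, b)"]) auto
        then have small: "dom_pow M ?\<kappa> (D ?w a) e Le" using T by blast
        have "R a b + \<theta> b + ?\<kappa> \<le> 1" using R(2)[OF a b] by auto
        from dom_pow_mult3(3)[OF finM domQ[OF a b] emb_v[OF b] small R(1)[OF a b] th(1)[OF b] _ this]
        have "\<bar>\<integral>z. cQ u a b z * D ?v b z * D ?w a z \<partial>M\<bar> \<le> N * (Ce * (2 * B + 2 * B')) * e * (L + Le + Le)"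
          using T_ok[OF inT] by blast
        then show ?thesis by (simp add: E_def algebra_simps)
      next
        case 3
        let ?\<kappa> = "if \<theta> b = 0 then 0 else 1 - R b a - \<theta> a"
        have inT: "(b, ?\<kappa>) \<in> T" unfolding T_def using a b 3 by (intro image_eqI[of _ _ "(b, a)"]) auto
        then have small: "dom_pow M ?\<kappa> (D ?v b) e Le" using T by blast
        have "R a b + ?\<kappa> + \<theta> a \<le> 1" using R(2)[OF a b] R(3)[OF a b] by auto
        from dom_pow_mult3(3)[OF finM domQ[OF a b] small emb_w[OF a] R(1)[OF a b] _ th(1)[OF a] this]
        have "\<bar>\<integral>z. cQ u a b z * D ?v b z * D ?w a z \<partial>M\<bar> \<le> N * e * (Ce * (2 * B + 2 * B')) * (L + Le + Le)"
          using T_ok[OF inT] by blast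
        then show ?thesis by (simp add: E_def algebra_simps)
      qed
    qed
    have "(nm ?w)\<^sup>2 = bform (cQ u) ?v ?w"
      using ip_op(3)[OF u v(1) w(1)] nm_sq[OF w(1)] w_eq by simp
    also have "\<dots> \<le> (real (card I))\<^sup>2 * (E * e)" using bform_le[of "cQ u" ?v ?w, OF pair_le] by linarith
    finally show ?thesis .
  qed
  have "\<exists>K. \<forall>j\<ge>K. \<forall>k\<ge>K. nm (y (q j) - y (q k)) < e" if e: "e > 0" for e
  proof -
    define F where "F = (real (card I))\<^sup>2 * E"
    have F: "0 \<le> F" using E by (simp add: F_def)
    define d where "d = e\<^sup>2 / (F + 1)"
    have d: "0 < d" "F * d < e\<^sup>2" using e F by (auto simp: d_def field_simps)
    obtain K where K: "\<forall>j\<ge>K. \<forall>k\<ge>K. \<forall>(c, \<kappa>)\<in>T. dom_pow M \<kappa> (D (x (q j) - x (q k)) c) d Le \<and>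
      dom_pow M \<kappa> (D (y (q j) - y (q k)) c) d Le" using ev[OF d(1)] by blast
    have "nm (y (q j) - y (q k)) < e" if "j \<ge> K" "k \<ge> K" for j k
    proof -
      have "(nm (y (q j) - y (q k)))\<^sup>2 \<le> F * d"
        using key[OF d(1) K[THEN spec, THEN mp, OF that(1), THEN spec, THEN mp, OF that(2)]] by (simp add: F_def mult.assoc)
      also have "\<dots> < e\<^sup>2" by (rule d(2))
      finally show ?thesis using e by (meson less_imp_le power_less_imp_less_base)
    qed
    then show ?thesis by blast
  qed
  then obtain w where "w \<in> H" "(\<lambda>k. nm (y (q k) - w)) \<longlonglongrightarrow> 0"
    using complete[of "\<lambda>k. y (q k)"] y(1) by blast
  then show "\<exists>r. \<exists>w\<in>H. strict_mono r \<and> (\<lambda>k. nm (opQ u (x (r k)) - w)) \<longlonglongrightarrow> 0"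
    using q unfolding y_def by blast
qed

theorem hypothesis_A_regular_func: "hypothesis_A_regular H ip H H func dL"
proof -
  obtain C0 where C0: "C0 > 0" "\<And>u v. u \<in> H \<Longrightarrow> v \<in> H \<Longrightarrow> C0 * (nm v)\<^sup>2 \<le> ip (opP u v) v"
    using opP_coercive by blast
  have "dense_subspace H H ip"
    unfolding dense_subspace_def using sub by (auto intro!: bexI)
  moreover have "open_in_hilbert H H ip" unfolding open_in_hilbert_def by (auto intro: exI[of _ 1])
  moreover have "positive_definite_op H ip (opP u)" if u: "u \<in> H" for u
    unfolding positive_definite_op_def
  proof (intro ballI impI)
    fix v assume v: "v \<in> H" "v \<noteq> 0"
    have "0 < C0 * (nm v)\<^sup>2" using C0(1) v ip_pos by (simp add: nm_sq)
    also have "\<dots> \<le> ip (opP u v) v" by (rule C0(2)[OF u v(1)])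
    finally show "0 < ip (opP u v) v" .
  qed
  moreover have "\<exists>grad B P Q. is_gradient H ip H dL grad \<and>
       (\<forall>x\<in>H \<inter> H.
          selfadjoint_op H ip (B x) \<and> has_gateaux_deriv H ip grad x (B x) \<and>
          (\<forall>u\<in>H. B x u = P x u + Q x u) \<and>
          selfadjoint_op H ip (P x) \<and> positive_definite_op H ip (P x) \<and>
          selfadjoint_op H ip (Q x) \<and> compact_op H ip (Q x)) \<and>
       (\<forall>\<mu>\<le>0. \<forall>e\<in>H. e \<noteq> 0 \<and> B 0 e = \<mu> *\<^sub>R e \<longrightarrow> e \<in> H) \<and>
       (\<forall>x. null_seq_in (H \<inter> H) ip x \<longrightarrow>
          (\<forall>u\<in>H. (\<lambda>k. nm (P (x k) u - P 0 u)) \<longlonglongrightarrow> 0)) \<and>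
       (\<forall>e>0. \<exists>d>0. \<forall>x\<in>H \<inter> H. nm x < d \<longrightarrow>
          (\<forall>u\<in>H. nm (Q x u - Q 0 u) \<le> e * nm u)) \<and>
       (\<forall>x. null_seq_in (H \<inter> H) ip x \<longrightarrow>
          (\<exists>C0>0. \<exists>k0. \<forall>k\<ge>k0. \<forall>u\<in>H. ip (P (x k) u) u \<ge> C0 * (nm u)\<^sup>2))"
  proof (rule exI[of _ grad], rule exI[of _ opB], rule exI[of _ opP], rule exI[of _ opQ],
      intro conjI ballI allI impI)
    show "is_gradient H ip H dL grad" by (rule is_gradient)
    show "(\<lambda>k. nm (opP (x k) u - opP 0 u)) \<longlonglongrightarrow> 0" if "null_seq_in (H \<inter> H) ip x" "u \<in> H" for x u
      using opP_strongly_continuous[of x u] that by (simp add: null_seq_in_def)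
    show "\<exists>C0>0. \<exists>k0. \<forall>k\<ge>k0. \<forall>u\<in>H. C0 * (nm u)\<^sup>2 \<le> ip (opP (x k) u) u" if "null_seq_in (H \<inter> H) ip x" for x
      using C0 that by (intro exI[of _ C0] conjI exI[of _ 0]) (auto simp: null_seq_in_def)
  qed (use selfadjoint_ops opB_gateaux opB_eq calculation opQ_compact opQ_norm_continuous in simp_all)
  ultimately show ?thesis
    unfolding hypothesis_A_regular_def using hilbert func_C1 by simp
qed

end

section \<open>Test functions and weak derivatives\<close>

definition expinv :: "nat \<Rightarrow> real \<Rightarrow> real" where
  "expinv n t = (if 0 < t then exp (- 1 / t) / t ^ n else 0)"

lemma expinv_tendsto_0: "((\<lambda>t. expinv n t) \<longlongrightarrow> 0) (at 0)"
proof -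
  have "((\<lambda>t. inverse t ^ n / exp (inverse t)) \<longlongrightarrow> 0) (at_right (0::real))"
    using filterlim_compose[OF tendsto_power_div_exp_0 filterlim_inverse_at_top_right] .
  then have "((\<lambda>t. expinv n t) \<longlongrightarrow> 0) (at_right 0)"
  proof (rule Lim_transform_eventually)
    show "\<forall>\<^sub>F t in at_right 0. inverse t ^ n / exp (inverse t) = expinv n t"
      using eventually_at_right_less[of 0]
      by eventually_elim (simp add: expinv_def exp_minus field_simps)
  qed
  moreover have "((\<lambda>t. expinv n t) \<longlongrightarrow> 0) (at_left 0)"
  proof (rule Lim_transform_eventually[OF tendsto_const])
    show "\<forall>\<^sub>F t in at_left 0. 0 = expinv n t"
      unfolding eventually_at by (auto simp: expinv_def intro: exI[of _ 1])
  qed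
  ultimately show ?thesis by (simp add: filterlim_split_at)
qed

lemma expinv_deriv: "(expinv n has_real_derivative (expinv (n + 2) t - real n * expinv (n + 1) t)) (at t)"
proof -
  consider "t > 0" | "t < 0" | "t = 0" by linarith
  then show ?thesis
  proof cases
    case 1
    have "((\<lambda>t. exp (- 1 / t) / t ^ n) has_real_derivative (expinv (n + 2) t - real n * expinv (n + 1) t)) (at t)"
    proof -
      have 2: "((\<lambda>t. exp (- 1 / t)) has_real_derivative exp (- 1 / t) / t\<^sup>2) (at t)"
        using 1 by (auto intro!: derivative_eq_intros simp: power2_eq_square)
      have 3: "((\<lambda>t. t ^ n) has_real_derivative real n * t ^ n / t) (at t)"
        using DERIV_pow[of n t] 1 by (cases n) auto
      have eq: "(E / t\<^sup>2 * p - E * (real n * p / t)) / (p * p) = E / (p * t\<^sup>2) - real n * (E / (p * t))"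
        if "p > 0" for p E
        using 1 that by (simp add: diff_divide_distrib power2_eq_square mult_ac)
      have "(exp (- 1 / t) / t\<^sup>2 * t ^ n - exp (- 1 / t) * (real n * t ^ n / t)) / (t ^ n * t ^ n)
          = expinv (n + 2) t - real n * expinv (n + 1) t"
        using 1 by (subst eq) (simp_all add: expinv_def power_add power2_eq_square mult_ac)
      then show ?thesis using DERIV_divide[OF 2 3] 1 by simp
    qed
    then show ?thesis
      by (rule has_field_derivative_transform_within_open[where S = "{0<..}"]) (use 1 in \<open>auto simp: expinv_def\<close>)
  next
    case 2
    have "((\<lambda>t. 0) has_real_derivative 0) (at t)" by simp
    then have "(expinv n has_real_derivative 0) (at t)"
      by (rule has_field_derivative_transform_within_open[where S = "{..<0}"]) (use 2 in \<open>auto simp: expinv_def\<close>)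
    then show ?thesis using 2 by (simp add: expinv_def)
  next
    case 3
    have "((\<lambda>h. (expinv n (0 + h) - expinv n 0) / h) \<longlongrightarrow> 0) (at 0)"
    proof (rule Lim_transform_eventually[OF expinv_tendsto_0[of "n + 1"]])
      show "\<forall>\<^sub>F h in at 0. expinv (n + 1) h = (expinv n (0 + h) - expinv n 0) / h"
        unfolding eventually_at by (auto simp: expinv_def field_simps intro: exI[of _ 1])
    qed
    then show ?thesis unfolding 3 DERIV_def by (simp add: expinv_def)
  qed
qed

lemma partial_eq:
  assumes "(f has_derivative f') (at x)"
  shows "partial j f x = f' (axis j 1)"
proof -
  have lin: "bounded_linear f'" using assms by (rule has_derivative_bounded_linear)
  have "((\<lambda>t. x + t *\<^sub>R axis j 1) has_derivative (\<lambda>h. h *\<^sub>R axis j 1)) (at 0)"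
    by (auto intro!: derivative_eq_intros)
  moreover have "(f has_derivative f') (at (x + 0 *\<^sub>R axis j 1))" using assms by simp
  ultimately have "((\<lambda>t. f (x + t *\<^sub>R axis j 1)) has_derivative (\<lambda>h. f' (h *\<^sub>R axis j 1))) (at 0)"
    by (rule has_derivative_compose)
  moreover have "(\<lambda>h. f' (h *\<^sub>R axis j 1)) = (\<lambda>h. h * f' (axis j 1))"
    using bounded_linear.linear[OF lin] by (simp add: linear_scale)
  ultimately have "((\<lambda>t. f (x + t *\<^sub>R axis j 1)) has_real_derivative f' (axis j 1)) (at 0)"
    by (simp add: has_field_derivative_def mult.commute[of _ "f' (axis j 1)"])
  then show ?thesis unfolding partial_def by (rule DERIV_imp_deriv)
qed

inductive bumpy :: "(real^'n::finite \<Rightarrow> real) \<Rightarrow> bool" where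
  base: "bumpy (\<lambda>x. expinv n (s * x $ i + t))"
| const: "bumpy (\<lambda>_. c)"
| add: "bumpy f \<Longrightarrow> bumpy g \<Longrightarrow> bumpy (\<lambda>x. f x + g x)"
| mult: "bumpy f \<Longrightarrow> bumpy g \<Longrightarrow> bumpy (\<lambda>x. f x * g x)"

lemma bumpy_deriv:
  fixes f :: "real^'n::finite \<Rightarrow> real"
  shows "bumpy f \<Longrightarrow> \<exists>f'. (\<forall>x. (f has_derivative f' x) (at x)) \<and> (\<forall>j. bumpy (\<lambda>x. f' x (axis j 1)))"
proof (induction rule: bumpy.induct)
  case (base n s i t)
  let ?d = "\<lambda>x::real^'n. expinv (n + 2) (s * x $ i + t) - real n * expinv (n + 1) (s * x $ i + t)"
  have "((\<lambda>x. expinv n (s * x $ i + t)) has_derivative (\<lambda>h. ?d x * (s * h $ i))) (at x)" for x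
  proof -
    have "((\<lambda>x. s * x $ i + t) has_derivative (\<lambda>h. s * h $ i)) (at x)"
      by (auto intro!: derivative_eq_intros bounded_linear_imp_has_derivative bounded_linear_vec_nth)
    moreover have "(expinv n has_derivative (\<lambda>h. ?d x * h)) (at (s * x $ i + t))"
      using expinv_deriv[of n "s * x $ i + t"] by (simp add: has_field_derivative_def)
    ultimately show ?thesis by (rule has_derivative_compose)
  qed
  moreover have "bumpy (\<lambda>x. ?d x * (s * (axis j 1 :: real^'n) $ i))" for j
  proof -
    have "bumpy (\<lambda>x::real^'n. (expinv (n + 2) (s * x $ i + t) + (- real n) * expinv (n + 1) (s * x $ i + t)) * (s * (axis j 1 :: real^'n) $ i))"
      by (intro bumpy.intros)
    then show ?thesis by simp
  qed
  ultimately show ?case by (intro exI[of _ "\<lambda>x h. ?d x * (s * h $ i)"]) auto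
next
  case (const c)
  show ?case by (intro exI[of _ "\<lambda>_ _. 0"]) (auto intro: bumpy.const)
next
  case (add f g)
  then obtain f' g' where "\<forall>x. (f has_derivative f' x) (at x)" "\<forall>j. bumpy (\<lambda>x. f' x (axis j 1))"
    "\<forall>x. (g has_derivative g' x) (at x)" "\<forall>j. bumpy (\<lambda>x. g' x (axis j 1))" by blast
  then show ?case
    by (intro exI[of _ "\<lambda>x h. f' x h + g' x h"]) (auto intro!: has_derivative_add bumpy.add)
next
  case (mult f g)
  then obtain f' g' where *: "\<forall>x. (f has_derivative f' x) (at x)" "\<forall>j. bumpy (\<lambda>x. f' x (axis j 1))"
    "\<forall>x. (g has_derivative g' x) (at x)" "\<forall>j. bumpy (\<lambda>x. g' x (axis j 1))" by blast
  then show ?case using mult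
    by (intro exI[of _ "\<lambda>x h. f x * g' x h + f' x h * g x"]) (auto intro!: has_derivative_mult bumpy.add bumpy.mult)
qed

lemma bumpy_partial: "bumpy f \<Longrightarrow> bumpy (partial j f)"
proof -
  assume "bumpy f"
  then obtain f' where f': "\<forall>x. (f has_derivative f' x) (at x)" "\<forall>j. bumpy (\<lambda>x. f' x (axis j 1))"
    using bumpy_deriv by blast
  have "partial j f = (\<lambda>x. f' x (axis j 1))" using f'(1) partial_eq by fast
  then show ?thesis using f'(2) by simp
qed

lemma bumpy_smooth: "bumpy f \<Longrightarrow> smooth f"
proof -
  assume "bumpy f"
  then have "bumpy (iter_partial is f)" for "is"
    by (induction "is") (auto simp: iter_partial_def bumpy_partial)
  then show ?thesis
    using bumpy_deriv unfolding smooth_def differentiable_def by blast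
qed

lemma bumpy_prod: "finite A \<Longrightarrow> (\<And>i. i \<in> A \<Longrightarrow> bumpy (f i)) \<Longrightarrow> bumpy (\<lambda>x. \<Prod>i\<in>A. f i x)"
  by (induction A rule: finite_induct) (auto intro: bumpy.intros)

definition box_bump :: "real^'n::finite \<Rightarrow> real^'n \<Rightarrow> nat \<Rightarrow> real^'n \<Rightarrow> real" where
  "box_bump a b k x = (\<Prod>i\<in>UNIV. expinv 0 (real (Suc k) * x $ i + - real (Suc k) * a $ i) *
     expinv 0 (- real (Suc k) * x $ i + real (Suc k) * b $ i))"

lemma expinv_0_bounds: "0 \<le> expinv 0 t" "expinv 0 t \<le> 1"
  by (auto simp: expinv_def)

lemma box_bump_bounds: "0 \<le> box_bump a b k x" "box_bump a b k x \<le> 1"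
  unfolding box_bump_def
  by (auto intro!: prod_nonneg prod_le_1 mult_nonneg_nonneg mult_le_one simp: expinv_0_bounds simp del: of_nat_Suc)

lemma box_bump_outside:
  assumes "x \<notin> box a b" shows "box_bump a b k x = 0"
proof -
  obtain i where "\<not> (a $ i < x $ i \<and> x $ i < b $ i)" using assms by (auto simp: mem_box_cart)
  then have "\<not> 0 < real (Suc k) * (x $ i - a $ i) \<or> \<not> 0 < real (Suc k) * (b $ i - x $ i)"
    by (auto simp: zero_less_mult_iff)
  then have "expinv 0 (real (Suc k) * x $ i + - real (Suc k) * a $ i) * expinv 0 (- real (Suc k) * x $ i + real (Suc k) * b $ i) = 0"
    by (auto simp: expinv_def algebra_simps simp del: of_nat_Suc)
  then show ?thesis unfolding box_bump_def by (intro prod_zero) auto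
qed

lemma test_function_box_bump:
  assumes "cbox a b \<subseteq> \<Omega>" shows "test_function \<Omega> (box_bump a b k)"
proof -
  have "bumpy (box_bump a b k)"
    unfolding box_bump_def[abs_def] by (intro bumpy_prod bumpy.mult bumpy.base) auto
  moreover have "x \<notin> cbox a b \<longrightarrow> box_bump a b k x = 0" for x
    using box_bump_outside[of x a b] box_subset_cbox by blast
  ultimately show ?thesis
    unfolding test_function_def using assms compact_cbox bumpy_smooth by blast
qed

lemma expinv_0_scaled_limit:
  assumes "0 < t" shows "(\<lambda>k. expinv 0 (real (Suc k) * t)) \<longlonglongrightarrow> 1"
proof -
  have "(\<lambda>k. 1 / real (Suc k)) \<longlonglongrightarrow> 0" by (rule LIMSEQ_Suc[OF lim_1_over_n])
  then have "(\<lambda>k. exp (- (1 / real (Suc k)) * (1 / t))) \<longlonglongrightarrow> exp (- 0 * (1 / t))"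
    by (intro tendsto_intros)
  moreover have "expinv 0 (real (Suc k) * t) = exp (- (1 / real (Suc k)) * (1 / t))" for k
    using assms by (simp add: expinv_def)
  ultimately show ?thesis by simp
qed

lemma box_bump_limit: "(\<lambda>k. box_bump a b k x) \<longlonglongrightarrow> indicat_real (box a b) x"
proof (cases "x \<in> box a b")
  case True
  have "(\<lambda>k. box_bump a b k x) \<longlonglongrightarrow> (\<Prod>i\<in>(UNIV::'a set). 1 * 1)"
    unfolding box_bump_def
  proof (intro tendsto_prod tendsto_mult)
    fix i :: 'a
    have "0 < x $ i - a $ i" "0 < b $ i - x $ i" using True by (auto simp: mem_box_cart)
    from this[THEN expinv_0_scaled_limit]
    show "(\<lambda>k. expinv 0 (real (Suc k) * x $ i + - real (Suc k) * a $ i)) \<longlonglongrightarrow> 1"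
      "(\<lambda>k. expinv 0 (- real (Suc k) * x $ i + real (Suc k) * b $ i)) \<longlonglongrightarrow> 1"
      by (simp_all add: algebra_simps)
  qed
  then show ?thesis using True by simp
next
  case False
  then show ?thesis by (simp add: box_bump_outside)
qed

lemma borel_measurable_lebesgue_on_AE:
  fixes f g :: "'a::euclidean_space \<Rightarrow> 'b::euclidean_space"
  assumes S: "S \<in> sets lebesgue" and f: "f \<in> borel_measurable (lebesgue_on S)"
    and ae: "AE x in lebesgue_on S. f x = g x"
  shows "g \<in> borel_measurable (lebesgue_on S)"
proof -
  have "AE x in lebesgue. x \<in> S \<longrightarrow> f x = g x"
    using ae S by (simp add: AE_restrict_space_iff)
  then have "AE x in lebesgue. (if x \<in> S then f x else 0) = (if x \<in> S then g x else 0)"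
    by eventually_elim auto
  with borel_measurable_if_I[OF f S] have "(\<lambda>x. if x \<in> S then g x else 0) \<in> borel_measurable lebesgue"
    by (rule borel_measurable_AE)
  then show ?thesis by (rule borel_measurable_if_D)
qed

lemma integrable_lebesgue_on_AE:
  fixes f g :: "'a::euclidean_space \<Rightarrow> real"
  assumes S: "S \<in> sets lebesgue" and f: "integrable (lebesgue_on S) f"
    and ae: "AE x in lebesgue_on S. f x = g x"
  shows "integrable (lebesgue_on S) g"
proof -
  have "g \<in> borel_measurable (lebesgue_on S)"
    by (rule borel_measurable_lebesgue_on_AE[OF S borel_measurable_integrable[OF f] ae])
  then show ?thesis using f ae integrable_cong_AE[of f _ g] by auto
qed

lemma AE_lebesgue_on_subset:
  assumes "S \<in> sets lebesgue" "T \<in> sets lebesgue" "T \<subseteq> S" "AE x in lebesgue_on S. P x"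
  shows "AE x in lebesgue_on T. P x"
proof -
  have "AE x in lebesgue. x \<in> S \<longrightarrow> P x" using assms by (simp add: AE_restrict_space_iff)
  then have "AE x in lebesgue. x \<in> T \<longrightarrow> P x" by eventually_elim (use assms(3) in auto)
  then show ?thesis using assms(2) by (simp add: AE_restrict_space_iff)
qed

lemma integrable_lebesgue_on_subset:
  fixes f :: "'a::euclidean_space \<Rightarrow> real"
  assumes S: "S \<in> sets lebesgue" and T: "T \<in> sets lebesgue" "T \<subseteq> S" and f: "integrable (lebesgue_on S) f"
  shows "integrable (lebesgue_on T) f"
proof -
  have "integrable lebesgue (\<lambda>x. indicator T x *\<^sub>R (if x \<in> S then f x else 0))"
    using f S T by (intro integrable_mult_indicator) (simp_all add: Lebesgue_Measure.integrable_restrict_UNIV)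
  moreover have "(\<lambda>x. indicator T x *\<^sub>R (if x \<in> S then f x else 0)) = (\<lambda>x. if x \<in> T then f x else 0)"
    using T by (auto simp: fun_eq_iff)
  ultimately show ?thesis using T by (simp add: Lebesgue_Measure.integrable_restrict_UNIV)
qed

lemma integrable_locally_times_bounded:
  assumes \<Omega>: "\<Omega> \<in> sets lebesgue" and u: "locally_integrable \<Omega> u" and K: "compact K" "K \<subseteq> \<Omega>"
    and \<psi>: "\<psi> \<in> borel_measurable borel" "\<And>x. \<bar>\<psi> x\<bar> \<le> C" "\<And>x. x \<notin> K \<Longrightarrow> \<psi> x = 0"
  shows "integrable (lebesgue_on \<Omega>) (\<lambda>x. u x * \<psi> x)"
proof -
  have Kl: "K \<in> sets lebesgue" using K(1) by (simp add: compact_imp_closed)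
  have u: "integrable (lebesgue_on K) u" using u K by (simp add: locally_integrable_def)
  have \<psi>K: "\<psi> \<in> borel_measurable (lebesgue_on K)"
    by (intro measurable_restrict_space1 measurable_completion) (use \<psi>(1) in simp)
  have "integrable (lebesgue_on K) (\<lambda>x. C * u x)" using u by simp
  then have "integrable (lebesgue_on K) (\<lambda>x. u x * \<psi> x)"
  proof (rule Bochner_Integration.integrable_bound)
    show "(\<lambda>x. u x * \<psi> x) \<in> borel_measurable (lebesgue_on K)"
      using borel_measurable_integrable[OF u] \<psi>K by (rule borel_measurable_times)
    have "\<bar>u x\<bar> * \<bar>\<psi> x\<bar> \<le> \<bar>C\<bar> * \<bar>u x\<bar>" for x
    proof -
      have "\<bar>\<psi> x\<bar> \<le> \<bar>C\<bar>" using \<psi>(2)[of x] by linarith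
      then have "\<bar>u x\<bar> * \<bar>\<psi> x\<bar> \<le> \<bar>u x\<bar> * \<bar>C\<bar>" by (rule mult_left_mono) simp
      then show ?thesis by (simp only: mult.commute)
    qed
    then show "AE x in lebesgue_on K. norm (u x * \<psi> x) \<le> norm (C * u x)" by (simp add: abs_mult)
  qed
  then have "integrable lebesgue (\<lambda>x. if x \<in> K then u x * \<psi> x else 0)" by (simp add: Lebesgue_Measure.integrable_restrict_UNIV Kl)
  moreover have "(\<lambda>x. if x \<in> K then u x * \<psi> x else 0) = (\<lambda>x. if x \<in> \<Omega> then u x * \<psi> x else 0)"
    using \<psi>(3) K(2) by (auto simp: fun_eq_iff)
  ultimately show ?thesis using Lebesgue_Measure.integrable_restrict_UNIV[OF \<Omega>, of "\<lambda>x. u x * \<psi> x"] by simp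
qed

lemma partial_zero_outside:
  assumes "closed K" "\<And>x. x \<notin> K \<Longrightarrow> f x = 0" "x \<notin> K"
  shows "partial j f x = 0"
proof -
  have "((\<lambda>_. 0) has_derivative (\<lambda>_. 0)) (at x)" by simp
  then have "(f has_derivative (\<lambda>_. 0)) (at x)"
    by (rule has_derivative_transform_within_open[of _ _ _ _ "- K"]) (use assms in auto)
  then show ?thesis by (simp add: partial_eq)
qed

lemma test_function_derivative:
  assumes "test_function \<Omega> \<phi>"
  obtains K C where "compact K" "K \<subseteq> \<Omega>" "\<forall>x. x \<notin> K \<longrightarrow> iter_partial is \<phi> x = 0"
    "\<forall>x. \<bar>iter_partial is \<phi> x\<bar> \<le> C" "iter_partial is \<phi> \<in> borel_measurable borel"
proof -
  obtain K where K: "compact K" "K \<subseteq> \<Omega>" "\<And>x. x \<notin> K \<Longrightarrow> \<phi> x = 0" and sm: "smooth \<phi>"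
    using assms unfolding test_function_def by blast
  have zero: "x \<notin> K \<Longrightarrow> iter_partial is \<phi> x = 0" for x "is"
  proof (induction "is" arbitrary: x)
    case Nil
    then show ?case using K(3) by (simp add: iter_partial_def)
  next
    case (Cons i "is")
    have "partial i (iter_partial is \<phi>) x = 0"
      by (rule partial_zero_outside[OF compact_imp_closed[OF K(1)] Cons.IH Cons.prems])
    then show ?case by (simp add: iter_partial_def)
  qed
  have cont: "continuous_on UNIV (iter_partial is \<phi>)"
    using sm unfolding smooth_def
    by (intro continuous_at_imp_continuous_on ballI differentiable_imp_continuous_within) auto
  then have "compact (iter_partial is \<phi> ` K)"
    using K(1) continuous_on_subset by (intro compact_continuous_image) auto
  then obtain C where "\<forall>y\<in>iter_partial is \<phi> ` K. norm y \<le> C"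
    using bounded_iff[THEN iffD1, OF compact_imp_bounded] by blast
  then have C: "\<And>x. x \<in> K \<Longrightarrow> \<bar>iter_partial is \<phi> x\<bar> \<le> C" by simp
  have "\<bar>iter_partial is \<phi> x\<bar> \<le> \<bar>C\<bar>" for x
    using C[of x] zero[of x] by (cases "x \<in> K") auto
  moreover have "iter_partial is \<phi> \<in> borel_measurable borel"
    using cont by (rule borel_measurable_continuous_onI)
  ultimately show ?thesis using that K zero by blast
qed

lemma weak_pairing_integrable:
  assumes \<Omega>: "\<Omega> \<in> sets lebesgue" and u: "locally_integrable \<Omega> u" and \<phi>: "test_function \<Omega> \<phi>"
  shows "integrable (lebesgue_on \<Omega>) (\<lambda>x. u x * mi_partial \<gamma> \<phi> x)"
    and "integrable (lebesgue_on \<Omega>) (\<lambda>x. u x * \<phi> x)"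
proof -
  have *: "integrable (lebesgue_on \<Omega>) (\<lambda>x. u x * iter_partial is \<phi> x)" for "is"
  proof -
    obtain K C where "compact K" "K \<subseteq> \<Omega>" "\<forall>x. x \<notin> K \<longrightarrow> iter_partial is \<phi> x = 0"
      "\<forall>x. \<bar>iter_partial is \<phi> x\<bar> \<le> C" "iter_partial is \<phi> \<in> borel_measurable borel"
      using test_function_derivative[OF \<phi>] .
    then show ?thesis by (intro integrable_locally_times_bounded[OF \<Omega> u]) auto
  qed
  show "integrable (lebesgue_on \<Omega>) (\<lambda>x. u x * mi_partial \<gamma> \<phi> x)" unfolding mi_partial_def by (rule *)
  show "integrable (lebesgue_on \<Omega>) (\<lambda>x. u x * \<phi> x)" using *[of "[]"] by (simp add: iter_partial_def)
qed

lemma integral_cbox_eq_zero: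
  assumes \<Omega>: "open \<Omega>" and v: "locally_integrable \<Omega> v" and sub: "cbox a b \<subseteq> \<Omega>"
    and zero: "\<And>\<phi>. test_function \<Omega> \<phi> \<Longrightarrow> (\<integral>x. v x * \<phi> x \<partial>lebesgue_on \<Omega>) = 0"
  shows "integral (cbox a b) v = 0"
proof -
  have \<Omega>l: "\<Omega> \<in> sets lebesgue" using \<Omega> by simp
  have vK: "integrable (lebesgue_on (cbox a b)) v" using v sub by (simp add: locally_integrable_def)
  have "integrable lebesgue (\<lambda>x. if x \<in> cbox a b then v x else 0)" using vK by (simp add: Lebesgue_Measure.integrable_restrict_UNIV)
  moreover have "(\<lambda>x. if x \<in> cbox a b then v x else 0) = (\<lambda>x. if x \<in> \<Omega> then v x * indicat_real (cbox a b) x else 0)"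
    using sub by (auto simp: fun_eq_iff indicator_def)
  ultimately have dom: "integrable (lebesgue_on \<Omega>) (\<lambda>x. v x * indicat_real (cbox a b) x)"
    using Lebesgue_Measure.integrable_restrict_UNIV[OF \<Omega>l, of "\<lambda>x. v x * indicat_real (cbox a b) x"] by simp
  note pair = weak_pairing_integrable(2)[OF \<Omega>l v test_function_box_bump[OF sub]]
  have lim: "(\<lambda>k. \<integral>x. v x * box_bump a b k x \<partial>lebesgue_on \<Omega>) \<longlonglongrightarrow> (\<integral>x. v x * indicat_real (box a b) x \<partial>lebesgue_on \<Omega>)"
  proof (rule integral_dominated_convergence[OF _ _ integrable_abs[OF dom]])
    show "(\<lambda>x. v x * box_bump a b k x) \<in> borel_measurable (lebesgue_on \<Omega>)" for k
      using borel_measurable_integrable[OF pair] .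
    show "AE x in lebesgue_on \<Omega>. (\<lambda>k. v x * box_bump a b k x) \<longlonglongrightarrow> v x * indicat_real (box a b) x"
      by (intro always_eventually allI tendsto_mult tendsto_const box_bump_limit)
    show "(\<lambda>x. v x * indicat_real (box a b) x) \<in> borel_measurable (lebesgue_on \<Omega>)"
      by (rule borel_measurable_LIMSEQ_metric[where f = "\<lambda>k x. v x * box_bump a b k x",
        OF borel_measurable_integrable[OF pair]]) (intro tendsto_mult tendsto_const box_bump_limit)
    show "AE x in lebesgue_on \<Omega>. norm (v x * box_bump a b k x) \<le> \<bar>v x * indicat_real (cbox a b) x\<bar>" for k
    proof (intro always_eventually allI)
      fix x
      have "\<bar>box_bump a b k x\<bar> \<le> indicat_real (cbox a b) x"
        using box_bump_bounds[of a b k x] box_bump_outside[of x a b k] box_subset_cbox[of a b]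
        by (cases "x \<in> cbox a b") auto
      then show "norm (v x * box_bump a b k x) \<le> \<bar>v x * indicat_real (cbox a b) x\<bar>"
        by (auto simp: abs_mult intro!: mult_left_mono)
    qed
  qed
  have eq0: "(\<integral>x. v x * box_bump a b k x \<partial>lebesgue_on \<Omega>) = 0" for k
    by (rule zero[OF test_function_box_bump[OF sub]])
  have "(\<integral>x. v x * indicat_real (box a b) x \<partial>lebesgue_on \<Omega>) = 0"
    by (rule LIMSEQ_unique[OF lim]) (simp add: eq0)
  also have "(\<lambda>x. v x * indicat_real (box a b) x) = (\<lambda>x. if x \<in> box a b then v x else 0)"
    by (auto simp: fun_eq_iff)
  finally have "(\<integral>x. (if x \<in> box a b then v x else 0) \<partial>lebesgue_on \<Omega>) = 0" .
  then have "(\<integral>x. v x \<partial>lebesgue_on (box a b)) = 0"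
    using integral_restrict[of "box a b" \<Omega> v] sub box_subset_cbox[of a b] \<Omega>l by simp
  moreover have "integrable (lebesgue_on (box a b)) v"
    using integrable_lebesgue_on_subset[of "cbox a b" "box a b" v] vK box_subset_cbox[of a b] by auto
  ultimately have "(v has_integral 0) (box a b)"
    using has_integral_integral_lebesgue_on[of "box a b" v] by simp
  then show ?thesis by (simp add: has_integral_open_interval integral_unique)
qed

lemma du_Bois_Reymond:
  assumes \<Omega>: "open \<Omega>" and v: "locally_integrable \<Omega> v"
    and zero: "\<And>\<phi>. test_function \<Omega> \<phi> \<Longrightarrow> (\<integral>x. v x * \<phi> x \<partial>lebesgue_on \<Omega>) = 0"
  shows "AE x in lebesgue_on \<Omega>. v x = 0"
proof -
  have box: "negligible {x \<in> cbox p q. v x \<noteq> 0}" if sub: "cbox p q \<subseteq> \<Omega>" for p q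
  proof -
    define f where "f x = (if x \<in> cbox p q then v x else 0)" for x
    have vK: "integrable (lebesgue_on (cbox p q)) v" using v sub by (simp add: locally_integrable_def)
    then have "v integrable_on cbox p q"
      using has_integral_integral_lebesgue_on[of "cbox p q" v] by auto
    then have "f integrable_on UNIV" unfolding f_def by (simp add: integrable_restrict_UNIV)
    then have "f integrable_on cbox a b" for a b by (rule integrable_on_subcbox) auto
    then obtain N where N: "negligible N" and lim: "\<And>x e. \<lbrakk>x \<notin> N; 0 < e\<rbrakk> \<Longrightarrow>
        \<exists>d>0. \<forall>h. 0 < h \<and> h < d \<longrightarrow> norm (integral (cbox x (x + h *\<^sub>R One)) f /\<^sub>R h ^ DIM(real^'a) - f x) < e"
      using integrable_ccontinuous_explicit by blast
    have "v x = 0" if x: "x \<in> box p q" "x \<notin> N" for x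
    proof (rule ccontr)
      assume "v x \<noteq> 0"
      then have "0 < \<bar>v x\<bar>" by simp
      then obtain d where d: "d > 0"
        and dl: "\<forall>h. 0 < h \<and> h < d \<longrightarrow> norm (integral (cbox x (x + h *\<^sub>R One)) f /\<^sub>R h ^ DIM(real^'a) - f x) < \<bar>v x\<bar>"
        using lim[OF x(2)] by blast
      obtain e where e: "e > 0" "ball x e \<subseteq> box p q"
        using x(1) open_box open_contains_ball by metis
      define h where "h = min (d / 2) (e / (2 * norm (One :: real^'a)))"
      have n1: "norm (One :: real^'a) > 0" by simp
      have h: "0 < h" "h < d" "h * norm (One :: real^'a) < e"
      proof -
        show "0 < h" "h < d" using d e(1) n1 by (auto simp: h_def)
        have "h * norm (One :: real^'a) \<le> (e / (2 * norm (One :: real^'a))) * norm (One :: real^'a)"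
          by (intro mult_right_mono) (auto simp: h_def)
        also have "\<dots> < e" using e(1) n1 by simp
        finally show "h * norm (One :: real^'a) < e" .
      qed
      have "x + h *\<^sub>R One \<in> ball x e" using h by (simp add: dist_norm)
      then have "x + h *\<^sub>R One \<in> box p q" using e(2) by blast
      then have cb: "cbox x (x + h *\<^sub>R One) \<subseteq> cbox p q"
        using x(1) box_subset_cbox by (intro subset_box_imp) (auto simp: mem_box)
      have "integral (cbox x (x + h *\<^sub>R One)) f = integral (cbox x (x + h *\<^sub>R One)) v"
        using cb by (intro Henstock_Kurzweil_Integration.integral_cong) (auto simp: f_def)
      also have "\<dots> = 0" by (rule integral_cbox_eq_zero[OF \<Omega> v _ zero]) (use cb sub in auto)
      finally have "norm (f x) < \<bar>v x\<bar>" using dl h by fastforce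
      then show False using x(1) box_subset_cbox[of p q] by (auto simp: f_def)
    qed
    then have "{x \<in> cbox p q. v x \<noteq> 0} \<subseteq> N \<union> (cbox p q - box p q)" by auto
    moreover have "negligible (N \<union> (cbox p q - box p q))"
      using N negligible_frontier_interval by (intro negligible_Un) auto
    ultimately show ?thesis using negligible_subset by blast
  qed
  obtain \<D> where \<D>: "countable \<D>" "\<D> \<subseteq> Pow \<Omega>" "\<And>X. X \<in> \<D> \<Longrightarrow> \<exists>a b. X = cbox a b" "\<Union>\<D> = \<Omega>"
    using open_countable_Union_open_cbox[OF \<Omega>] by metis
  have "negligible (\<Union>X\<in>\<D>. {x \<in> X. v x \<noteq> 0})"
  proof (rule negligible_countable_Union)
    show "countable ((\<lambda>X. {x \<in> X. v x \<noteq> 0}) ` \<D>)" using \<D>(1) by simp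
    fix Y assume "Y \<in> (\<lambda>X. {x \<in> X. v x \<noteq> 0}) ` \<D>"
    then obtain X where X: "X \<in> \<D>" "Y = {x \<in> X. v x \<noteq> 0}" by blast
    then obtain a b where "X = cbox a b" using \<D>(3) by blast
    then show "negligible Y" using box[of a b] X \<D>(2) by auto
  qed
  then have "(\<Union>X\<in>\<D>. {x \<in> X. v x \<noteq> 0}) \<in> null_sets lebesgue" by (simp add: negligible_iff_null_sets)
  then have "AE x in lebesgue. x \<notin> (\<Union>X\<in>\<D>. {x \<in> X. v x \<noteq> 0})" by (rule AE_not_in)
  then have "AE x in lebesgue. x \<in> \<Omega> \<longrightarrow> v x = 0" by eventually_elim (use \<D>(4) in auto)
  then show ?thesis using \<Omega> by (simp add: AE_restrict_space_iff)
qed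

section \<open>The Sobolev space as a Hilbert space\<close>

lemma (in finite_measure) integral_abs_le_of_square:
  fixes f :: "'a \<Rightarrow> real"
  assumes f: "f \<in> borel_measurable M" "integrable M (\<lambda>x. (f x)\<^sup>2)" and d: "0 < d"
  shows "integrable M f" "(\<integral>x. \<bar>f x\<bar> \<partial>M) \<le> (\<integral>x. (f x)\<^sup>2 \<partial>M) / d + d * measure M (space M)"
proof -
  have le: "\<bar>f x\<bar> \<le> (f x)\<^sup>2 / d + d" for x
  proof (cases "\<bar>f x\<bar> \<le> d")
    case False
    then have "\<bar>f x\<bar> * d \<le> \<bar>f x\<bar> * \<bar>f x\<bar>" by (intro mult_left_mono) auto
    then have "\<bar>f x\<bar> \<le> (f x)\<^sup>2 / d" using d by (simp add: pos_le_divide_eq power2_eq_square)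
    then show ?thesis using d by simp
  qed (use d in \<open>simp add: add_increasing\<close>)
  have int: "integrable M (\<lambda>x. (f x)\<^sup>2 / d + d)" using f by simp
  show f_int: "integrable M f"
    by (rule Bochner_Integration.integrable_bound[OF int f(1)]) (use le d in \<open>auto intro!: always_eventually\<close>)
  have "(\<integral>x. \<bar>f x\<bar> \<partial>M) \<le> (\<integral>x. (f x)\<^sup>2 / d + d \<partial>M)"
    using f_int int le by (intro integral_mono) auto
  also have "\<dots> = (\<integral>x. (f x)\<^sup>2 \<partial>M) / d + d * measure M (space M)" using f by simp
  finally show "(\<integral>x. \<bar>f x\<bar> \<partial>M) \<le> (\<integral>x. (f x)\<^sup>2 \<partial>M) / d + d * measure M (space M)" .
qed

lemma square_diff_integrable:
  fixes f g :: "'a \<Rightarrow> real"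
  assumes f: "f \<in> borel_measurable M" "integrable M (\<lambda>x. (f x)\<^sup>2)"
    and g: "g \<in> borel_measurable M" "integrable M (\<lambda>x. (g x)\<^sup>2)"
  shows "integrable M (\<lambda>x. (f x - g x)\<^sup>2)"
proof (rule Bochner_Integration.integrable_bound[of _ "\<lambda>x. 2 * (f x)\<^sup>2 + 2 * (g x)\<^sup>2"])
  have "(f x - g x)\<^sup>2 \<le> 2 * (f x)\<^sup>2 + 2 * (g x)\<^sup>2" for x
    using zero_le_power2[of "f x + g x"] by (simp add: power2_sum power2_diff)
  then show "AE x in M. norm ((f x - g x)\<^sup>2) \<le> norm (2 * (f x)\<^sup>2 + 2 * (g x)\<^sup>2)"
    by (intro always_eventually allI) (simp add: add_nonneg_nonneg)
  show "integrable M (\<lambda>x. 2 * (f x)\<^sup>2 + 2 * (g x)\<^sup>2)" using f g by simp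
  show "(\<lambda>x. (f x - g x)\<^sup>2) \<in> borel_measurable M" using f(1) g(1) by measurable
qed

lemma (in finite_measure) L2_complete:
  fixes f :: "nat \<Rightarrow> 'a \<Rightarrow> real"
  assumes f: "\<And>k. f k \<in> borel_measurable M" "\<And>k. integrable M (\<lambda>x. (f k x)\<^sup>2)"
    and cauchy: "\<And>e. 0 < e \<Longrightarrow> \<exists>K. \<forall>j\<ge>K. \<forall>k\<ge>K. (\<integral>x. (f j x - f k x)\<^sup>2 \<partial>M) < e"
  shows "\<exists>g. g \<in> borel_measurable M \<and> integrable M (\<lambda>x. (g x)\<^sup>2) \<and> (\<lambda>k. \<integral>x. (f k x - g x)\<^sup>2 \<partial>M) \<longlonglongrightarrow> 0"
proof -
  note diff_int = square_diff_integrable[OF f f]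
  have diff_meas: "(\<lambda>x. f j x - f k x) \<in> borel_measurable M" for j k using f(1) by measurable
  have "\<exists>N. \<forall>i\<ge>N. \<forall>j\<ge>N. (\<integral>x. norm (f i x - f j x) \<partial>M) < e" if e: "e > 0" for e
  proof -
    define s where "s = measure M (space M) + 1"
    have s: "0 < s" unfolding s_def using measure_nonneg[of M "space M"] by linarith
    define d where "d = e / (2 * s)"
    have d: "0 < d" using e s by (simp add: d_def)
    have "d * measure M (space M) \<le> d * s"
      using d by (intro mult_left_mono) (auto simp: s_def)
    also have "\<dots> = e / 2" using s by (simp add: d_def)
    finally have "d * measure M (space M) \<le> e / 2" .
    obtain K where K: "\<forall>i\<ge>K. \<forall>j\<ge>K. (\<integral>x. (f i x - f j x)\<^sup>2 \<partial>M) < d * (e / 2)"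
      using cauchy[of "d * (e / 2)"] d e by auto
    have "(\<integral>x. norm (f i x - f j x) \<partial>M) < e" if "i \<ge> K" "j \<ge> K" for i j
    proof -
      have "(\<integral>x. (f i x - f j x)\<^sup>2 \<partial>M) / d < e / 2"
        using K that d by (simp add: pos_divide_less_eq mult.commute)
      then show ?thesis
        using integral_abs_le_of_square(2)[OF diff_meas diff_int d, of i j] \<open>d * measure M (space M) \<le> e / 2\<close>
        unfolding real_norm_def by linarith
    qed
    then show ?thesis by blast
  qed
  from cauchy_L1_AE_cauchy_subseq[OF integral_abs_le_of_square(1)[OF f zero_less_one] this]
  obtain r :: "nat \<Rightarrow> nat" where r: "strict_mono r" and ae: "AE x in M. Cauchy (\<lambda>i. f (r i) x)" by metis
  define g where "g x = lim (\<lambda>i. f (r i) x)" for x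
  have g_meas: "g \<in> borel_measurable M"
    unfolding g_def by (rule borel_measurable_lim_metric) (rule f(1))
  have lim: "AE x in M. (\<lambda>i. f (r i) x) \<longlonglongrightarrow> g x"
    using ae by eventually_elim (simp add: g_def convergent_LIMSEQ_iff Cauchy_convergent_iff)
  have fatou: "integrable M (\<lambda>x. (f j x - g x)\<^sup>2) \<and> (\<integral>x. (f j x - g x)\<^sup>2 \<partial>M) \<le> e"
    if K: "\<forall>i\<ge>K. \<forall>j\<ge>K. (\<integral>x. (f i x - f j x)\<^sup>2 \<partial>M) < e" and j: "j \<ge> K" and e: "0 < e" for j K e
  proof -
    have "(\<integral>\<^sup>+x. ennreal ((f j x - g x)\<^sup>2) \<partial>M) = (\<integral>\<^sup>+x. liminf (\<lambda>i. ennreal ((f j x - f (r i) x)\<^sup>2)) \<partial>M)"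
    proof (rule nn_integral_cong_AE)
      show "AE x in M. ennreal ((f j x - g x)\<^sup>2) = liminf (\<lambda>i. ennreal ((f j x - f (r i) x)\<^sup>2))"
        using lim
      proof eventually_elim
        case (elim x)
        have "(\<lambda>i. ennreal ((f j x - f (r i) x)\<^sup>2)) \<longlonglongrightarrow> ennreal ((f j x - g x)\<^sup>2)"
          using elim by (intro tendsto_ennrealI tendsto_intros)
        then show ?case by (rule lim_imp_Liminf[OF sequentially_bot, symmetric])
      qed
    qed
    also have "\<dots> \<le> liminf (\<lambda>i. \<integral>\<^sup>+x. ennreal ((f j x - f (r i) x)\<^sup>2) \<partial>M)"
      using f(1) by (intro nn_integral_liminf) measurable
    also have "\<dots> \<le> liminf (\<lambda>i. ennreal e)"
    proof (rule Liminf_mono)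
      have "(\<integral>\<^sup>+x. ennreal ((f j x - f (r i) x)\<^sup>2) \<partial>M) \<le> ennreal e" if "i \<ge> K" for i
      proof -
        have "r i \<ge> K" using seq_suble[OF r, of i] that by simp
        then have "(\<integral>x. (f j x - f (r i) x)\<^sup>2 \<partial>M) \<le> e" using K j by (auto intro: less_imp_le)
        then show ?thesis by (simp add: nn_integral_eq_integral[OF diff_int] ennreal_leI)
      qed
      then show "\<forall>\<^sub>F i in sequentially. (\<integral>\<^sup>+x. ennreal ((f j x - f (r i) x)\<^sup>2) \<partial>M) \<le> ennreal e"
        unfolding eventually_sequentially by blast
    qed
    also have "\<dots> = ennreal e" by (simp add: Liminf_const)
    finally have le: "(\<integral>\<^sup>+x. ennreal ((f j x - g x)\<^sup>2) \<partial>M) \<le> ennreal e" .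
    have int: "integrable M (\<lambda>x. (f j x - g x)\<^sup>2)"
    proof (rule integrableI_nonneg)
      show "(\<lambda>x. (f j x - g x)\<^sup>2) \<in> borel_measurable M" using f(1) g_meas by measurable
      show "(\<integral>\<^sup>+x. ennreal ((f j x - g x)\<^sup>2) \<partial>M) < \<infinity>" using le by (simp add: le_less_trans)
    qed auto
    then have "ennreal (\<integral>x. (f j x - g x)\<^sup>2 \<partial>M) \<le> ennreal e"
      using le by (simp add: nn_integral_eq_integral)
    then show ?thesis using int e by (simp add: ennreal_le_iff)
  qed
  have conv: "(\<lambda>k. \<integral>x. (f k x - g x)\<^sup>2 \<partial>M) \<longlonglongrightarrow> 0"
  proof (rule LIMSEQ_I)
    fix e :: real assume e: "0 < e"
    obtain K where K: "\<forall>i\<ge>K. \<forall>j\<ge>K. (\<integral>x. (f i x - f j x)\<^sup>2 \<partial>M) < e / 2"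
      using cauchy[of "e / 2"] e by auto
    have "norm ((\<integral>x. (f k x - g x)\<^sup>2 \<partial>M) - 0) < e" if "k \<ge> K" for k
      using fatou[OF K that] e by (simp add: abs_of_nonneg)
    then show "\<exists>K. \<forall>k\<ge>K. norm ((\<integral>x. (f k x - g x)\<^sup>2 \<partial>M) - 0) < e" by blast
  qed
  obtain K where K: "\<forall>i\<ge>K. \<forall>j\<ge>K. (\<integral>x. (f i x - f j x)\<^sup>2 \<partial>M) < 1"
    using cauchy[of 1] by auto
  have "(\<lambda>x. f K x - g x) \<in> borel_measurable M" using f(1) g_meas by measurable
  from square_diff_integrable[OF f(1)[of K] f(2)[of K] this conjunct1[OF fatou[OF K order_refl zero_less_one]]]
  have "integrable M (\<lambda>x. (g x)\<^sup>2)" by simp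
  then show ?thesis using g_meas conv by (intro exI[of _ g]) auto
qed

lemma locally_integrable_add:
  "locally_integrable \<Omega> u \<Longrightarrow> locally_integrable \<Omega> v \<Longrightarrow> locally_integrable \<Omega> (\<lambda>x. u x + v x)"
  by (auto simp: locally_integrable_def)

lemma locally_integrable_scale: "locally_integrable \<Omega> u \<Longrightarrow> locally_integrable \<Omega> (\<lambda>x. c * u x)"
  by (auto simp: locally_integrable_def)

lemma locally_integrable_cong:
  assumes \<Omega>: "\<Omega> \<in> sets lebesgue" and u: "locally_integrable \<Omega> u" and ae: "AE x in lebesgue_on \<Omega>. u x = v x"
  shows "locally_integrable \<Omega> v"
  unfolding locally_integrable_def
proof (intro allI impI, elim conjE)
  fix K assume K: "compact K" "K \<subseteq> \<Omega>"
  then have Kl: "K \<in> sets lebesgue" by (simp add: compact_imp_closed)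
  show "integrable (lebesgue_on K) v"
    by (rule integrable_lebesgue_on_AE[OF Kl _ AE_lebesgue_on_subset[OF \<Omega> Kl K(2) ae]])
      (use u K in \<open>simp add: locally_integrable_def\<close>)
qed

locale open_domain =
  fixes \<Omega> :: "(real^'n::finite) set"
  assumes open_\<Omega>: "open \<Omega>" and bounded_\<Omega>: "bounded \<Omega>"
begin

lemma \<Omega>_sets [simp]: "\<Omega> \<in> sets lebesgue"
  using open_\<Omega> by simp

abbreviation \<Lambda> :: "(real^'n) measure" where "\<Lambda> \<equiv> lebesgue_on \<Omega>"

sublocale finite_measure \<Lambda>
  using bounded_\<Omega> by (intro finite_measure_lebesgue_on bounded_set_imp_lmeasurable) simp_all

lemma integrable_locally: "integrable \<Lambda> u \<Longrightarrow> locally_integrable \<Omega> u"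
  unfolding locally_integrable_def
  by (auto intro!: integrable_lebesgue_on_subset[of \<Omega>] simp: compact_imp_closed)

lemma weak_deriv_unique:
  assumes v: "is_weak_deriv \<Omega> \<gamma> u v" and w: "is_weak_deriv \<Omega> \<gamma> u w"
  shows "AE x in \<Lambda>. v x = w x"
proof -
  have loc: "locally_integrable \<Omega> v" "locally_integrable \<Omega> w" using v w by (auto simp: is_weak_deriv_def)
  have "locally_integrable \<Omega> (\<lambda>x. v x + (- 1) * w x)"
    using loc by (intro locally_integrable_add locally_integrable_scale)
  moreover have "(\<integral>x. (v x + (- 1) * w x) * \<phi> x \<partial>\<Lambda>) = 0" if \<phi>: "test_function \<Omega> \<phi>" for \<phi>
  proof -
    have "(-1) ^ mi_order \<gamma> * (\<integral>x. v x * \<phi> x \<partial>\<Lambda>) = (-1) ^ mi_order \<gamma> * (\<integral>x. w x * \<phi> x \<partial>\<Lambda>)"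
      using v w \<phi> by (auto simp: is_weak_deriv_def)
    then have "(\<integral>x. v x * \<phi> x \<partial>\<Lambda>) = (\<integral>x. w x * \<phi> x \<partial>\<Lambda>)" by simp
    then show ?thesis
      using weak_pairing_integrable(2)[OF \<Omega>_sets loc(1) \<phi>] weak_pairing_integrable(2)[OF \<Omega>_sets loc(2) \<phi>]
      by (simp add: left_diff_distrib)
  qed
  ultimately have "AE x in \<Lambda>. v x + (- 1) * w x = 0" by (rule du_Bois_Reymond[OF open_\<Omega>])
  then show ?thesis by eventually_elim simp
qed

lemma weak_deriv_add:
  assumes v: "is_weak_deriv \<Omega> \<gamma> u v" and v': "is_weak_deriv \<Omega> \<gamma> u' v'"
  shows "is_weak_deriv \<Omega> \<gamma> (\<lambda>x. u x + u' x) (\<lambda>x. v x + v' x)"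
proof -
  have loc: "locally_integrable \<Omega> u" "locally_integrable \<Omega> v" "locally_integrable \<Omega> u'" "locally_integrable \<Omega> v'"
    using v v' by (auto simp: is_weak_deriv_def)
  have "(\<integral>x. (u x + u' x) * mi_partial \<gamma> \<phi> x \<partial>\<Lambda>) = (-1) ^ mi_order \<gamma> * (\<integral>x. (v x + v' x) * \<phi> x \<partial>\<Lambda>)"
    if \<phi>: "test_function \<Omega> \<phi>" for \<phi>
    using v v' \<phi> weak_pairing_integrable[OF \<Omega>_sets loc(1) \<phi>] weak_pairing_integrable[OF \<Omega>_sets loc(2) \<phi>]
      weak_pairing_integrable[OF \<Omega>_sets loc(3) \<phi>] weak_pairing_integrable[OF \<Omega>_sets loc(4) \<phi>]
    by (simp add: is_weak_deriv_def distrib_right distrib_left)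
  then show ?thesis using loc by (simp add: is_weak_deriv_def locally_integrable_add)
qed

lemma weak_deriv_scale:
  assumes v: "is_weak_deriv \<Omega> \<gamma> u v"
  shows "is_weak_deriv \<Omega> \<gamma> (\<lambda>x. c * u x) (\<lambda>x. c * v x)"
  using v by (auto simp: is_weak_deriv_def locally_integrable_scale mult.assoc)

lemma weak_deriv_cong:
  assumes v: "is_weak_deriv \<Omega> \<gamma> u v" and u': "AE x in \<Lambda>. u x = u' x" and v': "AE x in \<Lambda>. v x = v' x"
  shows "is_weak_deriv \<Omega> \<gamma> u' v'"
proof -
  have loc: "locally_integrable \<Omega> u" "locally_integrable \<Omega> v" using v by (auto simp: is_weak_deriv_def)
  have loc': "locally_integrable \<Omega> u'" "locally_integrable \<Omega> v'"
    using locally_integrable_cong[OF \<Omega>_sets loc(1) u'] locally_integrable_cong[OF \<Omega>_sets loc(2) v'] .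
  have "(\<integral>x. u' x * mi_partial \<gamma> \<phi> x \<partial>\<Lambda>) = (-1) ^ mi_order \<gamma> * (\<integral>x. v' x * \<phi> x \<partial>\<Lambda>)"
    if \<phi>: "test_function \<Omega> \<phi>" for \<phi>
  proof -
    have 1: "(\<integral>x. u' x * mi_partial \<gamma> \<phi> x \<partial>\<Lambda>) = (\<integral>x. u x * mi_partial \<gamma> \<phi> x \<partial>\<Lambda>)"
      using u' by (intro integral_cong_AE borel_measurable_integrable weak_pairing_integrable \<phi> loc loc' \<Omega>_sets)
        (auto elim!: eventually_mono)
    have 2: "(\<integral>x. v' x * \<phi> x \<partial>\<Lambda>) = (\<integral>x. v x * \<phi> x \<partial>\<Lambda>)"
      using v' by (intro integral_cong_AE borel_measurable_integrable weak_pairing_integrable \<phi> loc loc' \<Omega>_sets)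
        (auto elim!: eventually_mono)
    show ?thesis unfolding 1 2 using v \<phi> by (simp add: is_weak_deriv_def)
  qed
  then show ?thesis using loc' by (simp add: is_weak_deriv_def)
qed

lemma weak_deriv_zero_order:
  assumes "locally_integrable \<Omega> u" shows "is_weak_deriv \<Omega> (\<lambda>_. 0) u u"
proof -
  have "(\<forall>i. count_list is i = (0::nat)) \<longleftrightarrow> is = []" for "is" :: "'n list"
    by (cases "is") (auto intro: exI[of _ "hd is"])
  then have "mi_partial (\<lambda>_. 0) \<phi> = \<phi>" for \<phi> :: "real^'n \<Rightarrow> real"
    by (simp add: mi_partial_def iter_partial_def)
  then show ?thesis using assms by (simp add: is_weak_deriv_def mi_order_def)
qed

lemma Lp_cong: "f \<in> Lp q \<Omega> \<Longrightarrow> AE x in \<Lambda>. f x = g x \<Longrightarrow> g \<in> Lp q \<Omega>"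
  unfolding Lp_def
  by (auto intro: borel_measurable_lebesgue_on_AE[of \<Omega> f] integrable_lebesgue_on_AE[of \<Omega> "\<lambda>x. \<bar>f x\<bar> powr q"] elim!: eventually_mono)

lemma Lp_integrable:
  assumes f: "f \<in> Lp q \<Omega>" and q: "1 \<le> q"
  shows "integrable \<Lambda> f"
proof -
  have "\<bar>f x\<bar> \<le> 1 + \<bar>f x\<bar> powr q" for x
  proof (cases "\<bar>f x\<bar> \<le> 1")
    case False
    then have "\<bar>f x\<bar> powr 1 \<le> \<bar>f x\<bar> powr q" using q by (intro powr_mono) auto
    then show ?thesis by simp
  qed (simp add: add_increasing2)
  then show ?thesis
    using f unfolding Lp_def
    by (auto intro!: Bochner_Integration.integrable_bound[of \<Lambda> "\<lambda>x. 1 + \<bar>f x\<bar> powr q" f] always_eventually simp: abs_of_nonneg add_nonneg_nonneg)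
qed

lemma Lp_locally_integrable: "f \<in> Lp q \<Omega> \<Longrightarrow> 1 \<le> q \<Longrightarrow> locally_integrable \<Omega> f"
  using Lp_integrable integrable_locally by blast

lemma Lp_scale: "f \<in> Lp q \<Omega> \<Longrightarrow> (\<lambda>x. c * f x) \<in> Lp q \<Omega>"
  unfolding Lp_def by (auto simp: abs_mult powr_mult)

lemma Lp_add:
  assumes f: "f \<in> Lp q \<Omega>" and g: "g \<in> Lp q \<Omega>" and q: "0 < q"
  shows "(\<lambda>x. f x + g x) \<in> Lp q \<Omega>"
proof -
  have [measurable]: "f \<in> borel_measurable \<Lambda>" "g \<in> borel_measurable \<Lambda>" using f g by (auto simp: Lp_def)
  have le: "\<bar>f x + g x\<bar> powr q \<le> 2 powr q * (\<bar>f x\<bar> powr q + \<bar>g x\<bar> powr q)" for x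
  proof -
    have "\<bar>f x + g x\<bar> powr q \<le> (2 * max \<bar>f x\<bar> \<bar>g x\<bar>) powr q" using q by (intro powr_mono2) auto
    also have "\<dots> = 2 powr q * (max \<bar>f x\<bar> \<bar>g x\<bar>) powr q" by (simp add: powr_mult)
    also have "(max \<bar>f x\<bar> \<bar>g x\<bar>) powr q \<le> \<bar>f x\<bar> powr q + \<bar>g x\<bar> powr q" by (simp add: max_def)
    finally show ?thesis by simp
  qed
  have "integrable \<Lambda> (\<lambda>x. \<bar>f x + g x\<bar> powr q)"
  proof (rule Bochner_Integration.integrable_bound[of _ "\<lambda>x. 2 powr q * (\<bar>f x\<bar> powr q + \<bar>g x\<bar> powr q)"])
    show "integrable \<Lambda> (\<lambda>x. 2 powr q * (\<bar>f x\<bar> powr q + \<bar>g x\<bar> powr q))" using f g by (auto simp: Lp_def)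
    show "AE x in \<Lambda>. norm (\<bar>f x + g x\<bar> powr q) \<le> norm (2 powr q * (\<bar>f x\<bar> powr q + \<bar>g x\<bar> powr q))"
      using le by (intro always_eventually allI) (simp add: abs_of_nonneg)
  qed measurable
  then show ?thesis by (simp add: Lp_def)
qed

lemma Lp_diff: "f \<in> Lp q \<Omega> \<Longrightarrow> g \<in> Lp q \<Omega> \<Longrightarrow> 0 < q \<Longrightarrow> (\<lambda>x. f x - g x) \<in> Lp q \<Omega>"
  using Lp_add[of f q "\<lambda>x. (-1) * g x"] Lp_scale[of g q "-1"] by simp

lemma is_weak_deriv_weak_deriv: "is_weak_deriv \<Omega> \<gamma> u v \<Longrightarrow> is_weak_deriv \<Omega> \<gamma> u (weak_deriv \<Omega> \<gamma> u)"
  unfolding weak_deriv_def by (rule someI[of "is_weak_deriv \<Omega> \<gamma> u"])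

lemma weak_deriv_eq: "is_weak_deriv \<Omega> \<gamma> u v \<Longrightarrow> AE x in \<Lambda>. weak_deriv \<Omega> \<gamma> u x = v x"
  by (rule weak_deriv_unique[OF is_weak_deriv_weak_deriv])

lemma sobolev_weak_deriv:
  assumes u: "u \<in> sobolev m p \<Omega>" and \<gamma>: "\<gamma> \<in> mi_le m"
  shows "is_weak_deriv \<Omega> \<gamma> u (weak_deriv \<Omega> \<gamma> u)" and "weak_deriv \<Omega> \<gamma> u \<in> Lp p \<Omega>"
proof -
  obtain v where v: "v \<in> Lp p \<Omega>" "is_weak_deriv \<Omega> \<gamma> u v" using u \<gamma> by (auto simp: sobolev_def)
  show "is_weak_deriv \<Omega> \<gamma> u (weak_deriv \<Omega> \<gamma> u)" by (rule is_weak_deriv_weak_deriv[OF v(2)])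
  show "weak_deriv \<Omega> \<gamma> u \<in> Lp p \<Omega>"
    using weak_deriv_eq[OF v(2)] by (intro Lp_cong[OF v(1)]) (auto elim!: eventually_mono)
qed

lemma sobolev_cong:
  assumes u: "u \<in> sobolev m p \<Omega>" and ae: "AE x in \<Lambda>. u x = u' x"
  shows "u' \<in> sobolev m p \<Omega>"
  using u Lp_cong[OF _ ae] weak_deriv_cong[OF _ ae AE_I2[OF refl]] unfolding sobolev_def by blast

lemma sobolev_add:
  assumes "u \<in> sobolev m p \<Omega>" "v \<in> sobolev m p \<Omega>" "0 < p"
  shows "(\<lambda>x. u x + v x) \<in> sobolev m p \<Omega>"
  using assms Lp_add weak_deriv_add unfolding sobolev_def by blast

lemma sobolev_scale:
  assumes "u \<in> sobolev m p \<Omega>"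
  shows "(\<lambda>x. c * u x) \<in> sobolev m p \<Omega>"
  using assms Lp_scale weak_deriv_scale unfolding sobolev_def by blast

lemma sobolev_norm_component:
  assumes u: "u \<in> sobolev j q \<Omega>" and \<gamma>: "\<gamma> \<in> mi_le j" and q: "1 \<le> q" and le: "sobolev_norm j q \<Omega> u \<le> b"
  shows "(\<integral>x. \<bar>weak_deriv \<Omega> \<gamma> u x\<bar> powr q \<partial>\<Lambda>) \<le> b powr q"
proof -
  let ?s = "\<Sum>\<gamma>\<in>mi_le j. \<integral>x. \<bar>weak_deriv \<Omega> \<gamma> u x\<bar> powr q \<partial>\<Lambda>"
  have "(\<integral>x. \<bar>weak_deriv \<Omega> \<gamma> u x\<bar> powr q \<partial>\<Lambda>) \<le> ?s"
    using \<gamma> finite_mi_le by (intro member_le_sum) auto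
  also have "?s = (?s powr (1 / q)) powr q" using q by (simp add: powr_powr sum_nonneg)
  also have "\<dots> \<le> b powr q"
    using le q unfolding sobolev_norm_def by (intro powr_mono2) auto
  finally show ?thesis .
qed

lemma dom_pow_weak_deriv:
  assumes emb: "sobolev_embeds m 2 j q \<Omega>" and \<gamma>: "\<gamma> \<in> mi_le j" and q: "1 \<le> q"
  shows "\<exists>C\<ge>0. \<forall>u\<in>sobolev m 2 \<Omega>. weak_deriv \<Omega> \<gamma> u \<in> Lp q \<Omega> \<and>
    (\<integral>x. \<bar>weak_deriv \<Omega> \<gamma> u x\<bar> powr q \<partial>\<Lambda>) \<le> (C * sobolev_norm m 2 \<Omega> u) powr q"
proof -
  obtain C where sub: "sobolev m 2 \<Omega> \<subseteq> sobolev j q \<Omega>"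
    and C: "\<And>u. u \<in> sobolev m 2 \<Omega> \<Longrightarrow> sobolev_norm j q \<Omega> u \<le> C * sobolev_norm m 2 \<Omega> u"
    using emb unfolding sobolev_embeds_def by blast
  have "weak_deriv \<Omega> \<gamma> u \<in> Lp q \<Omega> \<and>
      (\<integral>x. \<bar>weak_deriv \<Omega> \<gamma> u x\<bar> powr q \<partial>\<Lambda>) \<le> (\<bar>C\<bar> * sobolev_norm m 2 \<Omega> u) powr q" if u: "u \<in> sobolev m 2 \<Omega>" for u
  proof -
    have uj: "u \<in> sobolev j q \<Omega>" using sub u by blast
    have "sobolev_norm j q \<Omega> u \<le> C * sobolev_norm m 2 \<Omega> u" by (rule C[OF u])
    also have "\<dots> \<le> \<bar>C\<bar> * sobolev_norm m 2 \<Omega> u" by (intro mult_right_mono) (auto simp: sobolev_norm_def)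
    finally show ?thesis using sobolev_weak_deriv(2)[OF uj \<gamma>] sobolev_norm_component[OF uj \<gamma> q] by blast
  qed
  then show ?thesis by (intro exI[of _ "\<bar>C\<bar>"]) auto
qed

lemma compact_weak_deriv_Lp:
  assumes emb: "sobolev_embeds_compactly m 2 j q \<Omega>" and \<gamma>: "\<gamma> \<in> mi_le j" and q: "1 \<le> q"
    and u: "bounded_sobolev_seq m 2 \<Omega> u"
  shows "\<exists>r g. strict_mono (r :: nat \<Rightarrow> nat) \<and> g \<in> Lp q \<Omega> \<and> (\<forall>k. weak_deriv \<Omega> \<gamma> (u k) \<in> Lp q \<Omega>) \<and>
    (\<lambda>k. \<integral>x. \<bar>weak_deriv \<Omega> \<gamma> (u (r k)) x - g x\<bar> powr q \<partial>\<Lambda>) \<longlonglongrightarrow> 0"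
proof -
  obtain r w where r: "strict_mono (r :: nat \<Rightarrow> nat)" and w: "w \<in> sobolev j q \<Omega>"
    and lim: "(\<lambda>k. sobolev_norm j q \<Omega> (\<lambda>x. u (r k) x - w x)) \<longlonglongrightarrow> 0"
    and sub: "sobolev m 2 \<Omega> \<subseteq> sobolev j q \<Omega>"
    using emb u unfolding sobolev_embeds_compactly_def sobolev_embeds_def by blast
  have uj: "u k \<in> sobolev j q \<Omega>" for k using u sub unfolding bounded_sobolev_seq_def by blast
  define d where "d k = (\<lambda>x. u (r k) x - w x)" for k
  have d_wd: "is_weak_deriv \<Omega> \<gamma>' (d k) (\<lambda>x. weak_deriv \<Omega> \<gamma>' (u (r k)) x - weak_deriv \<Omega> \<gamma>' w x)" if "\<gamma>' \<in> mi_le j" for k \<gamma>'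
    using weak_deriv_add[OF sobolev_weak_deriv(1)[OF uj that] weak_deriv_scale[OF sobolev_weak_deriv(1)[OF w that], of "-1"]]
    by (simp add: d_def)
  have d: "d k \<in> sobolev j q \<Omega>" for k
    using sobolev_add[OF uj sobolev_scale[OF w, of "-1"]] q by (simp add: d_def)
  have eq: "(\<integral>x. \<bar>weak_deriv \<Omega> \<gamma> (d k) x\<bar> powr q \<partial>\<Lambda>) = (\<integral>x. \<bar>weak_deriv \<Omega> \<gamma> (u (r k)) x - weak_deriv \<Omega> \<gamma> w x\<bar> powr q \<partial>\<Lambda>)" for k
    using weak_deriv_eq[OF d_wd[OF \<gamma>], of k] sobolev_weak_deriv(2)[OF d \<gamma>]
      Lp_diff[OF sobolev_weak_deriv(2)[OF uj \<gamma>] sobolev_weak_deriv(2)[OF w \<gamma>]] q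
    by (intro integral_cong_AE) (auto simp: Lp_def elim!: eventually_mono)
  have le: "(\<integral>x. \<bar>weak_deriv \<Omega> \<gamma> (u (r k)) x - weak_deriv \<Omega> \<gamma> w x\<bar> powr q \<partial>\<Lambda>) \<le> sobolev_norm j q \<Omega> (d k) powr q" for k
    unfolding eq[symmetric] by (rule sobolev_norm_component[OF d \<gamma> q order_refl])
  have "(\<lambda>k. sobolev_norm j q \<Omega> (d k) powr q) \<longlonglongrightarrow> 0 powr q"
    using lim q unfolding d_def by (intro tendsto_powr') (auto simp: sobolev_norm_def)
  then have lim0: "(\<lambda>k. sobolev_norm j q \<Omega> (d k) powr q) \<longlonglongrightarrow> 0" by simp
  have "(\<lambda>k. \<integral>x. \<bar>weak_deriv \<Omega> \<gamma> (u (r k)) x - weak_deriv \<Omega> \<gamma> w x\<bar> powr q \<partial>\<Lambda>) \<longlonglongrightarrow> 0"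
    by (rule tendsto_sandwich[OF _ _ tendsto_const lim0]) (use le in auto)
  then show ?thesis using r sobolev_weak_deriv(2)[OF w \<gamma>] sobolev_weak_deriv(2)[OF uj \<gamma>] by blast
qed

end

lemma rep_abs_aefun: "AE x in lebesgue. rep_aefun (abs_aefun f) x = f x"
proof -
  have "abs_aefun (rep_aefun (abs_aefun f)) = abs_aefun f"
    by (rule Quotient3_abs_rep[OF Quotient3_aefun])
  then show ?thesis unfolding aefun.abs_eq_iff ae_eq_def .
qed

lemma abs_rep_aefun: "abs_aefun (rep_aefun u) = u"
  by (rule Quotient3_abs_rep[OF Quotient3_aefun])

lemma rep_aefun_add: "AE x in lebesgue. rep_aefun (u + v) x = rep_aefun u x + rep_aefun v x"
  using rep_abs_aefun[of "\<lambda>x. rep_aefun u x + rep_aefun v x"]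
  by (simp add: plus_aefun.abs_eq[symmetric] abs_rep_aefun)

lemma rep_aefun_scale: "AE x in lebesgue. rep_aefun (c *\<^sub>R u) x = c *\<^sub>R rep_aefun u x"
  using rep_abs_aefun[of "\<lambda>x. c *\<^sub>R rep_aefun u x"]
  by (simp add: scaleR_aefun.abs_eq[symmetric] abs_rep_aefun)

lemma product_integrable_of_squares:
  fixes f g :: "'a \<Rightarrow> real"
  assumes "f \<in> borel_measurable M" "integrable M (\<lambda>x. (f x)\<^sup>2)" "g \<in> borel_measurable M" "integrable M (\<lambda>x. (g x)\<^sup>2)"
  shows "integrable M (\<lambda>x. f x * g x)"
proof (rule Bochner_Integration.integrable_bound[of _ "\<lambda>x. (f x)\<^sup>2 + (g x)\<^sup>2"])
  have "\<bar>a * b\<bar> \<le> a\<^sup>2 + b\<^sup>2" for a b :: real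
  proof -
    have "2 * (\<bar>a\<bar> * \<bar>b\<bar>) \<le> a\<^sup>2 + b\<^sup>2"
      using zero_le_power2[of "\<bar>a\<bar> - \<bar>b\<bar>"] by (simp add: power2_diff)
    moreover have "0 \<le> \<bar>a\<bar> * \<bar>b\<bar>" by simp
    ultimately show ?thesis unfolding abs_mult by linarith
  qed
  then show "AE x in M. norm (f x * g x) \<le> norm ((f x)\<^sup>2 + (g x)\<^sup>2)"
    by (intro always_eventually allI) (simp add: abs_of_nonneg add_nonneg_nonneg)
qed (use assms in auto)

context finite_measure
begin

lemma L2_tendsto_pairing:
  fixes f :: "nat \<Rightarrow> 'a \<Rightarrow> real"
  assumes f: "\<And>k. f k \<in> borel_measurable M" "\<And>k. integrable M (\<lambda>x. (f k x)\<^sup>2)"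
    and g: "g \<in> borel_measurable M" "integrable M (\<lambda>x. (g x)\<^sup>2)"
    and lim: "(\<lambda>k. \<integral>x. (f k x - g x)\<^sup>2 \<partial>M) \<longlonglongrightarrow> 0"
    and \<psi>: "\<psi> \<in> borel_measurable M" "\<And>x. \<bar>\<psi> x\<bar> \<le> C"
  shows "(\<lambda>k. \<integral>x. f k x * \<psi> x \<partial>M) \<longlonglongrightarrow> (\<integral>x. g x * \<psi> x \<partial>M)"
proof -
  have bint: "integrable M (\<lambda>x. h x * \<psi> x)" if h: "integrable M h" for h
  proof (rule Bochner_Integration.integrable_bound[of _ "\<lambda>x. C * h x"])
    have "\<bar>h x\<bar> * \<bar>\<psi> x\<bar> \<le> \<bar>h x\<bar> * \<bar>C\<bar>" for x
      using \<psi>(2)[of x] by (intro mult_left_mono) linarith+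
    then show "AE x in M. norm (h x * \<psi> x) \<le> norm (C * h x)"
      by (intro always_eventually allI) (simp add: abs_mult mult.commute)
  qed (use h \<psi>(1) in auto)
  note diff_int = square_diff_integrable[OF f g]
  have diff_meas: "(\<lambda>x. f k x - g x) \<in> borel_measurable M" for k using f(1) g(1) by measurable
  have fi: "integrable M (f k)" and gi: "integrable M g" for k
    using integral_abs_le_of_square(1)[OF f zero_less_one] integral_abs_le_of_square(1)[OF g zero_less_one] .
  have L1: "(\<lambda>k. \<integral>x. \<bar>f k x - g x\<bar> \<partial>M) \<longlonglongrightarrow> 0"
  proof (rule LIMSEQ_I)
    fix e :: real assume e: "0 < e"
    define s where "s = measure M (space M) + 1"
    have s: "0 < s" unfolding s_def using measure_nonneg[of M "space M"] by linarith
    define d where "d = e / (2 * s)"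
    have d: "0 < d" using e s by (simp add: d_def)
    have "d * measure M (space M) \<le> d * s" using d by (intro mult_left_mono) (auto simp: s_def)
    also have "\<dots> = e / 2" using s by (simp add: d_def)
    finally have dm: "d * measure M (space M) \<le> e / 2" .
    have "0 < d * (e / 2)" using d e by simp
    from LIMSEQ_D[OF lim this] obtain K where K: "\<forall>k\<ge>K. norm ((\<integral>x. (f k x - g x)\<^sup>2 \<partial>M) - 0) < d * (e / 2)" by blast
    have "norm ((\<integral>x. \<bar>f k x - g x\<bar> \<partial>M) - 0) < e" if "k \<ge> K" for k
    proof -
      have "(\<integral>x. (f k x - g x)\<^sup>2 \<partial>M) < d * (e / 2)" using K that by auto
      then have "(\<integral>x. (f k x - g x)\<^sup>2 \<partial>M) / d < e / 2" using d by (simp add: pos_divide_less_eq mult.commute)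
      then have "(\<integral>x. \<bar>f k x - g x\<bar> \<partial>M) < e"
        using integral_abs_le_of_square(2)[OF diff_meas diff_int d, of k] dm by linarith
      then show ?thesis by simp
    qed
    then show "\<exists>K. \<forall>k\<ge>K. norm ((\<integral>x. \<bar>f k x - g x\<bar> \<partial>M) - 0) < e" by blast
  qed
  have "(\<lambda>k. (\<integral>x. f k x * \<psi> x \<partial>M) - (\<integral>x. g x * \<psi> x \<partial>M)) \<longlonglongrightarrow> 0"
  proof (rule Lim_null_comparison)
    show "(\<lambda>k. \<bar>C\<bar> * (\<integral>x. \<bar>f k x - g x\<bar> \<partial>M)) \<longlonglongrightarrow> 0" by (rule tendsto_mult_right_zero[OF L1])
    show "\<forall>\<^sub>F k in sequentially. norm ((\<integral>x. f k x * \<psi> x \<partial>M) - (\<integral>x. g x * \<psi> x \<partial>M)) \<le> \<bar>C\<bar> * (\<integral>x. \<bar>f k x - g x\<bar> \<partial>M)"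
    proof (intro always_eventually allI)
      fix k
      have "(\<integral>x. f k x * \<psi> x \<partial>M) - (\<integral>x. g x * \<psi> x \<partial>M) = (\<integral>x. (f k x - g x) * \<psi> x \<partial>M)"
        using bint[OF fi] bint[OF gi] by (simp add: left_diff_distrib)
      also have "\<bar>\<dots>\<bar> \<le> (\<integral>x. \<bar>(f k x - g x) * \<psi> x\<bar> \<partial>M)" by (rule integral_abs_bound)
      also have "\<dots> \<le> (\<integral>x. \<bar>C\<bar> * \<bar>f k x - g x\<bar> \<partial>M)"
      proof (rule integral_mono)
        show "integrable M (\<lambda>x. \<bar>(f k x - g x) * \<psi> x\<bar>)" using bint[of "\<lambda>x. f k x - g x"] fi gi by simp
        show "integrable M (\<lambda>x. \<bar>C\<bar> * \<bar>f k x - g x\<bar>)" using fi gi by simp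
        fix x
        have "\<bar>\<psi> x\<bar> * \<bar>f k x - g x\<bar> \<le> \<bar>C\<bar> * \<bar>f k x - g x\<bar>"
          using \<psi>(2)[of x] by (intro mult_right_mono) linarith+
        then show "\<bar>(f k x - g x) * \<psi> x\<bar> \<le> \<bar>C\<bar> * \<bar>f k x - g x\<bar>" by (simp add: abs_mult mult.commute)
      qed
      finally show "norm ((\<integral>x. f k x * \<psi> x \<partial>M) - (\<integral>x. g x * \<psi> x \<partial>M)) \<le> \<bar>C\<bar> * (\<integral>x. \<bar>f k x - g x\<bar> \<partial>M)" by simp
    qed
  qed
  then show ?thesis by (simp add: LIM_zero_iff)
qed

end

context open_domain
begin

lemma AE_\<Lambda>I: "AE x in lebesgue. P x \<Longrightarrow> AE x in \<Lambda>. P x"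
  by (simp add: AE_restrict_space_iff) (auto elim!: eventually_mono)

lemma Lp_2_iff: "f \<in> Lp 2 \<Omega> \<longleftrightarrow> f \<in> borel_measurable \<Lambda> \<and> integrable \<Lambda> (\<lambda>x. (f x)\<^sup>2)"
  by (simp add: Lp_def)

lemma sobolev_vec_rep:
  fixes u :: "(real^'n, real^'N::finite) aefun"
  assumes "u \<in> sobolev_vec m 2 \<Omega>"
  shows "(\<lambda>x. rep_aefun u x $ i) \<in> sobolev m 2 \<Omega>" and "AE x in lebesgue. x \<notin> \<Omega> \<longrightarrow> rep_aefun u x = 0"
proof -
  obtain f where f: "u = abs_aefun f" "\<forall>x. x \<notin> \<Omega> \<longrightarrow> f x = 0" "\<forall>i. (\<lambda>x. f x $ i) \<in> sobolev m 2 \<Omega>"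
    using assms unfolding sobolev_vec_def by blast
  have ae: "AE x in lebesgue. rep_aefun u x = f x" unfolding f(1) by (rule rep_abs_aefun)
  then show "AE x in lebesgue. x \<notin> \<Omega> \<longrightarrow> rep_aefun u x = 0"
    by eventually_elim (use f(2) in simp)
  have "AE x in \<Lambda>. f x $ i = rep_aefun u x $ i"
    using AE_\<Lambda>I[OF ae] by eventually_elim simp
  then show "(\<lambda>x. rep_aefun u x $ i) \<in> sobolev m 2 \<Omega>"
    by (rule sobolev_cong[OF f(3)[rule_format]])
qed

lemma comp_deriv_props:
  fixes u :: "(real^'n, real^'N::finite) aefun"
  assumes u: "u \<in> sobolev_vec m 2 \<Omega>" and \<alpha>: "\<alpha> \<in> mi_le m"
  shows "is_weak_deriv \<Omega> \<alpha> (\<lambda>x. rep_aefun u x $ i) (comp_deriv \<Omega> \<alpha> i u)"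
    and "comp_deriv \<Omega> \<alpha> i u \<in> borel_measurable \<Lambda>" and "integrable \<Lambda> (\<lambda>x. (comp_deriv \<Omega> \<alpha> i u x)\<^sup>2)"
  using sobolev_weak_deriv[OF sobolev_vec_rep(1)[OF u] \<alpha>] unfolding comp_deriv_def Lp_2_iff by auto

lemma comp_deriv_add:
  fixes u v :: "(real^'n, real^'N::finite) aefun"
  assumes u: "u \<in> sobolev_vec m 2 \<Omega>" and v: "v \<in> sobolev_vec m 2 \<Omega>" and \<alpha>: "\<alpha> \<in> mi_le m"
  shows "AE x in \<Lambda>. comp_deriv \<Omega> \<alpha> i (u + v) x = comp_deriv \<Omega> \<alpha> i u x + comp_deriv \<Omega> \<alpha> i v x"
  unfolding comp_deriv_def[of _ _ _ "u + v"]
proof (rule weak_deriv_eq, rule weak_deriv_cong)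
  show "is_weak_deriv \<Omega> \<alpha> (\<lambda>x. rep_aefun u x $ i + rep_aefun v x $ i) (\<lambda>x. comp_deriv \<Omega> \<alpha> i u x + comp_deriv \<Omega> \<alpha> i v x)"
    by (rule weak_deriv_add[OF comp_deriv_props(1)[OF u \<alpha>] comp_deriv_props(1)[OF v \<alpha>]])
  show "AE x in \<Lambda>. rep_aefun u x $ i + rep_aefun v x $ i = rep_aefun (u + v) x $ i"
    using AE_\<Lambda>I[OF rep_aefun_add[of u v]] by eventually_elim simp
qed simp

lemma comp_deriv_scale:
  fixes u :: "(real^'n, real^'N::finite) aefun"
  assumes u: "u \<in> sobolev_vec m 2 \<Omega>" and \<alpha>: "\<alpha> \<in> mi_le m"
  shows "AE x in \<Lambda>. comp_deriv \<Omega> \<alpha> i (c *\<^sub>R u) x = c * comp_deriv \<Omega> \<alpha> i u x"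
  unfolding comp_deriv_def[of _ _ _ "c *\<^sub>R u"]
proof (rule weak_deriv_eq, rule weak_deriv_cong)
  show "is_weak_deriv \<Omega> \<alpha> (\<lambda>x. c * rep_aefun u x $ i) (\<lambda>x. c * comp_deriv \<Omega> \<alpha> i u x)"
    by (rule weak_deriv_scale[OF comp_deriv_props(1)[OF u \<alpha>]])
  show "AE x in \<Lambda>. c * rep_aefun u x $ i = rep_aefun (c *\<^sub>R u) x $ i"
    using AE_\<Lambda>I[OF rep_aefun_scale[of c u]] by eventually_elim simp
qed simp

lemma zero_in_mi_le: "(\<lambda>_. 0) \<in> mi_le m"
  by (simp add: mi_le_def mi_order_def)

lemma comp_deriv_mult_integrable:
  fixes u v :: "(real^'n, real^'N::finite) aefun"
  assumes "u \<in> sobolev_vec m 2 \<Omega>" "v \<in> sobolev_vec m 2 \<Omega>" "\<alpha> \<in> mi_le m"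
  shows "integrable \<Lambda> (\<lambda>x. comp_deriv \<Omega> \<alpha> i u x * comp_deriv \<Omega> \<alpha> i v x)"
  by (rule product_integrable_of_squares[OF comp_deriv_props(2,3)[OF assms(1,3)] comp_deriv_props(2,3)[OF assms(2,3)]])

lemma sobolev_ip_self_eq_0:
  fixes u :: "(real^'n, real^'N::finite) aefun"
  assumes u: "u \<in> sobolev_vec m 2 \<Omega>" and zero: "sobolev_ip m \<Omega> u u = 0"
  shows "u = 0"
proof -
  have comp: "AE x in lebesgue. x \<in> \<Omega> \<longrightarrow> rep_aefun u x $ i = 0" for i
  proof -
    let ?X = "\<lambda>i \<alpha>. \<integral>x. comp_deriv \<Omega> \<alpha> i u x * comp_deriv \<Omega> \<alpha> i u x \<partial>\<Lambda>"
    have "?X i (\<lambda>_. 0) \<le> (\<Sum>\<alpha>\<in>mi_le m. ?X i \<alpha>)"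
      by (rule member_le_sum[OF zero_in_mi_le]) (simp_all add: finite_mi_le)
    also have "\<dots> \<le> (\<Sum>i\<in>UNIV. \<Sum>\<alpha>\<in>mi_le m. ?X i \<alpha>)"
      by (rule member_le_sum) (auto intro!: sum_nonneg)
    also have "\<dots> = 0" using zero by (simp add: sobolev_ip_def)
    finally have "?X i (\<lambda>_. 0) = 0" by (simp add: order_antisym)
    then have "AE x in \<Lambda>. comp_deriv \<Omega> (\<lambda>_. 0) i u x * comp_deriv \<Omega> (\<lambda>_. 0) i u x = 0"
      using integral_nonneg_eq_0_iff_AE[OF comp_deriv_mult_integrable[OF u u zero_in_mi_le, of i]] by simp
    moreover have "AE x in \<Lambda>. comp_deriv \<Omega> (\<lambda>_. 0) i u x = rep_aefun u x $ i"
      unfolding comp_deriv_def using sobolev_vec_rep(1)[OF u, of i]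
      by (intro weak_deriv_eq weak_deriv_zero_order Lp_locally_integrable[of _ 2]) (auto simp: sobolev_def)
    ultimately have "AE x in \<Lambda>. rep_aefun u x $ i = 0" by eventually_elim simp
    then show ?thesis by (simp add: AE_restrict_space_iff)
  qed
  have "AE x in lebesgue. \<forall>i. x \<in> \<Omega> \<longrightarrow> rep_aefun u x $ i = 0" 
    by (rule AE_all_countable[THEN iffD2, OF allI[OF comp]])
  with sobolev_vec_rep(2)[OF u] have "AE x in lebesgue. rep_aefun u x = 0"
    by eventually_elim (auto simp: vec_eq_iff)
  then have "abs_aefun (rep_aefun u) = abs_aefun (\<lambda>_. 0)" by (simp add: aefun.abs_eq_iff ae_eq_def)
  then show ?thesis by (simp add: abs_rep_aefun zero_aefun_def)
qed

lemma comp_deriv_diff: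
  fixes u v :: "(real^'n, real^'N::finite) aefun"
  assumes u: "u \<in> sobolev_vec m 2 \<Omega>" and v: "v \<in> sobolev_vec m 2 \<Omega>" and nv: "(-1) *\<^sub>R v \<in> sobolev_vec m 2 \<Omega>"
    and \<alpha>: "\<alpha> \<in> mi_le m"
  shows "AE x in \<Lambda>. comp_deriv \<Omega> \<alpha> i (u - v) x = comp_deriv \<Omega> \<alpha> i u x - comp_deriv \<Omega> \<alpha> i v x"
proof -
  have "AE x in \<Lambda>. comp_deriv \<Omega> \<alpha> i (u + (-1) *\<^sub>R v) x = comp_deriv \<Omega> \<alpha> i u x + comp_deriv \<Omega> \<alpha> i ((-1) *\<^sub>R v) x"
    by (rule comp_deriv_add[OF u nv \<alpha>])
  with comp_deriv_scale[OF v \<alpha>, of i "-1"] show ?thesis by eventually_elim simp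
qed

lemma sobolev_vec_scale:
  fixes u :: "(real^'n, real^'N::finite) aefun"
  assumes u: "u \<in> sobolev_vec m 2 \<Omega>"
  shows "c *\<^sub>R u \<in> sobolev_vec m 2 \<Omega>"
proof -
  obtain f where f: "u = abs_aefun f" "\<forall>x. x \<notin> \<Omega> \<longrightarrow> f x = 0" "\<forall>i. (\<lambda>x. f x $ i) \<in> sobolev m 2 \<Omega>"
    using assms unfolding sobolev_vec_def by blast
  have "c *\<^sub>R u = abs_aefun (\<lambda>x. c *\<^sub>R f x)" by (simp add: f(1) scaleR_aefun.abs_eq)
  moreover have "(\<lambda>x. (c *\<^sub>R f x) $ i) \<in> sobolev m 2 \<Omega>" for i using sobolev_scale f(3) by simp
  ultimately show ?thesis unfolding sobolev_vec_def using f(2) by auto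
qed

lemma ip_norm_diff_sq:
  fixes u v :: "(real^'n, real^'N::finite) aefun"
  assumes u: "u \<in> sobolev_vec m 2 \<Omega>" and v: "v \<in> sobolev_vec m 2 \<Omega>"
  shows "sobolev_ip m \<Omega> (u - v) (u - v) =
    (\<Sum>i\<in>UNIV. \<Sum>\<alpha>\<in>mi_le m. \<integral>x. (comp_deriv \<Omega> \<alpha> i u x - comp_deriv \<Omega> \<alpha> i v x)\<^sup>2 \<partial>\<Lambda>)"
  unfolding sobolev_ip_def
proof (intro sum.cong refl)
  fix i :: 'N and \<alpha> :: "'n mindex" assume \<alpha>: "\<alpha> \<in> mi_le m"
  have "AE x in \<Lambda>. comp_deriv \<Omega> \<alpha> i u x - comp_deriv \<Omega> \<alpha> i v x = comp_deriv \<Omega> \<alpha> i (u - v) x"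
    using comp_deriv_diff[OF u v sobolev_vec_scale[OF v] \<alpha>, of i] by eventually_elim simp
  moreover from this have "comp_deriv \<Omega> \<alpha> i (u - v) \<in> borel_measurable \<Lambda>"
    by (rule borel_measurable_lebesgue_on_AE[OF \<Omega>_sets
      borel_measurable_diff[OF comp_deriv_props(2)[OF u \<alpha>] comp_deriv_props(2)[OF v \<alpha>]]])
  ultimately show "(\<integral>x. comp_deriv \<Omega> \<alpha> i (u - v) x * comp_deriv \<Omega> \<alpha> i (u - v) x \<partial>\<Lambda>) =
      (\<integral>x. (comp_deriv \<Omega> \<alpha> i u x - comp_deriv \<Omega> \<alpha> i v x)\<^sup>2 \<partial>\<Lambda>)"
    using comp_deriv_props(2)[OF u \<alpha>, of i] comp_deriv_props(2)[OF v \<alpha>, of i]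
    by (intro integral_cong_AE) (auto simp: power2_eq_square elim!: eventually_mono)
qed

lemma sobolev_vec_complete:
  fixes x :: "nat \<Rightarrow> (real^'n, real^'N::finite) aefun"
  assumes x: "\<And>k. x k \<in> sobolev_vec m 2 \<Omega>"
    and cauchy: "\<forall>e>0. \<exists>K. \<forall>j\<ge>K. \<forall>k\<ge>K. ip_norm (sobolev_ip m \<Omega>) (x j - x k) < e"
  shows "\<exists>u\<in>sobolev_vec m 2 \<Omega>. (\<lambda>k. ip_norm (sobolev_ip m \<Omega>) (x k - u)) \<longlonglongrightarrow> 0"
proof -
  note Dm = comp_deriv_props(2)[OF x] and D2 = comp_deriv_props(3)[OF x]
  have "\<forall>i. \<forall>\<alpha>\<in>mi_le m. \<exists>g. g \<in> borel_measurable \<Lambda> \<and> integrable \<Lambda> (\<lambda>y. (g y)\<^sup>2) \<and>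
      (\<lambda>k. \<integral>y. (comp_deriv \<Omega> \<alpha> i (x k) y - g y)\<^sup>2 \<partial>\<Lambda>) \<longlonglongrightarrow> 0"
  proof (intro allI ballI)
    fix i :: 'N and \<alpha> :: "'n mindex" assume \<alpha>: "\<alpha> \<in> mi_le m"
    show "\<exists>g. g \<in> borel_measurable \<Lambda> \<and> integrable \<Lambda> (\<lambda>y. (g y)\<^sup>2) \<and>
      (\<lambda>k. \<integral>y. (comp_deriv \<Omega> \<alpha> i (x k) y - g y)\<^sup>2 \<partial>\<Lambda>) \<longlonglongrightarrow> 0"
    proof (rule L2_complete[OF Dm[OF \<alpha>] D2[OF \<alpha>]])
      fix e :: real assume e: "0 < e"
      then obtain K where K: "\<forall>j\<ge>K. \<forall>k\<ge>K. ip_norm (sobolev_ip m \<Omega>) (x j - x k) < sqrt e"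
        using cauchy[rule_format, of "sqrt e"] by auto
      have "(\<integral>y. (comp_deriv \<Omega> \<alpha> i (x j) y - comp_deriv \<Omega> \<alpha> i (x k) y)\<^sup>2 \<partial>\<Lambda>) < e" if "j \<ge> K" "k \<ge> K" for j k
      proof -
        have "(\<integral>y. (comp_deriv \<Omega> \<alpha> i (x j) y - comp_deriv \<Omega> \<alpha> i (x k) y)\<^sup>2 \<partial>\<Lambda>)
            \<le> (\<Sum>\<alpha>\<in>mi_le m. \<integral>y. (comp_deriv \<Omega> \<alpha> i (x j) y - comp_deriv \<Omega> \<alpha> i (x k) y)\<^sup>2 \<partial>\<Lambda>)"
          using \<alpha> finite_mi_le by (intro member_le_sum[of \<alpha> _ "\<lambda>\<alpha>. \<integral>y. (comp_deriv \<Omega> \<alpha> i (x j) y - comp_deriv \<Omega> \<alpha> i (x k) y)\<^sup>2 \<partial>\<Lambda>"]) auto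
        also have "\<dots> \<le> sobolev_ip m \<Omega> (x j - x k) (x j - x k)"
          unfolding ip_norm_diff_sq[OF x x]
          by (intro member_le_sum[of i UNIV "\<lambda>i. \<Sum>\<alpha>\<in>mi_le m. \<integral>y. (comp_deriv \<Omega> \<alpha> i (x j) y - comp_deriv \<Omega> \<alpha> i (x k) y)\<^sup>2 \<partial>\<Lambda>"] sum_nonneg) auto
        also have "\<dots> < e" using K that by (simp add: ip_norm_def)
        finally show ?thesis .
      qed
      then show "\<exists>K. \<forall>j\<ge>K. \<forall>k\<ge>K. (\<integral>y. (comp_deriv \<Omega> \<alpha> i (x j) y - comp_deriv \<Omega> \<alpha> i (x k) y)\<^sup>2 \<partial>\<Lambda>) < e" by blast
    qed
  qed
  then have "\<exists>g. \<forall>i. \<forall>\<alpha>\<in>mi_le m. g i \<alpha> \<in> borel_measurable \<Lambda> \<and> integrable \<Lambda> (\<lambda>y. (g i \<alpha> y)\<^sup>2) \<and>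
      (\<lambda>k. \<integral>y. (comp_deriv \<Omega> \<alpha> i (x k) y - g i \<alpha> y)\<^sup>2 \<partial>\<Lambda>) \<longlonglongrightarrow> 0"
    unfolding bchoice_iff choice_iff .
  then obtain g where g: "\<And>i \<alpha>. \<alpha> \<in> mi_le m \<Longrightarrow> g i \<alpha> \<in> borel_measurable \<Lambda>"
    "\<And>i \<alpha>. \<alpha> \<in> mi_le m \<Longrightarrow> integrable \<Lambda> (\<lambda>y. (g i \<alpha> y)\<^sup>2)"
    "\<And>i \<alpha>. \<alpha> \<in> mi_le m \<Longrightarrow> (\<lambda>k. \<integral>y. (comp_deriv \<Omega> \<alpha> i (x k) y - g i \<alpha> y)\<^sup>2 \<partial>\<Lambda>) \<longlonglongrightarrow> 0"
    by blast
  have gLp: "g i \<alpha> \<in> Lp 2 \<Omega>" if "\<alpha> \<in> mi_le m" for i \<alpha> using g that by (simp add: Lp_2_iff)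
  have wd: "is_weak_deriv \<Omega> \<alpha> (g i (\<lambda>_. 0)) (g i \<alpha>)" if \<alpha>: "\<alpha> \<in> mi_le m" for i \<alpha>
    unfolding is_weak_deriv_def
  proof (intro conjI allI impI)
    show "locally_integrable \<Omega> (g i (\<lambda>_. 0))" "locally_integrable \<Omega> (g i \<alpha>)"
      using Lp_locally_integrable[OF gLp] zero_in_mi_le \<alpha> by auto
    fix \<phi> assume \<phi>: "test_function \<Omega> \<phi>"
    have bd: "\<exists>C. (\<forall>x. \<bar>iter_partial is \<phi> x\<bar> \<le> C) \<and> iter_partial is \<phi> \<in> borel_measurable \<Lambda>" for "is"
    proof -
      obtain K C where C: "\<forall>x. \<bar>iter_partial is \<phi> x\<bar> \<le> C" "iter_partial is \<phi> \<in> borel_measurable borel"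
        using test_function_derivative[OF \<phi>] .
      have "iter_partial is \<phi> \<in> borel_measurable \<Lambda>"
        by (intro measurable_restrict_space1 measurable_completion) (use C(2) in simp)
      then show ?thesis using C(1) by blast
    qed
    obtain C where C: "\<And>x. \<bar>mi_partial \<alpha> \<phi> x\<bar> \<le> C" "mi_partial \<alpha> \<phi> \<in> borel_measurable \<Lambda>"
      using bd unfolding mi_partial_def by blast
    obtain C' where C': "\<And>x. \<bar>\<phi> x\<bar> \<le> C'" "\<phi> \<in> borel_measurable \<Lambda>"
      using bd[of "[]"] by (auto simp: iter_partial_def)
    have lim1: "(\<lambda>k. \<integral>y. comp_deriv \<Omega> (\<lambda>_. 0) i (x k) y * mi_partial \<alpha> \<phi> y \<partial>\<Lambda>) \<longlonglongrightarrow> (\<integral>y. g i (\<lambda>_. 0) y * mi_partial \<alpha> \<phi> y \<partial>\<Lambda>)"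
      by (rule L2_tendsto_pairing[OF Dm D2 g C(2,1)]) (rule zero_in_mi_le)+
    have "(\<lambda>k. \<integral>y. comp_deriv \<Omega> \<alpha> i (x k) y * \<phi> y \<partial>\<Lambda>) \<longlonglongrightarrow> (\<integral>y. g i \<alpha> y * \<phi> y \<partial>\<Lambda>)"
      by (rule L2_tendsto_pairing[OF Dm D2 g C'(2,1)]) (rule \<alpha>)+
    then have lim2: "(\<lambda>k. (-1) ^ mi_order \<alpha> * (\<integral>y. comp_deriv \<Omega> \<alpha> i (x k) y * \<phi> y \<partial>\<Lambda>)) \<longlonglongrightarrow> (-1) ^ mi_order \<alpha> * (\<integral>y. g i \<alpha> y * \<phi> y \<partial>\<Lambda>)"
      by (intro tendsto_mult tendsto_const)
    have eq: "(\<integral>y. comp_deriv \<Omega> (\<lambda>_. 0) i (x k) y * mi_partial \<alpha> \<phi> y \<partial>\<Lambda>) =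
        (-1) ^ mi_order \<alpha> * (\<integral>y. comp_deriv \<Omega> \<alpha> i (x k) y * \<phi> y \<partial>\<Lambda>)" for k
    proof -
      have "AE y in \<Lambda>. rep_aefun (x k) y $ i = comp_deriv \<Omega> (\<lambda>_. 0) i (x k) y"
      proof (rule weak_deriv_unique)
        show "is_weak_deriv \<Omega> (\<lambda>_. 0) (\<lambda>y. rep_aefun (x k) y $ i) (\<lambda>y. rep_aefun (x k) y $ i)"
          using sobolev_vec_rep(1)[OF x, of k i]
          by (intro weak_deriv_zero_order Lp_locally_integrable[of _ 2]) (auto simp: sobolev_def)
      qed (rule comp_deriv_props(1)[OF x zero_in_mi_le])
      from weak_deriv_cong[OF comp_deriv_props(1)[OF x \<alpha>] this AE_I2[OF refl]]
      show ?thesis using \<phi> by (simp add: is_weak_deriv_def)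
    qed
    show "(\<integral>y. g i (\<lambda>_. 0) y * mi_partial \<alpha> \<phi> y \<partial>\<Lambda>) = (-1) ^ mi_order \<alpha> * (\<integral>y. g i \<alpha> y * \<phi> y \<partial>\<Lambda>)"
      using LIMSEQ_unique[OF lim1[unfolded eq] lim2] .
  qed
  define f where "f y = (\<chi> i. if y \<in> \<Omega> then g i (\<lambda>_. 0) y else 0)" for y
  have f_ae: "AE y in \<Lambda>. g i (\<lambda>_. 0) y = f y $ i" for i by (rule AE_I2) (simp add: f_def)
  have f_wd: "is_weak_deriv \<Omega> \<alpha> (\<lambda>y. f y $ i) (g i \<alpha>)" if "\<alpha> \<in> mi_le m" for i \<alpha>
    by (rule weak_deriv_cong[OF wd[OF that] f_ae]) simp
  define u where "u = abs_aefun f"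
  have u: "u \<in> sobolev_vec m 2 \<Omega>"
  proof -
    have "(\<lambda>y. f y $ i) \<in> sobolev m 2 \<Omega>" for i
      unfolding sobolev_def using f_wd gLp Lp_cong[OF gLp[OF zero_in_mi_le] f_ae] by blast
    moreover have "\<forall>y. y \<notin> \<Omega> \<longrightarrow> f y = 0" by (simp add: f_def vec_eq_iff)
    ultimately show ?thesis unfolding sobolev_vec_def u_def by blast
  qed
  have D_u: "AE y in \<Lambda>. comp_deriv \<Omega> \<alpha> i u y = g i \<alpha> y" if \<alpha>: "\<alpha> \<in> mi_le m" for i \<alpha>
    unfolding comp_deriv_def
  proof (rule weak_deriv_eq, rule weak_deriv_cong[OF f_wd[OF \<alpha>]])
    show "AE y in \<Lambda>. f y $ i = rep_aefun u y $ i"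
      using AE_\<Lambda>I[OF rep_abs_aefun[of f]] unfolding u_def by eventually_elim simp
  qed simp
  have int_eq: "(\<integral>y. (comp_deriv \<Omega> \<alpha> i (x k) y - comp_deriv \<Omega> \<alpha> i u y)\<^sup>2 \<partial>\<Lambda>) = (\<integral>y. (comp_deriv \<Omega> \<alpha> i (x k) y - g i \<alpha> y)\<^sup>2 \<partial>\<Lambda>)"
    if \<alpha>: "\<alpha> \<in> mi_le m" for i \<alpha> k
    using D_u[OF \<alpha>, of i] Dm[OF \<alpha>, of i k] g(1)[OF \<alpha>, of i] comp_deriv_props(2)[OF u \<alpha>, of i]
    by (intro integral_cong_AE) (auto elim!: eventually_mono)
  have "(\<lambda>k. \<Sum>i\<in>UNIV. \<Sum>\<alpha>\<in>mi_le m. \<integral>y. (comp_deriv \<Omega> \<alpha> i (x k) y - comp_deriv \<Omega> \<alpha> i u y)\<^sup>2 \<partial>\<Lambda>)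
      \<longlonglongrightarrow> (\<Sum>i\<in>(UNIV::'N set). \<Sum>\<alpha>\<in>(mi_le m :: 'n mindex set). 0)"
    by (rule tendsto_sum, rule tendsto_sum) (simp add: int_eq g(3))
  then have "(\<lambda>k. sobolev_ip m \<Omega> (x k - u) (x k - u)) \<longlonglongrightarrow> 0"
    using ip_norm_diff_sq[OF x u] by simp
  then have "(\<lambda>k. sqrt (sobolev_ip m \<Omega> (x k - u) (x k - u))) \<longlonglongrightarrow> sqrt 0" by (rule tendsto_real_sqrt)
  then show ?thesis using u by (intro bexI[of _ u]) (simp_all add: ip_norm_def)
qed

lemma hilbert_space_closed_subspace:
  fixes H :: "(real^'n, real^'N::finite) aefun set"
  assumes H: "closed_subspace H (sobolev_vec m 2 \<Omega>) (sobolev_ip m \<Omega>)"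
  shows "hilbert_space H (sobolev_ip m \<Omega>)"
proof -
  have sub: "subspace H" and HW: "\<And>u. u \<in> H \<Longrightarrow> u \<in> sobolev_vec m 2 \<Omega>"
    and closed: "\<And>x u. \<forall>k. x k \<in> H \<Longrightarrow> u \<in> sobolev_vec m 2 \<Omega> \<Longrightarrow> (\<lambda>k. ip_norm (sobolev_ip m \<Omega>) (x k - u)) \<longlonglongrightarrow> 0 \<Longrightarrow> u \<in> H"
    using H unfolding closed_subspace_def by blast+
  have "sobolev_ip m \<Omega> u v = sobolev_ip m \<Omega> v u" for u v :: "(real^'n, real^'N) aefun"
    by (simp add: sobolev_ip_def mult.commute)
  moreover have "sobolev_ip m \<Omega> (u + v) w = sobolev_ip m \<Omega> u w + sobolev_ip m \<Omega> v w"
    if u: "u \<in> H" and v: "v \<in> H" and w: "w \<in> H" for u v w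
    unfolding sobolev_ip_def sum.distrib[symmetric]
  proof (intro sum.cong refl)
    fix i :: 'N and \<alpha> :: "'n mindex" assume \<alpha>: "\<alpha> \<in> mi_le m"
    have int: "integrable \<Lambda> (\<lambda>x. comp_deriv \<Omega> \<alpha> i u x * comp_deriv \<Omega> \<alpha> i v x)" if "u \<in> H" "v \<in> H" for u v
      using comp_deriv_mult_integrable[OF HW[OF that(1)] HW[OF that(2)] \<alpha>] .
    have "(\<integral>x. comp_deriv \<Omega> \<alpha> i (u + v) x * comp_deriv \<Omega> \<alpha> i w x \<partial>\<Lambda>) =
        (\<integral>x. comp_deriv \<Omega> \<alpha> i u x * comp_deriv \<Omega> \<alpha> i w x + comp_deriv \<Omega> \<alpha> i v x * comp_deriv \<Omega> \<alpha> i w x \<partial>\<Lambda>)"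
      using comp_deriv_add[OF HW[OF u] HW[OF v] \<alpha>, of i] int u v w subspace_add[OF sub u v]
      by (intro integral_cong_AE borel_measurable_integrable Bochner_Integration.integrable_add)
        (auto simp: distrib_right elim!: eventually_mono)
    then show "(\<integral>x. comp_deriv \<Omega> \<alpha> i (u + v) x * comp_deriv \<Omega> \<alpha> i w x \<partial>\<Lambda>) =
        (\<integral>x. comp_deriv \<Omega> \<alpha> i u x * comp_deriv \<Omega> \<alpha> i w x \<partial>\<Lambda>) + (\<integral>x. comp_deriv \<Omega> \<alpha> i v x * comp_deriv \<Omega> \<alpha> i w x \<partial>\<Lambda>)"
      using int u v w by simp
  qed
  moreover have "sobolev_ip m \<Omega> (c *\<^sub>R u) v = c * sobolev_ip m \<Omega> u v" if u: "u \<in> H" and v: "v \<in> H" for c u v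
    unfolding sobolev_ip_def sum_distrib_left
  proof (intro sum.cong refl)
    fix i :: 'N and \<alpha> :: "'n mindex" assume \<alpha>: "\<alpha> \<in> mi_le m"
    have int: "integrable \<Lambda> (\<lambda>x. comp_deriv \<Omega> \<alpha> i u x * comp_deriv \<Omega> \<alpha> i v x)" if "u \<in> H" "v \<in> H" for u v
      using comp_deriv_mult_integrable[OF HW[OF that(1)] HW[OF that(2)] \<alpha>] .
    have "(\<integral>x. comp_deriv \<Omega> \<alpha> i (c *\<^sub>R u) x * comp_deriv \<Omega> \<alpha> i v x \<partial>\<Lambda>) =
        (\<integral>x. c * (comp_deriv \<Omega> \<alpha> i u x * comp_deriv \<Omega> \<alpha> i v x) \<partial>\<Lambda>)"
      using comp_deriv_scale[OF HW[OF u] \<alpha>, of i c] int u v subspace_scale[OF sub u, of c]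
      by (intro integral_cong_AE borel_measurable_integrable integrable_mult_right)
        (auto elim!: eventually_mono)
    then show "(\<integral>x. comp_deriv \<Omega> \<alpha> i (c *\<^sub>R u) x * comp_deriv \<Omega> \<alpha> i v x \<partial>\<Lambda>) =
        c * (\<integral>x. comp_deriv \<Omega> \<alpha> i u x * comp_deriv \<Omega> \<alpha> i v x \<partial>\<Lambda>)" by simp
  qed
  moreover have "sobolev_ip m \<Omega> u u > 0" if "u \<in> H" "u \<noteq> 0" for u
  proof -
    have "0 \<le> sobolev_ip m \<Omega> u u" by (simp add: sobolev_ip_def sum_nonneg)
    then show ?thesis using sobolev_ip_self_eq_0[OF HW[OF that(1)]] that(2) by fastforce
  qed
  moreover have "\<exists>u\<in>H. (\<lambda>k. ip_norm (sobolev_ip m \<Omega>) (x k - u)) \<longlonglongrightarrow> 0"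
    if x: "\<forall>k. x k \<in> H" and c: "\<forall>e>0. \<exists>K. \<forall>j\<ge>K. \<forall>k\<ge>K. ip_norm (sobolev_ip m \<Omega>) (x j - x k) < e"
    for x :: "nat \<Rightarrow> (real^'n, real^'N) aefun"
    using sobolev_vec_complete[OF HW c] closed[OF x] x by blast
  ultimately show ?thesis unfolding hilbert_space_def using sub by blast
qed

lemma sobolev_norm_component_le:
  fixes u :: "(real^'n, real^'N::finite) aefun"
  assumes u: "u \<in> sobolev_vec m 2 \<Omega>"
  shows "sobolev_norm m 2 \<Omega> (\<lambda>x. rep_aefun u x $ i) \<le> ip_norm (sobolev_ip m \<Omega>) u"
proof -
  let ?s = "\<lambda>i. \<Sum>\<alpha>\<in>mi_le m. \<integral>x. (comp_deriv \<Omega> \<alpha> i u x)\<^sup>2 \<partial>\<Lambda>"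
  have "sobolev_norm m 2 \<Omega> (\<lambda>x. rep_aefun u x $ i) = sqrt (?s i)"
    by (simp add: sobolev_norm_def comp_deriv_def powr_half_sqrt sum_nonneg)
  also have "?s i \<le> (\<Sum>i\<in>UNIV. ?s i)" by (intro member_le_sum) (auto intro!: sum_nonneg)
  finally show ?thesis by (simp add: ip_norm_def sobolev_ip_def power2_eq_square)
qed

end

section \<open>Functions of class C1 and C2 on jets\<close>

lemma tendsto_fun_iff:
  fixes f :: "'z \<Rightarrow> 'i \<Rightarrow> 'b::topological_space"
  shows "(f \<longlongrightarrow> l) F \<longleftrightarrow> (\<forall>i. ((\<lambda>x. f x i) \<longlongrightarrow> l i) F)"
proof -
  have "(f \<longlongrightarrow> l) F \<longleftrightarrow> limitin (product_topology (\<lambda>_. euclidean) UNIV) f l F"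
    by (simp add: euclidean_product_topology)
  then show ?thesis by (simp add: limitin_componentwise)
qed

lemma mvt_between:
  fixes f :: "real \<Rightarrow> real"
  assumes "\<And>s. (f has_real_derivative f' s) (at s)"
  shows "\<exists>z. \<bar>z - a\<bar> \<le> \<bar>b - a\<bar> \<and> f b - f a = (b - a) * f' z"
proof -
  consider "a < b" | "b < a" | "a = b" by linarith
  then show ?thesis
  proof cases
    case 1
    then obtain z where "a < z" "z < b" "f b - f a = (b - a) * f' z"
      using MVT2[of a b f f'] assms by blast
    then show ?thesis by (intro exI[of _ z]) auto
  next
    case 2
    then obtain z where "b < z" "z < a" "f a - f b = (a - b) * f' z"
      using MVT2[of b a f f'] assms by blast
    then show ?thesis by (intro exI[of _ z]) (auto simp: algebra_simps)
  qed auto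
qed

lemma jet_upd_apply: "jet_upd \<xi> i \<alpha> t j \<beta> = (if j = i \<and> \<beta> = \<alpha> then t else \<xi> j \<beta>)"
  by (simp add: jet_upd_def)

lemma jet_upd_upd [simp]: "jet_upd (jet_upd \<xi> i \<alpha> s) i \<alpha> t = jet_upd \<xi> i \<alpha> t"
  by (simp add: jet_upd_def)

lemma jet_upd_self [simp]: "jet_upd \<xi> i \<alpha> (\<xi> i \<alpha>) = \<xi>"
  by (simp add: jet_upd_def)

lemma jet_upd_commute: "(i, \<alpha>) \<noteq> (j, \<beta>) \<Longrightarrow> jet_upd (jet_upd \<xi> i \<alpha> s) j \<beta> t = jet_upd (jet_upd \<xi> j \<beta> t) i \<alpha> s"
  by (auto simp: jet_upd_apply fun_eq_iff)

lemma jet_upd_in_jets: "\<xi> \<in> jets m \<Longrightarrow> \<alpha> \<in> mi_le m \<Longrightarrow> jet_upd \<xi> i \<alpha> t \<in> jets m"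
  by (auto simp: jets_def jet_upd_apply)

lemma jet_partial_has_derivative:
  assumes f: "jet_C1 m f" and \<xi>: "\<xi> \<in> jets m" and \<alpha>: "\<alpha> \<in> mi_le m"
  shows "((\<lambda>t. f (jet_upd \<xi> i \<alpha> t)) has_real_derivative jet_partial i \<alpha> f (jet_upd \<xi> i \<alpha> s)) (at s)"
proof -
  let ?\<xi> = "jet_upd \<xi> i \<alpha> s"
  have "(\<lambda>t. f (jet_upd ?\<xi> i \<alpha> t)) differentiable (at (?\<xi> i \<alpha>))"
    using f jet_upd_in_jets[OF \<xi> \<alpha>] \<alpha> unfolding jet_C1_def by blast
  then show ?thesis
    unfolding jet_partial_def by (simp add: DERIV_deriv_iff_real_differentiable jet_upd_apply)
qed

lemma jet_tendsto_compose:
  assumes f: "continuous_on (jets m) f" and \<xi>: "\<xi> \<in> jets m" and g: "\<And>x. g x \<in> jets m"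
    and lim: "\<And>i \<alpha>. ((\<lambda>x. g x i \<alpha>) \<longlongrightarrow> \<xi> i \<alpha>) F"
  shows "((\<lambda>x. f (g x)) \<longlongrightarrow> f \<xi>) F"
  using continuous_on_tendsto_compose[OF f _ \<xi>, of g F] g lim by (simp add: tendsto_fun_iff)

lemma jet_line_quotient:
  assumes f: "jet_C1 m f" and \<xi>: "\<xi> \<in> jets m" and \<eta>: "\<eta> \<in> jets m" and A: "finite A" "A \<subseteq> UNIV \<times> mi_le m"
  shows "((\<lambda>t. (f (\<lambda>i \<alpha>. \<xi> i \<alpha> + t * (if (i, \<alpha>) \<in> A then \<eta> i \<alpha> else 0)) - f \<xi>) / t) \<longlongrightarrow>
    (\<Sum>(i, \<alpha>)\<in>A. jet_partial i \<alpha> f \<xi> * \<eta> i \<alpha>)) (at 0)"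
  using A
proof (induction A rule: finite_induct)
  case empty
  then show ?case by simp
next
  case (insert a A)
  obtain i \<alpha> where a: "a = (i, \<alpha>)" by (cases a)
  have \<alpha>: "\<alpha> \<in> mi_le m" using insert.prems a by auto
  define q where "q t = (\<lambda>j \<beta>. \<xi> j \<beta> + t * (if (j, \<beta>) \<in> A then \<eta> j \<beta> else 0))" for t
  have q_in: "q t \<in> jets m" for t using \<xi> \<eta> by (auto simp: q_def jets_def)
  have q_a: "q t i \<alpha> = \<xi> i \<alpha>" for t using insert.hyps a by (simp add: q_def)
  have full: "(\<lambda>j \<beta>. \<xi> j \<beta> + t * (if (j, \<beta>) \<in> insert a A then \<eta> j \<beta> else 0)) = jet_upd (q t) i \<alpha> (\<xi> i \<alpha> + t * \<eta> i \<alpha>)" for t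
  proof (intro ext)
    fix j \<beta>
    show "\<xi> j \<beta> + t * (if (j, \<beta>) \<in> insert a A then \<eta> j \<beta> else 0) = jet_upd (q t) i \<alpha> (\<xi> i \<alpha> + t * \<eta> i \<alpha>) j \<beta>"
      using insert.hyps a by (cases "(j, \<beta>) = (i, \<alpha>)") (auto simp: q_def jet_upd_apply)
  qed
  have "\<forall>t. \<exists>z. \<bar>z - \<xi> i \<alpha>\<bar> \<le> \<bar>(\<xi> i \<alpha> + t * \<eta> i \<alpha>) - \<xi> i \<alpha>\<bar> \<and>
      f (jet_upd (q t) i \<alpha> (\<xi> i \<alpha> + t * \<eta> i \<alpha>)) - f (jet_upd (q t) i \<alpha> (\<xi> i \<alpha>)) =
      ((\<xi> i \<alpha> + t * \<eta> i \<alpha>) - \<xi> i \<alpha>) * jet_partial i \<alpha> f (jet_upd (q t) i \<alpha> z)"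
    by (intro allI mvt_between jet_partial_has_derivative[OF f q_in \<alpha>])
  then obtain z where z: "\<And>t. \<bar>z t - \<xi> i \<alpha>\<bar> \<le> \<bar>t * \<eta> i \<alpha>\<bar>"
    "\<And>t. f (jet_upd (q t) i \<alpha> (\<xi> i \<alpha> + t * \<eta> i \<alpha>)) - f (q t) = t * \<eta> i \<alpha> * jet_partial i \<alpha> f (jet_upd (q t) i \<alpha> (z t))"
    unfolding choice_iff using q_a jet_upd_self by (metis add_diff_cancel_left')
  have cont: "continuous_on (jets m) (jet_partial i \<alpha> f)" using f \<alpha> by (simp add: jet_C1_def)
  have z_lim: "(z \<longlongrightarrow> \<xi> i \<alpha>) (at 0)"
  proof (rule LIM_zero_cancel, rule Lim_null_comparison)
    show "\<forall>\<^sub>F t in at 0. norm (z t - \<xi> i \<alpha>) \<le> \<bar>t * \<eta> i \<alpha>\<bar>" using z(1) by simp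
    show "((\<lambda>t. \<bar>t * \<eta> i \<alpha>\<bar>) \<longlongrightarrow> 0) (at 0)"
      by (intro tendsto_rabs_zero tendsto_mult_left_zero tendsto_ident_at)
  qed
  have q_lim: "((\<lambda>t. q t j \<beta>) \<longlongrightarrow> \<xi> j \<beta>) (at 0)" for j \<beta>
  proof -
    have "((\<lambda>t. q t j \<beta>) \<longlongrightarrow> \<xi> j \<beta> + 0 * (if (j, \<beta>) \<in> A then \<eta> j \<beta> else 0)) (at 0)"
      unfolding q_def by (intro tendsto_intros)
    then show ?thesis by simp
  qed
  have "((\<lambda>t. jet_partial i \<alpha> f (jet_upd (q t) i \<alpha> (z t))) \<longlongrightarrow> jet_partial i \<alpha> f \<xi>) (at 0)"
  proof (rule jet_tendsto_compose[OF cont \<xi> jet_upd_in_jets[OF q_in \<alpha>]])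
    fix j \<beta>
    show "((\<lambda>t. jet_upd (q t) i \<alpha> (z t) j \<beta>) \<longlongrightarrow> \<xi> j \<beta>) (at 0)"
      using z_lim q_lim by (cases "j = i \<and> \<beta> = \<alpha>") (auto simp: jet_upd_apply)
  qed
  then have "((\<lambda>t. jet_partial i \<alpha> f (jet_upd (q t) i \<alpha> (z t)) * \<eta> i \<alpha> + (f (q t) - f \<xi>) / t) \<longlongrightarrow>
      jet_partial i \<alpha> f \<xi> * \<eta> i \<alpha> + (\<Sum>(i, \<alpha>)\<in>A. jet_partial i \<alpha> f \<xi> * \<eta> i \<alpha>)) (at 0)"
    using insert.IH insert.prems unfolding q_def by (intro tendsto_intros) auto
  then have "((\<lambda>t. (f (jet_upd (q t) i \<alpha> (\<xi> i \<alpha> + t * \<eta> i \<alpha>)) - f \<xi>) / t) \<longlongrightarrow>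
      jet_partial i \<alpha> f \<xi> * \<eta> i \<alpha> + (\<Sum>(i, \<alpha>)\<in>A. jet_partial i \<alpha> f \<xi> * \<eta> i \<alpha>)) (at 0)"
  proof (rule Lim_transform_eventually)
    show "\<forall>\<^sub>F t in at 0. jet_partial i \<alpha> f (jet_upd (q t) i \<alpha> (z t)) * \<eta> i \<alpha> + (f (q t) - f \<xi>) / t =
        (f (jet_upd (q t) i \<alpha> (\<xi> i \<alpha> + t * \<eta> i \<alpha>)) - f \<xi>) / t"
      unfolding eventually_at
    proof (intro exI[of _ 1] conjI ballI impI)
      fix t :: real assume "t \<noteq> 0 \<and> dist t 0 < 1"
      then have t: "t \<noteq> 0" by simp
      have eq: "f (jet_upd (q t) i \<alpha> (\<xi> i \<alpha> + t * \<eta> i \<alpha>)) - f \<xi> =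
          t * (jet_partial i \<alpha> f (jet_upd (q t) i \<alpha> (z t)) * \<eta> i \<alpha>) + (f (q t) - f \<xi>)"
        using z(2)[of t] by (simp add: mult_ac)
      show "jet_partial i \<alpha> f (jet_upd (q t) i \<alpha> (z t)) * \<eta> i \<alpha> + (f (q t) - f \<xi>) / t =
        (f (jet_upd (q t) i \<alpha> (\<xi> i \<alpha> + t * \<eta> i \<alpha>)) - f \<xi>) / t"
        unfolding eq using t by (simp add: add_divide_distrib)
    qed simp
  qed
  then show ?case unfolding full using insert.hyps a by simp
qed

lemma jet_line_derivative:
  assumes f: "jet_C1 m f" and \<xi>: "\<xi> \<in> jets m" and \<eta>: "\<eta> \<in> jets m"
  shows "((\<lambda>t. f (\<lambda>i \<alpha>. \<xi> i \<alpha> + t * \<eta> i \<alpha>)) has_real_derivative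
    (\<Sum>(i, \<alpha>)\<in>(UNIV :: 'N::finite set) \<times> mi_le m. jet_partial i \<alpha> f \<xi> * \<eta> i \<alpha>)) (at 0)"
proof -
  have "(\<lambda>i \<alpha>. \<xi> i \<alpha> + t * (if (i, \<alpha>) \<in> (UNIV :: 'N set) \<times> mi_le m then \<eta> i \<alpha> else 0)) = (\<lambda>i \<alpha>. \<xi> i \<alpha> + t * \<eta> i \<alpha>)" for t
    using \<eta> by (auto simp: jets_def fun_eq_iff)
  with jet_line_quotient[OF f \<xi> \<eta>, of "UNIV \<times> mi_le m"] show ?thesis
    unfolding DERIV_def by (simp add: finite_mi_le)
qed

lemma jet_mixed_difference:
  assumes f: "jet_C1 m f" "jet_C1 m (jet_partial i \<alpha> f)" and \<xi>: "\<xi> \<in> jets m"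
    and \<alpha>: "\<alpha> \<in> mi_le m" and \<beta>: "\<beta> \<in> mi_le m" and ne: "(i, \<alpha>) \<noteq> (j, \<beta>)"
  shows "\<exists>x y. \<bar>x - \<xi> i \<alpha>\<bar> \<le> \<bar>h\<bar> \<and> \<bar>y - \<xi> j \<beta>\<bar> \<le> \<bar>h\<bar> \<and>
    f (jet_upd (jet_upd \<xi> i \<alpha> (\<xi> i \<alpha> + h)) j \<beta> (\<xi> j \<beta> + h)) - f (jet_upd \<xi> i \<alpha> (\<xi> i \<alpha> + h))
      - f (jet_upd \<xi> j \<beta> (\<xi> j \<beta> + h)) + f \<xi> =
    h * h * jet_partial j \<beta> (jet_partial i \<alpha> f) (jet_upd (jet_upd \<xi> i \<alpha> x) j \<beta> y)"
proof -
  let ?b = "jet_upd \<xi> j \<beta> (\<xi> j \<beta> + h)"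
  have b: "?b \<in> jets m" by (rule jet_upd_in_jets[OF \<xi> \<beta>])
  define \<phi> where "\<phi> s = f (jet_upd ?b i \<alpha> s) - f (jet_upd \<xi> i \<alpha> s)" for s
  have "(\<phi> has_real_derivative jet_partial i \<alpha> f (jet_upd ?b i \<alpha> s) - jet_partial i \<alpha> f (jet_upd \<xi> i \<alpha> s)) (at s)" for s
    unfolding \<phi>_def
    by (rule DERIV_diff[OF jet_partial_has_derivative[OF f(1) b \<alpha>] jet_partial_has_derivative[OF f(1) \<xi> \<alpha>]])
  from mvt_between[OF this, of "\<xi> i \<alpha>" "\<xi> i \<alpha> + h"]
  obtain x where x: "\<bar>x - \<xi> i \<alpha>\<bar> \<le> \<bar>h\<bar>"
    "\<phi> (\<xi> i \<alpha> + h) - \<phi> (\<xi> i \<alpha>) = h * (jet_partial i \<alpha> f (jet_upd ?b i \<alpha> x) - jet_partial i \<alpha> f (jet_upd \<xi> i \<alpha> x))"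
    by auto
  let ?x = "jet_upd \<xi> i \<alpha> x"
  have xj: "?x \<in> jets m" by (rule jet_upd_in_jets[OF \<xi> \<alpha>])
  have xb: "?x j \<beta> = \<xi> j \<beta>" using ne by (auto simp: jet_upd_apply)
  from mvt_between[OF jet_partial_has_derivative[OF f(2) xj \<beta>, of j], of "\<xi> j \<beta>" "\<xi> j \<beta> + h"]
  obtain y where y: "\<bar>y - \<xi> j \<beta>\<bar> \<le> \<bar>h\<bar>"
    "jet_partial i \<alpha> f (jet_upd ?x j \<beta> (\<xi> j \<beta> + h)) - jet_partial i \<alpha> f (jet_upd ?x j \<beta> (\<xi> j \<beta>)) =
      h * jet_partial j \<beta> (jet_partial i \<alpha> f) (jet_upd ?x j \<beta> y)"
    by auto
  have "jet_upd ?x j \<beta> (\<xi> j \<beta>) = ?x" using jet_upd_self[of ?x j \<beta>] xb by simp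
  moreover have "jet_upd ?b i \<alpha> x = jet_upd ?x j \<beta> (\<xi> j \<beta> + h)" using ne by (intro jet_upd_commute) auto
  moreover have "jet_upd ?b i \<alpha> (\<xi> i \<alpha>) = ?b"
    using jet_upd_self[of ?b i \<alpha>] ne by (auto simp: jet_upd_apply)
  moreover have "jet_upd ?b i \<alpha> (\<xi> i \<alpha> + h) = jet_upd (jet_upd \<xi> i \<alpha> (\<xi> i \<alpha> + h)) j \<beta> (\<xi> j \<beta> + h)"
    using ne by (intro jet_upd_commute) auto
  ultimately show ?thesis using x y by (intro exI[of _ x] exI[of _ y]) (simp add: \<phi>_def)
qed

lemma jet_partial_symmetric:
  assumes f: "jet_C2 m f" and \<xi>: "\<xi> \<in> jets m" and \<alpha>: "\<alpha> \<in> mi_le m" and \<beta>: "\<beta> \<in> mi_le m"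
  shows "jet_partial j \<beta> (jet_partial i \<alpha> f) \<xi> = jet_partial i \<alpha> (jet_partial j \<beta> f) \<xi>"
proof (cases "(i, \<alpha>) = (j, \<beta>)")
  case False
  have C1: "jet_C1 m f" "jet_C1 m (jet_partial i \<alpha> f)" "jet_C1 m (jet_partial j \<beta> f)"
    using f \<alpha> \<beta> by (auto simp: jet_C2_def)
  define h where "h k = 1 / real (Suc k)" for k
  have h: "h k \<noteq> 0" "h \<longlonglongrightarrow> 0" for k
    unfolding h_def by (simp, rule LIMSEQ_Suc[OF lim_1_over_n])
  have close: "(x \<longlonglongrightarrow> c)" if "\<And>k. \<bar>x k - c\<bar> \<le> \<bar>h k\<bar>" for x :: "nat \<Rightarrow> real" and c
  proof (rule LIM_zero_cancel, rule Lim_null_comparison)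
    show "\<forall>\<^sub>F k in sequentially. norm (x k - c) \<le> \<bar>h k\<bar>" using that by simp
    show "(\<lambda>k. \<bar>h k\<bar>) \<longlonglongrightarrow> 0" by (rule tendsto_rabs_zero[OF h(2)])
  qed
  define \<Delta> where "\<Delta> k = f (jet_upd (jet_upd \<xi> i \<alpha> (\<xi> i \<alpha> + h k)) j \<beta> (\<xi> j \<beta> + h k)) - f (jet_upd \<xi> i \<alpha> (\<xi> i \<alpha> + h k))
      - f (jet_upd \<xi> j \<beta> (\<xi> j \<beta> + h k)) + f \<xi>" for k
  obtain x y where xy: "\<And>k. \<bar>x k - \<xi> i \<alpha>\<bar> \<le> \<bar>h k\<bar>" "\<And>k. \<bar>y k - \<xi> j \<beta>\<bar> \<le> \<bar>h k\<bar>"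
    "\<And>k. \<Delta> k = h k * h k * jet_partial j \<beta> (jet_partial i \<alpha> f) (jet_upd (jet_upd \<xi> i \<alpha> (x k)) j \<beta> (y k))"
  proof -
    define P where "P k x y \<longleftrightarrow> \<bar>x - \<xi> i \<alpha>\<bar> \<le> \<bar>h k\<bar> \<and> \<bar>y - \<xi> j \<beta>\<bar> \<le> \<bar>h k\<bar> \<and>
      \<Delta> k = h k * h k * jet_partial j \<beta> (jet_partial i \<alpha> f) (jet_upd (jet_upd \<xi> i \<alpha> x) j \<beta> y)" for k x y
    have "\<exists>x y. P k x y" for k
      using jet_mixed_difference[OF C1(1,2) \<xi> \<alpha> \<beta> False, of "h k"] unfolding \<Delta>_def P_def .
    then obtain x y where "\<And>k. P k (x k) (y k)" by metis
    then show thesis using that unfolding P_def by blast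
  qed
  have \<Delta>': "\<Delta> k = f (jet_upd (jet_upd \<xi> j \<beta> (\<xi> j \<beta> + h k)) i \<alpha> (\<xi> i \<alpha> + h k)) - f (jet_upd \<xi> j \<beta> (\<xi> j \<beta> + h k))
      - f (jet_upd \<xi> i \<alpha> (\<xi> i \<alpha> + h k)) + f \<xi>" for k
    unfolding \<Delta>_def using jet_upd_commute[OF False] by simp
  have False': "(j, \<beta>) \<noteq> (i, \<alpha>)" using False by auto
  obtain x' y' where xy': "\<And>k. \<bar>x' k - \<xi> j \<beta>\<bar> \<le> \<bar>h k\<bar>" "\<And>k. \<bar>y' k - \<xi> i \<alpha>\<bar> \<le> \<bar>h k\<bar>"
    "\<And>k. \<Delta> k = h k * h k * jet_partial i \<alpha> (jet_partial j \<beta> f) (jet_upd (jet_upd \<xi> j \<beta> (x' k)) i \<alpha> (y' k))"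
  proof -
    define P where "P k x y \<longleftrightarrow> \<bar>x - \<xi> j \<beta>\<bar> \<le> \<bar>h k\<bar> \<and> \<bar>y - \<xi> i \<alpha>\<bar> \<le> \<bar>h k\<bar> \<and>
      \<Delta> k = h k * h k * jet_partial i \<alpha> (jet_partial j \<beta> f) (jet_upd (jet_upd \<xi> j \<beta> x) i \<alpha> y)" for k x y
    have "\<exists>x y. P k x y" for k
      using jet_mixed_difference[OF C1(1,3) \<xi> \<beta> \<alpha> False', of "h k"] unfolding \<Delta>' P_def .
    then obtain x y where "\<And>k. P k (x k) (y k)" by metis
    then show thesis using that unfolding P_def by blast
  qed
  have 1: "(\<lambda>k. jet_partial j \<beta> (jet_partial i \<alpha> f) (jet_upd (jet_upd \<xi> i \<alpha> (x k)) j \<beta> (y k))) \<longlonglongrightarrow> jet_partial j \<beta> (jet_partial i \<alpha> f) \<xi>"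
  proof (rule jet_tendsto_compose[OF _ \<xi> jet_upd_in_jets[OF jet_upd_in_jets[OF \<xi> \<alpha>] \<beta>]])
    show "continuous_on (jets m) (jet_partial j \<beta> (jet_partial i \<alpha> f))" using C1(2) \<beta> by (simp add: jet_C1_def)
    show "(\<lambda>k. jet_upd (jet_upd \<xi> i \<alpha> (x k)) j \<beta> (y k) l \<gamma>) \<longlonglongrightarrow> \<xi> l \<gamma>" for l \<gamma>
      using close[OF xy(1)] close[OF xy(2)]
      by (cases "l = j \<and> \<gamma> = \<beta>"; cases "l = i \<and> \<gamma> = \<alpha>") (auto simp: jet_upd_apply)
  qed
  have 2: "(\<lambda>k. jet_partial i \<alpha> (jet_partial j \<beta> f) (jet_upd (jet_upd \<xi> j \<beta> (x' k)) i \<alpha> (y' k))) \<longlonglongrightarrow> jet_partial i \<alpha> (jet_partial j \<beta> f) \<xi>"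
  proof (rule jet_tendsto_compose[OF _ \<xi> jet_upd_in_jets[OF jet_upd_in_jets[OF \<xi> \<beta>] \<alpha>]])
    show "continuous_on (jets m) (jet_partial i \<alpha> (jet_partial j \<beta> f))" using C1(3) \<alpha> by (simp add: jet_C1_def)
    show "(\<lambda>k. jet_upd (jet_upd \<xi> j \<beta> (x' k)) i \<alpha> (y' k) l \<gamma>) \<longlonglongrightarrow> \<xi> l \<gamma>" for l \<gamma>
      using close[OF xy'(1)] close[OF xy'(2)]
      by (cases "l = j \<and> \<gamma> = \<beta>"; cases "l = i \<and> \<gamma> = \<alpha>") (auto simp: jet_upd_apply)
  qed
  have "jet_partial j \<beta> (jet_partial i \<alpha> f) (jet_upd (jet_upd \<xi> i \<alpha> (x k)) j \<beta> (y k)) =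
      jet_partial i \<alpha> (jet_partial j \<beta> f) (jet_upd (jet_upd \<xi> j \<beta> (x' k)) i \<alpha> (y' k))" for k
    using xy(3)[of k] xy'(3)[of k] h(1)[of k] by simp
  with 1 2 show ?thesis using LIMSEQ_unique by simp
qed simp

lemma caratheodory_measurable:
  fixes G :: "'x::euclidean_space \<Rightarrow> ('N::finite, 'n::finite) jet \<Rightarrow> real"
  assumes \<Omega>: "\<Omega> \<in> sets lebesgue"
    and G: "\<And>\<xi>. \<xi> \<in> jets m \<Longrightarrow> (\<lambda>x. G x \<xi>) \<in> borel_measurable (lebesgue_on \<Omega>)"
    and cont: "AE x in lebesgue_on \<Omega>. continuous_on (jets m) (G x)"
    and J: "\<And>i \<alpha>. \<alpha> \<in> mi_le m \<Longrightarrow> (\<lambda>x. J x i \<alpha>) \<in> borel_measurable (lebesgue_on \<Omega>)" "\<And>x. J x \<in> jets m"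
  shows "(\<lambda>x. G x (J x)) \<in> borel_measurable (lebesgue_on \<Omega>)"
proof -
  define I where "I = (UNIV :: 'N set) \<times> (mi_le m :: 'n mindex set)"
  have I: "finite I" by (simp add: I_def finite_mi_le)
  define V where "V = (I \<rightarrow>\<^sub>E (UNIV :: int set))"
  have V: "countable V" unfolding V_def by (intro countable_PiE I) auto
  define n where "n k x = restrict (\<lambda>a. \<lfloor>real (Suc k) * J x (fst a) (snd a)\<rfloor>) I" for k x
  define jt where "jt k p = (\<lambda>i \<alpha>. if (i, \<alpha>) \<in> I then real_of_int (p (i, \<alpha>)) / real (Suc k) else 0)" for k and p :: "'N \<times> 'n mindex \<Rightarrow> int"
  have jt_in: "jt k p \<in> jets m" for k p by (auto simp: jt_def jets_def I_def)
  have n_meas: "n k \<in> measurable (lebesgue_on \<Omega>) (count_space V)" for k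
  proof (subst measurable_count_space_eq_countable[OF V], intro conjI ballI)
    show "n k \<in> space (lebesgue_on \<Omega>) \<rightarrow> V" by (auto simp: n_def V_def)
    fix p assume p: "p \<in> V"
    have "n k -` {p} \<inter> space (lebesgue_on \<Omega>) =
        {x \<in> space (lebesgue_on \<Omega>). \<forall>a\<in>I. \<lfloor>real (Suc k) * J x (fst a) (snd a)\<rfloor> = p a}"
    proof -
      have "n k x = p \<longleftrightarrow> (\<forall>a\<in>I. \<lfloor>real (Suc k) * J x (fst a) (snd a)\<rfloor> = p a)" for x
      proof
        assume "n k x = p"
        then show "\<forall>a\<in>I. \<lfloor>real (Suc k) * J x (fst a) (snd a)\<rfloor> = p a" by (auto simp: n_def)
      next
        assume "\<forall>a\<in>I. \<lfloor>real (Suc k) * J x (fst a) (snd a)\<rfloor> = p a"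
        moreover have "p \<in> extensional I" using p by (simp add: V_def PiE_def)
        ultimately show "n k x = p" unfolding n_def by (intro extensionalityI[of _ I]) auto
      qed
      then show ?thesis by auto
    qed
    also have "\<dots> \<in> sets (lebesgue_on \<Omega>)"
    proof (intro sets.sets_Collect_finite_All[OF _ I])
      fix a assume a: "a \<in> I"
      have [measurable]: "(\<lambda>x. J x (fst a) (snd a)) \<in> borel_measurable (lebesgue_on \<Omega>)"
        using a by (intro J(1)) (auto simp: I_def)
      show "{x \<in> space (lebesgue_on \<Omega>). \<lfloor>real (Suc k) * J x (fst a) (snd a)\<rfloor> = p a} \<in> sets (lebesgue_on \<Omega>)"
        by measurable
    qed
    finally show "n k -` {p} \<inter> space (lebesgue_on \<Omega>) \<in> sets (lebesgue_on \<Omega>)" .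
  qed
  have "(\<lambda>x. G x (jt k (n k x))) \<in> borel_measurable (lebesgue_on \<Omega>)" for k
    by (rule measurable_compose_countable'[where f = "\<lambda>p x. G x (jt k p)", OF G[OF jt_in] n_meas V])
  then have meas: "(\<lambda>x. lim (\<lambda>k. G x (jt k (n k x)))) \<in> borel_measurable (lebesgue_on \<Omega>)"
    by (rule borel_measurable_lim_metric)
  have lim: "(\<lambda>k. jt k (n k x) i \<alpha>) \<longlonglongrightarrow> J x i \<alpha>" for x i \<alpha>
  proof (cases "(i, \<alpha>) \<in> I")
    case True
    show ?thesis
    proof (rule LIM_zero_cancel, rule Lim_null_comparison)
      show "(\<lambda>k. 1 / real (Suc k)) \<longlonglongrightarrow> 0" by (rule LIMSEQ_Suc[OF lim_1_over_n])
      show "\<forall>\<^sub>F k in sequentially. norm (jt k (n k x) i \<alpha> - J x i \<alpha>) \<le> 1 / real (Suc k)"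
      proof (intro always_eventually allI)
        fix k
        let ?c = "real (Suc k)"
        have c: "?c > 0" by simp
        have "jt k (n k x) i \<alpha> - J x i \<alpha> = (real_of_int \<lfloor>?c * J x i \<alpha>\<rfloor> - ?c * J x i \<alpha>) / ?c"
          using True c by (simp add: jt_def n_def diff_divide_distrib del: of_nat_Suc)
        moreover have "\<bar>real_of_int \<lfloor>?c * J x i \<alpha>\<rfloor> - ?c * J x i \<alpha>\<bar> \<le> 1" by linarith
        ultimately show "norm (jt k (n k x) i \<alpha> - J x i \<alpha>) \<le> 1 / ?c"
          using c by (simp add: divide_right_mono del: of_nat_Suc)
      qed
    qed
  next
    case False
    then show ?thesis using J(2)[of x] by (simp add: jt_def jets_def I_def)
  qed
  have "AE x in lebesgue_on \<Omega>. lim (\<lambda>k. G x (jt k (n k x))) = G x (J x)"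
    using cont
  proof eventually_elim
    case (elim x)
    show ?case by (rule limI[OF jet_tendsto_compose[OF elim J(2) jt_in lim]])
  qed
  then show ?thesis by (rule borel_measurable_lebesgue_on_AE[OF \<Omega> meas])
qed

lemma jet_partial_measurable:
  fixes G :: "'x::euclidean_space \<Rightarrow> ('N::finite, 'n::finite) jet \<Rightarrow> real"
  assumes \<Omega>: "\<Omega> \<in> sets lebesgue"
    and G: "\<And>\<xi>. \<xi> \<in> jets m \<Longrightarrow> (\<lambda>x. G x \<xi>) \<in> borel_measurable (lebesgue_on \<Omega>)"
    and C1: "AE x in lebesgue_on \<Omega>. jet_C1 m (G x)" and \<xi>: "\<xi> \<in> jets m" and \<alpha>: "\<alpha> \<in> mi_le m"
  shows "(\<lambda>x. jet_partial i \<alpha> (G x) \<xi>) \<in> borel_measurable (lebesgue_on \<Omega>)"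
proof -
  define h where "h k = 1 / real (Suc k)" for k
  have h: "h k \<noteq> 0" "h \<longlonglongrightarrow> 0" for k
    unfolding h_def by (simp, rule LIMSEQ_Suc[OF lim_1_over_n])
  have "(\<lambda>x. (G x (jet_upd \<xi> i \<alpha> (\<xi> i \<alpha> + h k)) - G x \<xi>) / h k) \<in> borel_measurable (lebesgue_on \<Omega>)" for k
    using G[OF \<xi>] G[OF jet_upd_in_jets[OF \<xi> \<alpha>]] by measurable
  then have meas: "(\<lambda>x. lim (\<lambda>k. (G x (jet_upd \<xi> i \<alpha> (\<xi> i \<alpha> + h k)) - G x \<xi>) / h k)) \<in> borel_measurable (lebesgue_on \<Omega>)"
    by (rule borel_measurable_lim_metric)
  have "AE x in lebesgue_on \<Omega>. lim (\<lambda>k. (G x (jet_upd \<xi> i \<alpha> (\<xi> i \<alpha> + h k)) - G x \<xi>) / h k) = jet_partial i \<alpha> (G x) \<xi>"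
    using C1
  proof eventually_elim
    case (elim x)
    have "((\<lambda>t. G x (jet_upd \<xi> i \<alpha> t)) has_real_derivative jet_partial i \<alpha> (G x) \<xi>) (at (\<xi> i \<alpha>))"
      using jet_partial_has_derivative[OF elim \<xi> \<alpha>, of i "\<xi> i \<alpha>"] by simp
    then have "((\<lambda>t. (G x (jet_upd \<xi> i \<alpha> (\<xi> i \<alpha> + t)) - G x \<xi>) / t) \<longlongrightarrow> jet_partial i \<alpha> (G x) \<xi>) (at 0)"
      unfolding DERIV_def by simp
    then have "((\<lambda>t. (G x (jet_upd \<xi> i \<alpha> (\<xi> i \<alpha> + t)) - G x \<xi>) / t) \<circ> h) \<longlonglongrightarrow> jet_partial i \<alpha> (G x) \<xi>"
      using h unfolding tendsto_at_iff_sequentially by simp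
    then show ?case by (intro limI) (simp add: o_def)
  qed
  then show ?thesis by (rule borel_measurable_lebesgue_on_AE[OF \<Omega> meas])
qed

section \<open>The Sobolev embeddings as domination estimates\<close>

text \<open>The reciprocal of the exponent \<open>p\<^sub>\<gamma>\<close>, with \<open>p\<^sub>\<gamma> = \<infinity>\<close> below the critical order.\<close>

definition emb_exp :: "nat \<Rightarrow> ('n::finite mindex \<Rightarrow> real) \<Rightarrow> 'n mindex \<Rightarrow> real" where
  "emb_exp m P \<gamma> = (if real (mi_order \<gamma>) < crit_order m 2 TYPE('n) then 0 else 1 / P \<gamma>)"

context
  fixes m :: nat and P :: "'n::finite mindex \<Rightarrow> real"
  assumes adm: "admissible_exponents m 2 P"
begin

lemma P_above_critical:
  assumes "\<gamma> \<in> mi_le m" "crit_order m 2 TYPE('n) < real (mi_order \<gamma>)"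
  shows "P \<gamma> = real CARD('n) * 2 / (real CARD('n) - (real m - real (mi_order \<gamma>)) * 2)"
    and "0 < real CARD('n) - (real m - real (mi_order \<gamma>)) * 2"
  using adm assms by (auto simp: admissible_exponents_def Let_def crit_order_def)

lemma P_ge_2:
  assumes "\<gamma> \<in> mi_le m" "crit_order m 2 TYPE('n) \<le> real (mi_order \<gamma>)"
  shows "2 \<le> P \<gamma>"
proof (cases "crit_order m 2 TYPE('n) = real (mi_order \<gamma>)")
  case True
  then have "P \<gamma> > 2" using adm assms(1) by (simp add: admissible_exponents_def Let_def)
  then show ?thesis by simp
next
  case False
  then have c: "crit_order m 2 TYPE('n) < real (mi_order \<gamma>)" using assms(2) by simp
  have "mi_order \<gamma> \<le> m" using assms(1) by (simp add: mi_le_def)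
  then have "2 * (real CARD('n) - (real m - real (mi_order \<gamma>)) * 2) \<le> real CARD('n) * 2" by simp
  then show ?thesis
    using P_above_critical[OF assms(1) c] by (simp add: pos_le_divide_eq)
qed

lemma P_top:
  assumes "mi_order \<gamma> = m" shows "P \<gamma> = 2"
proof -
  have "\<gamma> \<in> mi_le m" "crit_order m 2 TYPE('n) < real (mi_order \<gamma>)"
    using assms by (auto simp: mi_le_def crit_order_def)
  from P_above_critical(1)[OF this] assms show ?thesis by simp
qed

lemma emb_exp_bounds:
  assumes "\<gamma> \<in> mi_le m" shows "0 \<le> emb_exp m P \<gamma>" "emb_exp m P \<gamma> \<le> 1 / 2"
  using P_ge_2[OF assms] by (auto simp: emb_exp_def not_less field_simps)

lemma emb_exp_pos_iff:
  assumes "\<gamma> \<in> mi_le m" shows "0 < emb_exp m P \<gamma> \<longleftrightarrow> crit_order m 2 TYPE('n) \<le> real (mi_order \<gamma>)"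
  using P_ge_2[OF assms] by (auto simp: emb_exp_def not_less)

lemma emb_exp_top: "mi_order \<gamma> = m \<Longrightarrow> emb_exp m P \<gamma> = 1 / 2"
  using P_top[of \<gamma>] by (simp add: emb_exp_def crit_order_def)

lemma pair_exponent_bounds:
  assumes R: "admissible_pair_exponents m 2 P R" and \<alpha>: "\<alpha> \<in> mi_le m" and \<beta>: "\<beta> \<in> mi_le m"
  shows "0 \<le> R \<alpha> \<beta>" "R \<alpha> \<beta> \<le> 1 - emb_exp m P \<alpha> - emb_exp m P \<beta>" "R \<alpha> \<beta> = R \<beta> \<alpha>"
    and "\<not> (mi_order \<alpha> = m \<and> mi_order \<beta> = m) \<Longrightarrow> 0 < emb_exp m P \<alpha> \<Longrightarrow> 0 < emb_exp m P \<beta> \<Longrightarrow>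
      R \<alpha> \<beta> < 1 - emb_exp m P \<alpha> - emb_exp m P \<beta>"
proof -
  let ?c = "crit_order m 2 TYPE('n)"
  have R': "R \<alpha> \<beta> = R \<beta> \<alpha>"
    "mi_order \<alpha> = m \<and> mi_order \<beta> = m \<Longrightarrow> R \<alpha> \<beta> = 1 - 1 / P \<alpha> - 1 / P \<beta>"
    "?c \<le> real (mi_order \<alpha>) \<Longrightarrow> real (mi_order \<beta>) < ?c \<Longrightarrow> R \<alpha> \<beta> = 1 - 1 / P \<alpha>"
    "?c \<le> real (mi_order \<beta>) \<Longrightarrow> real (mi_order \<alpha>) < ?c \<Longrightarrow> R \<beta> \<alpha> = 1 - 1 / P \<beta>"
    "real (mi_order \<alpha>) < ?c \<Longrightarrow> real (mi_order \<beta>) < ?c \<Longrightarrow> R \<alpha> \<beta> = 1"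
    "?c \<le> real (mi_order \<alpha>) \<Longrightarrow> ?c \<le> real (mi_order \<beta>) \<Longrightarrow> mi_order \<alpha> + mi_order \<beta> < 2 * m \<Longrightarrow>
      0 < R \<alpha> \<beta> \<and> R \<alpha> \<beta> < 1 - 1 / P \<alpha> - 1 / P \<beta>"
    using R \<alpha> \<beta> unfolding admissible_pair_exponents_def Let_def by blast+
  have lt: "mi_order \<alpha> + mi_order \<beta> < 2 * m" if "\<not> (mi_order \<alpha> = m \<and> mi_order \<beta> = m)"
    using \<alpha> \<beta> that by (auto simp: mi_le_def)
  have low: "real (mi_order \<alpha>) < ?c \<Longrightarrow> \<not> mi_order \<alpha> = m" "real (mi_order \<beta>) < ?c \<Longrightarrow> \<not> mi_order \<beta> = m"
    by (auto simp: crit_order_def)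
  have inv: "?c \<le> real (mi_order \<alpha>) \<Longrightarrow> 1 / P \<alpha> \<le> 1 / 2" "?c \<le> real (mi_order \<beta>) \<Longrightarrow> 1 / P \<beta> \<le> 1 / 2"
    using P_ge_2[OF \<alpha>] P_ge_2[OF \<beta>] by (auto simp: field_simps)
  show "R \<alpha> \<beta> = R \<beta> \<alpha>" by (rule R'(1))
  show "0 \<le> R \<alpha> \<beta>" "R \<alpha> \<beta> \<le> 1 - emb_exp m P \<alpha> - emb_exp m P \<beta>"
    using R' lt inv low P_top[of \<alpha>] P_top[of \<beta>]
    by (cases "?c \<le> real (mi_order \<alpha>)"; cases "?c \<le> real (mi_order \<beta>)";
        cases "mi_order \<alpha> = m \<and> mi_order \<beta> = m"; force simp: emb_exp_def)+
  show "R \<alpha> \<beta> < 1 - emb_exp m P \<alpha> - emb_exp m P \<beta>"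
    if "\<not> (mi_order \<alpha> = m \<and> mi_order \<beta> = m)" "0 < emb_exp m P \<alpha>" "0 < emb_exp m P \<beta>"
    using R'(6) lt[OF that(1)] that(2,3) unfolding emb_exp_pos_iff[OF \<alpha>] emb_exp_pos_iff[OF \<beta>]
    by (simp add: emb_exp_def)
qed

end

lemma sobolev_domainD:
  fixes \<Omega> :: "(real^'n::finite) set"
  assumes "sobolev_domain p m \<Omega>" "j \<le> m"
  shows "(real m - real j) * p < real CARD('n) \<Longrightarrow> 1 \<le> q \<Longrightarrow>
      q \<le> real CARD('n) * p / (real CARD('n) - (real m - real j) * p) \<Longrightarrow> sobolev_embeds m p j q \<Omega>"
    and "(real m - real j) * p < real CARD('n) \<Longrightarrow> j < m \<Longrightarrow> 1 \<le> q \<Longrightarrow>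
      q < real CARD('n) * p / (real CARD('n) - (real m - real j) * p) \<Longrightarrow> sobolev_embeds_compactly m p j q \<Omega>"
    and "(real m - real j) * p = real CARD('n) \<Longrightarrow> 1 \<le> q \<Longrightarrow> sobolev_embeds_compactly m p j q \<Omega>"
    and "(real m - real j) * p > real CARD('n) \<Longrightarrow> sobolev_embeds_compactly_CB m p j \<Omega>"
  using assms by (auto simp: sobolev_domain_def Let_def)

context open_domain
begin

lemma embedding_dom_pow:
  assumes dom: "sobolev_domain 2 m \<Omega>" and adm: "admissible_exponents m 2 P" and \<alpha>: "\<alpha> \<in> mi_le m"
  shows "\<exists>C\<ge>0. \<forall>u\<in>sobolev m 2 \<Omega>.
    dom_pow \<Lambda> (emb_exp m P \<alpha>) (weak_deriv \<Omega> \<alpha> u) (C * sobolev_norm m 2 \<Omega> u) (\<mu> + 1)"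
proof -
  let ?n = "real CARD('n)" and ?j = "mi_order \<alpha>"
  have j: "?j \<le> m" "\<alpha> \<in> mi_le ?j" using \<alpha> by (auto simp: mi_le_def)
  have norm0: "0 \<le> sobolev_norm m 2 \<Omega> u" for u :: "real^'n \<Rightarrow> real" by (simp add: sobolev_norm_def)
  show ?thesis
  proof (cases "real ?j < crit_order m 2 TYPE('n)")
    case True
    then have "(real m - real ?j) * 2 > ?n" by (simp add: crit_order_def)
    then obtain C where C: "\<And>u. u \<in> sobolev m 2 \<Omega> \<Longrightarrow> \<exists>v. cont_version ?j \<Omega> u v \<and>
        (\<forall>\<gamma>\<in>mi_le ?j. \<forall>x\<in>\<Omega>. \<bar>v \<gamma> x\<bar> \<le> C * sobolev_norm m 2 \<Omega> u)"
      using sobolev_domainD(4)[OF dom j(1)] unfolding sobolev_embeds_compactly_CB_def by blast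
    have "dom_pow \<Lambda> (emb_exp m P \<alpha>) (weak_deriv \<Omega> \<alpha> u) (\<bar>C\<bar> * sobolev_norm m 2 \<Omega> u) (\<mu> + 1)"
      if u: "u \<in> sobolev m 2 \<Omega>" for u
    proof -
      obtain v where v: "cont_version ?j \<Omega> u v" "\<forall>\<gamma>\<in>mi_le ?j. \<forall>x\<in>\<Omega>. \<bar>v \<gamma> x\<bar> \<le> C * sobolev_norm m 2 \<Omega> u"
        using C[OF u] by blast
      have "is_weak_deriv \<Omega> \<alpha> u (v \<alpha>)" using v(1) j(2) by (simp add: cont_version_def)
      from weak_deriv_eq[OF this]
      have "AE x in \<Lambda>. \<bar>weak_deriv \<Omega> \<alpha> u x\<bar> \<le> \<bar>C\<bar> * sobolev_norm m 2 \<Omega> u"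
      proof (rule lebesgue_on_mono)
        fix x assume x: "weak_deriv \<Omega> \<alpha> u x = v \<alpha> x" "x \<in> \<Omega>"
        have "\<bar>v \<alpha> x\<bar> \<le> C * sobolev_norm m 2 \<Omega> u" using v(2) j(2) x(2) by blast
        also have "\<dots> \<le> \<bar>C\<bar> * sobolev_norm m 2 \<Omega> u" by (intro mult_right_mono norm0) simp
        finally show "\<bar>weak_deriv \<Omega> \<alpha> u x\<bar> \<le> \<bar>C\<bar> * sobolev_norm m 2 \<Omega> u" using x(1) by simp
      qed
      then show ?thesis
        using sobolev_weak_deriv(2)[OF u \<alpha>] norm0 True
        by (intro dom_powI[where A = "\<lambda>_. 1"]) (auto simp: Lp_def emb_exp_def)
    qed
    then show ?thesis by (intro exI[of _ "\<bar>C\<bar>"]) auto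
  next
    case False
    then have high: "crit_order m 2 TYPE('n) \<le> real ?j" by simp
    have P2: "2 \<le> P \<alpha>" by (rule P_ge_2[OF adm \<alpha> high])
    have "sobolev_embeds m 2 ?j (P \<alpha>) \<Omega>"
    proof (cases "crit_order m 2 TYPE('n) = real ?j")
      case True
      then have "(real m - real ?j) * 2 = ?n" by (simp add: crit_order_def)
      then show ?thesis using sobolev_domainD(3)[OF dom j(1)] P2 by (simp add: sobolev_embeds_compactly_def)
    next
      case False
      then have c: "crit_order m 2 TYPE('n) < real ?j" using high by simp
      then have "(real m - real ?j) * 2 < ?n" by (simp add: crit_order_def)
      then show ?thesis
        by (rule sobolev_domainD(1)[OF dom j(1) _ _ eq_refl[OF P_above_critical(1)[OF adm \<alpha> c]]]) (use P2 in linarith)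
    qed
    then obtain C where C: "0 \<le> C" "\<And>u. u \<in> sobolev m 2 \<Omega> \<Longrightarrow> weak_deriv \<Omega> \<alpha> u \<in> Lp (P \<alpha>) \<Omega> \<and>
        (\<integral>x. \<bar>weak_deriv \<Omega> \<alpha> u x\<bar> powr (P \<alpha>) \<partial>\<Lambda>) \<le> (C * sobolev_norm m 2 \<Omega> u) powr (P \<alpha>)"
      using dom_pow_weak_deriv[of m ?j "P \<alpha>" \<alpha>] j(2) P2 by auto
    have "dom_pow \<Lambda> (emb_exp m P \<alpha>) (weak_deriv \<Omega> \<alpha> u) (C * sobolev_norm m 2 \<Omega> u) (\<mu> + 1)"
      if u: "u \<in> sobolev m 2 \<Omega>" for u
      using C(2)[OF u] C(1) norm0[of u] P2 high
      by (intro dom_pow_of_integrable) (auto simp: Lp_def emb_exp_def)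
    then show ?thesis using C(1) by blast
  qed
qed

lemma compact_embedding_dom_pow:
  assumes dom: "sobolev_domain 2 m \<Omega>" and adm: "admissible_exponents m 2 P" and \<alpha>: "\<alpha> \<in> mi_le m" "mi_order \<alpha> \<noteq> m"
    and \<kappa>: "emb_exp m P \<alpha> = 0 \<or> emb_exp m P \<alpha> < \<kappa>" "0 \<le> \<kappa>" "\<kappa> \<le> 1"
    and u: "bounded_sobolev_seq m 2 \<Omega> u"
  shows "\<exists>r. strict_mono (r :: nat \<Rightarrow> nat) \<and> (\<forall>e>0. \<exists>K. \<forall>j\<ge>K. \<forall>k\<ge>K.
    dom_pow \<Lambda> \<kappa> (\<lambda>x. weak_deriv \<Omega> \<alpha> (u (r j)) x - weak_deriv \<Omega> \<alpha> (u (r k)) x) e (2 * (\<mu> + 1)))"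
proof -
  let ?n = "real CARD('n)" and ?j = "mi_order \<alpha>"
  have j: "?j \<le> m" "?j < m" "\<alpha> \<in> mi_le ?j" using \<alpha> by (auto simp: mi_le_def)
  have us: "u k \<in> sobolev m 2 \<Omega>" for k using u by (simp add: bounded_sobolev_seq_def)
  have meas: "weak_deriv \<Omega> \<alpha> (u k) \<in> borel_measurable \<Lambda>" for k
    using sobolev_weak_deriv(2)[OF us \<alpha>(1)] by (simp add: Lp_def)
  show ?thesis
  proof (cases "real ?j < crit_order m 2 TYPE('n)")
    case True
    then have "(real m - real ?j) * 2 > ?n" by (simp add: crit_order_def)
    then obtain r v w where r: "strict_mono (r :: nat \<Rightarrow> nat)" "\<And>k. cont_version ?j \<Omega> (u (r k)) (v k)"
      and lim: "uniform_limit \<Omega> (\<lambda>k. v k \<alpha>) (w \<alpha>) sequentially"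
      using sobolev_domainD(4)[OF dom j(1)] u j(3) unfolding sobolev_embeds_compactly_CB_def by blast
    have ae: "AE x in \<Lambda>. weak_deriv \<Omega> \<alpha> (u (r k)) x = v k \<alpha> x" for k
      using r(2)[of k] j(3) by (intro weak_deriv_eq) (simp add: cont_version_def)
    have "\<exists>K. \<forall>j\<ge>K. \<forall>k\<ge>K. dom_pow \<Lambda> \<kappa> (\<lambda>x. weak_deriv \<Omega> \<alpha> (u (r j)) x - weak_deriv \<Omega> \<alpha> (u (r k)) x) e (2 * (\<mu> + 1))"
      if e: "e > 0" for e
    proof -
      have "\<forall>\<^sub>F k in sequentially. \<forall>x\<in>\<Omega>. dist (v k \<alpha> x) (w \<alpha> x) < e / 2"
        by (rule uniform_limitD[OF lim]) (use e in simp)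
      then obtain K where K: "\<And>k x. k \<ge> K \<Longrightarrow> x \<in> \<Omega> \<Longrightarrow> dist (v k \<alpha> x) (w \<alpha> x) < e / 2"
        unfolding eventually_sequentially by blast
      have "dom_pow \<Lambda> \<kappa> (\<lambda>x. weak_deriv \<Omega> \<alpha> (u (r j)) x - weak_deriv \<Omega> \<alpha> (u (r k)) x) e (2 * (\<mu> + 1))"
        if jk: "j \<ge> K" "k \<ge> K" for j k
      proof (rule dom_powI[where A = "\<lambda>_. 1"])
        have "AE x in \<Lambda>. weak_deriv \<Omega> \<alpha> (u (r j)) x = v j \<alpha> x \<and> weak_deriv \<Omega> \<alpha> (u (r k)) x = v k \<alpha> x"
          using ae[of j] ae[of k] by eventually_elim simp
        then show "AE x in \<Lambda>. \<bar>weak_deriv \<Omega> \<alpha> (u (r j)) x - weak_deriv \<Omega> \<alpha> (u (r k)) x\<bar> \<le> e * 1 powr \<kappa>"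
        proof (rule lebesgue_on_mono)
          fix x assume x: "weak_deriv \<Omega> \<alpha> (u (r j)) x = v j \<alpha> x \<and> weak_deriv \<Omega> \<alpha> (u (r k)) x = v k \<alpha> x" "x \<in> \<Omega>"
          have "\<bar>v j \<alpha> x - w \<alpha> x\<bar> < e / 2" "\<bar>v k \<alpha> x - w \<alpha> x\<bar> < e / 2"
            using K[OF jk(1) x(2)] K[OF jk(2) x(2)] by (auto simp: dist_real_def)
          then show "\<bar>weak_deriv \<Omega> \<alpha> (u (r j)) x - weak_deriv \<Omega> \<alpha> (u (r k)) x\<bar> \<le> e * 1 powr \<kappa>"
            using x(1) by (simp only: powr_one_eq_one mult_1_right)
        qed
        show "(\<lambda>x. weak_deriv \<Omega> \<alpha> (u (r j)) x - weak_deriv \<Omega> \<alpha> (u (r k)) x) \<in> borel_measurable \<Lambda>"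
          by (intro borel_measurable_diff meas)
      qed (use e in \<open>auto simp: add_increasing\<close>)
      then show ?thesis by blast
    qed
    then show ?thesis using r(1) by blast
  next
    case False
    then have high: "crit_order m 2 TYPE('n) \<le> real ?j" by simp
    have P2: "2 \<le> P \<alpha>" by (rule P_ge_2[OF adm \<alpha>(1) high])
    have \<kappa>P: "1 / P \<alpha> < \<kappa>" using \<kappa>(1) high P2 by (simp add: emb_exp_def)
    moreover have "0 < 1 / P \<alpha>" using P2 by simp
    ultimately have \<kappa>0: "0 < \<kappa>" by linarith
    define q where "q = 1 / \<kappa>"
    have q: "1 \<le> q" "q < P \<alpha>" using \<kappa>(3) \<kappa>0 \<kappa>P P2 by (auto simp: q_def field_simps)
    have "sobolev_embeds_compactly m 2 ?j q \<Omega>"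
    proof (cases "crit_order m 2 TYPE('n) = real ?j")
      case True
      then have "(real m - real ?j) * 2 = ?n" by (simp add: crit_order_def)
      then show ?thesis using sobolev_domainD(3)[OF dom j(1)] q by simp
    next
      case False
      then have c: "crit_order m 2 TYPE('n) < real ?j" using high by simp
      then have "(real m - real ?j) * 2 < ?n" by (simp add: crit_order_def)
      then show ?thesis
        using sobolev_domainD(2)[OF dom j(1) _ j(2), of q] P_above_critical(1)[OF adm \<alpha>(1) c] q by simp
    qed
    from compact_weak_deriv_Lp[OF this j(3) q(1) u]
    obtain r g where r: "strict_mono (r :: nat \<Rightarrow> nat)" and g: "g \<in> Lp q \<Omega>" "\<And>k. weak_deriv \<Omega> \<alpha> (u k) \<in> Lp q \<Omega>"
      and lim: "(\<lambda>k. \<integral>x. \<bar>weak_deriv \<Omega> \<alpha> (u (r k)) x - g x\<bar> powr q \<partial>\<Lambda>) \<longlonglongrightarrow> 0" by blast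
    define d where "d k x = weak_deriv \<Omega> \<alpha> (u (r k)) x - g x" for k x
    have dL: "d k \<in> Lp q \<Omega>" for k unfolding d_def using Lp_diff[OF g(2) g(1)] q by simp
    have "\<exists>K. \<forall>j\<ge>K. \<forall>k\<ge>K. dom_pow \<Lambda> \<kappa> (\<lambda>x. weak_deriv \<Omega> \<alpha> (u (r j)) x - weak_deriv \<Omega> \<alpha> (u (r k)) x) e (2 * (\<mu> + 1))"
      if e: "e > 0" for e
    proof -
      have "\<forall>\<^sub>F k in sequentially. dom_pow \<Lambda> \<kappa> (d k) (e / 2) (\<mu> + 1)"
        by (rule dom_pow_eventually_small) (use dL lim \<kappa>0 e in \<open>auto simp: Lp_def q_def d_def\<close>)
      then obtain K where K: "\<And>k. k \<ge> K \<Longrightarrow> dom_pow \<Lambda> \<kappa> (d k) (e / 2) (\<mu> + 1)"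
        unfolding eventually_sequentially by blast
      have "dom_pow \<Lambda> \<kappa> (\<lambda>x. weak_deriv \<Omega> \<alpha> (u (r j)) x - weak_deriv \<Omega> \<alpha> (u (r k)) x) e (2 * (\<mu> + 1))"
        if jk: "j \<ge> K" "k \<ge> K" for j k
      proof -
        have "dom_pow \<Lambda> \<kappa> (\<lambda>x. d j x + (-1) * d k x) (e / 2 + \<bar>-1\<bar> * (e / 2)) ((\<mu> + 1) + (\<mu> + 1))"
          by (intro dom_pow_add dom_pow_cmult K jk \<kappa>(2))
        moreover have "(\<lambda>x. d j x + (-1) * d k x) = (\<lambda>x. weak_deriv \<Omega> \<alpha> (u (r j)) x - weak_deriv \<Omega> \<alpha> (u (r k)) x)"
          by (simp add: d_def fun_eq_iff)
        ultimately show ?thesis by simp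
      qed
      then show ?thesis by blast
    qed
    then show ?thesis using r by blast
  qed
qed

lemma embedding_dom_pow_vec:
  assumes dom: "sobolev_domain 2 m \<Omega>" and adm: "admissible_exponents m 2 P"
  shows "\<exists>C\<ge>0. \<forall>u\<in>(sobolev_vec m 2 \<Omega> :: (real^'n, real^'N::finite) aefun set). \<forall>i. \<forall>\<alpha>\<in>mi_le m.
    dom_pow \<Lambda> (emb_exp m P \<alpha>) (comp_deriv \<Omega> \<alpha> i u) (C * ip_norm (sobolev_ip m \<Omega>) u) (2 * (\<mu> + 1))"
proof -
  have "\<forall>\<alpha>\<in>mi_le m. \<exists>C\<ge>0. \<forall>u\<in>sobolev m 2 \<Omega>.
      dom_pow \<Lambda> (emb_exp m P \<alpha>) (weak_deriv \<Omega> \<alpha> u) (C * sobolev_norm m 2 \<Omega> u) (\<mu> + 1)"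
    using embedding_dom_pow[OF dom adm] by blast
  then obtain C where C: "\<And>\<alpha>. \<alpha> \<in> mi_le m \<Longrightarrow> 0 \<le> C \<alpha>" "\<And>\<alpha> u. \<alpha> \<in> mi_le m \<Longrightarrow> u \<in> sobolev m 2 \<Omega> \<Longrightarrow>
      dom_pow \<Lambda> (emb_exp m P \<alpha>) (weak_deriv \<Omega> \<alpha> u) (C \<alpha> * sobolev_norm m 2 \<Omega> u) (\<mu> + 1)"
    unfolding bchoice_iff by blast
  define C0 where "C0 = (\<Sum>\<alpha>\<in>mi_le m. C \<alpha>)"
  have C0: "0 \<le> C0" "\<And>\<alpha>. \<alpha> \<in> mi_le m \<Longrightarrow> C \<alpha> \<le> C0"
    unfolding C0_def using C(1) by (auto intro!: sum_nonneg member_le_sum finite_mi_le)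
  have "dom_pow \<Lambda> (emb_exp m P \<alpha>) (comp_deriv \<Omega> \<alpha> i u) (C0 * ip_norm (sobolev_ip m \<Omega>) u) (2 * (\<mu> + 1))"
    if u: "u \<in> sobolev_vec m 2 \<Omega>" and \<alpha>: "\<alpha> \<in> mi_le m" for u :: "(real^'n, real^'N) aefun" and i \<alpha>
  proof (rule dom_pow_mono)
    show "dom_pow \<Lambda> (emb_exp m P \<alpha>) (comp_deriv \<Omega> \<alpha> i u) (C \<alpha> * sobolev_norm m 2 \<Omega> (\<lambda>x. rep_aefun u x $ i)) (\<mu> + 1)"
      unfolding comp_deriv_def by (rule C(2)[OF \<alpha> sobolev_vec_rep(1)[OF u]])
    show "C \<alpha> * sobolev_norm m 2 \<Omega> (\<lambda>x. rep_aefun u x $ i) \<le> C0 * ip_norm (sobolev_ip m \<Omega>) u"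
      using C0 \<alpha> sobolev_norm_component_le[OF u] by (intro mult_mono) (auto simp: sobolev_norm_def)
  qed simp
  then show ?thesis using C0(1) by blast
qed

lemma compact_embedding_dom_pow_vec:
  fixes v :: "nat \<Rightarrow> (real^'n, real^'N::finite) aefun"
  assumes dom: "sobolev_domain 2 m \<Omega>" and adm: "admissible_exponents m 2 P" and \<alpha>: "\<alpha> \<in> mi_le m" "mi_order \<alpha> \<noteq> m"
    and \<kappa>: "emb_exp m P \<alpha> = 0 \<or> emb_exp m P \<alpha> < \<kappa>" "0 \<le> \<kappa>" "\<kappa> \<le> 1"
    and v: "\<And>k. v k \<in> sobolev_vec m 2 \<Omega>" "\<And>k. ip_norm (sobolev_ip m \<Omega>) (v k) \<le> B"
  shows "\<exists>r. strict_mono (r :: nat \<Rightarrow> nat) \<and> (\<forall>e>0. \<exists>K. \<forall>j\<ge>K. \<forall>k\<ge>K.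
    dom_pow \<Lambda> \<kappa> (comp_deriv \<Omega> \<alpha> i (v (r j) - v (r k))) e (2 * (\<mu> + 1)))"
proof -
  have "bounded_sobolev_seq m 2 \<Omega> (\<lambda>k x. rep_aefun (v k) x $ i)"
    unfolding bounded_sobolev_seq_def
    using sobolev_vec_rep(1)[OF v(1)] order_trans[OF sobolev_norm_component_le[OF v(1)] v(2)] by blast
  from compact_embedding_dom_pow[OF dom adm \<alpha> \<kappa> this]
  obtain r where r: "strict_mono (r :: nat \<Rightarrow> nat)" and small: "\<forall>e>0. \<exists>K. \<forall>j\<ge>K. \<forall>k\<ge>K.
      dom_pow \<Lambda> \<kappa> (\<lambda>x. comp_deriv \<Omega> \<alpha> i (v (r j)) x - comp_deriv \<Omega> \<alpha> i (v (r k)) x) e (2 * (\<mu> + 1))"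
    unfolding comp_deriv_def by blast
  have "dom_pow \<Lambda> \<kappa> (comp_deriv \<Omega> \<alpha> i (v (r j) - v (r k))) e (2 * (\<mu> + 1))"
    if *: "dom_pow \<Lambda> \<kappa> (\<lambda>x. comp_deriv \<Omega> \<alpha> i (v (r j)) x - comp_deriv \<Omega> \<alpha> i (v (r k)) x) e (2 * (\<mu> + 1))" for j k e
  proof (rule dom_pow_bound[OF *])
    have ae: "AE x in \<Lambda>. comp_deriv \<Omega> \<alpha> i (v (r j)) x - comp_deriv \<Omega> \<alpha> i (v (r k)) x = comp_deriv \<Omega> \<alpha> i (v (r j) - v (r k)) x"
      using comp_deriv_diff[OF v(1) v(1) sobolev_vec_scale[OF v(1)] \<alpha>(1), of i "r j" "r k"] by eventually_elim simp
    show "comp_deriv \<Omega> \<alpha> i (v (r j) - v (r k)) \<in> borel_measurable \<Lambda>"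
      by (rule borel_measurable_lebesgue_on_AE[OF \<Omega>_sets dom_pow_measurable[OF *] ae])
    show "AE x in \<Lambda>. \<bar>comp_deriv \<Omega> \<alpha> i (v (r j) - v (r k)) x\<bar> \<le> \<bar>comp_deriv \<Omega> \<alpha> i (v (r j)) x - comp_deriv \<Omega> \<alpha> i (v (r k)) x\<bar>"
      using ae by eventually_elim simp
  qed
  then show ?thesis using r small by meson
qed

end

section \<open>The functional as a Nemytskii functional\<close>

lemma (in hilbert_on) frechet_deriv_unique:
  assumes l: "has_frechet_deriv H ip L u l" and l': "has_frechet_deriv H ip L u l'" and h: "h \<in> H"
  shows "l h = l' h"
proof (rule ccontr)
  assume "l h \<noteq> l' h"
  then have pos: "0 < \<bar>l h - l' h\<bar>" by simp
  define e where "e = \<bar>l h - l' h\<bar> / (2 * (nm h + 1))"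
  have nm1: "0 < nm h + 1" using nm_nonneg[OF h] by linarith
  have e: "e > 0" using pos nm1 by (simp add: e_def)
  obtain d where d: "d > 0" "\<And>h. h \<in> H \<Longrightarrow> nm h < d \<Longrightarrow> \<bar>L (u + h) - L u - l h\<bar> \<le> e * nm h"
    using l e unfolding has_frechet_deriv_def by meson
  obtain d' where d': "d' > 0" "\<And>h. h \<in> H \<Longrightarrow> nm h < d' \<Longrightarrow> \<bar>L (u + h) - L u - l' h\<bar> \<le> e * nm h"
    using l' e unfolding has_frechet_deriv_def by meson
  define t where "t = min d d' / (nm h + 1)"
  have t: "t > 0" using d(1) d'(1) nm1 by (simp add: t_def)
  have "nm (t *\<^sub>R h) = t * nm h" using t h by (simp add: nm_scale)
  moreover have "t * nm h < t * (nm h + 1)" using t by simp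
  moreover have "t * (nm h + 1) = min d d'" using nm1 by (simp add: t_def)
  ultimately have th: "nm (t *\<^sub>R h) = t * nm h" "nm (t *\<^sub>R h) < d" "nm (t *\<^sub>R h) < d'" by auto
  have "l (t *\<^sub>R h) = t * l h" "l' (t *\<^sub>R h) = t * l' h"
    using l l' h unfolding has_frechet_deriv_def linear_to_reals_def by blast+
  with d(2)[OF H_scale[OF h] th(2)] d'(2)[OF H_scale[OF h] th(3)]
  have "\<bar>t * l h - t * l' h\<bar> \<le> t * (2 * e * nm h)" unfolding th(1) by (simp add: algebra_simps)
  then have "\<bar>l h - l' h\<bar> \<le> 2 * e * nm h"
    using t by (simp add: right_diff_distrib[symmetric] abs_mult)
  also have "\<dots> < 2 * e * (nm h + 1)" using e by simp
  also have "\<dots> = \<bar>l h - l' h\<bar>" using nm1 by (simp add: e_def field_simps)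
  finally show False by simp
qed

lemma (in hilbert_on) hypothesis_A_of_regular:
  assumes reg: "hypothesis_A_regular H ip X V L dL" and crit: "has_frechet_deriv H ip L 0 (\<lambda>_. 0)"
  shows "hypothesis_A H ip X V L"
proof -
  have "0 \<in> V" "C1_with_deriv H ip V L dL"
    using reg unfolding hypothesis_A_regular_def by - (elim conjE, assumption)+
  then have "has_frechet_deriv H ip L 0 (dL 0)" by (simp add: C1_with_deriv_def)
  from frechet_deriv_unique[OF this crit] have "\<forall>h\<in>H. dL 0 h = 0" by blast
  then show ?thesis unfolding hypothesis_A_def by (intro exI[of _ dL] conjI reg)
qed

lemma curry_in_jets_iff:
  "curry \<xi> \<in> jets m \<longleftrightarrow> \<xi> \<in> {\<xi>. \<forall>c. c \<notin> UNIV \<times> mi_le m \<longrightarrow> \<xi> c = 0}"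
  by (auto simp: jets_def)

lemma curry_zero: "curry (\<lambda>_. 0) = (\<lambda>_ _. 0)"
  by (simp add: fun_eq_iff)

lemma jet_low_norm_le:
  fixes \<xi> :: "('N::finite, 'n::finite) jet"
  assumes K: "0 \<le> K" "\<And>i \<alpha>. \<alpha> \<in> mi_le m \<Longrightarrow> real (mi_order \<alpha>) < c \<Longrightarrow> \<bar>\<xi> i \<alpha>\<bar> \<le> K"
  shows "jet_low_norm m c \<xi> \<le> real CARD('N) * (real (card (mi_le m :: 'n mindex set)) * K)"
proof -
  let ?A = "{\<alpha> :: 'n mindex. \<alpha> \<in> mi_le m \<and> real (mi_order \<alpha>) < c}"
  have fin: "finite ?A" "card ?A \<le> card (mi_le m :: 'n mindex set)"
    by (auto intro!: card_mono finite_subset[OF _ finite_mi_le[of m]] finite_mi_le)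
  have "sqrt (\<Sum>\<alpha>\<in>?A. (\<xi> i \<alpha>)\<^sup>2) \<le> real (card (mi_le m :: 'n mindex set)) * K" for i
  proof -
    have "sqrt (\<Sum>\<alpha>\<in>?A. (\<xi> i \<alpha>)\<^sup>2) \<le> (\<Sum>\<alpha>\<in>?A. \<bar>\<xi> i \<alpha>\<bar>)"
      using L2_set_le_sum_abs[of "\<xi> i" ?A] by (simp add: L2_set_def)
    also have "\<dots> \<le> real (card ?A) * K" using K(2) by (intro sum_bounded_above) auto
    also have "\<dots> \<le> real (card (mi_le m :: 'n mindex set)) * K" using fin(2) K(1) by (intro mult_right_mono) auto
    finally show ?thesis .
  qed
  then show ?thesis unfolding jet_low_norm_def by (intro sum_bounded_above) auto
qed

lemma jet_low_norm_nonneg: "0 \<le> jet_low_norm m c \<xi>"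
  by (simp add: jet_low_norm_def sum_nonneg)

locale quadratic_integrand = open_domain \<Omega> for \<Omega> :: "(real^'n::finite) set" +
  fixes m :: nat and P :: "'n mindex \<Rightarrow> real" and R :: "'n mindex \<Rightarrow> 'n mindex \<Rightarrow> real"
    and F :: "real^'n \<Rightarrow> ('N::finite, 'n) jet \<Rightarrow> real" and g1 g2 :: "real \<Rightarrow> real"
  assumes dom: "sobolev_domain 2 m \<Omega>"
    and adm: "admissible_exponents m 2 P" and admR: "admissible_pair_exponents m 2 P R"
    and C2: "AE x in \<Lambda>. jet_C2 m (F x)"
    and F_meas: "\<And>\<xi>. \<xi> \<in> jets m \<Longrightarrow> (\<lambda>x. F x \<xi>) \<in> borel_measurable \<Lambda>"
    and F_zero: "(\<lambda>x. F x (\<lambda>_ _. 0)) \<in> Lp 1 \<Omega>"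
    and DF_zero: "\<And>i \<alpha>. \<alpha> \<in> mi_le m \<Longrightarrow> (\<lambda>x. jet_partial i \<alpha> (F x) (\<lambda>_ _. 0)) \<in> Lp (dual_exponent m 2 P \<alpha>) \<Omega>"
    and g1: "pos_nondecreasing g1" and g2: "pos_nondecreasing g2"
    and DDF_bound: "AE x in \<Lambda>. \<forall>\<xi>\<in>jets m. \<forall>i j. \<forall>\<alpha>\<in>mi_le m. \<forall>\<beta>\<in>mi_le m.
      \<bar>jet_partial j \<beta> (jet_partial i \<alpha> (F x)) \<xi>\<bar>
        \<le> g1 (jet_low_norm m (crit_order m 2 TYPE('n)) \<xi>) *
           (1 + jet_high_sum m (crit_order m 2 TYPE('n)) P \<xi>) powr R \<alpha> \<beta>"
    and DDF_elliptic: "AE x in \<Lambda>. \<forall>\<xi>\<in>jets m. \<forall>\<eta> :: ('N,'n) jet.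
      (\<Sum>i\<in>UNIV. \<Sum>j\<in>UNIV. \<Sum>\<alpha> | mi_order \<alpha> = m. \<Sum>\<beta> | mi_order \<beta> = m.
         jet_partial j \<beta> (jet_partial i \<alpha> (F x)) \<xi> * \<eta> i \<alpha> * \<eta> j \<beta>)
        \<ge> g2 (jet_low_norm m (crit_order m 2 TYPE('n)) \<xi>) *
           (1 + (\<Sum>k\<in>UNIV. \<Sum>\<gamma> | mi_order \<gamma> = m. \<bar>\<xi> k \<gamma>\<bar>)) powr (2 - 2) *
           (\<Sum>i\<in>UNIV. \<Sum>\<alpha> | mi_order \<alpha> = m. (\<eta> i \<alpha>)\<^sup>2)"
begin

abbreviation (input) I :: "('N \<times> 'n mindex) set" where "I \<equiv> UNIV \<times> mi_le m"
abbreviation (input) Top :: "('N \<times> 'n mindex) set" where "Top \<equiv> UNIV \<times> {\<alpha>. mi_order \<alpha> = m}"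
abbreviation (input) S :: "('N \<times> 'n mindex \<Rightarrow> real) set" where "S \<equiv> {\<xi>. \<forall>c. c \<notin> I \<longrightarrow> \<xi> c = 0}"
abbreviation (input) D :: "(real^'n, real^'N) aefun \<Rightarrow> 'N \<times> 'n mindex \<Rightarrow> real^'n \<Rightarrow> real"
  where "D u c \<equiv> comp_deriv \<Omega> (snd c) (fst c) u"
abbreviation (input) J :: "(real^'n, real^'N) aefun \<Rightarrow> real^'n \<Rightarrow> 'N \<times> 'n mindex \<Rightarrow> real"
  where "J \<equiv> \<lambda>u x c. if c \<in> I then D u c x else 0"
abbreviation (input) \<theta> :: "'N \<times> 'n mindex \<Rightarrow> real" where "\<theta> c \<equiv> emb_exp m P (snd c)"
abbreviation (input) F0 :: "real^'n \<Rightarrow> ('N \<times> 'n mindex \<Rightarrow> real) \<Rightarrow> real" where "F0 x \<xi> \<equiv> F x (curry \<xi>)"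
abbreviation (input) F1 :: "'N \<times> 'n mindex \<Rightarrow> real^'n \<Rightarrow> ('N \<times> 'n mindex \<Rightarrow> real) \<Rightarrow> real"
  where "F1 a x \<xi> \<equiv> jet_partial (fst a) (snd a) (F x) (curry \<xi>)"
abbreviation (input) F2 :: "'N \<times> 'n mindex \<Rightarrow> 'N \<times> 'n mindex \<Rightarrow> real^'n \<Rightarrow> ('N \<times> 'n mindex \<Rightarrow> real) \<Rightarrow> real"
  where "F2 a b x \<xi> \<equiv> jet_partial (fst b) (snd b) (jet_partial (fst a) (snd a) (F x)) (curry \<xi>)"

lemma curry_J: "curry (J u x) = jet_of m \<Omega> u x"
  by (auto simp: jet_of_def fun_eq_iff)

lemma jet_of_in_jets: "jet_of m \<Omega> u x \<in> jets m"
  by (simp add: jets_def jet_of_def)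

lemma F_C1: "AE x in \<Lambda>. jet_C1 m (F x)" "\<alpha> \<in> mi_le m \<Longrightarrow> AE x in \<Lambda>. jet_C1 m (jet_partial i \<alpha> (F x))"
  by (rule eventually_mono[OF C2], simp add: jet_C2_def)+

lemma DF_meas:
  assumes "\<xi> \<in> jets m" "\<alpha> \<in> mi_le m"
  shows "(\<lambda>x. jet_partial i \<alpha> (F x) \<xi>) \<in> borel_measurable \<Lambda>"
  using jet_partial_measurable[OF \<Omega>_sets F_meas F_C1(1) assms] by blast

lemma DDF_meas:
  assumes "\<xi> \<in> jets m" "\<alpha> \<in> mi_le m" "\<beta> \<in> mi_le m"
  shows "(\<lambda>x. jet_partial j \<beta> (jet_partial i \<alpha> (F x)) \<xi>) \<in> borel_measurable \<Lambda>"
  by (rule jet_partial_measurable[OF \<Omega>_sets DF_meas[OF _ assms(2)] F_C1(2)[OF assms(2)] assms(1,3)])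

lemma superposition_measurable:
  fixes G :: "real^'n \<Rightarrow> ('N, 'n) jet \<Rightarrow> real"
  assumes G: "\<And>\<xi>. \<xi> \<in> jets m \<Longrightarrow> (\<lambda>x. G x \<xi>) \<in> borel_measurable \<Lambda>"
    and cont: "AE x in \<Lambda>. continuous_on (jets m) (G x)" and u: "u \<in> sobolev_vec m 2 \<Omega>"
  shows "(\<lambda>x. G x (curry (J u x))) \<in> borel_measurable \<Lambda>"
  unfolding curry_J
proof (rule caratheodory_measurable[of _ _ G, OF \<Omega>_sets _ cont])
  show "(\<lambda>x. G x \<xi>) \<in> borel_measurable \<Lambda>" if "\<xi> \<in> jets m" for \<xi> by (rule G[OF that])
  show "(\<lambda>x. jet_of m \<Omega> u x i \<alpha>) \<in> borel_measurable \<Lambda>" if "\<alpha> \<in> mi_le m" for i \<alpha>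
    using comp_deriv_props(2)[OF u that] that by (simp add: jet_of_def)
qed (rule jet_of_in_jets)

lemma DDF_growth:
  assumes K: "0 \<le> K"
  shows "\<exists>C\<ge>0. AE x in \<Lambda>. \<forall>\<xi>\<in>S. (\<forall>c\<in>I. \<theta> c = 0 \<longrightarrow> \<bar>\<xi> c\<bar> \<le> K) \<longrightarrow>
    (\<forall>a\<in>I. \<forall>b\<in>I. \<bar>F2 a b x \<xi>\<bar> \<le> C * (1 + (\<Sum>c | c \<in> I \<and> 0 < \<theta> c. \<bar>\<xi> c\<bar> powr (1 / \<theta> c))) powr R (snd a) (snd b))"
proof -
  let ?c = "crit_order m 2 TYPE('n)"
  define B where "B = real CARD('N) * (real (card (mi_le m :: 'n mindex set)) * K)"
  have B: "0 \<le> B" using K by (simp add: B_def)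
  have high: "jet_high_sum m ?c P (curry \<xi>) = (\<Sum>c | c \<in> I \<and> 0 < \<theta> c. \<bar>\<xi> c\<bar> powr (1 / \<theta> c))" for \<xi> :: "'N \<times> 'n mindex \<Rightarrow> real"
  proof -
    let ?A = "{\<gamma> :: 'n mindex. \<gamma> \<in> mi_le m \<and> ?c \<le> real (mi_order \<gamma>)}"
    have "{c. c \<in> I \<and> 0 < \<theta> c} = UNIV \<times> ?A" using emb_exp_pos_iff[OF adm] by auto
    moreover have "(\<Sum>c\<in>UNIV \<times> ?A. \<bar>\<xi> c\<bar> powr (1 / \<theta> c)) = (\<Sum>c\<in>UNIV \<times> ?A. \<bar>\<xi> c\<bar> powr P (snd c))"
      by (rule sum.cong) (auto simp: emb_exp_def)
    ultimately show ?thesis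
      unfolding jet_high_sum_def by (simp add: sum.cartesian_product')
  qed
  have low: "g1 (jet_low_norm m ?c (curry \<xi>)) \<le> g1 B"
    if \<xi>: "\<forall>c\<in>I. \<theta> c = 0 \<longrightarrow> \<bar>\<xi> c\<bar> \<le> K" for \<xi> :: "'N \<times> 'n mindex \<Rightarrow> real"
  proof -
    have "jet_low_norm m ?c (curry \<xi>) \<le> B"
      unfolding B_def using \<xi> by (intro jet_low_norm_le K) (simp add: emb_exp_def)
    then show ?thesis
      using g1 B jet_low_norm_nonneg[of m ?c "curry \<xi>"] by (auto simp: pos_nondecreasing_def mono_on_def)
  qed
  have "AE x in \<Lambda>. \<forall>\<xi>\<in>S. (\<forall>c\<in>I. \<theta> c = 0 \<longrightarrow> \<bar>\<xi> c\<bar> \<le> K) \<longrightarrow>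
    (\<forall>a\<in>I. \<forall>b\<in>I. \<bar>F2 a b x \<xi>\<bar> \<le> g1 B * (1 + (\<Sum>c | c \<in> I \<and> 0 < \<theta> c. \<bar>\<xi> c\<bar> powr (1 / \<theta> c))) powr R (snd a) (snd b))"
    using DDF_bound
  proof eventually_elim
    case (elim x)
    show ?case
    proof (intro ballI impI)
      fix \<xi> :: "'N \<times> 'n mindex \<Rightarrow> real" and a b :: "'N \<times> 'n mindex"
      assume \<xi>: "\<xi> \<in> S" "\<forall>c\<in>I. \<theta> c = 0 \<longrightarrow> \<bar>\<xi> c\<bar> \<le> K" and ab: "a \<in> I" "b \<in> I"
      have "\<bar>F2 a b x \<xi>\<bar> \<le> g1 (jet_low_norm m ?c (curry \<xi>)) * (1 + jet_high_sum m ?c P (curry \<xi>)) powr R (snd a) (snd b)"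
        using elim \<xi>(1)[folded curry_in_jets_iff] ab by (auto simp del: curry_conv)
      also have "\<dots> \<le> g1 B * (1 + jet_high_sum m ?c P (curry \<xi>)) powr R (snd a) (snd b)"
        by (intro mult_right_mono low \<xi>(2)) simp
      finally show "\<bar>F2 a b x \<xi>\<bar> \<le> g1 B * (1 + (\<Sum>c | c \<in> I \<and> 0 < \<theta> c. \<bar>\<xi> c\<bar> powr (1 / \<theta> c))) powr R (snd a) (snd b)"
        unfolding high .
    qed
  qed
  moreover have "0 \<le> g1 B" using g1 B by (simp add: pos_nondecreasing_def less_imp_le)
  ultimately show ?thesis by blast
qed

lemma F_line_derivative:
  "AE x in \<Lambda>. \<forall>\<xi>\<in>S. \<forall>\<eta>\<in>S. ((\<lambda>t. F0 x (\<lambda>c. \<xi> c + t * \<eta> c)) has_real_derivative (\<Sum>a\<in>I. F1 a x \<xi> * \<eta> a)) (at 0)"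
  using F_C1(1)
proof eventually_elim
  case (elim x)
  have "((\<lambda>t. F0 x (\<lambda>c. \<xi> c + t * \<eta> c)) has_real_derivative (\<Sum>a\<in>I. F1 a x \<xi> * \<eta> a)) (at 0)"
    if "curry \<xi> \<in> jets m" "curry \<eta> \<in> jets m" for \<xi> \<eta> :: "'N \<times> 'n mindex \<Rightarrow> real"
    using jet_line_derivative[OF elim that] by (simp add: curry_def split_def)
  then show ?case unfolding curry_in_jets_iff by blast
qed

lemma DF_line_derivative:
  "AE x in \<Lambda>. \<forall>\<xi>\<in>S. \<forall>\<eta>\<in>S. \<forall>a\<in>I.
    ((\<lambda>t. F1 a x (\<lambda>c. \<xi> c + t * \<eta> c)) has_real_derivative (\<Sum>b\<in>I. F2 a b x \<xi> * \<eta> b)) (at 0)"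
  using C2
proof eventually_elim
  case (elim x)
  have "((\<lambda>t. F1 a x (\<lambda>c. \<xi> c + t * \<eta> c)) has_real_derivative (\<Sum>b\<in>I. F2 a b x \<xi> * \<eta> b)) (at 0)"
    if "curry \<xi> \<in> jets m" "curry \<eta> \<in> jets m" "a \<in> I" for \<xi> \<eta> :: "'N \<times> 'n mindex \<Rightarrow> real" and a
  proof -
    have "jet_C1 m (jet_partial (fst a) (snd a) (F x))" using elim that(3) by (auto simp: jet_C2_def)
    from jet_line_derivative[OF this that(1,2)] show ?thesis by (simp add: curry_def split_def)
  qed
  then show ?case unfolding curry_in_jets_iff by blast
qed

lemma DDF_symmetric: "AE x in \<Lambda>. \<forall>\<xi>\<in>S. \<forall>a\<in>I. \<forall>b\<in>I. F2 a b x \<xi> = F2 b a x \<xi>"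
  using C2
proof eventually_elim
  case (elim x)
  have "F2 a b x \<xi> = F2 b a x \<xi>" if "curry \<xi> \<in> jets m" "a \<in> I" "b \<in> I" for \<xi> a b
    using jet_partial_symmetric[OF elim that(1)] that(2,3) by auto
  then show ?case unfolding curry_in_jets_iff by blast
qed

lemma DDF_continuous_at_0:
  "AE x in \<Lambda>. \<forall>\<xi> :: nat \<Rightarrow> 'N \<times> 'n mindex \<Rightarrow> real. (\<forall>k. \<xi> k \<in> S) \<longrightarrow> (\<forall>c. (\<lambda>k. \<xi> k c) \<longlonglongrightarrow> 0) \<longrightarrow>
    (\<forall>a\<in>I. \<forall>b\<in>I. (\<lambda>k. F2 a b x (\<xi> k)) \<longlonglongrightarrow> F2 a b x (\<lambda>_. 0))"
  using C2
proof eventually_elim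
  case (elim x)
  have "(\<lambda>k. F2 a b x (\<xi> k)) \<longlonglongrightarrow> F2 a b x (\<lambda>_. 0)"
    if "\<And>k. curry (\<xi> k) \<in> jets m" "\<And>c. (\<lambda>k. \<xi> k c) \<longlonglongrightarrow> 0" "a \<in> I" "b \<in> I" for \<xi> :: "nat \<Rightarrow> 'N \<times> 'n mindex \<Rightarrow> real" and a b
  proof (rule jet_tendsto_compose[where f = "jet_partial (fst b) (snd b) (jet_partial (fst a) (snd a) (F x))"])
    show "continuous_on (jets m) (jet_partial (fst b) (snd b) (jet_partial (fst a) (snd a) (F x)))"
      using elim that(3,4) by (auto simp: jet_C2_def jet_C1_def)
  qed (use that in \<open>simp_all add: jets_def\<close>)
  then show ?case unfolding curry_in_jets_iff by blast
qed

lemma DF_zero_dom_pow: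
  assumes "\<alpha> \<in> mi_le m"
  shows "\<exists>c L. dom_pow \<Lambda> (1 - emb_exp m P \<alpha>) (\<lambda>x. jet_partial i \<alpha> (F x) (\<lambda>_ _. 0)) c L"
proof -
  let ?f = "\<lambda>x. jet_partial i \<alpha> (F x) (\<lambda>_ _. 0)" and ?t = "1 - emb_exp m P \<alpha>"
  have t: "0 < ?t" using emb_exp_bounds[OF adm assms] by simp
  have "1 / ?t = dual_exponent m 2 P \<alpha>"
    using P_ge_2[OF adm assms] by (auto simp: emb_exp_def dual_exponent_def not_less field_simps)
  then have f: "?f \<in> borel_measurable \<Lambda>" "integrable \<Lambda> (\<lambda>x. \<bar>?f x\<bar> powr (1 / ?t))"
    using DF_zero[OF assms] by (simp_all add: Lp_def)
  have "((\<integral>x. \<bar>?f x\<bar> powr (1 / ?t) \<partial>\<Lambda>) powr ?t) powr (1 / ?t) = (\<integral>x. \<bar>?f x\<bar> powr (1 / ?t) \<partial>\<Lambda>)"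
    using t by (simp add: powr_powr)
  then have "dom_pow \<Lambda> ?t ?f ((\<integral>x. \<bar>?f x\<bar> powr (1 / ?t) \<partial>\<Lambda>) powr ?t) (\<mu> + 1)"
    by (intro dom_pow_of_integrable f t) simp_all
  then show ?thesis by blast
qed

lemma DDF_top_elliptic:
  "\<exists>l>0. AE x in \<Lambda>. \<forall>\<xi>\<in>S. \<forall>\<eta> :: 'N \<times> 'n mindex \<Rightarrow> real.
    l * (\<Sum>a\<in>Top. (\<eta> a)\<^sup>2) \<le> (\<Sum>a\<in>Top. \<Sum>b\<in>Top. F2 a b x \<xi> * \<eta> a * \<eta> b)"
proof (intro exI conjI)
  show "0 < g2 0" using g2 by (simp add: pos_nondecreasing_def)
  show "AE x in \<Lambda>. \<forall>\<xi>\<in>S. \<forall>\<eta> :: 'N \<times> 'n mindex \<Rightarrow> real.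
    g2 0 * (\<Sum>a\<in>Top. (\<eta> a)\<^sup>2) \<le> (\<Sum>a\<in>Top. \<Sum>b\<in>Top. F2 a b x \<xi> * \<eta> a * \<eta> b)"
    using DDF_elliptic
  proof eventually_elim
    case (elim x)
    have "g2 0 * (\<Sum>a\<in>Top. (\<eta> a)\<^sup>2) \<le> (\<Sum>a\<in>Top. \<Sum>b\<in>Top. F2 a b x \<xi> * \<eta> a * \<eta> b)"
      if \<xi>: "curry \<xi> \<in> jets m" for \<xi> \<eta> :: "'N \<times> 'n mindex \<Rightarrow> real"
    proof -
      let ?T = "{\<alpha> :: 'n mindex. mi_order \<alpha> = m}" and ?low = "jet_low_norm m (crit_order m 2 TYPE('n)) (curry \<xi>)"
      have sq: "(\<Sum>i\<in>UNIV. \<Sum>\<alpha>\<in>?T. (curry \<eta> i \<alpha>)\<^sup>2) = (\<Sum>a\<in>Top. (\<eta> a)\<^sup>2)"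
        by (simp add: sum.cartesian_product split_def)
      have swap: "(\<Sum>j\<in>UNIV. \<Sum>\<alpha>\<in>?T. \<Sum>\<beta>\<in>?T. f j \<alpha> \<beta>) = (\<Sum>\<alpha>\<in>?T. \<Sum>j\<in>UNIV. \<Sum>\<beta>\<in>?T. f j \<alpha> \<beta>)" for f :: "'N \<Rightarrow> 'n mindex \<Rightarrow> 'n mindex \<Rightarrow> real"
        by (rule sum.swap)
      have "g2 0 \<le> g2 ?low"
        using g2 jet_low_norm_nonneg[of m "crit_order m 2 TYPE('n)" "curry \<xi>"]
        by (auto simp: pos_nondecreasing_def mono_on_def)
      then have "g2 0 * (\<Sum>a\<in>Top. (\<eta> a)\<^sup>2) \<le> g2 ?low * (\<Sum>a\<in>Top. (\<eta> a)\<^sup>2)"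
        by (intro mult_right_mono sum_nonneg) auto
      also have "\<dots> = g2 ?low * (1 + (\<Sum>k\<in>UNIV. \<Sum>\<gamma> | mi_order \<gamma> = m. \<bar>curry \<xi> k \<gamma>\<bar>)) powr (2 - 2) *
          (\<Sum>i\<in>UNIV. \<Sum>\<alpha>\<in>?T. (curry \<eta> i \<alpha>)\<^sup>2)"
      proof -
        have "0 \<le> (\<Sum>k\<in>UNIV. \<Sum>\<gamma> | mi_order \<gamma> = m. \<bar>curry \<xi> k \<gamma>\<bar>)" by (intro sum_nonneg) simp
        then show ?thesis unfolding sq by simp
      qed
      also have "\<dots> \<le> (\<Sum>i\<in>UNIV. \<Sum>j\<in>UNIV. \<Sum>\<alpha>\<in>?T. \<Sum>\<beta>\<in>?T.
         jet_partial j \<beta> (jet_partial i \<alpha> (F x)) (curry \<xi>) * curry \<eta> i \<alpha> * curry \<eta> j \<beta>)"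
        using elim \<xi> by blast
      also have "\<dots> = (\<Sum>a\<in>Top. \<Sum>b\<in>Top. F2 a b x \<xi> * \<eta> a * \<eta> b)"
        unfolding swap sum.cartesian_product' by simp
      finally show ?thesis .
    qed
    then show ?case unfolding curry_in_jets_iff by blast
  qed
qed

theorem hypothesis_A_regular_sobolev_functional:
  assumes H: "closed_subspace H (sobolev_vec m 2 \<Omega>) (sobolev_ip m \<Omega>)"
  shows "\<exists>dL. hypothesis_A_regular H (sobolev_ip m \<Omega>) H H (sobolev_functional m \<Omega> F) dL"
proof -
  have HW: "u \<in> sobolev_vec m 2 \<Omega>" if "u \<in> H" for u
    using H that by (auto simp: closed_subspace_def)
  obtain Ce where Ce: "0 \<le> Ce" and emb: "\<And>u i \<alpha>. u \<in> (sobolev_vec m 2 \<Omega> :: (real^'n, real^'N) aefun set) \<Longrightarrow> \<alpha> \<in> mi_le m \<Longrightarrow>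
      dom_pow \<Lambda> (emb_exp m P \<alpha>) (comp_deriv \<Omega> \<alpha> i u) (Ce * ip_norm (sobolev_ip m \<Omega>) u) (2 * (\<mu> + 1))"
    using embedding_dom_pow_vec[OF dom adm] by blast
  interpret N: nemytskii H "sobolev_ip m \<Omega>" \<Lambda> I Top D \<theta> "\<lambda>a b. R (snd a) (snd b)"
    F0 F1 F2 Ce "2 * (\<mu> + 1)" S J
  proof (intro nemytskii.intro nemytskii_axioms.intro)
    show "hilbert_on H (sobolev_ip m \<Omega>)"
      by (rule hilbert_on.intro[OF hilbert_space_closed_subspace[OF H]])
    show "finite_measure \<Lambda>" by (rule finite_measure_axioms)
    show "finite I" by (simp add: finite_mi_le)
    show "Top \<subseteq> I" by (auto simp: mi_le_def)
    show "0 \<le> 2 * (\<mu> + 1)" by simp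
    show "0 \<le> \<theta> c" "\<theta> c \<le> 1 / 2" if "c \<in> I" for c using emb_exp_bounds[OF adm] that by auto
    show "\<theta> c = 1 / 2" if "c \<in> Top" for c using emb_exp_top[OF adm] that by auto
    show "0 \<le> R (snd a) (snd b)" "R (snd a) (snd b) \<le> 1 - \<theta> a - \<theta> b" "R (snd a) (snd b) = R (snd b) (snd a)"
      if "a \<in> I" "b \<in> I" for a b
      using pair_exponent_bounds(1-3)[OF adm admR, of "snd a" "snd b"] that by auto
    show "R (snd a) (snd b) < 1 - \<theta> a - \<theta> b"
      if "a \<in> I" "b \<in> I" "\<not> (a \<in> Top \<and> b \<in> Top)" "0 < \<theta> a" "0 < \<theta> b" for a b
      using that by (intro pair_exponent_bounds(4)[OF adm admR]) auto
    show "AE x in \<Lambda>. D (u + v) c x = D u c x + D v c x" if "u \<in> H" "v \<in> H" "c \<in> I" for u v c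
      using comp_deriv_add[OF HW[OF that(1)] HW[OF that(2)]] that(3) by auto
    show "AE x in \<Lambda>. D (s *\<^sub>R u) c x = s * D u c x" if "u \<in> H" "c \<in> I" for u c s
      using comp_deriv_scale[OF HW[OF that(1)]] that(2) by auto
    show "sobolev_ip m \<Omega> u v = (\<Sum>c\<in>I. \<integral>x. D u c x * D v c x \<partial>\<Lambda>)" for u v :: "(real^'n, real^'N) aefun"
      by (simp add: sobolev_ip_def sum.cartesian_product split_def)
    show "0 \<le> Ce" by (rule Ce)
    show "dom_pow \<Lambda> (\<theta> c) (D u c) (Ce * ip_norm (sobolev_ip m \<Omega>) u) (2 * (\<mu> + 1))" if "u \<in> H" "c \<in> I" for u c
      using emb[OF HW[OF that(1)]] that(2) by auto
    show "\<exists>r. strict_mono (r :: nat \<Rightarrow> nat) \<and> (\<forall>e>0. \<exists>K. \<forall>j\<ge>K. \<forall>k\<ge>K. dom_pow \<Lambda> \<kappa> (D (v (r j) - v (r k)) c) e (2 * (\<mu> + 1)))"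
      if "c \<in> I" "c \<notin> Top" "\<theta> c = 0 \<or> \<theta> c < \<kappa>" "0 \<le> \<kappa>" "\<kappa> \<le> 1" "\<And>k. v k \<in> H" "\<And>k. ip_norm (sobolev_ip m \<Omega>) (v k) \<le> B"
      for c \<kappa> v B
    proof (rule compact_embedding_dom_pow_vec[OF dom adm _ _ that(3-5) HW[OF that(6)] that(7)])
      show "snd c \<in> mi_le m" "mi_order (snd c) \<noteq> m" using that(1,2) by auto
    qed
    show "\<exists>C\<ge>0. AE x in \<Lambda>. \<forall>\<xi>\<in>S. (\<forall>c\<in>I. \<theta> c = 0 \<longrightarrow> \<bar>\<xi> c\<bar> \<le> K) \<longrightarrow>
      (\<forall>a\<in>I. \<forall>b\<in>I. \<bar>F2 a b x \<xi>\<bar> \<le> C * (1 + (\<Sum>c | c \<in> I \<and> 0 < \<theta> c. \<bar>\<xi> c\<bar> powr (1 / \<theta> c))) powr R (snd a) (snd b))"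
      if "0 \<le> K" for K by (rule DDF_growth[OF that])
    show "(\<lambda>x. F0 x (J u x)) \<in> borel_measurable \<Lambda>" if "u \<in> H" for u
      by (rule superposition_measurable[OF F_meas _ HW[OF that]])
        (use F_C1(1) in \<open>auto simp: jet_C1_def elim!: eventually_mono\<close>)
    show "(\<lambda>x. F1 a x (J u x)) \<in> borel_measurable \<Lambda>" if "u \<in> H" "a \<in> I" for u a
    proof (rule superposition_measurable[OF _ _ HW[OF that(1)]])
      show "(\<lambda>x. jet_partial (fst a) (snd a) (F x) \<xi>) \<in> borel_measurable \<Lambda>" if "\<xi> \<in> jets m" for \<xi>
        using \<open>a \<in> I\<close> by (intro DF_meas[OF that]) auto
      show "AE x in \<Lambda>. continuous_on (jets m) (jet_partial (fst a) (snd a) (F x))"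
        using F_C1(1) by eventually_elim (use that in \<open>auto simp: jet_C1_def\<close>)
    qed
    show "(\<lambda>x. F2 a b x (J u x)) \<in> borel_measurable \<Lambda>" if "u \<in> H" "a \<in> I" "b \<in> I" for u a b
    proof (rule superposition_measurable[OF _ _ HW[OF that(1)]])
      show "(\<lambda>x. jet_partial (fst b) (snd b) (jet_partial (fst a) (snd a) (F x)) \<xi>) \<in> borel_measurable \<Lambda>"
        if "\<xi> \<in> jets m" for \<xi>
        using \<open>a \<in> I\<close> \<open>b \<in> I\<close> by (intro DDF_meas[OF that]) auto
      show "AE x in \<Lambda>. continuous_on (jets m) (jet_partial (fst b) (snd b) (jet_partial (fst a) (snd a) (F x)))"
        using C2 by eventually_elim (use that in \<open>auto simp: jet_C2_def jet_C1_def\<close>)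
    qed
    show "integrable \<Lambda> (\<lambda>x. F0 x (\<lambda>_. 0))"
      using Lp_integrable[OF F_zero] by (simp add: curry_zero)
    show "\<exists>c L. dom_pow \<Lambda> (1 - \<theta> a) (\<lambda>x. F1 a x (\<lambda>_. 0)) c L" if "a \<in> I" for a
      using DF_zero_dom_pow that by (auto simp: curry_zero)
  qed (rule F_line_derivative DF_line_derivative DDF_symmetric DDF_continuous_at_0 DDF_top_elliptic reflexive)+
  have "N.func = sobolev_functional m \<Omega> F"
    by (simp add: fun_eq_iff N.func_def sobolev_functional_def curry_J)
  with N.hypothesis_A_regular_func show ?thesis by auto
qed

end

theorem corollary4p4:
  fixes \<Omega> :: "(real^'n::finite) set"
    and F :: "real^'n \<Rightarrow> ('N::finite,'n) jet \<Rightarrow> real"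
    and m :: nat
    and H :: "(real^'n, real^'N) aefun set"
  assumes "m \<ge> 1"
    and "CARD('n) \<ge> 2"
    and "sobolev_domain 2 m \<Omega>"
    and "hypothesis_F 2 m \<Omega> F"
    and "closed_subspace H (sobolev_vec m 2 \<Omega>) (sobolev_ip m \<Omega>)"
  shows "(\<exists>dL. hypothesis_A_regular H (sobolev_ip m \<Omega>) H H (sobolev_functional m \<Omega> F) dL) \<and>
         (has_frechet_deriv H (sobolev_ip m \<Omega>) (sobolev_functional m \<Omega> F) 0 (\<lambda>_. 0) \<longrightarrow>
            hypothesis_A H (sobolev_ip m \<Omega>) H H (sobolev_functional m \<Omega> F))"
proof -
  interpret open_domain \<Omega>
    using assms(3) by unfold_locales (auto simp: sobolev_domain_def)
  obtain P R g1 g2 where "quadratic_integrand \<Omega> m P R F g1 g2"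
    using assms(4) unfolding hypothesis_F_def quadratic_integrand_def quadratic_integrand_axioms_def
    using assms(3) open_domain_axioms by blast
  then interpret quadratic_integrand \<Omega> m P R F g1 g2 .
  obtain dL where dL: "hypothesis_A_regular H (sobolev_ip m \<Omega>) H H (sobolev_functional m \<Omega> F) dL"
    using hypothesis_A_regular_sobolev_functional[OF assms(5)] by blast
  interpret hilbert_on H "sobolev_ip m \<Omega>"
    by (rule hilbert_on.intro[OF hilbert_space_closed_subspace[OF assms(5)]])
  show ?thesis using dL hypothesis_A_of_regular[OF dL] by blast
qed

end
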